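(* (i) Let $d\ge 1$ and $-2<s<d$ with $(d,s)\neq(1,0)$. For every $M>0$, there exist a $C^\infty$ compactly supported vector field $v:\mathbb{R}^d\to\mathbb{R}^d$ and zero-mean Schwartz functions $f$ and $g$ on $\mathbb{R}^d$ such that $$\frac{\displaystyle \left|\int_{(\mathbb{R}^d)^2}(v(x)-v(y))\cdot\nabla \mathsf{g}(x-y)\,f(x)g(y)\,dx\,dy\right|}{\displaystyle \Big(\|\nabla v\|_{BMO}+\||\nabla|^{\frac{d-s}{2}}v\|_{L^{\frac{2d}{d-s-2}}}\mathbf{1}_{s<d-2}\Big)\|f\|_{\dot H^{\frac{s-d}{2}}}\|g\|_{\dot H^{\frac{s-d}{2}}}}\ \ge\ M .$$ (ii) If $(d,s)=(1,0)$, then there exists $C>0$ such that for all $v$ with $v'\in BMO(\mathbb{R})$ and all $f,g\in\mathcal{S}(\mathbb{R})$ with zero mean, $$\left|\int_{\mathbb{R}^2}\frac{v(x)-v(y)}{x-y}f(x)g(y)\,dx\,dy\right|\le C\|v'\|_{BMO}\|f\|_{\dot H^{-\frac12}}\|g\|_{\dot H^{-\frac12}} .$$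
   Context: For $-2<s<d$, the log/Riesz potential on $\mathbb{R}^d$ is $\mathsf{g}(x)=\frac1s|x|^{-s}$ if $s\ne0$ and $\mathsf{g}(x)=-\log|x|$ if $s=0$. The Fourier transform is $\hat f(\xi)=\int_{\mathbb{R}^d}f(x)e^{-2\pi i\xi\cdot x}dx$; $|\nabla|$ is the Fourier multiplier with symbol $|2\pi\xi|$; $\|f\|_{\dot H^{a}}=\||\nabla|^a f\|_{L^2}$. $\mathcal{S}$ is the Schwartz space, and zero mean means $\int f=0$. $BMO$ is the space of functions of bounded mean oscillation with its usual seminorm. $\mathbf 1_{s<d-2}$ is $1$ if $s<d-2$ and $0$ otherwise (the corresponding term is then absent). *)

theory Defs
  imports "HOL-Analysis.Analysis"
begin

definition riesz_pot :: "real \<Rightarrow> 'a::euclidean_space \<Rightarrow> real" where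
  "riesz_pot s x = (if s = 0 then - ln (norm x) else (1 / s) * norm x powr (- s))"

(* A junk value where f is not differentiable; for riesz_pot this can only happen at the origin. *)
definition grad :: "('a::euclidean_space \<Rightarrow> real) \<Rightarrow> 'a \<Rightarrow> 'a" where
  "grad f x = (THE D. GDERIV f x :> D)"


subsection \<open>Smooth functions, test functions and Schwartz functions\<close>

(* iter_pderiv [b1, ..., bk] f is the iterated directional derivative
   d_b1 (... (d_bk f)); for basis vectors these are the partial derivatives of f. *)
primrec iter_pderiv ::
  "'a list \<Rightarrow> ('a::euclidean_space \<Rightarrow> 'b::real_normed_vector) \<Rightarrow> 'a \<Rightarrow> 'b" where
  "iter_pderiv [] f = f"
| "iter_pderiv (b # bs) f = (\<lambda>x. frechet_derivative (iter_pderiv bs f) (at x) b)"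

definition smooth :: "('a::euclidean_space \<Rightarrow> 'b::real_normed_vector) \<Rightarrow> bool" where
  "smooth f \<longleftrightarrow> (\<forall>bs. set bs \<subseteq> Basis \<longrightarrow> iter_pderiv bs f differentiable_on UNIV)"

definition compactly_supported :: "('a::euclidean_space \<Rightarrow> 'b::real_normed_vector) \<Rightarrow> bool" where
  "compactly_supported f \<longleftrightarrow> compact (closure {x. f x \<noteq> 0})"

definition schwartz :: "('a::euclidean_space \<Rightarrow> complex) \<Rightarrow> bool" where
  "schwartz f \<longleftrightarrow> smooth f \<and>
     (\<forall>bs k. set bs \<subseteq> Basis \<longrightarrow> (\<exists>B. \<forall>x. (1 + norm x) ^ k * norm (iter_pderiv bs f x) \<le> B))"

definition zero_mean :: "('a::euclidean_space \<Rightarrow> complex) \<Rightarrow> bool" where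
  "zero_mean f \<longleftrightarrow> (\<integral>x. f x \<partial>lborel) = 0"


subsection \<open>Fourier multipliers and norms\<close>

definition fourier :: "('a::euclidean_space \<Rightarrow> complex) \<Rightarrow> 'a \<Rightarrow> complex" where
  "fourier f \<xi> = (\<integral>x. f x * exp (- 2 * of_real pi * \<i> * of_real (\<xi> \<bullet> x)) \<partial>lborel)"

(* The Fourier multiplier |nabla|^a, written as an inverse Fourier integral. The integral converges
   absolutely for Schwartz f if a > - d, and for zero-mean Schwartz f if a > - d - 1, which
   includes a = (s - d) / 2 for all -2 < s < d. *)
definition abs_nabla_pow :: "real \<Rightarrow> ('a::euclidean_space \<Rightarrow> complex) \<Rightarrow> 'a \<Rightarrow> complex" where
  "abs_nabla_pow a f x =
     (\<integral>\<xi>. of_real ((2 * pi * norm \<xi>) powr a) * fourier f \<xi>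
            * exp (2 * of_real pi * \<i> * of_real (\<xi> \<bullet> x)) \<partial>lborel)"

definition abs_nabla_pow_vec :: "real \<Rightarrow> (real^'n \<Rightarrow> real^'n) \<Rightarrow> real^'n \<Rightarrow> complex^'n" where
  "abs_nabla_pow_vec a v x = (\<chi> i. abs_nabla_pow a (\<lambda>y. of_real (v y $ i)) x)"

(* Takes the value \<infinity> when the norm is infinite. *)
definition Lp_norm :: "real \<Rightarrow> ('a::euclidean_space \<Rightarrow> 'b::real_normed_vector) \<Rightarrow> ennreal" where
  "Lp_norm p f =
     (let I = (\<integral>\<^sup>+x. ennreal (norm (f x) powr p) \<partial>lebesgue)
      in if I = \<infinity> then \<infinity> else ennreal (enn2real I powr (1 / p)))"

definition Hdot_norm :: "real \<Rightarrow> ('a::euclidean_space \<Rightarrow> complex) \<Rightarrow> ennreal" where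
  "Hdot_norm a f = Lp_norm 2 (abs_nabla_pow a f)"


subsection \<open>Bounded mean oscillation\<close>

definition locally_integrable ::
  "('a::euclidean_space \<Rightarrow> 'b::{banach, second_countable_topology}) \<Rightarrow> bool" where
  "locally_integrable f \<longleftrightarrow> (\<forall>K. compact K \<longrightarrow> f absolutely_integrable_on K)"

definition ball_average ::
  "('a::euclidean_space \<Rightarrow> 'b::{banach, second_countable_topology}) \<Rightarrow> 'a \<Rightarrow> real \<Rightarrow> 'b" where
  "ball_average f c r =
     (1 / measure lebesgue (ball c r)) *\<^sub>R set_lebesgue_integral lebesgue (ball c r) f"

definition BMO_seminorm ::
  "('a::euclidean_space \<Rightarrow> 'b::{banach, second_countable_topology}) \<Rightarrow> ennreal" where
  "BMO_seminorm f =
     (SUP c. SUP r\<in>{0<..}.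
        (\<integral>\<^sup>+x\<in>ball c r. ennreal (norm (f x - ball_average f c r)) \<partial>lebesgue)
          / emeasure lebesgue (ball c r))"

definition BMO :: "('a::euclidean_space \<Rightarrow> 'b::{banach, second_countable_topology}) set" where
  "BMO = {f. locally_integrable f \<and> BMO_seminorm f < \<infinity>}"

definition has_weak_derivative :: "(real \<Rightarrow> real) \<Rightarrow> (real \<Rightarrow> real) \<Rightarrow> bool" where
  "has_weak_derivative v w \<longleftrightarrow> locally_integrable v \<and> locally_integrable w \<and>
     (\<forall>\<phi>::real \<Rightarrow> real. smooth \<phi> \<and> compactly_supported \<phi> \<longrightarrow>
        (\<integral>x. v x * deriv \<phi> x \<partial>lebesgue) = - (\<integral>x. w x * \<phi> x \<partial>lebesgue))"

end

theory Submission
  imports Defs "HOL-Probability.Probability"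
begin

text \<open>
  Part (i). The field v is a sum of K odd bump fields at lacunary scales. The mean oscillation of its gradient
  is bounded uniformly in K and the Lebesgue norm grows at most like the square root of K, whereas
  every scale contributes an amount bounded below, with the same sign, to the form at a fixed f = g.

  Part (ii). Let F, G be the Cauchy integrals of f, g. Averaging the product F G over cones
  \<open>t + s y + i y\<close>, \<open>|s| < 1\<close>, against \<open>sgn s\<close>, and subtracting the same expression in the lower half plane,
  gives a multiple of \<open>(sgn (c - t) - sgn (a - t)) / (a - c)\<close> tested against \<open>f(a) g(c)\<close>.
  Pairing with \<open>v'(t)\<close> therefore produces the commutator form; moving the average over s onto \<open>v'\<close> leaves
  only a mean oscillation of \<open>v'\<close> over an interval of length 2 y, and F G is integrable over the
  half plane since F and G are square integrable there with norm controlled by the \<open>H\<^sup>-\<^sup>1\<^sup>/\<^sup>2\<close> norms.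
\<close>

text \<open>The seminorm fails in part (i) because the linear field v(x) = (x . b) b has constant
  gradient, invisible to BMO, while its form is in general nonzero. Stacking K truncations of it
  produces a gradient of size K at the origin that resembles a truncated logarithm. In dimension 1
  the linear field leaves the kernel |x - y|^(-s), which for s = 0 is constant and annihilated by
  zero mean: the excluded case. The Lebesgue term is scale invariant, so each new scale is taken so
  wide that the p-th powers of the norms nearly add.

  Fourier analysis is done with absolutely convergent integrals only, so Plancherel appears as two
  inequalities with different hypotheses. In part (ii) the two half planes are subtracted because
  each averaged kernel contains ln |c - t| - ln |a - t|, the same for both, besides the sign
  functions, which enter with opposite signs. Fubini is available for bounded weights, so v' is
  first truncated; truncation is 1-Lipschitz and keeps the oscillation bound.\<close>

lemma integrable_pair_mult:
  fixes f :: "'a::euclidean_space \<Rightarrow> 'c::{real_normed_algebra,banach,second_countable_topology}"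
    and g :: "'b::euclidean_space \<Rightarrow> 'c"
  assumes f: "integrable lborel f" and g: "integrable lborel g"
  shows "integrable (lborel \<Otimes>\<^sub>M lborel) (\<lambda>p. f (fst p) * g (snd p))"
proof (rule lborel_pair.Fubini_integrable)
  have [measurable]: "f \<in> borel_measurable borel" "g \<in> borel_measurable borel"
    using f g by auto
  show m: "(\<lambda>p. f (fst p) * g (snd p)) \<in> borel_measurable (lborel \<Otimes>\<^sub>M lborel)" by measurable
  show "AE x in lborel. integrable lborel (\<lambda>y. f (fst (x, y)) * g (snd (x, y)))"
    using g by simp
  have "integrable lborel (\<lambda>x. norm (f x) * (\<integral>y. norm (g y) \<partial>lborel))"
    using f by (intro integrable_mult_left) auto
  then show "integrable lborel (\<lambda>x. \<integral>y. norm (f (fst (x, y)) * g (snd (x, y))) \<partial>lborel)"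
  proof (rule Bochner_Integration.integrable_bound)
    show "(\<lambda>x. \<integral>y. norm (f (fst (x, y)) * g (snd (x, y))) \<partial>lborel) \<in> borel_measurable lborel"
      by measurable
    show "AE x in lborel. norm (\<integral>y. norm (f (fst (x, y)) * g (snd (x, y))) \<partial>lborel)
        \<le> norm (norm (f x) * (\<integral>y. norm (g y) \<partial>lborel))"
    proof (rule AE_I2)
      fix x
      have "(\<integral>y. norm (f x * g y) \<partial>lborel) \<le> (\<integral>y. norm (f x) * norm (g y) \<partial>lborel)"
        using g by (intro integral_mono) (auto simp: norm_mult_ineq)
      then show "norm (\<integral>y. norm (f (fst (x, y)) * g (snd (x, y))) \<partial>lborel)
        \<le> norm (norm (f x) * (\<integral>y. norm (g y) \<partial>lborel))"
        by (simp add: integral_nonneg_AE)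
    qed
  qed
qed

section \<open>Fourier transforms of Gaussians\<close>

text \<open>Up to the factor sqrt (2 pi) the Gaussian is the standard normal density, so its Fourier
  integral is the characteristic function of that law.\<close>

lemma gauss_fourier_real:
  fixes t :: real
  shows "integrable lborel (\<lambda>x::real. complex_of_real (exp (- x\<^sup>2 / 2)) * cis (t * x))"
    and "(\<integral>x. complex_of_real (exp (- x\<^sup>2 / 2)) * cis (t * x) \<partial>lborel)
      = of_real (sqrt (2 * pi) * exp (- t\<^sup>2 / 2))"
proof -
  have e: "exp (- x\<^sup>2 / 2) = sqrt (2 * pi) * std_normal_density x" for x
    by (simp add: std_normal_density_def)
  have i: "integrable lborel std_normal_density"
    by (simp add: integrable_normal_density)
  have m: "(\<lambda>x. cis (t * x)) \<in> borel_measurable borel"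
    by (intro borel_measurable_continuous_onI continuous_intros)
  have "integrable lborel (\<lambda>x. complex_of_real (sqrt (2*pi) * std_normal_density x))"
    using i by (intro integrable_of_real integrable_mult_right)
  then show "integrable lborel (\<lambda>x::real. complex_of_real (exp (- x\<^sup>2 / 2)) * cis (t * x))"
    by (rule Bochner_Integration.integrable_bound) (use m in \<open>auto simp: std_normal_density_def norm_mult\<close>)
  have "char std_normal_distribution t = (\<integral>x. std_normal_density x *\<^sub>R iexp (t * x) \<partial>lborel)"
    unfolding char_def using m
    by (subst integral_density) (auto simp: normal_density_nonneg)
  also have "\<dots> = (\<integral>x. complex_of_real (std_normal_density x) * cis (t * x) \<partial>lborel)"
    by (simp add: scaleR_conv_of_real cis_conv_exp)
  finally have c: "(\<integral>x. complex_of_real (std_normal_density x) * cis (t * x) \<partial>lborel) = of_real (exp (- t\<^sup>2 / 2))"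
    by (simp add: char_std_normal_distribution)
  have "(\<integral>x. complex_of_real (exp (- x\<^sup>2 / 2)) * cis (t * x) \<partial>lborel)
    = (\<integral>x. of_real (sqrt (2 * pi)) * (complex_of_real (std_normal_density x) * cis (t * x)) \<partial>lborel)"
    unfolding e by (simp add: mult.assoc)
  also have "\<dots> = of_real (sqrt (2 * pi) * exp (- t\<^sup>2 / 2))"
    by (subst integral_mult_right_zero) (simp add: c)
  finally show "(\<integral>x. complex_of_real (exp (- x\<^sup>2 / 2)) * cis (t * x) \<partial>lborel)
      = of_real (sqrt (2 * pi) * exp (- t\<^sup>2 / 2))" .
qed

lemma cis_sum: "finite A \<Longrightarrow> cis (\<Sum>i\<in>A. f i) = (\<Prod>i\<in>A. cis (f i))"
  by (induction rule: finite_induct) (auto simp: cis_mult[symmetric])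

text \<open>Lebesgue measure is the image of a product of one-dimensional measures, and both the
  Gaussian and the character factor over the coordinates.\<close>

lemma gauss_fourier_std:
  fixes z :: "'a::euclidean_space"
  shows "integrable lborel (\<lambda>x::'a. complex_of_real (exp (- (norm x)\<^sup>2 / 2)) * cis (z \<bullet> x))"
    and "(\<integral>x. complex_of_real (exp (- (norm x)\<^sup>2 / 2)) * cis (z \<bullet> x) \<partial>lborel)
      = of_real (sqrt (2 * pi) ^ DIM('a) * exp (- (norm z)\<^sup>2 / 2))"
proof -
  interpret product_sigma_finite "\<lambda>_::'a. lborel :: real measure" by standard
  let ?g = "\<lambda>x::'a. complex_of_real (exp (- (norm x)\<^sup>2 / 2)) * cis (z \<bullet> x)"
  let ?h = "\<lambda>b x. complex_of_real (exp (- x\<^sup>2 / 2)) * cis ((z \<bullet> b) * x)"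
  have norm2: "(norm x)\<^sup>2 = (\<Sum>b\<in>Basis. (x \<bullet> b)\<^sup>2)" for x :: 'a
    by (simp add: norm_eq_sqrt_inner euclidean_inner[of x x] power2_eq_square sum_nonneg)
  have sm: "(\<Sum>b\<in>Basis. f b *\<^sub>R b) \<bullet> c = f c" if "c \<in> Basis" for f and c :: 'a
    using that by (rule inner_sum_left_Basis)
  have g: "?g (\<Sum>b\<in>Basis. f b *\<^sub>R b) = (\<Prod>b\<in>Basis. ?h b (f b))" for f
  proof -
    have "(norm (\<Sum>b\<in>Basis. f b *\<^sub>R b :: 'a))\<^sup>2 = (\<Sum>b\<in>(Basis::'a set). (f b)\<^sup>2)"
      unfolding norm2 by (intro sum.cong) (simp_all add: sm)
    moreover have "z \<bullet> (\<Sum>b\<in>Basis. f b *\<^sub>R b) = (\<Sum>b\<in>Basis. (z \<bullet> b) * f b)"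
      by (simp add: inner_sum_right mult.commute)
    ultimately show ?thesis
      by (simp add: prod.distrib cis_sum exp_sum sum_divide_distrib sum_negf[symmetric] exp_of_real[symmetric])
  qed
  have gm: "?g \<in> borel_measurable borel"
    by (intro borel_measurable_continuous_onI continuous_intros) auto
  have hi: "integrable lborel (?h b)" for b using gauss_fourier_real(1) by auto
  have mm: "(\<lambda>f. \<Sum>b\<in>Basis. f b *\<^sub>R b :: 'a) \<in> measurable (\<Pi>\<^sub>M b\<in>Basis. lborel) borel"
    by measurable
  show "integrable lborel ?g"
  proof -
    have "integrable (\<Pi>\<^sub>M b\<in>Basis. lborel) (\<lambda>f. ?g (\<Sum>b\<in>Basis. f b *\<^sub>R b))"
      unfolding g by (rule product_integrable_prod[OF finite_Basis hi])
    then show ?thesis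
      unfolding lborel_eq[where 'a='a] using gm mm by (subst integrable_distr_eq) simp_all
  qed
  have "(\<integral>x. ?g x \<partial>lborel) = (\<integral>f. (\<Prod>b\<in>Basis. ?h b (f b)) \<partial>(\<Pi>\<^sub>M b\<in>Basis. lborel))"
    unfolding lborel_eq[where 'a='a] by (subst integral_distr[OF mm gm]) (simp only: g)
  also have "\<dots> = (\<Prod>b\<in>Basis. (\<integral>x. ?h b x \<partial>lborel))"
    by (rule product_integral_prod[OF finite_Basis hi])
  also have "\<dots> = (\<Prod>b\<in>(Basis::'a set). of_real (sqrt (2 * pi) * exp (- (z \<bullet> b)\<^sup>2 / 2)))"
    using gauss_fourier_real(2) by simp
  also have "\<dots> = of_real (sqrt (2 * pi) ^ DIM('a) * exp (- (norm z)\<^sup>2 / 2))"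
    unfolding norm2 by (simp add: prod.distrib exp_sum sum_divide_distrib sum_negf[symmetric] exp_of_real[symmetric])
  finally show "(\<integral>x. ?g x \<partial>lborel) = of_real (sqrt (2 * pi) ^ DIM('a) * exp (- (norm z)\<^sup>2 / 2))" .
qed

lemma lborel_integral_affine:
  fixes f :: "'a::euclidean_space \<Rightarrow> 'b :: {banach, second_countable_topology}"
  assumes c: "c \<noteq> 0" 
  shows "(\<integral>x. f x \<partial>lborel) = \<bar>c\<bar>^DIM('a) *\<^sub>R (\<integral>x. f (t + c *\<^sub>R x) \<partial>lborel)"
    and "integrable lborel (\<lambda>x. f (t + c *\<^sub>R x)) \<longleftrightarrow> integrable lborel f"
proof -
  have *: "integrable lborel (\<lambda>x. f (t + c *\<^sub>R x))" if "integrable lborel f" "c \<noteq> 0" for t c and f :: "'a \<Rightarrow> 'b"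
  proof -
    have [measurable]: "f \<in> borel_measurable borel" using that(1) by auto
    have "integrable lborel (\<lambda>x. \<bar>c\<bar> ^ DIM('a) *\<^sub>R f (t + c *\<^sub>R x))" using that(1)
      by (subst (asm) lborel_affine[OF that(2), of t])
        (simp add: integrable_density integrable_distr_eq)
    then have "integrable lborel (\<lambda>x. (1 / \<bar>c\<bar> ^ DIM('a)) *\<^sub>R \<bar>c\<bar> ^ DIM('a) *\<^sub>R f (t + c *\<^sub>R x))"
      by (rule integrable_scaleR_right)
    then show ?thesis using that(2) by simp
  qed
  show iff: "integrable lborel (\<lambda>x. f (t + c *\<^sub>R x)) \<longleftrightarrow> integrable lborel f"
    using *[of f c t] *[of "\<lambda>x. f (t + c *\<^sub>R x)" "1/c" "-(1/c) *\<^sub>R t"] c by (auto simp: algebra_simps)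
  show "(\<integral>x. f x \<partial>lborel) = \<bar>c\<bar>^DIM('a) *\<^sub>R (\<integral>x. f (t + c *\<^sub>R x) \<partial>lborel)"
  proof (cases "integrable lborel f")
    case True
    then have [measurable]: "f \<in> borel_measurable borel" by auto
    show ?thesis
      by (subst lborel_affine[OF c, of t]) (simp add: integral_density integral_distr)
  next
    \<comment> \<open>A non-integrable function has integral 0 by convention, and the substitution
      preserves non-integrability, so both sides vanish.\<close>
    case False
    then show ?thesis using iff by (simp add: not_integrable_integral_eq)
  qed
qed

lemma nn_integral_lborel_affine:
  fixes f :: "'a::euclidean_space \<Rightarrow> ennreal"
  assumes c: "c \<noteq> 0" and [measurable]: "f \<in> borel_measurable borel"
  shows "(\<integral>\<^sup>+x. f x \<partial>lborel) = ennreal (\<bar>c\<bar>^DIM('a)) * (\<integral>\<^sup>+x. f (t + c *\<^sub>R x) \<partial>lborel)"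
  by (subst lborel_affine[OF c, of t]) (simp add: nn_integral_density nn_integral_distr nn_integral_cmult)

lemma gauss_fourier:
  fixes z :: "'a::euclidean_space"
  assumes e: "e > 0"
  shows "integrable lborel (\<lambda>x::'a. complex_of_real (exp (- (e * norm x)\<^sup>2 / 2)) * cis (z \<bullet> x))"
    and "(\<integral>x. complex_of_real (exp (- (e * norm x)\<^sup>2 / 2)) * cis (z \<bullet> x) \<partial>lborel)
      = of_real ((sqrt (2 * pi) / e) ^ DIM('a) * exp (- (norm z / e)\<^sup>2 / 2))"
proof -
  let ?f = "\<lambda>x::'a. complex_of_real (exp (- (norm x)\<^sup>2 / 2)) * cis (((1/e) *\<^sub>R z) \<bullet> x)"
  have eq: "complex_of_real (exp (- (e * norm x)\<^sup>2 / 2)) * cis (z \<bullet> x) = ?f (0 + e *\<^sub>R x)" for x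
    using e by simp
  show "integrable lborel (\<lambda>x::'a. complex_of_real (exp (- (e * norm x)\<^sup>2 / 2)) * cis (z \<bullet> x))"
    unfolding eq using e gauss_fourier_std(1)[of "(1/e) *\<^sub>R z"] by (subst lborel_integral_affine(2)) auto
  have "of_real (sqrt (2 * pi) ^ DIM('a) * exp (- (norm ((1/e) *\<^sub>R z))\<^sup>2 / 2)) = (\<integral>x. ?f x \<partial>lborel)"
    by (rule gauss_fourier_std(2)[symmetric])
  also have "\<dots> = \<bar>e\<bar>^DIM('a) *\<^sub>R (\<integral>x. ?f (0 + e *\<^sub>R x) \<partial>lborel)"
    using e by (intro lborel_integral_affine(1)) auto
  also have "(\<integral>x. ?f (0 + e *\<^sub>R x) \<partial>lborel) = (\<integral>x. complex_of_real (exp (- (e * norm x)\<^sup>2 / 2)) * cis (z \<bullet> x) \<partial>lborel)"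
    by (simp only: eq)
  finally show "(\<integral>x. complex_of_real (exp (- (e * norm x)\<^sup>2 / 2)) * cis (z \<bullet> x) \<partial>lborel)
      = of_real ((sqrt (2 * pi) / e) ^ DIM('a) * exp (- (norm z / e)\<^sup>2 / 2))"
    using e by (simp add: scaleR_conv_of_real field_simps power_divide)
qed

section \<open>Plancherel inequalities for inverse Fourier integrals\<close>

definition inverse_fourier :: "('a::euclidean_space \<Rightarrow> complex) \<Rightarrow> 'a \<Rightarrow> complex" where
  "inverse_fourier u x = (\<integral>\<xi>. u \<xi> * cis (2 * pi * (\<xi> \<bullet> x)) \<partial>lborel)"

lemma borel_measurable_cis [measurable]: "cis \<in> borel_measurable borel"
  by (intro borel_measurable_continuous_onI continuous_intros)

lemma borel_measurable_cnj [measurable]: "cnj \<in> borel_measurable borel"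
  by (intro borel_measurable_continuous_onI continuous_intros)

lemma integrable_mult_cis:
  fixes u :: "'a \<Rightarrow> complex"
  assumes u: "integrable M u" and [measurable]: "\<theta> \<in> borel_measurable M"
  shows "integrable M (\<lambda>x. u x * cis (\<theta> x))"
  by (rule Bochner_Integration.integrable_bound[OF u]) (use u in \<open>auto simp: norm_mult\<close>)

lemma integrable_mult_bounded:
  fixes u v :: "'a \<Rightarrow> 'c::{real_normed_algebra,banach,second_countable_topology}"
  assumes u: "integrable M u" and v: "v \<in> borel_measurable M" and B: "\<And>x. norm (v x) \<le> B"
  shows "integrable M (\<lambda>x. u x * v x)"
proof (rule Bochner_Integration.integrable_bound)
  show "integrable M (\<lambda>x. B * norm (u x))" using u by auto
  show "AE x in M. norm (u x * v x) \<le> norm (B * norm (u x))"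
  proof (rule AE_I2)
    fix x
    have "norm (u x * v x) \<le> norm (u x) * norm (v x)" by (rule norm_mult_ineq)
    also have "\<dots> \<le> norm (u x) * B" using B by (intro mult_left_mono) auto
    finally show "norm (u x * v x) \<le> norm (B * norm (u x))" by (simp add: mult.commute)
  qed
qed (use u v in auto)

lemma measurable_inverse_fourier [measurable]:
  fixes u :: "'a::euclidean_space \<Rightarrow> complex"
  assumes [measurable]: "u \<in> borel_measurable borel"
  shows "inverse_fourier u \<in> borel_measurable borel"
  unfolding inverse_fourier_def[abs_def]
  by (rule lborel.borel_measurable_lebesgue_integral) measurable

lemma norm_inverse_fourier_le:
  "norm (inverse_fourier u x) \<le> (\<integral>\<xi>. norm (u \<xi>) \<partial>lborel)"
  unfolding inverse_fourier_def by (rule order_trans[OF integral_norm_bound]) (simp add: norm_mult)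

text \<open>The Fourier integral of the damping factor exp(-(e |x|)^2 / 2) at the frequency 2 pi z.
  As a function of z it is an approximate identity for e tending to 0.\<close>

definition gauss_kernel :: "real \<Rightarrow> 'a::euclidean_space \<Rightarrow> real" where
  "gauss_kernel e z = (sqrt (2 * pi) / e) ^ DIM('a) * exp (- (norm ((2 * pi) *\<^sub>R z) / e)\<^sup>2 / 2)"

lemma gauss_kernel_measurable [measurable]: "gauss_kernel e \<in> borel_measurable borel"
  unfolding gauss_kernel_def[abs_def] by measurable

lemma gauss_kernel_nonneg: "e > 0 \<Longrightarrow> 0 \<le> gauss_kernel e z"
  unfolding gauss_kernel_def by auto

text \<open>The square of the inverse Fourier integral is a double integral over frequencies.
  Integrating it over x is not absolutely convergent; the Gaussian factor repairs this, and Fubini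
  then replaces the x-integral by the kernel.\<close>

lemma inverse_fourier_gauss:
  fixes u :: "'a::euclidean_space \<Rightarrow> complex"
  assumes u: "integrable lborel u" and e: "e > 0"
  shows "integrable lborel (\<lambda>x. (norm (inverse_fourier u x))\<^sup>2 * exp (- (e * norm x)\<^sup>2 / 2))"
    and "integrable (lborel \<Otimes>\<^sub>M lborel) (\<lambda>p. u (fst p) * cnj (u (snd p)) * of_real (gauss_kernel e (fst p - snd p)))"
    and "of_real (\<integral>x. (norm (inverse_fourier u x))\<^sup>2 * exp (- (e * norm x)\<^sup>2 / 2) \<partial>lborel)
       = (\<integral>p. u (fst p) * cnj (u (snd p)) * of_real (gauss_kernel e (fst p - snd p)) \<partial>(lborel \<Otimes>\<^sub>M lborel))"
proof -
  let ?g = "\<lambda>x::'a. exp (- (e * norm x)\<^sup>2 / 2)"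
  have um[measurable]: "u \<in> borel_measurable borel" using u by auto
  have gi: "integrable lborel ?g"
    using gauss_fourier(1)[OF e, of 0] by (simp add: complex_of_real_integrable_eq)
  show i1: "integrable lborel (\<lambda>x. (norm (inverse_fourier u x))\<^sup>2 * ?g x)"
  proof -
    have "integrable lborel (\<lambda>x. ?g x * (norm (inverse_fourier u x))\<^sup>2)"
      by (rule integrable_mult_bounded[OF gi, of _ "(\<integral>\<xi>. norm (u \<xi>) \<partial>lborel)\<^sup>2"])
        (auto intro!: power_mono norm_inverse_fourier_le)
    then show ?thesis by (simp add: mult.commute)
  qed
  have Gb: "norm (of_real (gauss_kernel e z) :: complex) \<le> (sqrt (2 * pi) / e) ^ DIM('a)" for z :: 'a
  proof -
    have "gauss_kernel e z \<le> (sqrt (2 * pi) / e) ^ DIM('a) * 1"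
      unfolding gauss_kernel_def using e by (intro mult_left_mono) auto
    moreover have "0 \<le> gauss_kernel e z" unfolding gauss_kernel_def using e by auto
    ultimately show ?thesis by simp
  qed
  have uu: "integrable (lborel \<Otimes>\<^sub>M lborel) (\<lambda>p. u (fst p) * cnj (u (snd p)))"
    using u by (intro integrable_pair_mult) auto
  show "integrable (lborel \<Otimes>\<^sub>M lborel) (\<lambda>p. u (fst p) * cnj (u (snd p)) * of_real (gauss_kernel e (fst p - snd p)))"
    by (rule integrable_mult_bounded[OF uu _ Gb]) measurable
  have sq: "of_real ((norm (inverse_fourier u x))\<^sup>2)
      = (\<integral>p. u (fst p) * cnj (u (snd p)) * cis (2 * pi * ((fst p - snd p) \<bullet> x)) \<partial>(lborel \<Otimes>\<^sub>M lborel))" for x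
  proof -
    have a: "integrable lborel (\<lambda>\<xi>. u \<xi> * cis (2 * pi * (\<xi> \<bullet> x)))"
      by (intro integrable_mult_cis u) measurable
    then have b: "integrable lborel (\<lambda>\<xi>. cnj (u \<xi> * cis (2 * pi * (\<xi> \<bullet> x))))" by (intro integrable_cnj)
    have c: "cnj (inverse_fourier u x) = (\<integral>\<eta>. cnj (u \<eta> * cis (2 * pi * (\<eta> \<bullet> x))) \<partial>lborel)"
      unfolding inverse_fourier_def by (rule Bochner_Integration.integral_cnj[symmetric])
    have "of_real ((norm (inverse_fourier u x))\<^sup>2) = inverse_fourier u x * cnj (inverse_fourier u x)"
      by (rule complex_norm_square)
    also have "\<dots> = (\<integral>\<xi>. (\<integral>\<eta>. (u \<xi> * cis (2 * pi * (\<xi> \<bullet> x))) * cnj (u \<eta> * cis (2 * pi * (\<eta> \<bullet> x))) \<partial>lborel) \<partial>lborel)"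
      unfolding c by (simp only: integral_mult_right_zero integral_mult_left_zero inverse_fourier_def)
    also have "\<dots> = (\<integral>p. (u (fst p) * cis (2 * pi * (fst p \<bullet> x))) * cnj (u (snd p) * cis (2 * pi * (snd p \<bullet> x))) \<partial>(lborel \<Otimes>\<^sub>M lborel))"
      using lborel_pair.integral_fst'[OF integrable_pair_mult[OF a b]] by simp
    also have "\<dots> = (\<integral>p. u (fst p) * cnj (u (snd p)) * cis (2 * pi * ((fst p - snd p) \<bullet> x)) \<partial>(lborel \<Otimes>\<^sub>M lborel))"
      by (intro Bochner_Integration.integral_cong)
        (auto simp: cis_cnj cis_mult inner_diff_left right_diff_distrib cis_divide[symmetric] field_simps)
    finally show ?thesis .
  qed
  \<comment> \<open>The triple integrand whose two orders of integration give the two sides.\<close>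
  let ?F = "\<lambda>p x. u (fst p) * cnj (u (snd p)) * cis (2 * pi * ((fst p - snd p) \<bullet> x)) * of_real (?g x)"
  interpret P: pair_sigma_finite "lborel \<Otimes>\<^sub>M lborel :: ('a \<times> 'a) measure" "lborel :: 'a measure" 
    unfolding lborel_prod by standard
  have "integrable ((lborel \<Otimes>\<^sub>M lborel) \<Otimes>\<^sub>M lborel) (\<lambda>q. (u (fst (fst q)) * cnj (u (snd (fst q)))) * complex_of_real (?g (snd q)))"
    using uu gi unfolding lborel_prod[where 'a='a and 'b='a]
    by (intro integrable_pair_mult) (auto simp: complex_of_real_integrable_eq)
  then have "integrable ((lborel \<Otimes>\<^sub>M lborel) \<Otimes>\<^sub>M lborel) (\<lambda>q. (u (fst (fst q)) * cnj (u (snd (fst q)))) * complex_of_real (?g (snd q))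
     * cis (2 * pi * ((fst (fst q) - snd (fst q)) \<bullet> snd q)))"
    by (intro integrable_mult_cis) measurable
  also have "(\<lambda>q. (u (fst (fst q)) * cnj (u (snd (fst q)))) * complex_of_real (?g (snd q))
     * cis (2 * pi * ((fst (fst q) - snd (fst q)) \<bullet> snd q))) = case_prod ?F"
    by (simp add: fun_eq_iff)
  finally have Fi: "integrable ((lborel \<Otimes>\<^sub>M lborel) \<Otimes>\<^sub>M lborel) (case_prod ?F)" .
  have "of_real (\<integral>x. (norm (inverse_fourier u x))\<^sup>2 * ?g x \<partial>lborel)
    = (\<integral>x. complex_of_real ((norm (inverse_fourier u x))\<^sup>2 * ?g x) \<partial>lborel)"
    by (rule integral_complex_of_real[symmetric])
  also have "\<dots> = (\<integral>x. (\<integral>p. ?F p x \<partial>(lborel \<Otimes>\<^sub>M lborel)) \<partial>lborel)"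
    by (simp only: of_real_mult sq integral_mult_left_zero)
  also have "\<dots> = (\<integral>p. (\<integral>x. ?F p x \<partial>lborel) \<partial>(lborel \<Otimes>\<^sub>M lborel))"
    by (rule P.Fubini_integral[OF Fi])
  also have "(\<lambda>p. (\<integral>x. ?F p x \<partial>lborel)) = (\<lambda>p. u (fst p) * cnj (u (snd p)) * of_real (gauss_kernel e (fst p - snd p)))"
  proof
    fix p :: "'a \<times> 'a"
    have "(\<integral>x. ?F p x \<partial>lborel) = (\<integral>x. u (fst p) * cnj (u (snd p)) * (of_real (?g x) * cis (((2 * pi) *\<^sub>R (fst p - snd p)) \<bullet> x)) \<partial>lborel)"
      by (simp add: mult_ac)
    also have "\<dots> = u (fst p) * cnj (u (snd p)) * of_real (gauss_kernel e (fst p - snd p))"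
      by (subst integral_mult_right_zero, subst gauss_fourier(2)[OF e]) (simp add: gauss_kernel_def)
    finally show "(\<integral>x. ?F p x \<partial>lborel) = u (fst p) * cnj (u (snd p)) * of_real (gauss_kernel e (fst p - snd p))" .
  qed
  finally show "of_real (\<integral>x. (norm (inverse_fourier u x))\<^sup>2 * exp (- (e * norm x)\<^sup>2 / 2) \<partial>lborel)
       = (\<integral>p. u (fst p) * cnj (u (snd p)) * of_real (gauss_kernel e (fst p - snd p)) \<partial>(lborel \<Otimes>\<^sub>M lborel))" .
qed

text \<open>The damped norm is a quadratic form with a positive kernel of mass 1, hence at most the
  squared norm of u by Schur's test. The damping is then removed by Fatou's lemma, so integrability
  of u is the only hypothesis.\<close>

lemma inverse_fourier_L2_le:
  fixes u :: "'a::euclidean_space \<Rightarrow> complex"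
  assumes u: "integrable lborel u"
  shows "(\<integral>\<^sup>+x. ennreal ((norm (inverse_fourier u x))\<^sup>2) \<partial>lborel) \<le> (\<integral>\<^sup>+x. ennreal ((norm (u x))\<^sup>2) \<partial>lborel)"
proof -
  have [measurable]: "u \<in> borel_measurable borel" using u by auto
  have *: "(\<integral>\<^sup>+x. ennreal ((norm (inverse_fourier u x))\<^sup>2 * exp (- (e * norm x)\<^sup>2 / 2)) \<partial>lborel)
      \<le> (\<integral>\<^sup>+x. ennreal ((norm (u x))\<^sup>2) \<partial>lborel)" if e: "e > 0" for e
  proof -
    define G :: "'a \<Rightarrow> real" where "G = gauss_kernel e"
    note ig = inverse_fourier_gauss[OF u e, folded G_def]
    have G0: "0 \<le> G z" for z unfolding G_def using e by (rule gauss_kernel_nonneg)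
    have Gm[measurable]: "G \<in> borel_measurable borel" unfolding G_def by measurable
    \<comment> \<open>The mass of the kernel: dilating by 2 pi / e reduces it to the Gaussian
      integral at frequency 0.\<close>
    have G1: "(\<integral>\<^sup>+z. ennreal (G z) \<partial>lborel) = 1"
    proof -
      have gi: "integrable lborel (\<lambda>x::'a. exp (- (norm x)\<^sup>2 / 2))"
        using gauss_fourier(1)[of 1 "0::'a"] by (simp add: complex_of_real_integrable_eq)
      have "complex_of_real (\<integral>x. exp (- (norm (x::'a))\<^sup>2 / 2) \<partial>lborel) = (\<integral>x. complex_of_real (exp (- (norm (x::'a))\<^sup>2 / 2)) \<partial>lborel)"
        by (rule integral_complex_of_real[symmetric])
      also have "\<dots> = of_real (sqrt (2 * pi) ^ DIM('a))"
        using gauss_fourier_std(2)[of "0::'a"]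
        by (simp only: inner_zero_left cis_zero mult.right_neutral norm_zero power_zero_numeral minus_zero div_0 exp_zero)
      finally have gv: "(\<integral>x. exp (- (norm (x::'a))\<^sup>2 / 2) \<partial>lborel) = sqrt (2 * pi) ^ DIM('a)"
        by (simp only: of_real_eq_iff)
      have nv: "(\<integral>\<^sup>+x. ennreal (exp (- (norm (x::'a))\<^sup>2 / 2)) \<partial>lborel) = ennreal (sqrt (2 * pi) ^ DIM('a))"
        using gv by (subst nn_integral_eq_integral[OF gi]) auto
      have "(\<integral>\<^sup>+x. ennreal (exp (- (norm (x::'a))\<^sup>2 / 2)) \<partial>lborel)
        = ennreal (\<bar>2 * pi / e\<bar> ^ DIM('a)) * (\<integral>\<^sup>+x. ennreal (exp (- (norm (0 + (2 * pi / e) *\<^sub>R (x::'a)))\<^sup>2 / 2)) \<partial>lborel)"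
        using e by (intro nn_integral_lborel_affine) auto
      also have "(\<lambda>x::'a. exp (- (norm (0 + (2 * pi / e) *\<^sub>R x))\<^sup>2 / 2)) = (\<lambda>x. exp (- (norm ((2 * pi) *\<^sub>R x) / e)\<^sup>2 / 2))"
        using e by (simp add: abs_mult)
      finally have "ennreal (\<bar>2 * pi / e\<bar> ^ DIM('a)) * (\<integral>\<^sup>+x. ennreal (exp (- (norm ((2 * pi) *\<^sub>R (x::'a)) / e)\<^sup>2 / 2)) \<partial>lborel) = ennreal (sqrt (2 * pi) ^ DIM('a))"
        by (simp only: nv)
      moreover have "\<bar>2 * pi / e\<bar> = 2 * pi / e" using e by simp
      ultimately have 1: "ennreal ((2 * pi / e) ^ DIM('a)) * (\<integral>\<^sup>+x. ennreal (exp (- (norm ((2 * pi) *\<^sub>R (x::'a)) / e)\<^sup>2 / 2)) \<partial>lborel) = ennreal (sqrt (2 * pi) ^ DIM('a))"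
        by (simp only:)
      have "(\<integral>\<^sup>+z. ennreal (G z) \<partial>lborel) = ennreal ((sqrt (2 * pi) / e) ^ DIM('a)) * (\<integral>\<^sup>+x. ennreal (exp (- (norm ((2 * pi) *\<^sub>R (x::'a)) / e)\<^sup>2 / 2)) \<partial>lborel)"
        unfolding G_def gauss_kernel_def using e by (subst nn_integral_cmult[symmetric]) (auto simp: ennreal_mult[symmetric])
      also have "(sqrt (2 * pi) / e) ^ DIM('a) = (1 / sqrt (2 * pi)) ^ DIM('a) * (2 * pi / e) ^ DIM('a)"
        unfolding power_mult_distrib[symmetric] using e
        by (intro arg_cong[where f="\<lambda>t. t ^ DIM('a)"]) (simp add: field_simps)
      also have "ennreal \<dots> = ennreal ((1 / sqrt (2 * pi)) ^ DIM('a)) * ennreal ((2 * pi / e) ^ DIM('a))"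
        using e by (intro ennreal_mult) auto
      finally have "(\<integral>\<^sup>+z. ennreal (G z) \<partial>lborel) = ennreal ((1 / sqrt (2 * pi)) ^ DIM('a)) * ennreal (sqrt (2 * pi) ^ DIM('a))"
        by (simp only: mult.assoc 1)
      also have "\<dots> = ennreal ((1 / sqrt (2 * pi)) ^ DIM('a) * sqrt (2 * pi) ^ DIM('a))"
        by (rule ennreal_mult[symmetric]) auto
      also have "(1 / sqrt (2 * pi)) ^ DIM('a) * sqrt (2 * pi) ^ DIM('a) = 1"
        unfolding power_mult_distrib[symmetric] by simp
      finally show ?thesis by simp
    qed
    have G1': "(\<integral>\<^sup>+z. ennreal (G (x - z)) \<partial>lborel) = 1" for x
      using nn_integral_lborel_affine[of "-1" "\<lambda>z. ennreal (G z)" x] G1 by simp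
    have G1'': "(\<integral>\<^sup>+z. ennreal (G (z - x)) \<partial>lborel) = 1" for x
      using nn_integral_lborel_affine[of "1" "\<lambda>z. ennreal (G z)" "-x"] G1 by simp
    let ?I = "\<integral>x. (norm (inverse_fourier u x))\<^sup>2 * exp (- (e * norm x)\<^sup>2 / 2) \<partial>lborel"
    let ?N = "\<integral>\<^sup>+x. ennreal ((norm (u x))\<^sup>2) \<partial>lborel"
    have "(\<integral>\<^sup>+x. ennreal ((norm (inverse_fourier u x))\<^sup>2 * exp (- (e * norm x)\<^sup>2 / 2)) \<partial>lborel) = ennreal ?I"
      by (rule nn_integral_eq_integral[OF ig(1)]) auto
    also have "\<dots> \<le> ennreal (norm (complex_of_real ?I))" by (intro ennreal_leI) simp
    also have "\<dots> \<le> (\<integral>\<^sup>+p. norm (u (fst p) * cnj (u (snd p)) * of_real (G (fst p - snd p))) \<partial>(lborel \<Otimes>\<^sub>M lborel))"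
      unfolding ig(3) by (rule integral_norm_bound_ennreal[OF ig(2)])
    also have "\<dots> \<le> (\<integral>\<^sup>+p. ennreal (1/2) * (ennreal ((norm (u (fst p)))\<^sup>2) * ennreal (G (fst p - snd p)) + ennreal ((norm (u (snd p)))\<^sup>2) * ennreal (G (fst p - snd p))) \<partial>(lborel \<Otimes>\<^sub>M lborel))"
    proof (rule nn_integral_mono)
      fix p :: "'a \<times> 'a"
      let ?a = "norm (u (fst p))" and ?b = "norm (u (snd p))" and ?g = "G (fst p - snd p)"
      \<comment> \<open>Splitting the product symmetrically leaves, in each term, one variable that
        occurs in the kernel alone.\<close>
      have "?a * ?b \<le> 1/2 * (?a\<^sup>2 + ?b\<^sup>2)"
        using sum_squares_bound[of ?a ?b] by simp
      then have "?a * ?b * ?g \<le> 1/2 * (?a\<^sup>2 + ?b\<^sup>2) * ?g" using G0 by (intro mult_right_mono) auto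
      then show "ennreal (norm (u (fst p) * cnj (u (snd p)) * of_real ?g)) \<le> ennreal (1/2) * (ennreal (?a\<^sup>2) * ennreal ?g + ennreal (?b\<^sup>2) * ennreal ?g)"
      proof -
        have "ennreal (1/2 * (?a\<^sup>2 + ?b\<^sup>2) * ?g) = ennreal (1/2 * (?a\<^sup>2 + ?b\<^sup>2)) * ennreal ?g"
          using G0 by (intro ennreal_mult) auto
        also have "ennreal (1/2 * (?a\<^sup>2 + ?b\<^sup>2)) = ennreal (1/2) * ennreal (?a\<^sup>2 + ?b\<^sup>2)"
          by (intro ennreal_mult) auto
        also have "ennreal (?a\<^sup>2 + ?b\<^sup>2) = ennreal (?a\<^sup>2) + ennreal (?b\<^sup>2)"
          by (intro ennreal_plus) auto
        finally have "ennreal (1/2 * (?a\<^sup>2 + ?b\<^sup>2) * ?g) = ennreal (1/2) * (ennreal (?a\<^sup>2) * ennreal ?g + ennreal (?b\<^sup>2) * ennreal ?g)"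
          by (simp only: distrib_right mult.assoc)
        moreover have "norm (u (fst p) * cnj (u (snd p)) * of_real ?g) = ?a * ?b * ?g"
          using G0[of "fst p - snd p"] by (simp add: norm_mult)
        ultimately show ?thesis
          using \<open>?a * ?b * ?g \<le> 1/2 * (?a\<^sup>2 + ?b\<^sup>2) * ?g\<close> by (metis ennreal_leI)
      qed
    qed
    also have "\<dots> = ennreal (1/2) * ((\<integral>\<^sup>+p. ennreal ((norm (u (fst p)))\<^sup>2) * ennreal (G (fst p - snd p)) \<partial>(lborel \<Otimes>\<^sub>M lborel))
        + (\<integral>\<^sup>+p. ennreal ((norm (u (snd p)))\<^sup>2) * ennreal (G (fst p - snd p)) \<partial>(lborel \<Otimes>\<^sub>M lborel)))"
      by (simp add: nn_integral_cmult nn_integral_add)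
    also have "(\<integral>\<^sup>+p. ennreal ((norm (u (fst p)))\<^sup>2) * ennreal (G (fst p - snd p)) \<partial>(lborel \<Otimes>\<^sub>M lborel)) = ?N"
      by (subst lborel.nn_integral_fst[symmetric]) (simp_all add: nn_integral_cmult G1')
    also have "(\<integral>\<^sup>+p. ennreal ((norm (u (snd p)))\<^sup>2) * ennreal (G (fst p - snd p)) \<partial>(lborel \<Otimes>\<^sub>M lborel)) = ?N"
      by (subst lborel_pair.nn_integral_snd[symmetric]) (simp_all add: nn_integral_cmult G1'')
    also have "ennreal (1/2) * (?N + ?N) = ?N"
    proof -
      have "?N + ?N = ennreal 2 * ?N" by (simp add: mult_2[symmetric])
      then have "ennreal (1/2) * (?N + ?N) = (ennreal (1/2) * ennreal 2) * ?N" by (simp only: mult.assoc)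
      also have "ennreal (1/2) * ennreal 2 = 1" by (subst ennreal_mult[symmetric]) auto
      finally show ?thesis by simp
    qed
    finally show ?thesis by simp
  qed
  have "(\<integral>\<^sup>+x. ennreal ((norm (inverse_fourier u x))\<^sup>2) \<partial>lborel)
    = (\<integral>\<^sup>+x. liminf (\<lambda>n. ennreal ((norm (inverse_fourier u x))\<^sup>2 * exp (- (inverse (real (Suc n)) * norm x)\<^sup>2 / 2))) \<partial>lborel)"
  proof (rule nn_integral_cong)
    fix x :: 'a
    have "(\<lambda>n. ennreal ((norm (inverse_fourier u x))\<^sup>2 * exp (- (inverse (real (Suc n)) * norm x)\<^sup>2 / 2)))
      \<longlonglongrightarrow> ennreal ((norm (inverse_fourier u x))\<^sup>2 * exp (- (0 * norm x)\<^sup>2 / 2))"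
      by (intro tendsto_intros LIMSEQ_inverse_real_of_nat) auto
    from lim_imp_Liminf[OF _ this] show "ennreal ((norm (inverse_fourier u x))\<^sup>2) = liminf (\<lambda>n. ennreal ((norm (inverse_fourier u x))\<^sup>2 * exp (- (inverse (real (Suc n)) * norm x)\<^sup>2 / 2)))"
      by simp
  qed
  \<comment> \<open>Fatou's lemma along e = 1 / (n + 1).\<close>
  also have "\<dots> \<le> liminf (\<lambda>n. \<integral>\<^sup>+x. ennreal ((norm (inverse_fourier u x))\<^sup>2 * exp (- (inverse (real (Suc n)) * norm x)\<^sup>2 / 2)) \<partial>lborel)"
    by (intro nn_integral_liminf) measurable
  also have "\<dots> \<le> (\<integral>\<^sup>+x. ennreal ((norm (u x))\<^sup>2) \<partial>lborel)"
    by (intro Liminf_le always_eventually allI *) auto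
  finally show ?thesis .
qed

text \<open>The same damped identity, now used with equality. After the substitution y = x - e z the
  kernel no longer depends on e; continuity of u gives the pointwise limit of the integrand and
  boundedness gives its domination.\<close>

lemma inverse_fourier_L2_ge:
  fixes u :: "'a::euclidean_space \<Rightarrow> complex"
  assumes u: "integrable lborel u" and c: "continuous_on UNIV u" and B: "\<And>x. norm (u x) \<le> B"
  shows "(\<integral>\<^sup>+x. ennreal ((norm (u x))\<^sup>2) \<partial>lborel) \<le> (\<integral>\<^sup>+x. ennreal ((norm (inverse_fourier u x))\<^sup>2) \<partial>lborel)"
proof -
  have [measurable]: "u \<in> borel_measurable borel" using u by auto
  \<comment> \<open>The kernel at parameter e = 1; dilation by e maps \<open>gauss_kernel e\<close>
    to it.\<close>
  define G where "G = (\<lambda>z::'a. sqrt (2 * pi) ^ DIM('a) * exp (- (norm ((2 * pi) *\<^sub>R z))\<^sup>2 / 2))"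
  have [measurable]: "G \<in> borel_measurable borel" unfolding G_def by measurable
  have G0: "0 \<le> G z" for z unfolding G_def by auto
  have gi: "integrable lborel (\<lambda>x::'a. exp (- (2 * pi * norm x)\<^sup>2 / 2))"
    using gauss_fourier(1)[of "2 * pi" "0::'a"] by (simp add: complex_of_real_integrable_eq)
  then have Gi: "integrable lborel G" unfolding G_def by simp
  have G1: "(\<integral>z. G z \<partial>lborel) = 1"
  proof -
    have "complex_of_real (\<integral>x. exp (- (2 * pi * norm (x::'a))\<^sup>2 / 2) \<partial>lborel) = of_real ((sqrt (2 * pi) / (2 * pi)) ^ DIM('a))"
      using gauss_fourier(2)[of "2 * pi" "0::'a"] by (simp add: integral_complex_of_real del: of_real_power)
    then have "(\<integral>x. exp (- (2 * pi * norm (x::'a))\<^sup>2 / 2) \<partial>lborel) = (sqrt (2 * pi) / (2 * pi)) ^ DIM('a)"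
      by (simp only: of_real_eq_iff)
    then show ?thesis
      unfolding G_def by (simp add: power_mult_distrib[symmetric])
  qed
  let ?L = "\<integral>\<^sup>+x. ennreal ((norm (inverse_fourier u x))\<^sup>2) \<partial>lborel"
  \<comment> \<open>The quadratic form after y = x - e z. At e = 0 it is the squared norm of u times
    the mass of G.\<close>
  let ?J = "\<lambda>e. (\<integral>p. u (fst p) * cnj (u (fst p - e *\<^sub>R snd p)) * of_real (G (snd p)) \<partial>(lborel \<Otimes>\<^sub>M lborel))"
  have J: "ennreal (Re (?J e)) \<le> ?L" if e: "e > 0" for e
  proof -
    define H :: "'a \<Rightarrow> real" where "H = gauss_kernel e"
    have [measurable]: "H \<in> borel_measurable borel" unfolding H_def by measurable
    note ig = inverse_fourier_gauss[OF u e, folded H_def]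
    have HG: "e ^ DIM('a) * H (e *\<^sub>R z) = G z" for z
      using e by (simp add: H_def gauss_kernel_def G_def power_divide power_mult_distrib)
    have Ji: "integrable (lborel \<Otimes>\<^sub>M lborel) (\<lambda>p. u (fst p) * cnj (u (fst p - e *\<^sub>R snd p)) * of_real (G (snd p)))"
    proof -
      have "integrable (lborel \<Otimes>\<^sub>M lborel) (\<lambda>p. (u (fst p) * complex_of_real (G (snd p))) * cnj (u (fst p - e *\<^sub>R snd p)))"
      proof (rule integrable_mult_bounded[where B=B])
        show "integrable (lborel \<Otimes>\<^sub>M lborel) (\<lambda>p. u (fst p) * complex_of_real (G (snd p)))"
          using u Gi by (intro integrable_pair_mult) (auto simp: complex_of_real_integrable_eq)
        show "(\<lambda>p. cnj (u (fst p - e *\<^sub>R snd p))) \<in> borel_measurable (lborel \<Otimes>\<^sub>M lborel)"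
          by measurable
      qed (use B in simp)
      then show ?thesis by (simp add: mult_ac)
    qed
    let ?I = "\<integral>x. (norm (inverse_fourier u x))\<^sup>2 * exp (- (e * norm x)\<^sup>2 / 2) \<partial>lborel"
    have "complex_of_real ?I = (\<integral>x. (\<integral>y. u x * cnj (u y) * of_real (H (x - y)) \<partial>lborel) \<partial>lborel)"
      unfolding ig(3) using lborel_pair.integral_fst'[OF ig(2)] by (simp only: fst_conv snd_conv)
    also have "\<dots> = (\<integral>x. (\<integral>y. u x * cnj (u (x - e *\<^sub>R y)) * of_real (G y) \<partial>lborel) \<partial>lborel)"
    proof (rule Bochner_Integration.integral_cong[OF refl])
      fix x
      have "(\<integral>y. u x * cnj (u y) * of_real (H (x - y)) \<partial>lborel) = \<bar>-e\<bar> ^ DIM('a) *\<^sub>R (\<integral>y. u x * cnj (u (x + (-e) *\<^sub>R y)) * of_real (H (x - (x + (-e) *\<^sub>R y))) \<partial>lborel)"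
        using e by (intro lborel_integral_affine(1)) auto
      also have "\<dots> = (\<integral>y. \<bar>-e\<bar> ^ DIM('a) *\<^sub>R (u x * cnj (u (x + (-e) *\<^sub>R y)) * of_real (H (x - (x + (-e) *\<^sub>R y)))) \<partial>lborel)"
        by simp
      also have "\<dots> = (\<integral>y. u x * cnj (u (x - e *\<^sub>R y)) * of_real (G y) \<partial>lborel)"
        using e by (intro Bochner_Integration.integral_cong) (auto simp: HG[symmetric] scaleR_conv_of_real mult_ac)
      finally show "(\<integral>y. u x * cnj (u y) * of_real (H (x - y)) \<partial>lborel) = (\<integral>y. u x * cnj (u (x - e *\<^sub>R y)) * of_real (G y) \<partial>lborel)" .
    qed
    also have "\<dots> = ?J e"
      using lborel_pair.integral_fst'[OF Ji] by simp
    finally have "?I = Re (?J e)" by (metis Re_complex_of_real)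
    then have "ennreal (Re (?J e)) = (\<integral>\<^sup>+x. ennreal ((norm (inverse_fourier u x))\<^sup>2 * exp (- (e * norm x)\<^sup>2 / 2)) \<partial>lborel)"
      using nn_integral_eq_integral[OF ig(1)] by simp
    also have "\<dots> \<le> ?L" by (intro nn_integral_mono ennreal_leI mult_left_le) auto
    finally show ?thesis .
  qed
  have Jlim: "(\<lambda>n. ?J (inverse (real (Suc n)))) \<longlonglongrightarrow> ?J 0"
  proof (rule integral_dominated_convergence[where w="\<lambda>p. norm (u (fst p)) * (B * G (snd p))"])
    show "integrable (lborel \<Otimes>\<^sub>M lborel) (\<lambda>p. norm (u (fst p)) * (B * G (snd p)))"
      using u Gi by (intro integrable_pair_mult) auto
    show "AE p in lborel \<Otimes>\<^sub>M lborel. (\<lambda>n. u (fst p) * cnj (u (fst p - inverse (real (Suc n)) *\<^sub>R snd p)) * of_real (G (snd p)))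
      \<longlonglongrightarrow> u (fst p) * cnj (u (fst p - 0 *\<^sub>R snd p)) * of_real (G (snd p))"
    proof (rule AE_I2)
      fix p :: "'a \<times> 'a"
      have "(\<lambda>n. fst p - inverse (real (Suc n)) *\<^sub>R snd p) \<longlonglongrightarrow> fst p - 0 *\<^sub>R snd p"
        by (intro tendsto_intros LIMSEQ_inverse_real_of_nat)
      moreover have "isCont u (fst p - 0 *\<^sub>R snd p)" using c by (simp add: continuous_on_eq_continuous_at)
      ultimately have "(\<lambda>n. u (fst p - inverse (real (Suc n)) *\<^sub>R snd p)) \<longlonglongrightarrow> u (fst p - 0 *\<^sub>R snd p)"
        by (rule isCont_tendsto_compose[rotated])
      then show "(\<lambda>n. u (fst p) * cnj (u (fst p - inverse (real (Suc n)) *\<^sub>R snd p)) * of_real (G (snd p)))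
      \<longlonglongrightarrow> u (fst p) * cnj (u (fst p - 0 *\<^sub>R snd p)) * of_real (G (snd p))"
        by (intro tendsto_intros)
    qed
    show "AE p in lborel \<Otimes>\<^sub>M lborel. norm (u (fst p) * cnj (u (fst p - inverse (real (Suc n)) *\<^sub>R snd p)) * of_real (G (snd p)))
      \<le> norm (u (fst p)) * (B * G (snd p))" for n
      using B G0 by (intro AE_I2) (auto simp: norm_mult mult.assoc intro!: mult_left_mono mult_right_mono)
  qed measurable
  have u2: "integrable lborel (\<lambda>x. (norm (u x))\<^sup>2)"
  proof -
    have "integrable lborel (\<lambda>x. norm (u x) * norm (u x))"
      using u B by (intro integrable_mult_bounded[where B=B]) auto
    then show ?thesis by (simp add: power2_eq_square)
  qed
  have J0: "?J 0 = of_real (\<integral>x. (norm (u x))\<^sup>2 \<partial>lborel)"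
  proof -
    have i: "integrable (lborel \<Otimes>\<^sub>M lborel) (\<lambda>p. (norm (u (fst p)))\<^sup>2 * G (snd p))"
      using u2 Gi by (intro integrable_pair_mult) auto
    have "?J 0 = (\<integral>p. complex_of_real ((norm (u (fst p)))\<^sup>2 * G (snd p)) \<partial>(lborel \<Otimes>\<^sub>M lborel))"
      by (intro Bochner_Integration.integral_cong) (auto simp: complex_norm_square simp del: of_real_power)
    also have "\<dots> = of_real (\<integral>x. \<integral>y. (norm (u x))\<^sup>2 * G y \<partial>lborel \<partial>lborel)"
      using lborel_pair.integral_fst'[OF i] by (simp add: integral_complex_of_real del: of_real_mult)
    also have "\<dots> = of_real (\<integral>x. (norm (u x))\<^sup>2 \<partial>lborel)" by (simp add: G1)
    finally show ?thesis .
  qed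
  have "(\<lambda>n. ennreal (Re (?J (inverse (real (Suc n)))))) \<longlonglongrightarrow> ennreal (Re (?J 0))"
    by (intro tendsto_intros Jlim)
  then have "ennreal (Re (?J 0)) \<le> ?L"
    by (rule LIMSEQ_le_const2) (use J in auto)
  then show ?thesis
    unfolding J0 using nn_integral_eq_integral[OF u2] by simp
qed

subsection \<open>Smooth bump functions\<close>

text \<open>The negative powers of t are built in so that the family is closed under differentiation
  up to linear combinations.\<close>

definition exp_recip :: "nat \<Rightarrow> real \<Rightarrow> real" where
  "exp_recip k t = (if t > 0 then exp (- (1 / t)) / t ^ k else 0)"

lemma exp_recip_nonneg: "0 \<le> exp_recip k t"
  by (simp add: exp_recip_def)

lemma power_div_fact_le_exp: "0 \<le> (x::real) \<Longrightarrow> x ^ n / fact n \<le> exp x"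
  using sum_le_suminf[OF summable_exp_generic[of x], of "{n}"] by (auto simp: exp_def divide_inverse mult.commute)

text \<open>A single term of the exponential series at 1/t already beats the power; the free
  exponent n expresses flatness of every order at 0.\<close>

lemma exp_recip_le: "\<bar>exp_recip k t\<bar> \<le> fact (k + n) * \<bar>t\<bar> ^ n"
proof (cases "t > 0")
  case True
  have "(1 / t) ^ (k + n) / fact (k + n) \<le> exp (1 / t)"
    using True by (intro power_div_fact_le_exp) auto
  then have "exp (- (1 / t)) \<le> fact (k + n) * t ^ (k + n)"
    using True by (simp add: exp_minus field_simps power_divide)
  then show ?thesis
    using True by (simp add: exp_recip_def field_simps power_add)
qed (simp add: exp_recip_def)

lemma exp_recip_bounded: "\<bar>exp_recip k t\<bar> \<le> fact k"
  using exp_recip_le[of k t 0] by simp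

lemma exp_recip_has_derivative:
  "(exp_recip k has_real_derivative (exp_recip (k + 2) t - real k * exp_recip (k + 1) t)) (at t)"
proof -
  consider "t > 0" | "t < 0" | "t = 0" by linarith
  then show ?thesis
  proof cases
    case 1
    have "((\<lambda>t. exp (- (1 / t)) / t ^ k) has_real_derivative (exp_recip (k + 2) t - real k * exp_recip (k + 1) t)) (at t)"
      using 1 by (auto intro!: derivative_eq_intros simp: exp_recip_def field_simps power2_eq_square power_add)
        (cases k; simp add: field_simps power_add)
    then show ?thesis
      by (rule has_field_derivative_transform_within_open[where S="{0<..}"])
        (use 1 in \<open>auto simp: exp_recip_def\<close>)
  next
    case 2
    have "((\<lambda>t. 0) has_real_derivative (exp_recip (k + 2) t - real k * exp_recip (k + 1) t)) (at t)"
      using 2 by (auto simp: exp_recip_def)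
    then show ?thesis
      by (rule has_field_derivative_transform_within_open[where S="{..<0}"])
        (use 2 in \<open>auto simp: exp_recip_def\<close>)
  next
    case 3
    \<comment> \<open>Quadratic flatness, the case n = 2 of \<open>exp_recip_le\<close>, makes the
      difference quotient at 0 of order |h|.\<close>
    have "((\<lambda>h. exp_recip k h / h) \<longlongrightarrow> 0) (at 0)"
    proof (rule Lim_null_comparison)
      show "\<forall>\<^sub>F h in at 0. norm (exp_recip k h / h) \<le> fact (k + 2) * \<bar>h\<bar>"
      proof (rule always_eventually, rule allI)
        fix h :: real
        show "norm (exp_recip k h / h) \<le> fact (k + 2) * \<bar>h\<bar>"
        proof (cases "h = 0")
          case False
          then have "\<bar>exp_recip k h\<bar> / \<bar>h\<bar> \<le> (fact (k + 2) * \<bar>h\<bar> ^ 2) / \<bar>h\<bar>"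
            by (intro divide_right_mono exp_recip_le) auto
          also have "\<dots> = fact (k + 2) * \<bar>h\<bar>"
            unfolding power2_eq_square using False by (simp only: times_divide_eq_right[symmetric]) simp
          finally show ?thesis by (simp only: real_norm_def abs_divide)
        qed simp
      qed
      show "((\<lambda>h. fact (k + 2) * \<bar>h\<bar>) \<longlongrightarrow> 0) (at (0::real))"
        by (auto intro!: tendsto_eq_intros)
    qed
    then show ?thesis
      using 3 by (simp add: DERIV_def exp_recip_def)
  qed
qed

text \<open>A class of compactly supported functions closed under directional derivatives, so that
  smoothness of all orders follows from first-order differentiability. Coordinate factors are
  included because they appear when the radial profile is differentiated. The constant c in the
  profile serves to approximate indicators of balls: for large c the profile with k = 0 tends to 1
  inside.\<close>

inductive bump :: "('a::euclidean_space \<Rightarrow> real) \<Rightarrow> bool" where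
  base: "r > 0 \<Longrightarrow> c > 0 \<Longrightarrow> bump (\<lambda>x. exp_recip k (c * (1 - (norm (x - a))\<^sup>2 / r\<^sup>2)))"
| add: "bump f \<Longrightarrow> bump g \<Longrightarrow> bump (\<lambda>x. f x + g x)"
| cmult: "bump f \<Longrightarrow> bump (\<lambda>x. c * f x)"
| coord: "bump f \<Longrightarrow> bump (\<lambda>x. (x \<bullet> b) * f x)"

lemma bump_diff: "bump f \<Longrightarrow> bump g \<Longrightarrow> bump (\<lambda>x. f x - g x)"
  using bump.add[OF _ bump.cmult[of g "-1"], of f] by simp

lemma bump_bounded_support:
  assumes "bump f"
  shows "\<exists>R C. R > 0 \<and> C > 0 \<and> (\<forall>x. \<bar>f x\<bar> \<le> C) \<and> (\<forall>x. norm x \<ge> R \<longrightarrow> f x = 0)"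
  using assms
proof induction
  case (base r c k a)
  show ?case
  proof (rule exI[of _ "norm a + r"], rule exI[of _ "fact k"], intro conjI allI impI exp_recip_bounded)
    fix x :: 'a assume "norm x \<ge> norm a + r"
    then have "norm (x - a) \<ge> r" using norm_triangle_sub[of x a] by simp
    then have "(norm (x - a))\<^sup>2 / r\<^sup>2 \<ge> 1" using base by simp
    then have "c * (1 - (norm (x - a))\<^sup>2 / r\<^sup>2) \<le> 0" using base by (intro mult_nonneg_nonpos) auto
    then show "exp_recip k (c * (1 - (norm (x - a))\<^sup>2 / r\<^sup>2)) = 0" by (simp add: exp_recip_def)
  qed (use base in \<open>auto simp: add_nonneg_pos\<close>)
next
  case (add f g)
  then obtain R C R' C' where *: "R > 0" "C > 0" "\<forall>x. \<bar>f x\<bar> \<le> C" "\<forall>x. norm x \<ge> R \<longrightarrow> f x = 0"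
    "R' > 0" "C' > 0" "\<forall>x. \<bar>g x\<bar> \<le> C'" "\<forall>x. norm x \<ge> R' \<longrightarrow> g x = 0" by metis
  have "\<bar>f x + g x\<bar> \<le> C + C'" for x using *(3,7) abs_triangle_ineq[of "f x" "g x"] by (meson add_mono order_trans)
  then show ?case using * by (intro exI[of _ "max R R'"] exI[of _ "C + C'"]) auto
next
  case (cmult f c)
  then obtain R C where *: "R > 0" "C > 0" "\<forall>x. \<bar>f x\<bar> \<le> C" "\<forall>x. norm x \<ge> R \<longrightarrow> f x = 0" by metis
  have "\<bar>c * f x\<bar> \<le> (\<bar>c\<bar> + 1) * C" for x
    unfolding abs_mult using * by (intro mult_mono) auto
  then show ?case using * by (intro exI[of _ R] exI[of _ "(\<bar>c\<bar> + 1) * C"]) (auto intro: mult_pos_pos add_nonneg_pos)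
next
  case (coord f b)
  then obtain R C where *: "R > 0" "C > 0" "\<forall>x. \<bar>f x\<bar> \<le> C" "\<forall>x. norm x \<ge> R \<longrightarrow> f x = 0" by metis
  have "\<bar>(x \<bullet> b) * f x\<bar> \<le> (R * norm b + 1) * C" for x
  proof (cases "norm x \<ge> R")
    case True then show ?thesis using * by simp
  next
    case False
    have "\<bar>x \<bullet> b\<bar> \<le> norm x * norm b" by (rule Cauchy_Schwarz_ineq2)
    also have "\<dots> \<le> R * norm b" using False by (intro mult_right_mono) auto
    finally show ?thesis
      unfolding abs_mult using * by (intro mult_mono) auto
  qed
  then show ?case using * by (intro exI[of _ R] exI[of _ "(R * norm b + 1) * C"]) (auto intro!: mult_pos_pos add_nonneg_pos)
qed

lemma bump_has_derivative:
  assumes "bump f"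
  shows "\<exists>D. \<forall>x. (f has_derivative D x) (at x) \<and> (\<forall>b. bump (\<lambda>x. D x b))"
  using assms
proof induction
  case (base r c k a)
  let ?t = "\<lambda>x. c * (1 - (norm (x - a))\<^sup>2 / r\<^sup>2)"
  let ?E = "\<lambda>x. exp_recip (k + 2) (?t x) - real k * exp_recip (k + 1) (?t x)"
  let ?D = "\<lambda>x h. ?E x * (- (2 * c) / r\<^sup>2 * ((x - a) \<bullet> h))"
  have 1: "((\<lambda>x. exp_recip k (?t x)) has_derivative ?D x) (at x)" for x
  proof -
    define d where "d = inverse (r\<^sup>2)"
    have "((\<lambda>x. c * (1 - ((x - a) \<bullet> (x - a)) * d)) has_derivative (\<lambda>h. - (2 * c) * d * ((x - a) \<bullet> h))) (at x)"
      by (auto intro!: derivative_eq_intros simp: inner_commute algebra_simps fun_eq_iff)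
    then have "(?t has_derivative (\<lambda>h. - (2 * c) / r\<^sup>2 * ((x - a) \<bullet> h))) (at x)"
      by (simp add: d_def power2_norm_eq_inner divide_inverse)
    from has_derivative_compose[OF this exp_recip_has_derivative[unfolded has_field_derivative_def]]
    show ?thesis by simp
  qed
  have 2: "bump ?E"
    by (intro bump_diff bump.cmult bump.base base)
  have 3: "bump (\<lambda>x. ?D x b)" for b
  proof -
    \<comment> \<open>Expands (x - a) . b so that the derivative is assembled from
      \<open>coord\<close> and \<open>cmult\<close> alone.\<close>
    have "u * (- c * (p - q)) = - c * (p * u) + (c * q) * u" for u c p q :: real
      by (simp add: algebra_simps)
    from this[of _ "2 * c / r\<^sup>2"]
    have "(\<lambda>x. ?D x b) = (\<lambda>x. (- (2 * c) / r\<^sup>2) * ((x \<bullet> b) * ?E x) + (2 * c / r\<^sup>2 * (a \<bullet> b)) * ?E x)"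
      by (simp only: fun_eq_iff inner_diff_left minus_divide_left) blast
    then show ?thesis using 2 by (simp only:) (intro bump.add bump.cmult bump.coord)
  qed
  show ?case using 1 3 by (intro exI[of _ ?D]) blast
next
  case (add f g)
  then obtain D E where "\<forall>x. (f has_derivative D x) (at x) \<and> (\<forall>b. bump (\<lambda>x. D x b))"
    "\<forall>x. (g has_derivative E x) (at x) \<and> (\<forall>b. bump (\<lambda>x. E x b))" by metis
  then show ?case by (intro exI[of _ "\<lambda>x h. D x h + E x h"]) (auto intro!: has_derivative_add bump.add)
next
  case (cmult f c)
  then obtain D where "\<forall>x. (f has_derivative D x) (at x) \<and> (\<forall>b. bump (\<lambda>x. D x b))" by metis
  then show ?case by (intro exI[of _ "\<lambda>x h. c * D x h"]) (auto intro!: has_derivative_mult_right bump.cmult)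
next
  case (coord f b)
  then obtain D where D: "\<forall>x. (f has_derivative D x) (at x) \<and> (\<forall>b. bump (\<lambda>x. D x b))" by metis
  have "((\<lambda>x. (x \<bullet> b) * f x) has_derivative (\<lambda>h. (x \<bullet> b) * D x h + (h \<bullet> b) * f x)) (at x)" for x
    using D by (intro has_derivative_mult has_derivative_inner_left has_derivative_ident) auto
  moreover have "bump (\<lambda>x. (x \<bullet> b) * D x h + (h \<bullet> b) * f x)" for h
    using D coord by (intro bump.add bump.cmult bump.coord) auto
  ultimately show ?case by (intro exI[of _ "\<lambda>x h. (x \<bullet> b) * D x h + (h \<bullet> b) * f x"]) blast
qed

lemma bump_differentiable: "bump f \<Longrightarrow> f differentiable (at x)"
  using bump_has_derivative[of f] unfolding differentiable_def by blast

lemma bump_frechet_derivative: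
  assumes "bump f" shows "bump (\<lambda>x. frechet_derivative f (at x) b)"
proof -
  obtain D where D: "\<forall>x. (f has_derivative D x) (at x) \<and> (\<forall>b. bump (\<lambda>x. D x b))"
    using bump_has_derivative[OF assms] by blast
  then have "(\<lambda>x. frechet_derivative f (at x) b) = (\<lambda>x. D x b)"
    by (metis frechet_derivative_at)
  with D show ?thesis by simp
qed

lemma bump_iter_pderiv: "bump f \<Longrightarrow> bump (iter_pderiv bs f)"
  by (induction bs) (auto intro: bump_frechet_derivative)

lemma bump_continuous: "bump f \<Longrightarrow> continuous_on S f"
  by (meson bump_differentiable continuous_at_imp_continuous_on differentiable_imp_continuous_within)

lemma bump_measurable: "bump f \<Longrightarrow> f \<in> borel_measurable borel"
  by (rule borel_measurable_continuous_onI[OF bump_continuous])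

lemma emeasure_lborel_ball_finite: "emeasure lborel (ball c r :: 'a::euclidean_space set) < top"
  using emeasure_bounded_finite[of "ball c r"] by simp

lemma bump_integrable: 
  assumes "bump (f :: 'a::euclidean_space \<Rightarrow> real)" shows "integrable lborel f"
proof -
  obtain R C where *: "\<forall>x. \<bar>f x\<bar> \<le> C" "\<forall>x. norm x \<ge> R \<longrightarrow> f x = 0"
    using bump_bounded_support[OF assms] by blast
  have "integrable lborel (\<lambda>x::'a. indicator (ball 0 R) x * C)"
    by (intro integrable_mult_left integrable_real_indicator) (auto simp: emeasure_lborel_ball_finite)
  then show ?thesis
    by (rule Bochner_Integration.integrable_bound)
      (use * bump_measurable[OF assms] in \<open>auto simp: indicator_def intro: order_trans[OF _ abs_ge_self]\<close>)
qed

text \<open>Transfers smoothness and decay from real bumps to the complex test functions and the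
  vector field, which are images of bumps under a linear map.\<close>

lemma iter_pderiv_bounded_linear:
  fixes f :: "'a::euclidean_space \<Rightarrow> real"
  assumes L: "bounded_linear L" and f: "bump f"
  shows "iter_pderiv bs (\<lambda>x. L (f x)) = (\<lambda>x. L (iter_pderiv bs f x))"
proof (induction bs)
  case (Cons b bs)
  have "((\<lambda>x. L (iter_pderiv bs f x)) has_derivative (\<lambda>h. L (frechet_derivative (iter_pderiv bs f) (at x) h))) (at x)" for x
    using bump_differentiable[OF bump_iter_pderiv[OF f]]
    by (intro bounded_linear.has_derivative[OF L]) (simp add: frechet_derivative_works)
  then have "frechet_derivative (\<lambda>x. L (iter_pderiv bs f x)) (at x) = (\<lambda>h. L (frechet_derivative (iter_pderiv bs f) (at x) h))" for x
    by (rule frechet_derivative_at[symmetric])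
  then show ?case using Cons by simp
qed simp

lemma smooth_bump_linear:
  fixes f :: "'a::euclidean_space \<Rightarrow> real"
  assumes L: "bounded_linear L" and f: "bump f"
  shows "smooth (\<lambda>x. L (f x))"
  unfolding smooth_def iter_pderiv_bounded_linear[OF assms] differentiable_on_def
proof (intro allI impI ballI)
  fix bs and x :: 'a
  obtain D where "(iter_pderiv bs f has_derivative D) (at x)"
    using bump_differentiable[OF bump_iter_pderiv[OF f]] unfolding differentiable_def by blast
  then show "(\<lambda>x. L (iter_pderiv bs f x)) differentiable (at x within UNIV)"
    unfolding differentiable_def using bounded_linear.has_derivative[OF L] by blast
qed

lemma smooth_bump: "bump f \<Longrightarrow> smooth f"
  using smooth_bump_linear[OF bounded_linear_ident, of f] by simp

lemma compactly_supportedI: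
  fixes f :: "'a::euclidean_space \<Rightarrow> 'b::real_normed_vector"
  assumes "\<And>x. norm x \<ge> R \<Longrightarrow> f x = 0"
  shows "compactly_supported f"
proof -
  have "bounded {x. f x \<noteq> 0}"
    using assms by (intro boundedI[of _ R]) (metis (mono_tags) linear mem_Collect_eq)
  then show ?thesis unfolding compactly_supported_def by (simp add: compact_closure)
qed

lemma schwartz_bump:
  assumes f: "bump f" shows "schwartz (\<lambda>x. complex_of_real (f x))"
  unfolding schwartz_def
proof (intro conjI allI impI smooth_bump_linear[OF bounded_linear_of_real f])
  fix bs :: "'a list" and k :: nat
  obtain R C where *: "R > 0" "C > 0" "\<forall>x. \<bar>iter_pderiv bs f x\<bar> \<le> C" "\<forall>x. norm x \<ge> R \<longrightarrow> iter_pderiv bs f x = 0"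
    using bump_bounded_support[OF bump_iter_pderiv[OF f]] by blast
  show "\<exists>B. \<forall>x. (1 + norm x) ^ k * norm (iter_pderiv bs (\<lambda>x. complex_of_real (f x)) x) \<le> B"
  proof (intro exI[of _ "(1 + R) ^ k * C"] allI)
    fix x :: 'a
    show "(1 + norm x) ^ k * norm (iter_pderiv bs (\<lambda>x. complex_of_real (f x)) x) \<le> (1 + R) ^ k * C"
    proof (cases "norm x \<ge> R")
      case True
      then show ?thesis using * by (simp add: iter_pderiv_bounded_linear[OF bounded_linear_of_real f])
    next
      case False
      then show ?thesis using * unfolding iter_pderiv_bounded_linear[OF bounded_linear_of_real f]
        by (intro mult_mono power_mono) auto
    qed
  qed
qed

subsection \<open>Integrability of radial powers\<close>

lemma ennreal_le_suminf: "f k \<le> (\<Sum>k. f k :: ennreal)"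
  using sum_le_suminf[of f "{k}"] by simp

text \<open>The index places \<open>norm x\<close> between 2^-(k+1) and 2^-k; since g <= 0 the power
  is largest at the inner radius.\<close>

lemma powr_dyadic_near_0:
  fixes x :: "'a::real_normed_vector"
  assumes g: "g \<le> 0" and x: "x \<noteq> 0" "norm x < 1"
  shows "\<exists>k::nat. norm x < (1/2) ^ k \<and> norm x powr g \<le> (1/2) powr (g * (real k + 1))"
proof -
  obtain k where k: "(1/2) ^ (Suc k) \<le> norm x" "norm x < (1/2::real) ^ k"
  proof -
    obtain n where n: "(1/2::real) ^ n < norm x" using real_arch_pow_inv[of "norm x" "1/2"] x by auto
    define m where "m = (LEAST n. (1/2::real) ^ n \<le> norm x)"
    have m: "(1/2::real) ^ m \<le> norm x" unfolding m_def by (rule LeastI[of _ n]) (use n in simp)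
    have "m \<noteq> 0" using m x by (intro notI) simp
    then obtain k where mk: "m = Suc k" using not0_implies_Suc by blast
    have "\<not> (1/2::real) ^ k \<le> norm x" using not_less_Least[of k "\<lambda>n. (1/2::real) ^ n \<le> norm x"] mk m_def by simp
    with m mk that[of k] show thesis by simp
  qed
  have "norm x powr g \<le> ((1/2) ^ Suc k) powr g"
    using g k(1) by (intro powr_mono2') auto
  also have "\<dots> = (1/2) powr (g * (real k + 1))"
    by (simp add: powr_realpow[symmetric] powr_powr algebra_simps del: power_Suc)
  finally show ?thesis using k by blast
qed

lemma powr_dyadic_near_infinity:
  fixes x :: "'a::real_normed_vector"
  assumes g: "g \<le> 0" and x: "norm x \<ge> 1"
  shows "\<exists>k::nat. norm x < 2 ^ (k + 1) \<and> norm x powr g \<le> 2 powr (g * real k)"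
proof -
  obtain k where k: "2 ^ k \<le> norm x" "norm x < (2::real) ^ (Suc k)"
  proof -
    obtain n where n: "norm x < (2::real) ^ n" using real_arch_pow[of 2 "norm x"] by auto
    define m where "m = (LEAST n. norm x < (2::real) ^ n)"
    have m: "norm x < (2::real) ^ m" unfolding m_def by (rule LeastI[of _ n]) (use n in simp)
    have "m \<noteq> 0" using m x by (intro notI) simp
    then obtain k where mk: "m = Suc k" using not0_implies_Suc by blast
    have "\<not> norm x < (2::real) ^ k" using not_less_Least[of k "\<lambda>n. norm x < (2::real) ^ n"] mk m_def by simp
    with m mk that[of k] show thesis by simp
  qed
  have "norm x powr g \<le> (2 ^ k) powr g"
    using g k(1) by (intro powr_mono2') auto
  also have "\<dots> = 2 powr (g * real k)"
    by (simp add: powr_realpow[symmetric] powr_powr mult.commute)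
  finally show ?thesis using k by (intro exI[of _ k]) auto
qed

lemma emeasure_lborel_ball0:
  "r \<ge> 0 \<Longrightarrow> emeasure lborel (ball (0::'a::euclidean_space) r) = ennreal (unit_ball_vol (DIM('a)) * r ^ DIM('a))"
  by (rule emeasure_ball)

text \<open>For negative g every dyadic shell is enlarged to the ball of its outer radius, at the
  cost of a constant. The resulting series is geometric with ratio 2^-(g + d), and the hypothesis on
  g makes this less than 1.\<close>

lemma nn_integral_powr_near_0:
  fixes g :: real
  assumes g: "g > - real DIM('a::euclidean_space)"
  shows "(\<integral>\<^sup>+x\<in>ball (0::'a) 1. ennreal (norm x powr g) \<partial>lborel) < \<infinity>"
proof (cases "g \<ge> 0")
  case True
  have "(\<integral>\<^sup>+x\<in>ball (0::'a) 1. ennreal (norm x powr g) \<partial>lborel) \<le> (\<integral>\<^sup>+x. indicator (ball (0::'a) 1) x \<partial>lborel)"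
  proof (rule nn_integral_mono)
    fix x :: 'a
    have "norm x powr g \<le> 1" if "norm x < 1" using that True powr_mono2[of g "norm x" 1] by simp
    then show "ennreal (norm x powr g) * indicator (ball 0 1) x \<le> indicator (ball 0 1) x"
      by (auto simp: indicator_def)
  qed
  also have "\<dots> < \<infinity>" by (simp add: emeasure_lborel_ball_finite)
  finally show ?thesis .
next
  case False
  define d where "d = real DIM('a)"
  define q where "q = (1/2::real) powr (g + d)"
  have "q = 2 powr (- (g + d))" unfolding q_def powr_def by (simp add: ln_div algebra_simps)
  moreover have "2 powr (- (g + d)) < 1" using g unfolding d_def by (intro powr_less_one) auto
  ultimately have q: "0 < q" "q < 1" by (auto simp: q_def)
  define A where "A = (1/2::real) powr g * unit_ball_vol d"
  have A: "0 \<le> A" unfolding A_def by (simp add: d_def)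
  let ?h = "\<lambda>k x. ennreal ((1/2) powr (g * (real k + 1))) * indicator (ball (0::'a) ((1/2) ^ k)) x"
  have "(\<integral>\<^sup>+x\<in>ball (0::'a) 1. ennreal (norm x powr g) \<partial>lborel) \<le> (\<integral>\<^sup>+x. (\<Sum>k. ?h k x) \<partial>lborel)"
  proof (rule nn_integral_mono)
    fix x :: 'a
    show "ennreal (norm x powr g) * indicator (ball 0 1) x \<le> (\<Sum>k. ?h k x)"
    proof (cases "x \<noteq> 0 \<and> norm x < 1")
      case True
      then obtain k :: nat where k: "norm x < (1/2) ^ k" "norm x powr g \<le> (1/2) powr (g * (real k + 1))"
        using powr_dyadic_near_0[of g x] False by auto
      have "ennreal (norm x powr g) * indicator (ball 0 1) x \<le> ?h k x"
        using k True by (auto simp: indicator_def intro!: ennreal_leI)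
      also have "\<dots> \<le> (\<Sum>k. ?h k x)"
        by (rule ennreal_le_suminf[of "\<lambda>k. ?h k x" k])
      finally show ?thesis .
    next
      case False
      then have "ennreal (norm x powr g) * indicator (ball 0 1) x = 0" by (auto simp: indicator_def)
      then show ?thesis by (simp only: zero_le)
    qed
  qed
  also have "\<dots> = (\<Sum>k. \<integral>\<^sup>+x. ?h k x \<partial>lborel)"
    by (intro nn_integral_suminf borel_measurable_times_ennreal borel_measurable_const borel_measurable_indicator) simp
  also have "\<dots> = (\<Sum>k. ennreal (A * q ^ k))"
  proof (intro suminf_cong)
    fix k :: nat
    have "(\<integral>\<^sup>+x. ?h k x \<partial>lborel) = ennreal ((1/2) powr (g * (real k + 1))) * emeasure lborel (ball (0::'a) ((1/2) ^ k))"
      by (rule nn_integral_cmult_indicator) simp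
    also have "\<dots> = ennreal ((1/2) powr (g * (real k + 1)) * (unit_ball_vol d * ((1/2) ^ k) ^ DIM('a)))"
      by (subst emeasure_lborel_ball0) (auto simp: d_def ennreal_mult)
    also have "((1/2) ^ k) ^ DIM('a) = (1/2::real) powr (d * real k)"
    proof -
      have "((1/2) ^ k) ^ DIM('a) = (1/2::real) ^ (k * DIM('a))" by (rule power_mult[symmetric])
      also have "\<dots> = (1/2) powr (real (k * DIM('a)))" by (rule powr_realpow[symmetric]) simp
      also have "real (k * DIM('a)) = d * real k" by (simp add: d_def)
      finally show ?thesis .
    qed
    also have "(1/2) powr (g * (real k + 1)) * (unit_ball_vol d * (1/2::real) powr (d * real k)) = A * q ^ k"
    proof -
      have "q ^ k = q powr real k" using q by (simp add: powr_realpow)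
      also have "\<dots> = (1/2) powr ((g + d) * real k)" unfolding q_def by (rule powr_powr)
      finally have "A * q ^ k = unit_ball_vol d * ((1/2) powr g * (1/2) powr ((g + d) * real k))"
        unfolding A_def by simp
      also have "(1/2) powr g * (1/2) powr ((g + d) * real k) = (1/2) powr (g + (g + d) * real k)"
        by (rule powr_add[symmetric])
      also have "g + (g + d) * real k = g * (real k + 1) + d * real k" by (simp add: algebra_simps)
      finally show ?thesis by (simp add: powr_add)
    qed
    finally show "(\<integral>\<^sup>+x. ?h k x \<partial>lborel) = ennreal (A * q ^ k)" .
  qed
  also have "\<dots> = ennreal (\<Sum>k. A * q ^ k)"
    using A q by (intro suminf_ennreal2) (auto intro!: summable_mult summable_geometric)
  also have "\<dots> < \<infinity>" by simp
  finally show ?thesis .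
qed

text \<open>The counterpart at infinity: shells are enlarged to balls of radius 2^(k+1) and the
  ratio is 2^(g + d).\<close>

lemma nn_integral_powr_near_infinity:
  fixes g :: real
  assumes g: "g < - real DIM('a::euclidean_space)"
  shows "(\<integral>\<^sup>+x\<in>- ball (0::'a) 1. ennreal (norm x powr g) \<partial>lborel) < \<infinity>"
proof -
  define d where "d = real DIM('a)"
  define q where "q = (2::real) powr (g + d)"
  have q: "0 < q" "q < 1" using g unfolding q_def d_def by (auto simp: powr_less_one)
  define A where "A = (2::real) powr d * unit_ball_vol d"
  have A: "0 \<le> A" unfolding A_def by (simp add: d_def)
  let ?h = "\<lambda>k x. ennreal (2 powr (g * real k)) * indicator (ball (0::'a) (2 ^ (k + 1))) x"
  have "(\<integral>\<^sup>+x\<in>- ball (0::'a) 1. ennreal (norm x powr g) \<partial>lborel) \<le> (\<integral>\<^sup>+x. (\<Sum>k. ?h k x) \<partial>lborel)"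
  proof (rule nn_integral_mono)
    fix x :: 'a
    show "ennreal (norm x powr g) * indicator (- ball 0 1) x \<le> (\<Sum>k. ?h k x)"
    proof (cases "norm x \<ge> 1")
      case True
      then obtain k :: nat where k: "norm x < 2 ^ (k + 1)" "norm x powr g \<le> 2 powr (g * real k)"
        using powr_dyadic_near_infinity[of g x] g by auto
      have "ennreal (norm x powr g) * indicator (- ball 0 1) x \<le> ?h k x"
        using k True by (auto simp: indicator_def intro!: ennreal_leI)
      also have "\<dots> \<le> (\<Sum>k. ?h k x)"
        by (rule ennreal_le_suminf[of "\<lambda>k. ?h k x" k])
      finally show ?thesis .
    next
      case False
      then have "ennreal (norm x powr g) * indicator (- ball 0 1) x = 0" by (auto simp: indicator_def)
      then show ?thesis by (simp only: zero_le)
    qed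
  qed
  also have "\<dots> = (\<Sum>k. \<integral>\<^sup>+x. ?h k x \<partial>lborel)"
    by (intro nn_integral_suminf borel_measurable_times_ennreal borel_measurable_const borel_measurable_indicator) simp
  also have "\<dots> = (\<Sum>k. ennreal (A * q ^ k))"
  proof (intro suminf_cong)
    fix k :: nat
    have "(\<integral>\<^sup>+x. ?h k x \<partial>lborel) = ennreal (2 powr (g * real k)) * emeasure lborel (ball (0::'a) (2 ^ (k + 1)))"
      by (rule nn_integral_cmult_indicator) simp
    also have "\<dots> = ennreal (2 powr (g * real k) * (unit_ball_vol d * (2 ^ (k + 1)) ^ DIM('a)))"
      by (subst emeasure_lborel_ball0) (auto simp: d_def ennreal_mult simp del: power_Suc)
    also have "(2 ^ (k + 1)) ^ DIM('a) = (2::real) powr (d * (real k + 1))"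
    proof -
      have "(2 ^ (k + 1)) ^ DIM('a) = (2::real) ^ ((k + 1) * DIM('a))" by (rule power_mult[symmetric])
      also have "\<dots> = 2 powr (real ((k + 1) * DIM('a)))" by (rule powr_realpow[symmetric]) simp
      also have "real ((k + 1) * DIM('a)) = d * (real k + 1)" by (simp add: d_def algebra_simps)
      finally show ?thesis .
    qed
    also have "2 powr (g * real k) * (unit_ball_vol d * (2::real) powr (d * (real k + 1))) = A * q ^ k"
    proof -
      have "q ^ k = q powr real k" using q by (simp add: powr_realpow)
      also have "\<dots> = 2 powr ((g + d) * real k)" unfolding q_def by (rule powr_powr)
      finally have "A * q ^ k = unit_ball_vol d * (2 powr d * 2 powr ((g + d) * real k))"
        unfolding A_def by simp
      also have "2 powr d * 2 powr ((g + d) * real k) = 2 powr (d + (g + d) * real k)"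
        by (rule powr_add[symmetric])
      also have "d + (g + d) * real k = g * real k + d * (real k + 1)" by (simp add: algebra_simps)
      finally show ?thesis by (simp add: powr_add)
    qed
    finally show "(\<integral>\<^sup>+x. ?h k x \<partial>lborel) = ennreal (A * q ^ k)" .
  qed
  also have "\<dots> = ennreal (\<Sum>k. A * q ^ k)"
    using A q by (intro suminf_ennreal2) (auto intro!: summable_mult summable_geometric)
  also have "\<dots> < \<infinity>" by simp
  finally show ?thesis .
qed

text \<open>The bound near the origin leaves out x = 0, where \<open>powr\<close> is 0 by convention
  even for a negative exponent; a single point is null.\<close>

lemma integrable_power_bounds:
  fixes u :: "'a::euclidean_space \<Rightarrow> 'b::{banach, second_countable_topology}"
  assumes u: "u \<in> borel_measurable borel"
    and g: "g > - real DIM('a)" and h: "h < - real DIM('a)"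
    and near: "\<And>x. norm x < 1 \<Longrightarrow> x \<noteq> 0 \<Longrightarrow> norm (u x) \<le> C * norm x powr g"
    and far: "\<And>x. norm x \<ge> 1 \<Longrightarrow> norm (u x) \<le> C * norm x powr h"
  shows "integrable lborel u"
proof (rule integrableI_bounded)
  \<comment> \<open>A unit vector satisfies the second bound, which forces the constant to be
    nonnegative.\<close>
  have C: "C \<ge> 0"
  proof -
    obtain b :: 'a where b: "b \<in> Basis" using nonempty_Basis by blast
    have "0 \<le> norm (u b)" by simp
    also have "\<dots> \<le> C * norm b powr h" using b by (intro far) simp
    finally show ?thesis using b by simp
  qed
  have nz: "AE x in lborel. x \<noteq> (0::'a)"
    by (rule AE_I[where N="{0}"]) auto
  have "(\<integral>\<^sup>+x. ennreal (norm (u x)) \<partial>lborel) \<le> (\<integral>\<^sup>+x. ennreal C * (ennreal (norm x powr g) * indicator (ball (0::'a) 1) x) +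
      ennreal C * (ennreal (norm x powr h) * indicator (- ball 0 1) x) \<partial>lborel)"
  proof -
    have "AE x in lborel. ennreal (norm (u x)) \<le> ennreal C * (ennreal (norm x powr g) * indicator (ball (0::'a) 1) x) +
      ennreal C * (ennreal (norm x powr h) * indicator (- ball 0 1) x)"
      using nz
    proof eventually_elim
      case (elim x)
      show ?case
        using near[OF _ elim] far[of x] C
        by (cases "norm x < 1") (auto simp: ennreal_mult[symmetric] intro!: ennreal_leI)
    qed
    then show ?thesis by (rule nn_integral_mono_AE)
  qed
  also have "\<dots> = ennreal C * (\<integral>\<^sup>+x\<in>ball 0 1. ennreal (norm (x::'a) powr g) \<partial>lborel) + ennreal C * (\<integral>\<^sup>+x\<in>- ball 0 1. ennreal (norm (x::'a) powr h) \<partial>lborel)"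
  proof -
    have m: "(\<lambda>x::'a. ennreal (norm x powr a) * indicator S x) \<in> borel_measurable lborel" if "S \<in> sets borel" for a S
      using that by measurable
    have "ball (0::'a) 1 \<in> sets borel" "- ball (0::'a) 1 \<in> sets borel" by auto
    note m = m[OF this(1)] m[OF this(2)]
    show ?thesis
      by (subst nn_integral_add, (intro borel_measurable_times_ennreal borel_measurable_const m)+,
          subst nn_integral_cmult[OF m(1)], subst nn_integral_cmult[OF m(2)]) simp
  qed
  also have "\<dots> < \<infinity>"
    using nn_integral_powr_near_0[OF g] nn_integral_powr_near_infinity[OF h] by (simp add: ennreal_mult_less_top)
  finally show "(\<integral>\<^sup>+x. ennreal (norm (u x)) \<partial>lborel) < \<infinity>" .
qed (use u in simp)

subsection \<open>Fourier transforms\<close>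

lemma fourier_cis: "fourier f \<xi> = (\<integral>x. f x * cis (- 2 * pi * (\<xi> \<bullet> x)) \<partial>lborel)"
  by (simp add: fourier_def cis_conv_exp mult_ac)

lemma abs_nabla_pow_eq_inverse_fourier:
  "abs_nabla_pow a f = inverse_fourier (\<lambda>\<xi>. of_real ((2 * pi * norm \<xi>) powr a) * fourier f \<xi>)"
  by (simp add: abs_nabla_pow_def inverse_fourier_def cis_conv_exp mult_ac fun_eq_iff)

lemma measurable_fourier [measurable]:
  fixes f :: "'a::euclidean_space \<Rightarrow> complex"
  assumes [measurable]: "f \<in> borel_measurable borel"
  shows "fourier f \<in> borel_measurable borel"
  unfolding fourier_cis[abs_def] by (rule lborel.borel_measurable_lebesgue_integral) measurable

lemma norm_fourier_le: "norm (fourier f \<xi>) \<le> (\<integral>x. norm (f x) \<partial>lborel)"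
  unfolding fourier_cis by (rule order_trans[OF integral_norm_bound]) (simp add: norm_mult)

text \<open>Difference quotients have integral 0 by translation invariance. The mean value
  inequality bounds them by W, so dominated convergence passes this to the derivative; no divergence
  theorem is involved.\<close>

lemma integral_directional_derivative_eq_0:
  fixes F :: "'a::euclidean_space \<Rightarrow> 'b::{banach, second_countable_topology}"
  assumes F: "integrable lborel F" and m: "(\<lambda>x. D x b) \<in> borel_measurable borel"
    and D: "\<And>x. (F has_derivative D x) (at x)"
    and W: "integrable lborel W" "\<And>x t. \<bar>t\<bar> \<le> 1 \<Longrightarrow> norm (D (x + t *\<^sub>R b) b) \<le> W x"
  shows "(\<integral>x. D x b \<partial>lborel) = 0"
proof -
  define e where "e = (\<lambda>n. inverse (real (Suc n)))"
  have e: "e n > 0" "e n \<le> 1" for n by (auto simp: e_def field_simps)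
  let ?Q = "\<lambda>n x. (1 / e n) *\<^sub>R (F (x + e n *\<^sub>R b) - F x)"
  have [measurable]: "F \<in> borel_measurable borel" using F by auto
  have line: "((\<lambda>t. F (x + t *\<^sub>R b)) has_derivative (\<lambda>h. h *\<^sub>R D (x + s *\<^sub>R b) b)) (at s)" for x s
  proof -
    have "((\<lambda>t. x + t *\<^sub>R b) has_derivative (\<lambda>h. h *\<^sub>R b)) (at s)"
      by (auto intro!: derivative_eq_intros)
    from has_derivative_compose[OF this D]
    have "((\<lambda>t. F (x + t *\<^sub>R b)) has_derivative (\<lambda>h. D (x + s *\<^sub>R b) (h *\<^sub>R b))) (at s)" .
    moreover have "bounded_linear (D (x + s *\<^sub>R b))" using D has_derivative_bounded_linear by blast
    ultimately show ?thesis by (simp add: linear_simps)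
  qed
  have "(\<lambda>n. \<integral>x. ?Q n x \<partial>lborel) \<longlonglongrightarrow> (\<integral>x. D x b \<partial>lborel)"
  proof (rule integral_dominated_convergence[where w=W])
    show "AE x in lborel. (\<lambda>n. ?Q n x) \<longlonglongrightarrow> D x b"
    proof (rule AE_I2)
      fix x
      have "((\<lambda>h. norm (F (x + (0 + h) *\<^sub>R b) - F (x + 0 *\<^sub>R b) - h *\<^sub>R D (x + 0 *\<^sub>R b) b) / norm h) \<longlongrightarrow> 0) (at 0)"
        using line[of x 0] unfolding has_derivative_at by blast
      moreover have "filterlim e (at 0) sequentially"
      proof (rule filterlim_atI)
        show "e \<longlonglongrightarrow> 0" unfolding e_def by (rule LIMSEQ_inverse_real_of_nat)
        show "\<forall>\<^sub>F n in sequentially. e n \<noteq> 0" using e(1) by (intro always_eventually allI) (metis less_irrefl)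
      qed
      ultimately have lim: "(\<lambda>n. norm (F (x + (0 + e n) *\<^sub>R b) - F (x + 0 *\<^sub>R b) - e n *\<^sub>R D (x + 0 *\<^sub>R b) b) / norm (e n)) \<longlonglongrightarrow> 0"
        by (rule filterlim_compose)
      have eq: "norm (F (x + (0 + e n) *\<^sub>R b) - F (x + 0 *\<^sub>R b) - e n *\<^sub>R D (x + 0 *\<^sub>R b) b) / norm (e n) = norm (?Q n x - D x b)" for n
      proof -
        have "?Q n x - D x b = (1 / e n) *\<^sub>R (F (x + e n *\<^sub>R b) - F x - e n *\<^sub>R D x b)"
          using e[of n] by (simp add: scaleR_diff_right)
        then have "norm (?Q n x - D x b) = norm (F (x + e n *\<^sub>R b) - F x - e n *\<^sub>R D x b) / norm (e n)"
          by (simp only: norm_scaleR) (simp add: abs_divide)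
        then show ?thesis by (simp only: add_0_left scaleR_zero_left add_0_right)
      qed
      show "(\<lambda>n. ?Q n x) \<longlonglongrightarrow> D x b"
        by (rule LIM_zero_cancel, rule tendsto_norm_zero_cancel) (rule lim[unfolded eq])
    qed
    show "AE x in lborel. norm (?Q n x) \<le> W x" for n
    proof (rule AE_I2)
      fix x
      have "norm (F (x + e n *\<^sub>R b) - F (x + 0 *\<^sub>R b)) \<le> W x * norm (e n - 0)"
      proof (rule differentiable_bound[where S="{0..e n}" and f'="\<lambda>t h. h *\<^sub>R D (x + t *\<^sub>R b) b"])
        show "((\<lambda>t. F (x + t *\<^sub>R b)) has_derivative (\<lambda>h. h *\<^sub>R D (x + t *\<^sub>R b) b)) (at t within {0..e n})" for t
          by (rule has_derivative_at_withinI[OF line])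
        show "onorm (\<lambda>h. h *\<^sub>R D (x + t *\<^sub>R b) b) \<le> W x" if "t \<in> {0..e n}" for t
          using W(2)[of t x] that e[of n] by (intro onorm_le) (auto simp: mult.commute intro!: mult_left_mono)
      qed (use e[of n] in auto)
      then have "norm (F (x + e n *\<^sub>R b) - F x) / e n \<le> W x"
        using e[of n] by (simp add: pos_divide_le_eq)
      moreover have "norm (?Q n x) = norm (F (x + e n *\<^sub>R b) - F x) / e n"
        by (simp only: norm_scaleR) (simp add: abs_of_pos[OF e(1)])
      ultimately show "norm (?Q n x) \<le> W x" by (simp only:)
    qed
    show "?Q n \<in> borel_measurable lborel" for n by measurable
  qed (use W m in auto)
  moreover have "(\<integral>x. ?Q n x \<partial>lborel) = 0" for n
  proof -
    have "integrable lborel (\<lambda>x. F (e n *\<^sub>R b + 1 *\<^sub>R x))"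
      using F by (subst lborel_integral_affine(2)) auto
    moreover have "(\<integral>x. F x \<partial>lborel) = (\<integral>x. F (e n *\<^sub>R b + 1 *\<^sub>R x) \<partial>lborel)"
      using lborel_integral_affine(1)[of 1 F "e n *\<^sub>R b"] by simp
    ultimately show ?thesis using F by (simp add: add.commute)
  qed
  ultimately have "(\<lambda>n::nat. 0) \<longlonglongrightarrow> (\<integral>x. D x b \<partial>lborel)" by (simp only:)
  then show ?thesis by (simp add: LIMSEQ_const_iff)
qed

lemma has_derivative_cis_inner:
  "((\<lambda>x. cis (c * (z \<bullet> x))) has_derivative (\<lambda>h. \<i> * of_real (c * (z \<bullet> h)) * cis (c * (z \<bullet> x)))) (at x)"
proof -
  have "((\<lambda>x. \<i> * complex_of_real (c * (z \<bullet> x))) has_derivative (\<lambda>h. \<i> * complex_of_real (c * (z \<bullet> h)))) (at x)"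
    by (intro has_derivative_of_real has_derivative_mult_right has_derivative_inner_right has_derivative_ident)
  from has_derivative_compose[OF this DERIV_exp[unfolded has_field_derivative_def]]
  show ?thesis by (simp add: cis_conv_exp mult.commute)
qed

text \<open>Integration by parts: the derivative of f times the character has integral 0, and the
  product rule separates the two terms. The dominating function has to cover short translates of
  both f and its derivative.\<close>

lemma fourier_derivative:
  fixes f :: "'a::euclidean_space \<Rightarrow> complex"
  assumes f: "integrable lborel f" and f': "integrable lborel (\<lambda>x. D x b)"
    and D: "\<And>x. (f has_derivative D x) (at x)"
    and W: "integrable lborel W" "\<And>x t. \<bar>t\<bar> \<le> 1 \<Longrightarrow> norm (D (x + t *\<^sub>R b) b) \<le> W x"
      "\<And>x t. \<bar>t\<bar> \<le> 1 \<Longrightarrow> norm (f (x + t *\<^sub>R b)) \<le> W x"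
  shows "fourier (\<lambda>x. D x b) \<xi> = 2 * of_real pi * \<i> * of_real (\<xi> \<bullet> b) * fourier f \<xi>"
proof -
  let ?c = "\<lambda>x. cis (- 2 * pi * (\<xi> \<bullet> x))"
  have i1: "integrable lborel (\<lambda>x. f x * ?c x)" and i2: "integrable lborel (\<lambda>x. D x b * ?c x)"
    by (intro integrable_mult_cis f f'; measurable)+
  let ?D = "\<lambda>x h. f x * (\<i> * of_real (- 2 * pi * (\<xi> \<bullet> h)) * ?c x) + D x h * ?c x"
  have eq: "?D x b = (- 2 * of_real pi * \<i> * of_real (\<xi> \<bullet> b)) * (f x * ?c x) + D x b * ?c x" for x
    by (simp add: mult_ac)
  have i: "integrable lborel (\<lambda>x. ?D x b)"
    unfolding eq using i1 i2 by (intro Bochner_Integration.integrable_add integrable_mult_right)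
  have "(\<integral>x. ?D x b \<partial>lborel) = 0"
  proof (rule integral_directional_derivative_eq_0[OF i1, where D="?D" and b=b])
    show "((\<lambda>x. f x * ?c x) has_derivative ?D x) (at x)" for x
      by (intro has_derivative_mult D has_derivative_cis_inner)
    show "integrable lborel (\<lambda>x. (2 * pi * \<bar>\<xi> \<bullet> b\<bar> + 1) * W x)" using W by auto
    show "norm (?D (x + t *\<^sub>R b) b) \<le> (2 * pi * \<bar>\<xi> \<bullet> b\<bar> + 1) * W x" if "\<bar>t\<bar> \<le> 1" for x t
    proof -
      have "norm (?D (x + t *\<^sub>R b) b) \<le> norm (f (x + t *\<^sub>R b)) * (2 * pi * \<bar>\<xi> \<bullet> b\<bar>) + norm (D (x + t *\<^sub>R b) b)"
        by (rule order_trans[OF norm_triangle_ineq]) (simp add: norm_mult abs_mult)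
      also have "\<dots> \<le> W x * (2 * pi * \<bar>\<xi> \<bullet> b\<bar>) + W x"
        using W(2,3) that by (intro add_mono mult_right_mono) auto
      finally show ?thesis by (simp add: algebra_simps)
    qed
  qed (use i in auto)
  also have "(\<integral>x. ?D x b \<partial>lborel) = (- 2 * of_real pi * \<i> * of_real (\<xi> \<bullet> b)) * fourier f \<xi> + fourier (\<lambda>x. D x b) \<xi>"
    unfolding eq fourier_cis using i1 i2
    by (subst Bochner_Integration.integral_add) (auto intro: integrable_mult_right simp del: integral_mult_right_zero simp: integral_mult_right_zero)
  finally show ?thesis by (simp add: algebra_simps add_eq_0_iff2)
qed

lemma integrable_one_plus_norm_power:
  assumes "k > DIM('a::euclidean_space)"
  shows "integrable lborel (\<lambda>x::'a. C / (1 + norm x) ^ k)"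
proof (rule integrable_power_bounds[where g=0 and h="- real k" and C="\<bar>C\<bar>"])
  show "norm (C / (1 + norm x) ^ k) \<le> \<bar>C\<bar> * norm x powr 0" if "x \<noteq> 0" for x :: 'a
  proof -
    have 1: "1 \<le> (1 + norm x) ^ k" by (rule one_le_power) simp
    then have 0: "0 < (1 + norm x) ^ k" by linarith
    with 1 have "\<bar>C\<bar> / (1 + norm x) ^ k \<le> \<bar>C\<bar> / 1" by (intro divide_left_mono) auto
    moreover have "norm (C / (1 + norm x) ^ k) = \<bar>C\<bar> / (1 + norm x) ^ k" 
      unfolding real_norm_def abs_divide by (simp only: abs_of_pos[OF 0])
    moreover have "norm x powr 0 = 1" using that by simp
    ultimately show ?thesis by (simp only: div_by_1 mult_1_right)
  qed
  show "norm (C / (1 + norm x) ^ k) \<le> \<bar>C\<bar> * norm x powr (- real k)" if "1 \<le> norm x" for x :: 'a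
  proof -
    have pos: "0 < norm x ^ k" using that by (intro zero_less_power) linarith
    have pos': "0 < (1 + norm x) ^ k" using that by (intro zero_less_power) linarith
    have "norm x ^ k \<le> (1 + norm x) ^ k" by (intro power_mono) auto
    then have "\<bar>C\<bar> / (1 + norm x) ^ k \<le> \<bar>C\<bar> / norm x ^ k"
      using pos pos' by (intro divide_left_mono mult_pos_pos) auto
    moreover have "norm x powr (- real k) = 1 / norm x ^ k"
      unfolding powr_minus_divide using that by (subst powr_realpow) (linarith, rule refl)
    ultimately show ?thesis by (simp add: abs_divide)
  qed
qed (use assms in auto)

lemma iter_pderiv_append: "iter_pderiv (bs @ cs) f = iter_pderiv bs (iter_pderiv cs f)"
  by (induction bs) auto

lemma schwartz_derivative:
  assumes "schwartz f" "b \<in> Basis"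
  shows "schwartz (\<lambda>x. frechet_derivative f (at x) b)"
proof -
  have "iter_pderiv bs (\<lambda>x. frechet_derivative f (at x) b) = iter_pderiv (bs @ [b]) f" for bs
    by (simp add: iter_pderiv_append)
  moreover have "set bs \<subseteq> Basis \<Longrightarrow> set (bs @ [b]) \<subseteq> Basis" for bs using assms(2) by auto
  ultimately show ?thesis using assms(1) unfolding schwartz_def smooth_def by metis
qed

lemma schwartz_has_derivative:
  assumes "schwartz f" shows "(f has_derivative frechet_derivative f (at x)) (at x)"
proof -
  have "iter_pderiv [] f differentiable_on UNIV"
    using assms unfolding schwartz_def smooth_def by (metis empty_iff empty_set subsetI)
  then have "f differentiable (at x)" by (simp add: differentiable_on_def)
  then show ?thesis by (rule frechet_derivative_works[THEN iffD1])
qed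

lemma schwartz_continuous: "schwartz f \<Longrightarrow> continuous_on UNIV f"
  using schwartz_has_derivative has_derivative_continuous by (meson continuous_at_imp_continuous_on)

lemma schwartz_measurable: "schwartz f \<Longrightarrow> f \<in> borel_measurable borel"
  by (rule borel_measurable_continuous_onI[OF schwartz_continuous])

lemma schwartz_bound:
  assumes "schwartz f" shows "\<exists>C\<ge>0. \<forall>x. norm (f x) \<le> C / (1 + norm x) ^ k"
proof -
  have "\<exists>B. \<forall>x. (1 + norm x) ^ k * norm (iter_pderiv [] f x) \<le> B"
    using assms unfolding schwartz_def by (metis empty_iff empty_set subsetI)
  then obtain B where B: "\<And>x. (1 + norm x) ^ k * norm (f x) \<le> B" by auto
  have pos: "0 < (1 + norm x) ^ k" for x :: 'a by (intro zero_less_power) (simp add: add_pos_nonneg)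
  have "norm (f x) \<le> \<bar>B\<bar> / (1 + norm x) ^ k" for x
    using B[of x] pos[of x] by (simp add: pos_le_divide_eq mult.commute abs_ge_self order_trans[OF _ abs_ge_self])
  then show ?thesis by (intro exI[of _ "\<bar>B\<bar>"]) auto
qed

lemma schwartz_integrable:
  fixes f :: "'a::euclidean_space \<Rightarrow> complex"
  assumes f: "schwartz f"
  shows "integrable lborel f" "integrable lborel (\<lambda>x. norm x * norm (f x))"
proof -
  have [measurable]: "f \<in> borel_measurable borel" by (rule schwartz_measurable[OF f])
  let ?k = "DIM('a) + 1"
  obtain C where C: "C \<ge> 0" "\<And>x. norm (f x) \<le> C / (1 + norm x) ^ ?k" using schwartz_bound[OF f] by blast
  obtain C' where C': "C' \<ge> 0" "\<And>x. norm (f x) \<le> C' / (1 + norm x) ^ (Suc ?k)" using schwartz_bound[OF f] by blast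
  have ge: "norm (C / (1 + norm x) ^ ?k) = C / (1 + norm x) ^ ?k" if "C \<ge> 0" for C and x :: 'a using that by simp
  show "integrable lborel f"
    by (rule Bochner_Integration.integrable_bound[OF integrable_one_plus_norm_power[of ?k C]]) (use C ge in auto)
  have "norm x * norm (f x) \<le> C' / (1 + norm x) ^ ?k" for x
  proof -
    have p: "1 + norm x > 0" by (simp add: add_pos_nonneg)
    have "norm x * norm (f x) \<le> (1 + norm x) * (C' / (1 + norm x) ^ (Suc ?k))"
      by (intro mult_mono C') auto
    also have "\<dots> = C' / (1 + norm x) ^ ?k" using p by simp
    finally show ?thesis .
  qed
  then show "integrable lborel (\<lambda>x. norm x * norm (f x))"
    by (intro Bochner_Integration.integrable_bound[OF integrable_one_plus_norm_power[of ?k C']]) (use C' ge in auto)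
qed

lemma fourier_schwartz_derivative:
  fixes f :: "'a::euclidean_space \<Rightarrow> complex"
  assumes f: "schwartz f" and b: "b \<in> Basis"
  shows "fourier (\<lambda>x. frechet_derivative f (at x) b) \<xi> = 2 * of_real pi * \<i> * of_real (\<xi> \<bullet> b) * fourier f \<xi>"
proof -
  note f' = schwartz_derivative[OF f b]
  let ?k = "DIM('a) + 1"
  obtain C where C: "C \<ge> 0" "\<And>x. norm (f x) \<le> C / (1 + norm x) ^ ?k" using schwartz_bound[OF f] by blast
  obtain C' where C': "C' \<ge> 0" "\<And>x. norm (frechet_derivative f (at x) b) \<le> C' / (1 + norm x) ^ ?k" using schwartz_bound[OF f'] by blast
  \<comment> \<open>For |t| <= 1 one has 1 + |x| <= 2 (1 + |x + t b|), so a translate loses at most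
    the factor 2^k.\<close>
  have shift: "A / (1 + norm (x + t *\<^sub>R b)) ^ ?k \<le> (C + C') * 2 ^ ?k / (1 + norm x) ^ ?k"
    if t: "\<bar>t\<bar> \<le> 1" and A: "0 \<le> A" "A \<le> C + C'" for A t and x :: 'a
  proof -
    have "norm x \<le> norm (x + t *\<^sub>R b) + norm (t *\<^sub>R b)" using norm_triangle_ineq4[of "x + t *\<^sub>R b" "t *\<^sub>R b"] by simp
    moreover have "norm (t *\<^sub>R b) \<le> 1" using t b by simp
    ultimately have "norm x \<le> norm (x + t *\<^sub>R b) + 1" by (rule order_trans[OF _ add_left_mono])
    moreover have "n \<le> N + 1 \<Longrightarrow> 0 \<le> N \<Longrightarrow> 1 + n \<le> 2 * (1 + N)" for n N :: real by simp
    ultimately have le: "1 + norm x \<le> 2 * (1 + norm (x + t *\<^sub>R b))" using norm_ge_zero by blast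
    have p: "0 < 1 + norm x" "0 < 1 + norm (x + t *\<^sub>R b)" by (simp_all add: add_pos_nonneg)
    have "(1 + norm x) ^ ?k \<le> (2 * (1 + norm (x + t *\<^sub>R b))) ^ ?k" using le p by (intro power_mono) auto
    then have le': "(1 + norm x) ^ ?k \<le> 2 ^ ?k * (1 + norm (x + t *\<^sub>R b)) ^ ?k" by (simp only: power_mult_distrib)
    have "A / (1 + norm (x + t *\<^sub>R b)) ^ ?k = A * 2 ^ ?k / (2 ^ ?k * (1 + norm (x + t *\<^sub>R b)) ^ ?k)" by simp
    also have "\<dots> \<le> A * 2 ^ ?k / (1 + norm x) ^ ?k"
      using A p le' by (intro divide_left_mono mult_pos_pos zero_less_power) auto
    also have "\<dots> \<le> (C + C') * 2 ^ ?k / (1 + norm x) ^ ?k"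
      using A p by (intro divide_right_mono mult_right_mono zero_le_power) auto
    finally show ?thesis .
  qed
  show ?thesis
  proof (rule fourier_derivative[where D="\<lambda>x. frechet_derivative f (at x)" and W="\<lambda>x. (C + C') * 2 ^ ?k / (1 + norm x) ^ ?k"])
    show "integrable lborel (\<lambda>x::'a. (C + C') * 2 ^ ?k / (1 + norm x) ^ ?k)" by (rule integrable_one_plus_norm_power) simp
    show "norm (frechet_derivative f (at (x + t *\<^sub>R b)) b) \<le> (C + C') * 2 ^ ?k / (1 + norm x) ^ ?k" if "\<bar>t\<bar> \<le> 1" for x t
      by (rule order_trans[OF C'(2) shift[OF that C'(1)]]) (simp add: C)
    show "norm (f (x + t *\<^sub>R b)) \<le> (C + C') * 2 ^ ?k / (1 + norm x) ^ ?k" if "\<bar>t\<bar> \<le> 1" for x t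
      by (rule order_trans[OF C(2) shift[OF that C(1)]]) (simp add: C')
  qed (intro schwartz_integrable f f' schwartz_has_derivative)+
qed

text \<open>Each derivative in direction b is worth one factor |\<xi> . b|, by induction on
  m.\<close>

lemma fourier_schwartz_decay:
  fixes f :: "'a::euclidean_space \<Rightarrow> complex"
  assumes "schwartz f"
  shows "\<exists>C. \<forall>\<xi>. norm \<xi> ^ m * norm (fourier f \<xi>) \<le> C"
proof -
  have "\<exists>C. \<forall>\<xi>. \<bar>\<xi> \<bullet> b\<bar> ^ m * norm (fourier f \<xi>) \<le> C" if b: "b \<in> Basis" for b
    using assms
  proof (induction m arbitrary: f)
    case 0
    show ?case using norm_fourier_le by auto
  next
    case (Suc m)
    obtain C where C: "\<forall>\<xi>. \<bar>\<xi> \<bullet> b\<bar> ^ m * norm (fourier (\<lambda>x. frechet_derivative f (at x) b) \<xi>) \<le> C"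
      using Suc.IH[OF schwartz_derivative[OF Suc.prems b]] by blast
    have "\<bar>\<xi> \<bullet> b\<bar> ^ Suc m * norm (fourier f \<xi>) \<le> C / (2 * pi)" for \<xi>
      using C[rule_format, of \<xi>] unfolding fourier_schwartz_derivative[OF Suc.prems b]
      by (simp add: norm_mult field_simps)
    then show ?case by blast
  qed
  then obtain C where C: "\<And>b \<xi>. b \<in> Basis \<Longrightarrow> \<bar>\<xi> \<bullet> b\<bar> ^ m * norm (fourier f \<xi>) \<le> C b" by metis
  show ?thesis
  proof (intro exI allI)
    fix \<xi> :: 'a
    \<comment> \<open>Some coordinate carries at least the fraction 1/d of the norm, so decay in the
      coordinate directions is enough.\<close>
    have "\<exists>b\<in>Basis. norm \<xi> \<le> real DIM('a) * \<bar>\<xi> \<bullet> b\<bar>"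
    proof (rule ccontr)
      assume "\<not> ?thesis"
      then have "(\<Sum>b\<in>Basis. real DIM('a) * \<bar>\<xi> \<bullet> b\<bar>) < (\<Sum>b\<in>(Basis::'a set). norm \<xi>)"
        by (intro sum_strict_mono) auto
      then have "real DIM('a) * (\<Sum>b\<in>Basis. \<bar>\<xi> \<bullet> b\<bar>) < real DIM('a) * norm \<xi>"
        by (simp add: sum_distrib_left)
      then have "(\<Sum>b\<in>Basis. \<bar>\<xi> \<bullet> b\<bar>) < norm \<xi>" by simp
      with norm_le_l1[of \<xi>] show False by simp
    qed
    then obtain b where b: "b \<in> Basis" "norm \<xi> \<le> real DIM('a) * \<bar>\<xi> \<bullet> b\<bar>" by blast
    have "norm \<xi> ^ m * norm (fourier f \<xi>) \<le> (real DIM('a) * \<bar>\<xi> \<bullet> b\<bar>) ^ m * norm (fourier f \<xi>)"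
      using b by (intro mult_right_mono power_mono) auto
    also have "\<dots> \<le> real DIM('a) ^ m * C b"
      using C[OF b(1), of \<xi>] by (simp add: power_mult_distrib mult.assoc mult_left_mono)
    also have "\<dots> \<le> (\<Sum>b\<in>Basis. \<bar>real DIM('a) ^ m * C b\<bar>)"
      using b member_le_sum[of b Basis "\<lambda>b. \<bar>real DIM('a) ^ m * C b\<bar>"] by simp
    finally show "norm \<xi> ^ m * norm (fourier f \<xi>) \<le> (\<Sum>b\<in>Basis. \<bar>real DIM('a) ^ m * C b\<bar>)" .
  qed
qed

lemma norm_cis_diff_1_le: "norm (cis t - 1) \<le> \<bar>t\<bar>"
proof -
  have "norm (cis t - cis 0) \<le> 1 * norm (t - 0)"
  proof (rule differentiable_bound[where S=UNIV and f'="\<lambda>t h. h *\<^sub>R (\<i> * cis t)"])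
    show "(cis has_derivative (\<lambda>h. h *\<^sub>R (\<i> * cis s))) (at s within UNIV)" for s
      using has_derivative_cis_inner[of 1 1 s] by (simp add: scaleR_conv_of_real mult_ac)
    show "onorm (\<lambda>h. h *\<^sub>R (\<i> * cis s)) \<le> 1" for s
      by (intro onorm_le) (auto simp: norm_mult)
  qed auto
  then show ?thesis by simp
qed

text \<open>Zero mean allows 1 to be subtracted from the character, and |cis t - 1| <= |t| yields a
  first-order zero at the origin.\<close>

lemma fourier_zero_mean_bound:
  fixes f :: "'a::euclidean_space \<Rightarrow> complex"
  assumes f: "integrable lborel f" and g: "integrable lborel (\<lambda>x. norm x * norm (f x))" and z: "zero_mean f"
  shows "norm (fourier f \<xi>) \<le> 2 * pi * norm \<xi> * (\<integral>x. norm x * norm (f x) \<partial>lborel)"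
proof -
  have i: "integrable lborel (\<lambda>x. f x * cis (- 2 * pi * (\<xi> \<bullet> x)))"
    by (intro integrable_mult_cis f; measurable)
  have "fourier f \<xi> = (\<integral>x. f x * (cis (- 2 * pi * (\<xi> \<bullet> x)) - 1) \<partial>lborel)"
    using z i f unfolding fourier_cis zero_mean_def
    by (simp add: right_diff_distrib)
  also have "norm \<dots> \<le> (\<integral>x. 2 * pi * norm \<xi> * (norm x * norm (f x)) \<partial>lborel)"
  proof (rule Bochner_Integration.integral_norm_bound_integral)
    show "integrable lborel (\<lambda>x. f x * (cis (- 2 * pi * (\<xi> \<bullet> x)) - 1))"
      using i f by (simp add: right_diff_distrib)
    fix x
    have "norm (cis (- 2 * pi * (\<xi> \<bullet> x)) - 1) \<le> 2 * pi * \<bar>\<xi> \<bullet> x\<bar>"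
      using norm_cis_diff_1_le[of "- 2 * pi * (\<xi> \<bullet> x)"] by (simp add: abs_mult)
    also have "\<dots> \<le> 2 * pi * (norm \<xi> * norm x)"
      by (intro mult_left_mono Cauchy_Schwarz_ineq2) auto
    finally have "norm (f x) * norm (cis (- 2 * pi * (\<xi> \<bullet> x)) - 1) \<le> norm (f x) * (2 * pi * (norm \<xi> * norm x))"
      by (intro mult_left_mono) auto
    then show "norm (f x * (cis (- 2 * pi * (\<xi> \<bullet> x)) - 1)) \<le> 2 * pi * norm \<xi> * (norm x * norm (f x))"
      by (simp add: norm_mult mult_ac)
  qed (use g in auto)
  finally show ?thesis by simp
qed

text \<open>The number j records the order of vanishing at the origin: it is used with j = 0 for
  positive powers and j = 1 for zero-mean functions. Square integrability near 0 is the stronger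
  demand and dictates the threshold -d/2.\<close>

lemma abs_nabla_symbol_integrable:
  fixes w :: "'a::euclidean_space \<Rightarrow> complex"
  assumes w: "w \<in> borel_measurable borel"
    and near: "\<And>\<xi>. norm (w \<xi>) \<le> C * norm \<xi> ^ j"
    and far: "\<And>m. \<exists>C. \<forall>\<xi>. norm \<xi> ^ m * norm (w \<xi>) \<le> C"
    and a: "a + real j > - real DIM('a) / 2"
  defines "u \<equiv> \<lambda>\<xi>. of_real ((2 * pi * norm \<xi>) powr a) * w \<xi>"
  shows "integrable lborel u" and "integrable lborel (\<lambda>\<xi>. (norm (u \<xi>))\<^sup>2)"
proof -
  have [measurable]: "w \<in> borel_measurable borel" by (rule w)
  have um[measurable]: "u \<in> borel_measurable borel" unfolding u_def by measurable
  define d where "d = real DIM('a)"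
  have d1: "d \<ge> 1" by (simp add: d_def Suc_le_eq)
  \<comment> \<open>Enough decay that both a - m and 2 (a - m) lie below -d.\<close>
  obtain m :: nat where m: "real m > a + d" using reals_Archimedean2 by blast
  obtain C' where C': "\<And>\<xi>. norm \<xi> ^ m * norm (w \<xi>) \<le> C'" using far[of m] by blast
  define A where "A = (2 * pi) powr a * max \<bar>C\<bar> \<bar>C'\<bar>"
  have A0: "0 \<le> A" unfolding A_def by simp
  have u_norm: "norm (u \<xi>) = (2 * pi) powr a * norm \<xi> powr a * norm (w \<xi>)" for \<xi>
    by (simp add: u_def norm_mult powr_mult)
  have n: "norm (u \<xi>) \<le> A * norm \<xi> powr (a + j)" if "\<xi> \<noteq> 0" for \<xi>
  proof -
    have "norm (w \<xi>) \<le> max \<bar>C\<bar> \<bar>C'\<bar> * norm \<xi> ^ j"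
      using near[of \<xi>] by (rule order_trans) (intro mult_right_mono, auto)
    then have "norm (u \<xi>) \<le> (2 * pi) powr a * norm \<xi> powr a * (max \<bar>C\<bar> \<bar>C'\<bar> * norm \<xi> ^ j)"
      unfolding u_norm by (intro mult_left_mono) auto
    also have "norm \<xi> ^ j = norm \<xi> powr j" using that by (simp add: powr_realpow)
    finally show ?thesis using that by (simp add: A_def powr_add mult_ac)
  qed
  have f: "norm (u \<xi>) \<le> A * norm \<xi> powr (a - m)" if "norm \<xi> \<ge> 1" for \<xi>
  proof -
    have "norm (w \<xi>) \<le> C' / norm \<xi> ^ m" 
    proof -
      have "0 < norm \<xi> ^ m" using that by (intro zero_less_power) linarith
      then show ?thesis using C'[of \<xi>] by (simp add: pos_le_divide_eq mult.commute)
    qed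
    also have "\<dots> \<le> max \<bar>C\<bar> \<bar>C'\<bar> / norm \<xi> ^ m" by (intro divide_right_mono) auto
    finally have "norm (u \<xi>) \<le> (2 * pi) powr a * norm \<xi> powr a * (max \<bar>C\<bar> \<bar>C'\<bar> / norm \<xi> ^ m)"
      unfolding u_norm by (intro mult_left_mono) auto
    also have "norm \<xi> ^ m = norm \<xi> powr m" using that by (subst powr_realpow) auto
    finally show ?thesis by (simp add: A_def powr_diff mult_ac)
  qed
  show "integrable lborel u"
    using n f a m d1 by (intro integrable_power_bounds[where g="a + j" and h="a - m" and C=A]) (auto simp: d_def)
  have sq: "(t powr b)\<^sup>2 = t powr (2 * b)" for t b :: real
    by (simp add: power2_eq_square powr_add[symmetric])
  show "integrable lborel (\<lambda>\<xi>. (norm (u \<xi>))\<^sup>2)"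
  proof (rule integrable_power_bounds[where g="2 * (a + j)" and h="2 * (a - m)" and C="A\<^sup>2"])
    show "norm ((norm (u \<xi>))\<^sup>2) \<le> A\<^sup>2 * norm \<xi> powr (2 * (a + j))" if "\<xi> \<noteq> 0" for \<xi>
    proof -
      have "(norm (u \<xi>))\<^sup>2 \<le> (A * norm \<xi> powr (a + j))\<^sup>2" using n[OF that] by (intro power_mono) auto
      then show ?thesis by (simp add: power_mult_distrib sq)
    qed
    show "norm ((norm (u \<xi>))\<^sup>2) \<le> A\<^sup>2 * norm \<xi> powr (2 * (a - m))" if "norm \<xi> \<ge> 1" for \<xi>
    proof -
      have "(norm (u \<xi>))\<^sup>2 \<le> (A * norm \<xi> powr (a - m))\<^sup>2" using f[OF that] by (intro power_mono) auto
      then show ?thesis by (simp add: power_mult_distrib sq)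
    qed
  qed (use a m d1 in \<open>auto simp: d_def\<close>)
qed

lemma fourier_scale:
  fixes f :: "'a::euclidean_space \<Rightarrow> complex"
  assumes l: "l > 0"
  shows "fourier (\<lambda>x. f ((1 / l) *\<^sub>R x)) \<xi> = of_real (l ^ DIM('a)) * fourier f (l *\<^sub>R \<xi>)"
  unfolding fourier_cis
  by (subst lborel_integral_affine(1)[where c=l and t=0]) (use l in \<open>auto simp: scaleR_conv_of_real\<close>)

lemma abs_nabla_pow_scale:
  fixes f :: "'a::euclidean_space \<Rightarrow> complex"
  assumes l: "l > 0"
  shows "abs_nabla_pow a (\<lambda>x. f ((1 / l) *\<^sub>R x)) x = of_real (l powr (- a)) * abs_nabla_pow a f ((1 / l) *\<^sub>R x)"
proof -
  let ?h = "\<lambda>\<xi>. of_real ((2 * pi * norm \<xi>) powr a) * fourier (\<lambda>x. f ((1 / l) *\<^sub>R x)) \<xi> * cis (2 * pi * (\<xi> \<bullet> x))"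
  have "abs_nabla_pow a (\<lambda>x. f ((1 / l) *\<^sub>R x)) x = \<bar>1 / l\<bar> ^ DIM('a) *\<^sub>R (\<integral>\<xi>. ?h (0 + (1 / l) *\<^sub>R \<xi>) \<partial>lborel)"
    unfolding abs_nabla_pow_eq_inverse_fourier inverse_fourier_def
    by (rule lborel_integral_affine(1)) (use l in auto)
  also have "(\<lambda>\<xi>. ?h (0 + (1 / l) *\<^sub>R \<xi>)) = (\<lambda>\<xi>. of_real (l ^ DIM('a) * l powr (- a)) * (of_real ((2 * pi * norm \<xi>) powr a) * fourier f \<xi> * cis (2 * pi * (\<xi> \<bullet> ((1 / l) *\<^sub>R x)))))"
  proof
    fix \<xi> :: 'a
    have "(2 * pi * norm ((1 / l) *\<^sub>R \<xi>)) powr a = (2 * pi * norm \<xi>) powr a * l powr (- a)"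
    proof -
      have "2 * pi * norm ((1 / l) *\<^sub>R \<xi>) = (2 * pi * norm \<xi>) / l" using l by simp
      also have "\<dots> powr a = (2 * pi * norm \<xi>) powr a / l powr a" by (rule powr_divide)
      finally show ?thesis by (simp add: powr_minus_divide)
    qed
    then show "?h (0 + (1 / l) *\<^sub>R \<xi>) = of_real (l ^ DIM('a) * l powr (- a)) * (of_real ((2 * pi * norm \<xi>) powr a) * fourier f \<xi> * cis (2 * pi * (\<xi> \<bullet> ((1 / l) *\<^sub>R x))))"
      using l by (simp add: fourier_scale mult_ac)
  qed
  also have "\<bar>1 / l\<bar> ^ DIM('a) *\<^sub>R (\<integral>\<xi>. of_real (l ^ DIM('a) * l powr (- a)) * (of_real ((2 * pi * norm \<xi>) powr a) * fourier f \<xi> * cis (2 * pi * (\<xi> \<bullet> ((1 / l) *\<^sub>R x)))) \<partial>lborel)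
     = of_real (l powr (- a)) * abs_nabla_pow a f ((1 / l) *\<^sub>R x)"
    unfolding abs_nabla_pow_eq_inverse_fourier inverse_fourier_def using l
    by (subst integral_mult_right_zero) (simp add: scaleR_conv_of_real power_divide)
  finally show ?thesis .
qed

subsection \<open>The norms\<close>

lemma Lp_norm_lborel:
  "Lp_norm p f = (let I = (\<integral>\<^sup>+x. ennreal (norm (f x) powr p) \<partial>lborel)
      in if I = \<infinity> then \<infinity> else ennreal (enn2real I powr (1 / p)))"
  by (simp add: Lp_norm_def nn_integral_completion)

lemma Lp_norm_finite_iff: "Lp_norm p f < \<infinity> \<longleftrightarrow> (\<integral>\<^sup>+x. ennreal (norm (f x) powr p) \<partial>lborel) < \<infinity>"
  by (auto simp: Lp_norm_lborel Let_def top.not_eq_extremum)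

lemma Lp_norm_pos:
  "0 < (\<integral>\<^sup>+x. ennreal (norm (f x) powr p) \<partial>lborel) \<Longrightarrow> 0 < Lp_norm p f"
  by (auto simp: Lp_norm_lborel Let_def top.not_eq_extremum less_top enn2real_eq_0_iff)

lemma norm_powr_2: "norm x powr 2 = (norm x)\<^sup>2"
  by (cases "norm x = 0") (auto simp: powr_numeral)

definition abs_nabla_symbol :: "real \<Rightarrow> ('a::euclidean_space \<Rightarrow> complex) \<Rightarrow> 'a \<Rightarrow> complex" where
  "abs_nabla_symbol a f \<xi> = of_real ((2 * pi * norm \<xi>) powr a) * fourier f \<xi>"

lemma abs_nabla_pow_symbol: "abs_nabla_pow a f = inverse_fourier (abs_nabla_symbol a f)"
  by (simp add: abs_nabla_pow_eq_inverse_fourier abs_nabla_symbol_def[abs_def])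

lemma schwartz_symbol_integrable:
  fixes f :: "'a::euclidean_space \<Rightarrow> complex"
  assumes f: "schwartz f" and a: "a > 0"
  shows "integrable lborel (abs_nabla_symbol a f)"
    and "integrable lborel (\<lambda>\<xi>. (norm (abs_nabla_symbol a f \<xi>))\<^sup>2)"
proof -
  have [measurable]: "f \<in> borel_measurable borel" by (rule schwartz_measurable[OF f])
  have m: "fourier f \<in> borel_measurable borel" by measurable
  have d: "0 < real DIM('a)" by simp
  note * = abs_nabla_symbol_integrable[OF m, where j=0 and a=a and C="\<integral>x. norm (f x) \<partial>lborel", folded abs_nabla_symbol_def]
  show "integrable lborel (abs_nabla_symbol a f)"
    and "integrable lborel (\<lambda>\<xi>. (norm (abs_nabla_symbol a f \<xi>))\<^sup>2)"
    using norm_fourier_le[of f] fourier_schwartz_decay[OF f] a d by (intro *; simp)+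
qed

text \<open>Zero mean lowers the admissible order by one. For a = (s - d) / 2 the condition reads s
  > -2, the lower end of the range in the theorem.\<close>

lemma schwartz_symbol_integrable_zero_mean:
  fixes f :: "'a::euclidean_space \<Rightarrow> complex"
  assumes f: "schwartz f" and z: "zero_mean f" and a: "a > - real DIM('a) / 2 - 1"
  shows "integrable lborel (abs_nabla_symbol a f)"
    and "integrable lborel (\<lambda>\<xi>. (norm (abs_nabla_symbol a f \<xi>))\<^sup>2)"
proof -
  have [measurable]: "f \<in> borel_measurable borel" by (rule schwartz_measurable[OF f])
  have m: "fourier f \<in> borel_measurable borel" by measurable
  have n: "norm (fourier f \<xi>) \<le> (2 * pi * (\<integral>x. norm x * norm (f x) \<partial>lborel)) * norm \<xi> ^ 1" for \<xi>
    using fourier_zero_mean_bound[OF schwartz_integrable[OF f] z, of \<xi>] by (simp add: mult_ac)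
  have a': "a + real 1 > - real DIM('a) / 2" using a by simp
  show "integrable lborel (abs_nabla_symbol a f)"
    and "integrable lborel (\<lambda>\<xi>. (norm (abs_nabla_symbol a f \<xi>))\<^sup>2)"
    using abs_nabla_symbol_integrable[OF m n fourier_schwartz_decay[OF f] a', folded abs_nabla_symbol_def] by blast+
qed

lemma abs_nabla_pow_bump_add:
  fixes f :: "'a::euclidean_space \<Rightarrow> real"
  assumes f: "bump f" and g: "bump g" and a: "a > 0"
  shows "abs_nabla_pow a (\<lambda>x. of_real (f x + g x)) x = abs_nabla_pow a (\<lambda>x. of_real (f x)) x + abs_nabla_pow a (\<lambda>x. of_real (g x)) x"
proof -
  have "fourier (\<lambda>x. complex_of_real (f x + g x)) \<xi> = fourier (\<lambda>x. of_real (f x)) \<xi> + fourier (\<lambda>x. of_real (g x)) \<xi>" for \<xi>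
    unfolding fourier_cis of_real_add distrib_right
    by (intro Bochner_Integration.integral_add integrable_mult_cis integrable_of_real bump_integrable f g; measurable)
  then have "abs_nabla_symbol a (\<lambda>x. complex_of_real (f x + g x)) \<xi> = abs_nabla_symbol a (\<lambda>x. of_real (f x)) \<xi> + abs_nabla_symbol a (\<lambda>x. of_real (g x)) \<xi>" for \<xi>
    unfolding abs_nabla_symbol_def by (simp only: distrib_left)
  then show ?thesis
    unfolding abs_nabla_pow_symbol inverse_fourier_def
    by (simp only: distrib_right)
      (intro Bochner_Integration.integral_add integrable_mult_cis schwartz_symbol_integrable schwartz_bump f g a; measurable)
qed

lemma abs_nabla_pow_bump_L2:
  fixes f :: "'a::euclidean_space \<Rightarrow> real"
  assumes f: "bump f" and a: "a > 0"
  shows "(\<integral>\<^sup>+x. ennreal ((norm (abs_nabla_pow a (\<lambda>x. of_real (f x)) x))\<^sup>2) \<partial>lborel) < \<infinity>"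
proof -
  let ?u = "abs_nabla_symbol a (\<lambda>x. of_real (f x))"
  have "(\<integral>\<^sup>+x. ennreal ((norm (abs_nabla_pow a (\<lambda>x. of_real (f x)) x))\<^sup>2) \<partial>lborel) \<le> (\<integral>\<^sup>+x. ennreal ((norm (?u x))\<^sup>2) \<partial>lborel)"
    unfolding abs_nabla_pow_symbol by (rule inverse_fourier_L2_le[OF schwartz_symbol_integrable(1)[OF schwartz_bump[OF f] a]])
  also have "\<dots> < \<infinity>"
    using schwartz_symbol_integrable(2)[OF schwartz_bump[OF f] a] by (simp add: integrable_iff_bounded)
  finally show ?thesis .
qed

text \<open>Interpolation with the sup norm: |F|^p is at most B^(p-2) |F|^2.\<close>

lemma Lp_from_L2_bounded:
  fixes F :: "'a::euclidean_space \<Rightarrow> 'b::real_normed_vector"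
  assumes 2: "(\<integral>\<^sup>+x. ennreal ((norm (F x))\<^sup>2) \<partial>lborel) < \<infinity>" and m: "(\<lambda>x. norm (F x)) \<in> borel_measurable borel"
    and B: "\<And>x. norm (F x) \<le> B" and p: "p \<ge> 2"
  shows "(\<integral>\<^sup>+x. ennreal (norm (F x) powr p) \<partial>lborel) < \<infinity>"
proof -
  have "norm (F x) powr p \<le> B powr (p - 2) * (norm (F x))\<^sup>2" for x
  proof -
    have "norm (F x) powr p = norm (F x) powr (p - 2) * norm (F x) powr 2"
      by (subst powr_add[symmetric]) simp
    also have "\<dots> \<le> B powr (p - 2) * norm (F x) powr 2"
      using B[of x] p by (intro mult_right_mono powr_mono2) auto
    finally show ?thesis by (simp add: norm_powr_2)
  qed
  then have "(\<integral>\<^sup>+x. ennreal (norm (F x) powr p) \<partial>lborel) \<le> (\<integral>\<^sup>+x. ennreal (B powr (p - 2)) * ennreal ((norm (F x))\<^sup>2) \<partial>lborel)"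
    by (intro nn_integral_mono) (simp add: ennreal_mult[symmetric] ennreal_leI)
  also have "\<dots> = ennreal (B powr (p - 2)) * (\<integral>\<^sup>+x. ennreal ((norm (F x))\<^sup>2) \<partial>lborel)"
    using m by (intro nn_integral_cmult) simp
  also have "\<dots> < \<infinity>" using 2 by (simp add: ennreal_mult_less_top)
  finally show ?thesis .
qed

lemma nn_integral_pos_continuous:
  fixes f :: "'a::euclidean_space \<Rightarrow> real"
  assumes c: "continuous_on UNIV f" and x: "f x0 > 0"
  shows "0 < (\<integral>\<^sup>+x. ennreal (f x) \<partial>lborel)"
proof -
  have [measurable]: "f \<in> borel_measurable borel" by (rule borel_measurable_continuous_onI[OF c])
  have op: "open {x. f x > 0}"
    using open_Collect_less[of "\<lambda>_. 0" f] c by auto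
  have "(\<integral>\<^sup>+x. ennreal (f x) \<partial>lborel) \<noteq> 0"
  proof
    assume "(\<integral>\<^sup>+x. ennreal (f x) \<partial>lborel) = 0"
    then have "AE x in lborel. ennreal (f x) = 0"
      by (subst (asm) nn_integral_0_iff_AE) auto
    then have "AE x in lborel. \<not> f x > 0" by eventually_elim (simp add: ennreal_eq_0_iff)
    then have "AE x in lborel. x \<notin> {x. f x > 0}" by simp
    then have "emeasure lborel {x. f x > 0} = 0"
      using op by (subst (asm) AE_iff_measurable[of "{x. f x > 0}"]) auto
    then have "{x. f x > 0} \<in> null_sets lborel" using op by (intro null_setsI) auto
    then have "negligible {x. f x > 0}" by (simp add: negligible_iff_null_sets null_sets_completionI)
    then show False using open_not_negligible[OF op] x by auto
  qed
  then show ?thesis by (simp add: zero_less_iff_neq_zero)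
qed

text \<open>Finiteness is the upper Plancherel bound. For positivity the lower bound cannot be
  applied to the symbol, which may be unbounded at the origin. If the norm were 0, pairing the
  multiplier with f would give the integral of |2 pi \<xi>|^a times the squared modulus of the
  Fourier transform; hence the transform vanishes almost everywhere, and the lower Plancherel bound
  for f itself gives a contradiction.\<close>

lemma Hdot_norm_bump:
  fixes f :: "'a::euclidean_space \<Rightarrow> real"
  assumes f: "bump f" and z: "zero_mean (\<lambda>x. complex_of_real (f x))" and a: "a > - real DIM('a) / 2 - 1"
    and nz: "f x0 \<noteq> 0"
  shows "0 < Hdot_norm a (\<lambda>x. of_real (f x))" "Hdot_norm a (\<lambda>x. of_real (f x)) < \<infinity>"
proof -
  let ?f = "\<lambda>x. complex_of_real (f x)"
  let ?u = "abs_nabla_symbol a ?f"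
  have fi: "integrable lborel ?f" by (intro integrable_of_real bump_integrable f)
  have fm[measurable]: "f \<in> borel_measurable borel" by (rule bump_measurable[OF f])
  note u = schwartz_symbol_integrable_zero_mean[OF schwartz_bump[OF f] z a]
  have "(\<integral>\<^sup>+x. ennreal ((norm (abs_nabla_pow a ?f x))\<^sup>2) \<partial>lborel) \<le> (\<integral>\<^sup>+x. ennreal ((norm (?u x))\<^sup>2) \<partial>lborel)"
    unfolding abs_nabla_pow_symbol by (rule inverse_fourier_L2_le[OF u(1)])
  also have "\<dots> < \<infinity>" using u(2) by (simp add: integrable_iff_bounded)
  finally show "Hdot_norm a ?f < \<infinity>"
    unfolding Hdot_norm_def Lp_norm_finite_iff norm_powr_2 .
  have "(\<integral>\<^sup>+x. ennreal ((norm (abs_nabla_pow a ?f x))\<^sup>2) \<partial>lborel) \<noteq> 0"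
  proof
    assume "(\<integral>\<^sup>+x. ennreal ((norm (abs_nabla_pow a ?f x))\<^sup>2) \<partial>lborel) = 0"
    moreover have um[measurable]: "?u \<in> borel_measurable borel" using u(1) by auto
    ultimately have ae: "AE x in lborel. inverse_fourier ?u x = 0"
      unfolding abs_nabla_pow_symbol
      by (subst (asm) nn_integral_0_iff_AE) (auto simp: ennreal_eq_0_iff)
    \<comment> \<open>Integrated first over \<xi> this is f times the multiplier applied to f;
      integrated first over x it is the weighted squared modulus of the transform.\<close>
    let ?K = "\<lambda>x \<xi>. ?u \<xi> * ?f x * cis (2 * pi * (\<xi> \<bullet> x))"
    have "integrable (lborel \<Otimes>\<^sub>M lborel) (\<lambda>p. ?f (fst p) * ?u (snd p) * cis (2 * pi * (snd p \<bullet> fst p)))"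
      by (intro integrable_mult_cis integrable_pair_mult fi u(1)) measurable
    also have "(\<lambda>p. ?f (fst p) * ?u (snd p) * cis (2 * pi * (snd p \<bullet> fst p))) = case_prod ?K"
      by (simp add: fun_eq_iff)
    finally have K: "integrable (lborel \<Otimes>\<^sub>M lborel) (case_prod ?K)" .
    have "(\<integral>\<xi>. (\<integral>x. ?K x \<xi> \<partial>lborel) \<partial>lborel) = (\<integral>x. (\<integral>\<xi>. ?K x \<xi> \<partial>lborel) \<partial>lborel)"
      by (rule lborel_pair.Fubini_integral[OF K])
    also have "(\<lambda>x. \<integral>\<xi>. ?K x \<xi> \<partial>lborel) = (\<lambda>x. ?f x * inverse_fourier ?u x)"
    proof
      fix x
      have "(\<integral>\<xi>. ?K x \<xi> \<partial>lborel) = (\<integral>\<xi>. ?f x * (?u \<xi> * cis (2 * pi * (\<xi> \<bullet> x))) \<partial>lborel)"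
        by (simp add: mult_ac)
      also have "\<dots> = ?f x * inverse_fourier ?u x"
        unfolding inverse_fourier_def by (rule integral_mult_right_zero)
      finally show "(\<integral>\<xi>. ?K x \<xi> \<partial>lborel) = ?f x * inverse_fourier ?u x" .
    qed
    also have "(\<integral>x. ?f x * inverse_fourier ?u x \<partial>lborel) = (\<integral>x. 0 \<partial>(lborel :: 'a measure))"
      by (rule Bochner_Integration.integral_cong_AE) (use ae in auto)
    also have "(\<lambda>\<xi>. \<integral>x. ?K x \<xi> \<partial>lborel) = (\<lambda>\<xi>. of_real ((2 * pi * norm \<xi>) powr a * (norm (fourier ?f \<xi>))\<^sup>2))"
    proof
      fix \<xi>
      have c: "cnj (fourier ?f \<xi>) = (\<integral>x. ?f x * cis (2 * pi * (\<xi> \<bullet> x)) \<partial>lborel)"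
        unfolding fourier_cis Bochner_Integration.integral_cnj[symmetric] by (simp add: cis_cnj)
      have "(\<integral>x. ?K x \<xi> \<partial>lborel) = (\<integral>x. ?u \<xi> * (?f x * cis (2 * pi * (\<xi> \<bullet> x))) \<partial>lborel)"
        by (simp add: mult_ac)
      also have "\<dots> = ?u \<xi> * cnj (fourier ?f \<xi>)"
        unfolding c by (rule integral_mult_right_zero)
      also have "\<dots> = of_real ((2 * pi * norm \<xi>) powr a) * (fourier ?f \<xi> * cnj (fourier ?f \<xi>))"
        by (simp add: abs_nabla_symbol_def)
      finally show "(\<integral>x. ?K x \<xi> \<partial>lborel) = of_real ((2 * pi * norm \<xi>) powr a * (norm (fourier ?f \<xi>))\<^sup>2)"
        by (simp only: complex_norm_square[symmetric] of_real_mult)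
    qed
    finally have z0: "(\<integral>\<xi>. (2 * pi * norm \<xi>) powr a * (norm (fourier ?f \<xi>))\<^sup>2 \<partial>lborel) = 0"
      by (simp add: integral_complex_of_real del: of_real_mult)
    have "integrable lborel (\<lambda>\<xi>. ?u \<xi> * cnj (fourier ?f \<xi>))"
      using norm_fourier_le[of ?f] by (intro integrable_mult_bounded[OF u(1)]) auto
    then have "integrable lborel (\<lambda>\<xi>. norm (?u \<xi> * cnj (fourier ?f \<xi>)))" by simp
    then have "integrable lborel (\<lambda>\<xi>. (2 * pi * norm \<xi>) powr a * (norm (fourier ?f \<xi>))\<^sup>2)"
      by (simp add: abs_nabla_symbol_def norm_mult power2_eq_square mult.assoc)
    from integral_nonneg_eq_0_iff_AE[OF this] z0
    have "AE \<xi> in lborel. (2 * pi * norm \<xi>) powr a * (norm (fourier ?f \<xi>))\<^sup>2 = 0" by auto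
    moreover have "AE \<xi> in lborel. \<xi> \<noteq> (0::'a)" by (rule AE_I[where N="{0}"]) auto
    ultimately have "AE \<xi> in lborel. fourier ?f \<xi> = 0" by eventually_elim simp
    then have "(\<integral>\<^sup>+\<xi>. ennreal ((norm (fourier ?f \<xi>))\<^sup>2) \<partial>lborel) = 0"
      by (subst nn_integral_0_iff_AE) auto
    moreover have "(\<integral>\<^sup>+\<xi>. ennreal ((norm (fourier ?f \<xi>))\<^sup>2) \<partial>lborel) = (\<integral>\<^sup>+\<xi>. ennreal ((norm (inverse_fourier ?f \<xi>))\<^sup>2) \<partial>lborel)"
    proof -
      have "inverse_fourier ?f \<xi> = fourier ?f (- \<xi>)" for \<xi>
        unfolding inverse_fourier_def fourier_cis by (simp add: inner_commute)
      then show ?thesis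
        using nn_integral_lborel_affine[of "-1" "\<lambda>\<xi>. ennreal ((norm (fourier ?f \<xi>))\<^sup>2)" 0] by simp
    qed
    \<comment> \<open>The bump is continuous and bounded, as the lower Plancherel bound
      requires.\<close>
    moreover obtain C where "\<forall>x. \<bar>f x\<bar> \<le> C" using bump_bounded_support[OF f] by blast
    then have "(\<integral>\<^sup>+x. ennreal ((norm (?f x))\<^sup>2) \<partial>lborel) \<le> (\<integral>\<^sup>+x. ennreal ((norm (inverse_fourier ?f x))\<^sup>2) \<partial>lborel)"
      by (intro inverse_fourier_L2_ge[where B=C] fi continuous_on_of_real bump_continuous f) auto
    moreover have "0 < (\<integral>\<^sup>+x. ennreal ((norm (?f x))\<^sup>2) \<partial>lborel)"
      using nz by (intro nn_integral_pos_continuous[of _ x0] continuous_intros bump_continuous f) auto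
    ultimately show False by simp
  qed
  then show "0 < Hdot_norm a ?f"
    unfolding Hdot_norm_def by (intro Lp_norm_pos) (simp add: norm_powr_2 zero_less_iff_neq_zero)
qed

lemma sets_borel_ball [measurable]: "ball c r \<in> sets borel"
  by simp

subsection \<open>Superposition of widely separated scales in Lp\<close>

text \<open>Compares y with e x. The point is that one constant can be made as close to 1 as
  desired, so that repeated use does not multiply constants.\<close>

lemma powr_add_le_split:
  fixes x y p e :: real
  assumes "x \<ge> 0" "y \<ge> 0" "p \<ge> 0" "e > 0"
  shows "(x + y) powr p \<le> (1 + e) powr p * x powr p + (1 + 1 / e) powr p * y powr p"
proof (cases "y \<le> e * x")
  case True
  have "(x + y) powr p \<le> ((1 + e) * x) powr p" using assms True by (intro powr_mono2) (auto simp: algebra_simps)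
  also have "\<dots> = (1 + e) powr p * x powr p" using assms by (intro powr_mult)
  finally show ?thesis by (simp add: add_increasing2)
next
  case False
  then have "x \<le> y / e" using assms by (simp add: field_simps)
  then have "(x + y) powr p \<le> ((1 + 1 / e) * y) powr p" using assms by (intro powr_mono2) (auto simp: algebra_simps)
  also have "\<dots> = (1 + 1 / e) powr p * y powr p" using assms by (intro powr_mult)
  finally show ?thesis by (simp add: add_increasing)
qed

text \<open>The rescaled profile keeps its Lp norm but spreads out: its supremum decays like
  l^(-d/p). On a large ball it is negligible, and outside this ball F is; hence the p-th powers of
  the norms add up to an error, here at most 1 in three parts of 1/3.\<close>

lemma Lp_add_wide_scale:
  fixes F \<Psi> :: "'a::euclidean_space \<Rightarrow> complex"
  assumes Fm[measurable]: "F \<in> borel_measurable borel" and F: "integrable lborel (\<lambda>x. norm (F x) powr p)"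
    and Pm[measurable]: "\<Psi> \<in> borel_measurable borel" and P: "integrable lborel (\<lambda>x. norm (\<Psi> x) powr p)"
    and B: "\<And>x. norm (\<Psi> x) \<le> B" and p: "p > 0"
  defines "G \<equiv> \<lambda>l x. of_real (l powr (- real DIM('a) / p)) * \<Psi> ((1 / l) *\<^sub>R x)"
  shows "\<exists>L>0. \<forall>l\<ge>L. integrable lborel (\<lambda>x. norm (F x + G l x) powr p) \<and>
     (\<integral>x. norm (F x + G l x) powr p \<partial>lborel) \<le> (\<integral>x. norm (F x) powr p \<partial>lborel) + (\<integral>x. norm (\<Psi> x) powr p \<partial>lborel) + 1"
proof -
  define d where "d = real DIM('a)"
  let ?A = "\<integral>x. norm (F x) powr p \<partial>lborel" and ?J = "\<integral>x. norm (\<Psi> x) powr p \<partial>lborel"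
  have A0: "?A \<ge> 0" and J0: "?J \<ge> 0" by (auto intro: Bochner_Integration.integral_nonneg)
  have B0: "B \<ge> 0" using B[of 0] norm_ge_zero order_trans by blast
  \<comment> \<open>First third of the error: the excess of the constant (1 + e)^p over 1.\<close>
  obtain e where e: "e > 0" "((1 + e) powr p - 1) * (?A + ?J) \<le> 1/3"
  proof -
    have "((\<lambda>e. ((1 + e) powr p - 1) * (?A + ?J)) \<longlongrightarrow> ((1 + 0) powr p - 1) * (?A + ?J)) (at_right 0)"
      by (intro tendsto_intros) auto
    then have "\<forall>\<^sub>F e in at_right 0. ((1 + e) powr p - 1) * (?A + ?J) < 1/3"
      by (rule order_tendstoD) simp
    moreover have "\<forall>\<^sub>F e in at_right (0::real). e > 0" by (simp add: eventually_at_right_less)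
    ultimately have "\<forall>\<^sub>F e in at_right 0. e > 0 \<and> ((1 + e) powr p - 1) * (?A + ?J) < 1/3" by eventually_elim simp
    then obtain e where "e > 0 \<and> ((1 + e) powr p - 1) * (?A + ?J) < 1/3"
      using eventually_happens trivial_limit_at_right_real by blast
    then show thesis using that[of e] by auto
  qed
  define c where "c = (1 + 1 / e) powr p"
  define c' where "c' = (1 + e) powr p"
  have c: "c \<ge> 0" "c' \<ge> 0" by (auto simp: c_def c'_def)
  \<comment> \<open>Second third: the tail of F outside the ball of radius n, small even after
    multiplication by the large constant c.\<close>
  let ?T = "\<lambda>n. \<integral>x. indicator (- ball 0 (real n)) x * norm (F x) powr p \<partial>lborel"
  have "?T \<longlonglongrightarrow> (\<integral>x. 0 \<partial>(lborel :: 'a measure))"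
  proof (rule integral_dominated_convergence[where w="\<lambda>x. norm (F x) powr p"])
    show "AE x in lborel. (\<lambda>n. indicator (- ball 0 (real n)) x * norm (F x) powr p) \<longlonglongrightarrow> 0"
    proof (rule AE_I2)
      fix x :: 'a
      obtain N :: nat where N: "norm x < real N" using reals_Archimedean2 by blast
      have "\<forall>\<^sub>F n in sequentially. indicator (- ball 0 (real n)) x * norm (F x) powr p = 0"
        using eventually_ge_at_top[of N] by eventually_elim (use N in \<open>auto simp: indicator_def\<close>)
      then show "(\<lambda>n. indicator (- ball 0 (real n)) x * norm (F x) powr p) \<longlonglongrightarrow> 0" by (rule tendsto_eventually)
    qed
  qed (use F in \<open>auto simp: indicator_def\<close>)
  then have "(\<lambda>n. c * ?T n) \<longlonglongrightarrow> c * 0" by (intro tendsto_intros) simp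
  then have "\<forall>\<^sub>F n in sequentially. c * ?T n < 1/3" by (rule order_tendstoD) simp
  then obtain n where n: "c * ?T n < 1/3" using eventually_happens by fastforce
  define V where "V = c * B powr p * measure lborel (ball (0::'a) (real n))"
  have V0: "V \<ge> 0" unfolding V_def using c by simp
  \<comment> \<open>Last third: V / l^d bounds the contribution of the wide profile inside the ball,
    and l >= L gives l^d >= 3 V + 1.\<close>
  define L where "L = (3 * V + 1) powr (1 / d)"
  have d0: "d > 0" by (simp add: d_def)
  have L: "L > 0" unfolding L_def using V0 by simp
  show ?thesis
  proof (intro exI conjI allI impI)
    fix l assume l: "l \<ge> L"
    have l0: "l > 0" using l L by simp
    have ld: "l powr d \<ge> 3 * V + 1"
    proof -
      have "3 * V + 1 = L powr d" unfolding L_def using V0 d0 by (simp add: powr_powr)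
      also have "\<dots> \<le> l powr d" using l L d0 by (intro powr_mono2) auto
      finally show ?thesis .
    qed
    have Gp: "norm (G l x) powr p = l powr (- d) * norm (\<Psi> ((1 / l) *\<^sub>R x)) powr p" for x
      using p by (simp add: G_def norm_mult powr_mult powr_powr d_def)
    have [measurable]: "G l \<in> borel_measurable borel" unfolding G_def by measurable
    have Gi: "integrable lborel (\<lambda>x. norm (G l x) powr p)"
      unfolding Gp using P lborel_integral_affine(2)[of "1 / l" "\<lambda>x. norm (\<Psi> x) powr p" 0] l0
      by (intro integrable_mult_right) simp
    have GJ: "(\<integral>x. norm (G l x) powr p \<partial>lborel) = ?J"
    proof -
      have "l powr (- d) = \<bar>1 / l\<bar> ^ DIM('a)"
        using l0 by (simp add: d_def powr_minus_divide powr_realpow power_divide)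
      then show ?thesis unfolding Gp
        using lborel_integral_affine(1)[of "1 / l" "\<lambda>x. norm (\<Psi> x) powr p" 0] l0 by simp
    qed
    have tri: "norm (F x + G l x) powr p \<le> (norm (F x) + norm (G l x)) powr p" for x
      using p by (intro powr_mono2 norm_triangle_ineq) auto
    \<comment> \<open>On the ball F carries the constant c' near 1 and the wide profile the large
      constant c; outside, the two roles are exchanged.\<close>
    let ?R = "\<lambda>x. c' * norm (F x) powr p + c' * norm (G l x) powr p
        + (c * (indicator (- ball 0 (real n)) x * norm (F x) powr p)
        + c * (l powr (- d) * B powr p * indicator (ball 0 (real n)) x))"
    have bd: "norm (F x + G l x) powr p \<le> ?R x" for x
    proof (cases "x \<in> ball 0 (real n)")
      case True
      have 1: "norm (F x + G l x) powr p \<le> c' * norm (F x) powr p + c * norm (G l x) powr p"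
        using powr_add_le_split[of "norm (F x)" "norm (G l x)" p e] tri[of x] e p unfolding c_def c'_def by simp
      have "norm (G l x) powr p \<le> l powr (- d) * B powr p"
        unfolding Gp using B p by (intro mult_left_mono powr_mono2) auto
      then have 2: "c * norm (G l x) powr p \<le> c * (l powr (- d) * B powr p)" using c by (intro mult_left_mono) auto
      have 3: "0 \<le> c' * norm (G l x) powr p" using c by simp
      show ?thesis using True 1 2 3 by simp
    next
      case False
      have "norm (F x + G l x) powr p \<le> c' * norm (G l x) powr p + c * norm (F x) powr p"
        using powr_add_le_split[of "norm (G l x)" "norm (F x)" p e] tri[of x] e p unfolding c_def c'_def by (simp add: add.commute)
      moreover have "0 \<le> c' * norm (F x) powr p" using c by simp
      ultimately show ?thesis using False by simp
    qed
    have Ti: "integrable lborel (\<lambda>x. indicator (- ball 0 (real n)) x * norm (F x) powr p)"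
      by (rule Bochner_Integration.integrable_bound[OF F]) (auto simp: indicator_def)
    have Bi: "integrable lborel (indicator (ball (0::'a) (real n)) :: 'a \<Rightarrow> real)"
      by (intro integrable_real_indicator) (auto simp: emeasure_lborel_ball_finite)
    have Ri: "integrable lborel ?R"
      using F Gi Ti Bi by (intro Bochner_Integration.integrable_add integrable_mult_right)
    show I: "integrable lborel (\<lambda>x. norm (F x + G l x) powr p)"
      by (rule Bochner_Integration.integrable_bound[OF Ri]) (use bd in \<open>auto intro: order_trans[OF _ abs_ge_self]\<close>)
    have "(\<integral>x. norm (F x + G l x) powr p \<partial>lborel) \<le> (\<integral>x. ?R x \<partial>lborel)"
      by (rule integral_mono[OF I Ri bd])
    also have "\<dots> = c' * ?A + c' * ?J + (c * ?T n + c * (l powr (- d) * B powr p * measure lborel (ball (0::'a) (real n))))"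
      using F Gi Ti Bi by (subst Bochner_Integration.integral_add; simp add: GJ)+
    also have "c * (l powr (- d) * B powr p * measure lborel (ball (0::'a) (real n))) = V / l powr d"
      by (simp add: V_def powr_minus_divide)
    also have "V / l powr d \<le> 1/3"
      using ld V0 by (subst pos_divide_le_eq) auto
    also have "c' * ?A + c' * ?J = (c' - 1) * (?A + ?J) + ?A + ?J" by (simp add: algebra_simps)
    finally show "(\<integral>x. norm (F x + G l x) powr p \<partial>lborel) \<le> ?A + ?J + 1"
      using e(2) n unfolding c'_def by linarith
  qed (rule L)
qed

subsection \<open>The oscillating building block\<close>

text \<open>The linear function x . b truncated at radius l. Being odd it has zero mean, so with l =
  1 it also serves as f and g; with large l it is one scale of the field v.\<close>

definition bump_field :: "'a::euclidean_space \<Rightarrow> real \<Rightarrow> 'a \<Rightarrow> real" where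
  "bump_field b l x = (x \<bullet> b) * exp_recip 0 (1 - (norm x)\<^sup>2 / l\<^sup>2)"

lemma bump_bump_field: "l > 0 \<Longrightarrow> bump (bump_field b l)"
  unfolding bump_field_def[abs_def] using bump.coord[OF bump.base[of l 1 0 0], of b] by simp

lemma bump_field_scale: "l > 0 \<Longrightarrow> bump_field b l x = l * bump_field b 1 ((1 / l) *\<^sub>R x)"
  by (simp add: bump_field_def power_divide)

lemma bump_field_zero_mean: 
  "zero_mean (\<lambda>x. complex_of_real (bump_field b l x))"
proof -
  let ?f = "\<lambda>x. complex_of_real (bump_field b l x)"
  have "(\<integral>x. ?f x \<partial>lborel) = (\<integral>x. ?f (- x) \<partial>lborel)"
    using lborel_integral_affine(1)[of "-1" ?f 0] by simp
  also have "\<dots> = - (\<integral>x. ?f x \<partial>lborel)" by (simp add: bump_field_def)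
  finally show ?thesis by (simp add: zero_mean_def)
qed

lemma bump_field_outside: "norm x \<ge> 1 \<Longrightarrow> bump_field b 1 x = 0"
proof -
  assume "norm x \<ge> 1"
  then have "1 \<le> (norm x)\<^sup>2" by (rule one_le_power)
  then have "exp_recip 0 (1 - (norm x)\<^sup>2 / 1\<^sup>2) = 0"
    unfolding exp_recip_def by (intro if_not_P) simp
  then show ?thesis unfolding bump_field_def by (simp only: mult_zero_right)
qed

lemma bump_lipschitz:
  fixes f :: "'a::euclidean_space \<Rightarrow> real"
  assumes f: "bump f"
  shows "\<exists>C\<ge>0. \<forall>x y. \<bar>f x - f y\<bar> \<le> C * norm (x - y)"
proof -
  let ?D = "\<lambda>x. frechet_derivative f (at x)"
  have D: "(f has_derivative ?D x) (at x)" for x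
    using bump_differentiable[OF f] frechet_derivative_works by blast
  have "\<exists>C. \<forall>x. \<bar>?D x b\<bar> \<le> C" for b
    using bump_bounded_support[OF bump_frechet_derivative[OF f]] by blast
  then obtain C where C: "\<And>b x. \<bar>?D x b\<bar> \<le> C b" by metis
  define C' where "C' = (\<Sum>b\<in>Basis. C b)"
  have "C b \<ge> 0" for b using C[of 0 b] by linarith
  then have C'0: "C' \<ge> 0" unfolding C'_def by (intro sum_nonneg)
  have on: "onorm (?D x) \<le> C'" for x
  proof (rule onorm_le)
    fix h :: 'a
    interpret linear "?D x" using D has_derivative_linear by blast
    have "?D x h = ?D x (\<Sum>b\<in>Basis. (h \<bullet> b) *\<^sub>R b)" by (simp add: euclidean_representation)
    also have "\<dots> = (\<Sum>b\<in>Basis. (h \<bullet> b) * ?D x b)" by (simp add: sum scale)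
    also have "\<bar>\<dots>\<bar> \<le> (\<Sum>b\<in>Basis. \<bar>(h \<bullet> b) * ?D x b\<bar>)" by (rule sum_abs)
    also have "\<dots> \<le> (\<Sum>b\<in>Basis. norm h * C b)"
      unfolding abs_mult using C by (intro sum_mono mult_mono) (auto simp: Basis_le_norm)
    finally show "norm (?D x h) \<le> C' * norm h" by (simp add: C'_def sum_distrib_left mult.commute)
  qed
  have "\<bar>f x - f y\<bar> \<le> C' * norm (x - y)" for x y
    using differentiable_bound[OF convex_UNIV has_derivative_at_withinI[OF D] on, of x y] by auto
  then show ?thesis using C'0 by blast
qed

text \<open>The dilation l \<phi>(x / l) preserves the Lipschitz constant. Uniformity in l is what
  later gives a dominating function for the forms at all scales.\<close>

lemma bump_field_lipschitz:
  "\<exists>C\<ge>0. \<forall>l>0. \<forall>x y. \<bar>bump_field b l x - bump_field b l y\<bar> \<le> C * norm (x - y)"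
proof -
  obtain C where C: "C \<ge> 0" "\<And>x y. \<bar>bump_field b 1 x - bump_field b 1 y\<bar> \<le> C * norm (x - y)"
    using bump_lipschitz[OF bump_bump_field[of 1 b]] by auto
  have "\<bar>bump_field b l x - bump_field b l y\<bar> \<le> C * norm (x - y)" if l: "l > 0" for l x y
  proof -
    have "bump_field b l x - bump_field b l y = l * (bump_field b 1 ((1 / l) *\<^sub>R x) - bump_field b 1 ((1 / l) *\<^sub>R y))"
      unfolding bump_field_scale[OF l] by (simp add: right_diff_distrib)
    then have "\<bar>bump_field b l x - bump_field b l y\<bar> = l * \<bar>bump_field b 1 ((1 / l) *\<^sub>R x) - bump_field b 1 ((1 / l) *\<^sub>R y)\<bar>"
      using l by (simp add: abs_mult)
    also have "\<dots> \<le> l * (C * norm ((1 / l) *\<^sub>R x - (1 / l) *\<^sub>R y))" using l by (intro mult_left_mono C) auto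
    also have "(1 / l) *\<^sub>R x - (1 / l) *\<^sub>R y = (1 / l) *\<^sub>R (x - y)" by (simp add: scaleR_diff_right)
    finally show ?thesis using l by simp
  qed
  then show ?thesis using C(1) by blast
qed

text \<open>The exponent 1 - a equals -d/p for p = d / (a - 1), so the Lp norm of the derivative is
  the same at every scale.\<close>

lemma abs_nabla_pow_bump_field:
  assumes l: "l > 0"
  shows "abs_nabla_pow a (\<lambda>x. of_real (bump_field b l x)) x
    = of_real (l powr (1 - a)) * abs_nabla_pow a (\<lambda>x. of_real (bump_field b 1 x)) ((1 / l) *\<^sub>R x)"
proof -
  let ?g = "\<lambda>x. complex_of_real (bump_field b 1 x)"
  have *: "abs_nabla_pow a (\<lambda>x. c * h x) x = c * abs_nabla_pow a h x" for c and h :: "'a \<Rightarrow> complex"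
  proof -
    have "fourier (\<lambda>x. c * h x) \<xi> = c * fourier h \<xi>" for \<xi>
      unfolding fourier_cis mult.assoc by (rule integral_mult_right_zero)
    then show ?thesis
      unfolding abs_nabla_pow_symbol inverse_fourier_def abs_nabla_symbol_def
      by (subst integral_mult_right_zero[symmetric]) (simp add: mult_ac)
  qed
  have "(\<lambda>x. complex_of_real (bump_field b l x)) = (\<lambda>x. of_real l * ?g ((1 / l) *\<^sub>R x))"
    by (simp add: bump_field_scale[OF l, of b])
  then have "abs_nabla_pow a (\<lambda>x. of_real (bump_field b l x)) x = of_real l * (of_real (l powr (- a)) * abs_nabla_pow a ?g ((1 / l) *\<^sub>R x))"
    by (simp only: * abs_nabla_pow_scale[OF l, where f="?g"])
  also have "\<dots> = of_real (l powr (1 - a)) * abs_nabla_pow a ?g ((1 / l) *\<^sub>R x)"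
    using l by (simp add: powr_diff powr_minus_divide)
  finally show ?thesis .
qed

subsection \<open>Mean oscillation of lacunary sums\<close>

lemma emeasure_lebesgue_ball: "emeasure lebesgue (ball c r) = emeasure lborel (ball c r)"
  by simp

text \<open>Replacing the average by an arbitrary constant costs a factor 2, because the average
  differs from that constant by at most the mean deviation.\<close>

lemma BMO_seminorm_le:
  fixes f :: "'a::euclidean_space \<Rightarrow> 'b::euclidean_space"
  assumes li: "\<And>c r. integrable lborel (\<lambda>x. indicator (ball c r) x *\<^sub>R f x)"
    and A: "\<And>c r. r > 0 \<Longrightarrow> \<exists>A. (\<integral>\<^sup>+x\<in>ball c r. ennreal (norm (f x - A)) \<partial>lborel) \<le> ennreal B * emeasure lborel (ball c r)"
    and m: "f \<in> borel_measurable borel" and B: "B \<ge> 0"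
  shows "BMO_seminorm f \<le> ennreal (2 * B)"
  unfolding BMO_seminorm_def
proof (intro SUP_least)
  fix c :: 'a and r :: real assume "r \<in> {0<..}"
  then have r: "r > 0" by simp
  let ?b = "ball c r"
  define V where "V = measure lborel ?b"
  have V: "V > 0" unfolding V_def using r content_ball_pos[of r c] by simp
  have eV: "emeasure lborel ?b = ennreal V"
    unfolding V_def by (rule emeasure_eq_ennreal_measure) (use emeasure_lborel_ball_finite[of c r] in auto)
  obtain A where A: "(\<integral>\<^sup>+x\<in>?b. ennreal (norm (f x - A)) \<partial>lborel) \<le> ennreal B * ennreal V"
    using A[OF r, of c] eV by auto
  have [measurable]: "f \<in> borel_measurable borel" by (rule m)
  define a where "a = ball_average f c r"
  have bi: "integrable lborel (\<lambda>x. indicator ?b x :: real)"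
    by (intro integrable_real_indicator) (auto simp: emeasure_lborel_ball_finite)
  have ifA: "integrable lborel (\<lambda>x. indicator ?b x *\<^sub>R (f x - A))"
    using li[of c r] integrable_scaleR_left[OF bi, of A] by (simp add: scaleR_diff_right)
  have aA: "a - A = (1 / V) *\<^sub>R (\<integral>x. indicator ?b x *\<^sub>R (f x - A) \<partial>lborel)"
  proof -
    have "(\<integral>x. indicator ?b x *\<^sub>R (f x - A) \<partial>lborel) = (\<integral>x. indicator ?b x *\<^sub>R f x \<partial>lborel) - V *\<^sub>R A"
      using li[of c r] bi unfolding scaleR_diff_right
      by (subst Bochner_Integration.integral_diff) (auto simp: V_def intro: integrable_scaleR_left)
    moreover have "a = (1 / V) *\<^sub>R (\<integral>x. indicator ?b x *\<^sub>R f x \<partial>lborel)"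
      unfolding a_def ball_average_def set_lebesgue_integral_def V_def
      by (subst integral_completion) (use borel_measurable_integrable[OF li[of c r]] in auto)
    ultimately show ?thesis using V by (simp add: scaleR_diff_right)
  qed
  have "ennreal (norm (a - A)) * ennreal V \<le> (\<integral>\<^sup>+x\<in>?b. ennreal (norm (f x - A)) \<partial>lborel)"
  proof -
    have "norm (a - A) * V = norm (\<integral>x. indicator ?b x *\<^sub>R (f x - A) \<partial>lborel)"
      unfolding aA using V by simp
    also have "ennreal \<dots> \<le> (\<integral>\<^sup>+x. norm (indicator ?b x *\<^sub>R (f x - A)) \<partial>lborel)"
      by (rule integral_norm_bound_ennreal[OF ifA])
    also have "\<dots> = (\<integral>\<^sup>+x\<in>?b. ennreal (norm (f x - A)) \<partial>lborel)"
      by (intro nn_integral_cong) (auto simp: indicator_def)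
    finally show ?thesis using V by (simp add: ennreal_mult)
  qed
  then have aA': "ennreal (norm (a - A)) * ennreal V \<le> ennreal B * ennreal V" using A by (rule order_trans)
  have "(\<integral>\<^sup>+x\<in>?b. ennreal (norm (f x - a)) \<partial>lebesgue) = (\<integral>\<^sup>+x\<in>?b. ennreal (norm (f x - a)) \<partial>lborel)"
    by (rule nn_integral_completion)
  also have "\<dots> \<le> (\<integral>\<^sup>+x. ennreal (norm (f x - A)) * indicator ?b x + ennreal (norm (a - A)) * indicator ?b x \<partial>lborel)"
  proof (rule nn_integral_mono)
    fix x
    have "norm (f x - a) \<le> norm (f x - A) + norm (a - A)"
      using norm_triangle_ineq4[of "f x - A" "a - A"] by simp
    then show "ennreal (norm (f x - a)) * indicator ?b x \<le> ennreal (norm (f x - A)) * indicator ?b x + ennreal (norm (a - A)) * indicator ?b x"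
      by (auto simp: indicator_def ennreal_plus[symmetric] simp del: ennreal_plus intro: ennreal_leI)
  qed
  also have "\<dots> = (\<integral>\<^sup>+x\<in>?b. ennreal (norm (f x - A)) \<partial>lborel) + ennreal (norm (a - A)) * ennreal V"
    by (subst nn_integral_add) (auto simp: nn_integral_cmult_indicator eV)
  also have "\<dots> \<le> ennreal B * ennreal V + ennreal B * ennreal V"
    by (intro add_mono A aA')
  also have "\<dots> = ennreal (2 * B) * ennreal V"
    using B V by (simp add: ennreal_mult[symmetric] ennreal_plus[symmetric] del: ennreal_plus)
  finally show "(\<integral>\<^sup>+x\<in>?b. ennreal (norm (f x - ball_average f c r)) \<partial>lebesgue) / emeasure lebesgue ?b \<le> ennreal (2 * B)"
    using V unfolding a_def emeasure_lebesgue_ball eV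
    by (intro divide_le_posI_ennreal) (auto simp: mult.commute)
qed

text \<open>Both sums are dominated by geometric series: the scales below r by their largest member,
  the reciprocals of the scales above r by the first.\<close>

lemma lacunary_sum_le:
  fixes sc :: "nat \<Rightarrow> real"
  assumes pos: "\<And>k. k < K \<Longrightarrow> sc k > 0" and lac: "\<And>k. Suc k < K \<Longrightarrow> 2 * sc k \<le> sc (Suc k)"
  shows "(\<Sum>k | k < K \<and> sc k < r. sc k) \<le> 2 * max r 0" and "(\<Sum>k | k < K \<and> r \<le> sc k. max r 0 / sc k) \<le> 2"
proof -
  show "(\<Sum>k | k < K \<and> sc k < r. sc k) \<le> 2 * max r 0"
    using assms
  proof (induction K arbitrary: r)
    case (Suc K)
    show ?case
    proof (cases "sc K < r")
      case False
      then have "{k. k < Suc K \<and> sc k < r} = {k. k < K \<and> sc k < r}" by (auto simp: less_Suc_eq)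
      then show ?thesis using Suc by simp
    next
      case True
      have pK: "sc K > 0" using Suc.prems(1) by simp
      have all: "2 * sc k \<le> sc K" if "k < K" for k
      proof -
        have "Suc k \<le> K" using that by simp
        then have "sc (Suc k) \<le> sc K"
        proof (induction rule: inc_induct)
          case (step n)
          have "sc n \<le> 2 * sc n" using Suc.prems(1)[of n] step by simp
          also have "\<dots> \<le> sc (Suc n)" using Suc.prems(2)[of n] step by simp
          finally show ?case using step by simp
        qed simp
        then show ?thesis using Suc.prems(2)[of k] that by simp
      qed
      have "{k. k < Suc K \<and> sc k < r} = insert K {k. k < K \<and> sc k \<le> sc K / 2}"
      proof -
        have "k < K \<Longrightarrow> sc k < r" for k using all[of k] True Suc.prems(1)[of k] by simp
        moreover have "k < K \<Longrightarrow> sc k \<le> sc K / 2" for k using all[of k] by simp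
        ultimately show ?thesis using True by (auto simp: less_Suc_eq)
      qed
      moreover have "(\<Sum>k | k < K \<and> sc k \<le> sc K / 2. sc k) \<le> sc K"
      proof -
        have fin: "finite {k. k < K \<and> sc k \<le> sc K / 2}" by simp
        have "(\<Sum>k | k < K \<and> sc k \<le> sc K / 2. sc k) \<le> sc K"
        \<comment> \<open>The induction hypothesis has a strict threshold, so it is applied slightly
          above half of the top scale and the excess e is let go to 0.\<close>
        proof (rule field_le_epsilon)
          fix e :: real assume e: "e > 0"
          have "{k. k < K \<and> sc k \<le> sc K / 2} = {k. k < K \<and> sc k < sc K / 2 + e / 2}"
            using all e by (auto intro: order_le_less_trans simp: field_simps)
          then have "(\<Sum>k | k < K \<and> sc k \<le> sc K / 2. sc k) \<le> 2 * max (sc K / 2 + e / 2) 0"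
            using Suc.IH[of "sc K / 2 + e / 2"] Suc.prems by simp
          then show "(\<Sum>k | k < K \<and> sc k \<le> sc K / 2. sc k) \<le> sc K + e" using e pK by (simp add: max_def)
        qed
        then show ?thesis .
      qed
      ultimately show ?thesis using True pK by simp
    qed
  qed simp
next
  show "(\<Sum>k | k < K \<and> r \<le> sc k. max r 0 / sc k) \<le> 2"
  proof (cases "r > 0")
    case r: True
    \<comment> \<open>Strengthened for the induction: the margin r / sc (K - 1) pays for the next,
      at least doubled, scale. The second alternative covers empty sums, in particular K =
      0.\<close>
    have "(\<Sum>k | k < K \<and> r \<le> sc k. r / sc k) \<le> 2 - r / sc (K - 1) \<or> {k. k < K \<and> r \<le> sc k} = {}"
      using assms
    proof (induction K)
      case (Suc K)
      have eq: "{k. k < Suc K \<and> r \<le> sc k} = (if r \<le> sc K then insert K {k. k < K \<and> r \<le> sc k} else {k. k < K \<and> r \<le> sc k})"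
        by (auto simp: less_Suc_eq)
      have IH: "(\<Sum>k | k < K \<and> r \<le> sc k. r / sc k) \<le> 2 - r / sc (K - 1) \<or> {k. k < K \<and> r \<le> sc k} = {}"
        using Suc by simp
      have pK: "sc K > 0" using Suc.prems(1) by simp
      show ?case
      proof (cases "{k. k < K \<and> r \<le> sc k} = {}")
        case True
        show ?thesis
        proof (cases "r \<le> sc K")
          case rK: True
          have "{k. k < Suc K \<and> r \<le> sc k} = {K}" unfolding eq True using rK by simp
          moreover have "r / sc K \<le> 1" using rK pK by simp
          ultimately show ?thesis by simp
        next
          case False
          then have "{k. k < Suc K \<and> r \<le> sc k} = {}" unfolding eq True by simp
          then show ?thesis by blast
        qed
      next
        case False
        then have K: "K > 0" by auto
        have l: "2 * sc (K - 1) \<le> sc K" using Suc.prems(2)[of "K - 1"] K by simp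
        have p: "sc (K - 1) > 0" using Suc.prems(1)[of "K - 1"] K by simp
        have "r / sc K \<le> r / (2 * sc (K - 1))" using l p r by (intro divide_left_mono) auto
        then have "2 * (r / sc K) \<le> r / sc (K - 1)" by simp
        moreover have "r / sc K > 0" using r pK by simp
        ultimately show ?thesis using IH False unfolding eq by (auto split: if_splits)
      qed
    qed simp
    moreover have "r / sc (K - 1) > 0 \<or> K = 0" using r pos[of "K - 1"] by (cases K) auto
    ultimately have "(\<Sum>k | k < K \<and> r \<le> sc k. r / sc k) \<le> 2 \<or> {k. k < K \<and> r \<le> sc k} = {}"
      by auto
    then have "(\<Sum>k | k < K \<and> r \<le> sc k. r / sc k) \<le> 2"
    proof
      assume e: "{k. k < K \<and> r \<le> sc k} = {}"
      show ?thesis unfolding e by simp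
    qed
    then show ?thesis using r by (simp add: max_def)
  qed (simp add: max_def)
qed

text \<open>On a ball of radius r, scales above r vary by at most C r / sc k, which sums
  geometrically. Scales below r are bounded functions with small supports, and their total mass is
  comparable to the volume of the ball. Neither estimate sees the number of scales.\<close>

lemma BMO_lacunary:
  fixes \<Theta> :: "'a::euclidean_space \<Rightarrow> 'b::euclidean_space"
  assumes lip: "\<And>x y. norm (\<Theta> x - \<Theta> y) \<le> C * norm (x - y)"
    and bd: "\<And>x. norm (\<Theta> x) \<le> C" and out: "\<And>x. norm x \<ge> R \<Longrightarrow> \<Theta> x = 0" and R: "R \<ge> 0" and C: "C \<ge> 0"
  shows "\<exists>B\<ge>0. \<forall>K sc. (\<forall>k<K. sc k > 0) \<longrightarrow> (\<forall>k. Suc k < K \<longrightarrow> 2 * sc k \<le> sc (Suc k)) \<longrightarrow>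
     BMO_seminorm (\<lambda>x. \<Sum>k<K. \<Theta> ((1 / sc k) *\<^sub>R x)) \<le> ennreal B"
proof (intro exI conjI allI impI)
  define d where "d = DIM('a)"
  let ?B = "2 * C + 2 * C * R ^ d"
  show "0 \<le> 2 * ?B" using C R by simp
  fix K and sc :: "nat \<Rightarrow> real"
  assume pos: "\<forall>k<K. sc k > 0" and lac: "\<forall>k. Suc k < K \<longrightarrow> 2 * sc k \<le> sc (Suc k)"
  let ?f = "\<lambda>x. \<Sum>k<K. \<Theta> ((1 / sc k) *\<^sub>R x)"
  have contT: "continuous_on UNIV \<Theta>"
  proof (rule continuous_onI)
    fix x :: 'a and e :: real assume e: "e > 0"
    show "\<exists>d>0. \<forall>x'\<in>UNIV. dist x' x < d \<longrightarrow> dist (\<Theta> x') (\<Theta> x) \<le> e"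
    proof (intro exI[of _ "e / (C + 1)"] conjI ballI impI)
      show "0 < e / (C + 1)" using e C by simp
      fix x' assume "dist x' x < e / (C + 1)"
      then have "(C + 1) * norm (x' - x) \<le> e" using C by (simp add: dist_norm field_simps)
      moreover have "C * norm (x' - x) \<le> (C + 1) * norm (x' - x)" by (intro mult_right_mono) auto
      ultimately show "dist (\<Theta> x') (\<Theta> x) \<le> e" using lip[of x' x] by (simp add: dist_norm)
    qed
  qed
  have cont: "continuous_on UNIV ?f"
    by (intro continuous_intros continuous_on_compose2[OF contT]) auto
  have m: "?f \<in> borel_measurable borel" by (rule borel_measurable_continuous_onI[OF cont])
  have Tm[measurable]: "\<Theta> \<in> borel_measurable borel" by (rule borel_measurable_continuous_onI[OF contT])
  show "BMO_seminorm ?f \<le> ennreal (2 * ?B)"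
  proof (rule BMO_seminorm_le[OF _ _ m])
    show "integrable lborel (\<lambda>x. indicator (ball c r) x *\<^sub>R ?f x)" for c :: 'a and r
    proof -
      have "integrable lborel (\<lambda>x. indicator (ball c r) x * (real K * C))"
        by (intro integrable_mult_left integrable_real_indicator) (auto simp: emeasure_lborel_ball_finite)
      moreover have "norm (?f x) \<le> real K * C" for x
        using sum_norm_le[of "{..<K}" "\<lambda>k. \<Theta> ((1 / sc k) *\<^sub>R x)" "\<lambda>_. C"] bd by simp
      ultimately show ?thesis
        using m by (elim Bochner_Integration.integrable_bound) (auto simp: indicator_def intro: order_trans[OF _ abs_ge_self])
    qed
    fix c :: 'a and r :: real assume r: "r > 0"
    let ?big = "{k. k < K \<and> r \<le> sc k}" and ?small = "{k. k < K \<and> sc k < r}"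
    \<comment> \<open>The comparison constant: the coarse scales frozen at the centre of the
      ball.\<close>
    define A where "A = (\<Sum>k\<in>?big. \<Theta> ((1 / sc k) *\<^sub>R c))"
    have split: "{..<K} = ?big \<union> ?small" by auto
    have bound: "norm (?f x - A) \<le> 2 * C + (\<Sum>k\<in>?small. C * indicator (ball 0 (R * sc k)) x)" if x: "x \<in> ball c r" for x
    proof -
      have "?f x - A = (\<Sum>k\<in>?big. \<Theta> ((1 / sc k) *\<^sub>R x) - \<Theta> ((1 / sc k) *\<^sub>R c)) + (\<Sum>k\<in>?small. \<Theta> ((1 / sc k) *\<^sub>R x))"
        unfolding split A_def sum_subtractf by (subst sum.union_disjoint) auto
      then have tri: "norm (?f x - A) \<le> norm (\<Sum>k\<in>?big. \<Theta> ((1 / sc k) *\<^sub>R x) - \<Theta> ((1 / sc k) *\<^sub>R c)) + norm (\<Sum>k\<in>?small. \<Theta> ((1 / sc k) *\<^sub>R x))"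
        by (simp only: norm_triangle_ineq)
      have "norm (\<Sum>k\<in>?big. \<Theta> ((1 / sc k) *\<^sub>R x) - \<Theta> ((1 / sc k) *\<^sub>R c)) \<le> (\<Sum>k\<in>?big. C * (max r 0 / sc k))"
      proof (rule sum_norm_le)
        fix k assume k: "k \<in> ?big"
        then have lk: "sc k > 0" using pos by simp
        have "norm ((1 / sc k) *\<^sub>R x - (1 / sc k) *\<^sub>R c) = norm (c - x) / sc k"
          using lk by (simp add: scaleR_diff_right[symmetric] norm_minus_commute)
        also have "\<dots> \<le> max r 0 / sc k"
          using lk x r by (intro divide_right_mono) (auto simp: dist_norm)
        finally have "C * norm ((1 / sc k) *\<^sub>R x - (1 / sc k) *\<^sub>R c) \<le> C * (max r 0 / sc k)"
          using C by (intro mult_left_mono)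
        with lip show "norm (\<Theta> ((1 / sc k) *\<^sub>R x) - \<Theta> ((1 / sc k) *\<^sub>R c)) \<le> C * (max r 0 / sc k)"
          by (rule order_trans)
      qed
      also have "\<dots> = C * (\<Sum>k\<in>?big. max r 0 / sc k)" by (simp only: sum_distrib_left)
      also have "\<dots> \<le> C * 2"
        using C lacunary_sum_le(2)[of K sc r] pos lac by (intro mult_left_mono) auto
      finally have big: "norm (\<Sum>k\<in>?big. \<Theta> ((1 / sc k) *\<^sub>R x) - \<Theta> ((1 / sc k) *\<^sub>R c)) \<le> C * 2" .
      have "norm (\<Sum>k\<in>?small. \<Theta> ((1 / sc k) *\<^sub>R x)) \<le> (\<Sum>k\<in>?small. C * indicator (ball 0 (R * sc k)) x)"
      proof (rule sum_norm_le)
        fix k assume k: "k \<in> ?small"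
        then have lk: "sc k > 0" using pos by simp
        show "norm (\<Theta> ((1 / sc k) *\<^sub>R x)) \<le> C * indicator (ball 0 (R * sc k)) x"
        proof (cases "norm x < R * sc k")
          case True then show ?thesis using bd by (simp add: indicator_def)
        next
          case False
          then have "norm ((1 / sc k) *\<^sub>R x) \<ge> R" using lk by (simp add: field_simps)
          then show ?thesis using out C by simp
        qed
      qed
      with tri big show ?thesis by linarith
    qed
    show "\<exists>A. (\<integral>\<^sup>+x\<in>ball c r. ennreal (norm (?f x - A)) \<partial>lborel) \<le> ennreal ?B * emeasure lborel (ball c r)"
    proof (rule exI[of _ A])
      define w where "w = unit_ball_vol (real d)"
      have w: "w \<ge> 0" by (simp add: w_def)
      have vol: "emeasure lborel (ball y t) = ennreal (w * t ^ d)" if "t \<ge> 0" for y :: 'a and t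
        using that unfolding w_def d_def by (intro emeasure_ball)
      \<comment> \<open>All but one factor of (sc k)^d are estimated by r, so that the lacunary
        bound for first powers applies in every dimension.\<close>
      have "(\<Sum>k\<in>?small. C * (w * (R * sc k) ^ d)) \<le> (\<Sum>k\<in>?small. C * w * R ^ d * r ^ (d - 1) * sc k)"
      proof (rule sum_mono)
        fix k assume k: "k \<in> ?small"
        then have lk: "sc k > 0" using pos by simp
        have dd: "d = Suc (d - 1)" by (simp add: d_def)
        have "sc k ^ d = sc k ^ (d - 1) * sc k" by (subst dd) simp
        also have "\<dots> \<le> r ^ (d - 1) * sc k" using k lk by (intro mult_right_mono power_mono) auto
        finally have "C * w * R ^ d * sc k ^ d \<le> C * w * R ^ d * (r ^ (d - 1) * sc k)"
          using C w R by (intro mult_left_mono) auto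
        then show "C * (w * (R * sc k) ^ d) \<le> C * w * R ^ d * r ^ (d - 1) * sc k" by (simp add: power_mult_distrib mult_ac)
      qed
      also have "(\<Sum>k\<in>?small. C * w * R ^ d * r ^ (d - 1) * sc k) = C * w * R ^ d * r ^ (d - 1) * (\<Sum>k\<in>?small. sc k)"
        by (simp only: sum_distrib_left)
      also have "\<dots> \<le> C * w * R ^ d * r ^ (d - 1) * (2 * max r 0)"
        using C w R r pos lac lacunary_sum_le(1)[of K sc r] by (intro mult_left_mono) auto
      also have "\<dots> = 2 * C * R ^ d * (w * r ^ d)"
      proof -
        have "r ^ d = r ^ (d - 1) * r" using power_minus_mult[of d r] by (simp add: d_def)
        then show ?thesis using r by simp
      qed
      finally have small: "(\<Sum>k\<in>?small. C * (w * (R * sc k) ^ d)) \<le> 2 * C * R ^ d * (w * r ^ d)" .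
      have "(\<integral>\<^sup>+x\<in>ball c r. ennreal (norm (?f x - A)) \<partial>lborel)
        \<le> (\<integral>\<^sup>+x. ennreal (2 * C) * indicator (ball c r) x + (\<Sum>k\<in>?small. ennreal C * indicator (ball 0 (R * sc k)) x) \<partial>lborel)"
      proof (rule nn_integral_mono)
        fix x :: 'a
        show "ennreal (norm (?f x - A)) * indicator (ball c r) x \<le> ennreal (2 * C) * indicator (ball c r) x + (\<Sum>k\<in>?small. ennreal C * indicator (ball 0 (R * sc k)) x)"
        proof (cases "x \<in> ball c r")
          case True
          have "ennreal (norm (?f x - A)) \<le> ennreal (2 * C + (\<Sum>k\<in>?small. C * indicator (ball 0 (R * sc k)) x))"
            by (rule ennreal_leI[OF bound[OF True]])
          also have "\<dots> = ennreal (2 * C) + ennreal (\<Sum>k\<in>?small. C * indicator (ball 0 (R * sc k)) x)"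
            using C by (intro ennreal_plus) (auto intro!: sum_nonneg)
          also have "ennreal (\<Sum>k\<in>?small. C * indicator (ball 0 (R * sc k)) x) = (\<Sum>k\<in>?small. ennreal (C * indicator (ball 0 (R * sc k)) x))"
            using C by (intro sum_ennreal[symmetric]) auto
          also have "\<dots> = (\<Sum>k\<in>?small. ennreal C * indicator (ball 0 (R * sc k)) x)"
            by (intro sum.cong) (auto simp: indicator_def)
          finally show ?thesis using True by (simp add: indicator_def)
        qed simp
      qed
      also have "\<dots> = ennreal (2 * C) * emeasure lborel (ball c r) + (\<Sum>k\<in>?small. ennreal C * emeasure lborel (ball (0::'a) (R * sc k)))"
        by (subst nn_integral_add, simp, simp, subst nn_integral_sum) (auto simp: nn_integral_cmult_indicator)
      also have "\<dots> = ennreal (2 * C * (w * r ^ d)) + (\<Sum>k\<in>?small. ennreal (C * (w * (R * sc k) ^ d)))"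
        using r R pos C w by (subst vol, simp, intro arg_cong2[where f="(+)"] sum.cong)
          (auto simp: vol ennreal_mult)
      also have "(\<Sum>k\<in>?small. ennreal (C * (w * (R * sc k) ^ d))) = ennreal (\<Sum>k\<in>?small. C * (w * (R * sc k) ^ d))"
        using C w R pos by (intro sum_ennreal) (auto intro!: mult_nonneg_nonneg zero_le_power simp: less_imp_le)
      also have "ennreal (2 * C * (w * r ^ d)) + ennreal (\<Sum>k\<in>?small. C * (w * (R * sc k) ^ d)) \<le> ennreal (2 * C * (w * r ^ d)) + ennreal (2 * C * R ^ d * (w * r ^ d))"
        by (intro add_left_mono ennreal_leI small)
      also have "ennreal (2 * C * (w * r ^ d)) + ennreal (2 * C * R ^ d * (w * r ^ d)) = ennreal ?B * emeasure lborel (ball c r)"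
        using r w C R by (simp add: vol ennreal_mult[symmetric] ennreal_plus[symmetric] algebra_simps del: ennreal_plus)
      finally show "(\<integral>\<^sup>+x\<in>ball c r. ennreal (norm (?f x - A)) \<partial>lborel) \<le> ennreal ?B * emeasure lborel (ball c r)" .
    qed
  qed (use C R in simp)
qed

text \<open>Vanishing oscillation on one ball that contains x0 and reaches beyond the support would
  make f constant there, hence 0.\<close>

lemma BMO_seminorm_pos:
  fixes f :: "'a::euclidean_space \<Rightarrow> 'b::euclidean_space"
  assumes c: "continuous_on UNIV f" and out: "\<And>x. norm x \<ge> R \<Longrightarrow> f x = 0" and nz: "f x0 \<noteq> 0"
  shows "0 < BMO_seminorm f"
proof (rule ccontr)
  assume "\<not> 0 < BMO_seminorm f"
  then have z: "BMO_seminorm f = 0" by (simp add: zero_less_iff_neq_zero)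
  define r where "r = \<bar>R\<bar> + norm x0 + 2"
  have r: "r > 0" by (simp add: r_def add_nonneg_pos)
  define a where "a = ball_average f 0 r"
  let ?b = "ball (0::'a) r"
  have [measurable]: "f \<in> borel_measurable borel" by (rule borel_measurable_continuous_onI[OF c])
  have "(\<integral>\<^sup>+x\<in>?b. ennreal (norm (f x - a)) \<partial>lebesgue) / emeasure lebesgue ?b \<le> BMO_seminorm f"
    unfolding BMO_seminorm_def a_def using r by (intro SUP_upper2[of 0] SUP_upper2[of r]) auto
  then have "(\<integral>\<^sup>+x\<in>?b. ennreal (norm (f x - a)) \<partial>lebesgue) = 0"
    using z emeasure_lborel_ball_finite[of "0::'a" r] by (auto simp: ennreal_divide_eq_0_iff)
  then have "(\<integral>\<^sup>+x\<in>?b. ennreal (norm (f x - a)) \<partial>lborel) = 0" by (simp only: nn_integral_completion)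
  moreover have "(\<integral>\<^sup>+x\<in>?b. ennreal (norm (f x - a)) \<partial>lborel) = (\<integral>\<^sup>+x. ennreal (indicator ?b x * norm (f x - a)) \<partial>lborel)"
    by (intro nn_integral_cong) (auto simp: indicator_def)
  ultimately have "(\<integral>\<^sup>+x. ennreal (indicator ?b x * norm (f x - a)) \<partial>lborel) = 0" by (simp only:)
  then have "AE x in lborel. ennreal (indicator ?b x * norm (f x - a)) = 0"
    by (subst nn_integral_0_iff_AE[symmetric]) auto
  then have ae: "AE x in lborel. \<not> (x \<in> ?b \<and> f x \<noteq> a)"
    by eventually_elim (auto simp: indicator_def ennreal_eq_0_iff)
  have op: "open {x. x \<in> ?b \<and> f x \<noteq> a}"
  proof -
    have "{x. x \<in> ?b \<and> f x \<noteq> a} = ?b \<inter> f -` (- {a})" by auto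
    moreover have "open (f -` (- {a}))" using c by (intro open_vimage) auto
    ultimately show ?thesis by auto
  qed
  have "{x. x \<in> ?b \<and> f x \<noteq> a} \<in> null_sets lborel"
    using ae op by (subst (asm) AE_iff_null) auto
  then have "negligible {x. x \<in> ?b \<and> f x \<noteq> a}" by (simp add: negligible_iff_null_sets null_sets_completionI)
  then have e: "{x. x \<in> ?b \<and> f x \<noteq> a} = {}" using open_not_negligible[OF op] by blast
  obtain b :: 'a where b: "b \<in> Basis" using nonempty_Basis by blast
  have e': "f x = a" if "norm x < r" for x using e that by auto
  have "f ((\<bar>R\<bar> + 1) *\<^sub>R b) = a" using b by (intro e') (simp add: r_def add_pos_nonneg)
  moreover have "f ((\<bar>R\<bar> + 1) *\<^sub>R b) = 0" using b by (intro out) simp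
  moreover have "f x0 = a" by (intro e') (simp add: r_def)
  ultimately show False using nz by simp
qed

subsection \<open>The bilinear form on the building blocks\<close>

text \<open>The factor 1/s and the logarithm at s = 0 are normalised so that one formula holds for
  every s.\<close>

lemma grad_riesz_pot:
  fixes x :: "'a::euclidean_space"
  assumes x: "x \<noteq> 0"
  shows "grad (riesz_pot s) x = - (norm x powr (- s - 2)) *\<^sub>R x"
proof -
  have nx: "norm x > 0" using x by simp
  have G: "GDERIV (riesz_pot s) x :> - (norm x powr (- s - 2)) *\<^sub>R x"
  proof (cases "s = 0")
    case True
    have "((\<lambda>t. - ln t) has_real_derivative - (1 / norm x)) (at (norm x))"
      using nx by (auto intro!: derivative_eq_intros)
    from GDERIV_DERIV_compose[OF GDERIV_norm[OF x] this]
    have "GDERIV (\<lambda>x. - ln (norm x)) x :> - (1 / norm x) *\<^sub>R sgn x" .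
    moreover have "- (1 / norm x) *\<^sub>R sgn x = - (norm x powr (- s - 2)) *\<^sub>R x"
      using nx True by (simp add: sgn_div_norm powr_minus_divide powr_numeral power2_eq_square divide_inverse)
    moreover have "riesz_pot s = (\<lambda>x::'a. - ln (norm x))" using True by (simp add: riesz_pot_def fun_eq_iff)
    ultimately show ?thesis by simp
  next
    case False
    have "((\<lambda>t. (1 / s) * t powr (- s)) has_real_derivative - (norm x powr (- s - 1))) (at (norm x))"
      using nx False by (auto intro!: derivative_eq_intros has_real_derivative_powr)
    from GDERIV_DERIV_compose[OF GDERIV_norm[OF x] this]
    have "GDERIV (\<lambda>x. (1 / s) * norm x powr (- s)) x :> - (norm x powr (- s - 1)) *\<^sub>R sgn x" .
    moreover have "- (norm x powr (- s - 1)) *\<^sub>R sgn x = - (norm x powr (- s - 2)) *\<^sub>R x"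
    proof -
      have e: "- s - 2 = (- s - 1) + (- 1)" by simp
      have "norm x powr (- s - 2) = norm x powr (- s - 1) * norm x powr (- 1)"
        unfolding e by (rule powr_add)
      also have "norm x powr (- 1) = inverse (norm x)" using nx by (simp add: powr_minus)
      finally show ?thesis by (simp add: sgn_div_norm)
    qed
    moreover have "riesz_pot s = (\<lambda>x::'a. (1 / s) * norm x powr (- s))" using False by (simp add: riesz_pot_def fun_eq_iff)
    ultimately show ?thesis by simp
  qed
  show ?thesis
    unfolding grad_def
  proof (rule the_equality[where P="\<lambda>D. GDERIV (riesz_pot s) x :> D", OF G])
    fix D assume "GDERIV (riesz_pot s) x :> D"
    with G have "(\<lambda>h. h \<bullet> (- (norm x powr (- s - 2)) *\<^sub>R x)) = (\<lambda>h. h \<bullet> D)"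
      unfolding gderiv_def by (rule has_derivative_unique)
    then show "D = - (norm x powr (- s - 2)) *\<^sub>R x"
      by (metis inner_commute vector_eq_rdot)
  qed
qed

section \<open>Reflection in a coordinate hyperplane\<close>

definition reflection :: "'a::euclidean_space \<Rightarrow> 'a \<Rightarrow> 'a" where
  "reflection b x = x - (2 * (x \<bullet> b)) *\<^sub>R b"

lemma reflection_measurable [measurable]: "reflection b \<in> borel_measurable borel"
  unfolding reflection_def[abs_def] by measurable

lemma integral_reflection:
  fixes h :: "'a::euclidean_space \<Rightarrow> real"
  assumes b: "b \<in> Basis" and h[measurable]: "h \<in> borel_measurable borel"
  shows "(\<integral>x. h x \<partial>lborel) = (\<integral>x. h (reflection b x) \<partial>lborel)"
    and "integrable lborel h \<Longrightarrow> integrable lborel (\<lambda>x. h (reflection b x))"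
proof -
  let ?c = "\<lambda>j. if j = b then -1 else (1::real)"
  have T: "0 + (\<Sum>j\<in>Basis. (?c j * (x \<bullet> j)) *\<^sub>R j) = reflection b x" for x
  proof (rule euclidean_eqI)
    fix i :: 'a assume i: "i \<in> Basis"
    show "(0 + (\<Sum>j\<in>Basis. (?c j * (x \<bullet> j)) *\<^sub>R j)) \<bullet> i = reflection b x \<bullet> i"
      using i b by (simp add: reflection_def inner_diff_left inner_Basis)
  qed
  have "(\<Prod>j\<in>(Basis::'a set). \<bar>?c j\<bar>) = 1" by (intro prod.neutral) auto
  then have eq: "lborel = distr lborel borel (reflection b)"
    using lborel_affine_euclidean[of ?c 0] unfolding T by (simp add: density_1)
  show "(\<integral>x. h x \<partial>lborel) = (\<integral>x. h (reflection b x) \<partial>lborel)"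
    by (subst eq, subst integral_distr) auto
  show "integrable lborel (\<lambda>x. h (reflection b x))" if "integrable lborel h"
    using that by (subst (asm) eq, subst (asm) integrable_distr_eq) auto
qed

text \<open>Two points on the same side of the hyperplane move apart when one of them is reflected;
  this is the source of all signs below.\<close>

lemma norm_reflection_diff:
  assumes b: "b \<in> Basis"
  shows "(norm (x - reflection b y))\<^sup>2 = (norm (x - y))\<^sup>2 + 4 * (x \<bullet> b) * (y \<bullet> b)"
proof -
  have bb: "b \<bullet> b = 1" using b by (simp add: inner_Basis)
  show ?thesis
    unfolding reflection_def power2_norm_eq_inner
    by (simp add: inner_diff_left inner_diff_right inner_commute bb algebra_simps)
qed

lemma powr_local_integrable:
  fixes g R :: real
  assumes g: "g > - real DIM('a::euclidean_space)"
  shows "integrable lborel (\<lambda>x::'a. indicator (ball 0 R) x * norm x powr g)"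
proof (rule integrable_power_bounds[where g=g and h="- real DIM('a) - 1" and C="max 1 (R powr (g + real DIM('a) + 1))"])
  show "norm (indicator (ball 0 R) x * norm x powr g) \<le> max 1 (R powr (g + real DIM('a) + 1)) * norm x powr g" for x :: 'a
    using mult_right_mono[of 1 "max 1 (R powr (g + real DIM('a) + 1))" "norm x powr g"]
    by (auto simp: indicator_def)
  show "norm (indicator (ball 0 R) x * norm x powr g) \<le> max 1 (R powr (g + real DIM('a) + 1)) * norm x powr (- real DIM('a) - 1)" if "norm x \<ge> 1" for x :: 'a
  proof (cases "norm x < R")
    case True
    have "norm x powr g = norm x powr (g + real DIM('a) + 1) * norm x powr (- real DIM('a) - 1)"
      by (subst powr_add[symmetric]) simp
    also have "\<dots> \<le> R powr (g + real DIM('a) + 1) * norm x powr (- real DIM('a) - 1)"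
      using True g by (intro mult_right_mono powr_mono2) auto
    also have "\<dots> \<le> max 1 (R powr (g + real DIM('a) + 1)) * norm x powr (- real DIM('a) - 1)"
      by (intro mult_right_mono) auto
    finally show ?thesis using True by (simp add: indicator_def)
  qed (simp add: indicator_def)
qed (use g in auto)

text \<open>As f lives in the unit ball only |x - y| < 2 matters, where the power -s is integrable
  because s < d.\<close>

lemma riesz_kernel_integrable:
  fixes s :: real and f :: "'a::euclidean_space \<Rightarrow> real"
  assumes s: "s < real DIM('a)" and fm: "f \<in> borel_measurable borel"
    and out: "\<And>x. norm x \<ge> 1 \<Longrightarrow> f x = 0" and bd: "\<And>x. \<bar>f x\<bar> \<le> B"
  shows "integrable (lborel \<Otimes>\<^sub>M lborel) (\<lambda>p. norm (fst p - snd p) powr (- s) * \<bar>f (fst p)\<bar> * \<bar>f (snd p)\<bar>)"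
proof (rule lborel_pair.Fubini_integrable)
  have [measurable]: "f \<in> borel_measurable borel" by (rule fm)
  let ?k = "\<lambda>z::'a. indicator (ball 0 2) z * norm z powr (- s)"
  have k: "integrable lborel ?k" by (rule powr_local_integrable) (use s in simp)
  have kx: "integrable lborel (\<lambda>y. ?k (x - y))" for x
    using lborel_integral_affine(2)[of "-1" ?k x] k by simp
  have kxi: "(\<integral>y. ?k (x - y) \<partial>lborel) = (\<integral>y. ?k y \<partial>lborel)" for x
    using lborel_integral_affine(1)[of "-1" ?k x] by simp
  have B0: "B \<ge> 0" using bd[of 0] by linarith
  let ?F = "\<lambda>x y. norm (x - y) powr (- s) * \<bar>f x\<bar> * \<bar>f y\<bar>"
  have le: "?F x y \<le> B * \<bar>f x\<bar> * ?k (x - y)" for x y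
  proof (cases "norm x < 1 \<and> norm y < 1")
    case True
    then have "norm (x - y) < 2" using norm_triangle_ineq4[of x y] by simp
    moreover have "\<bar>f x\<bar> * \<bar>f y\<bar> \<le> \<bar>f x\<bar> * B" using bd by (intro mult_left_mono) auto
    then have t: "norm (x - y) powr (- s) * (\<bar>f x\<bar> * \<bar>f y\<bar>) \<le> norm (x - y) powr (- s) * (\<bar>f x\<bar> * B)"
      by (rule mult_left_mono) auto
    ultimately have "?k (x - y) = norm (x - y) powr (- s)" by (simp add: indicator_def)
    then show ?thesis using t by (simp only: mult_ac)
  next
    case False
    then have "f x = 0 \<or> f y = 0" using out by force
    then have "?F x y = 0" by auto
    moreover have "0 \<le> B * \<bar>f x\<bar> * ?k (x - y)" using B0 by (intro mult_nonneg_nonneg) auto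
    ultimately show ?thesis by (simp only:)
  qed
  show m: "(\<lambda>p. norm (fst p - snd p) powr (- s) * \<bar>f (fst p)\<bar> * \<bar>f (snd p)\<bar>) \<in> borel_measurable (lborel \<Otimes>\<^sub>M lborel)"
    by measurable
  have Fi: "integrable lborel (?F x)" for x
  proof (rule Bochner_Integration.integrable_bound)
    show "integrable lborel (\<lambda>y. B * \<bar>f x\<bar> * ?k (x - y))" using kx by (intro integrable_mult_right)
    show "AE y in lborel. norm (?F x y) \<le> norm (B * \<bar>f x\<bar> * ?k (x - y))"
      using le by (intro AE_I2) (auto intro: order_trans[OF _ abs_ge_self])
  qed measurable
  then show "AE x in lborel. integrable lborel (\<lambda>y. norm (fst (x, y) - snd (x, y)) powr (- s) * \<bar>f (fst (x, y))\<bar> * \<bar>f (snd (x, y))\<bar>)"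
    by simp
  show "integrable lborel (\<lambda>x. \<integral>y. norm (norm (fst (x, y) - snd (x, y)) powr (- s) * \<bar>f (fst (x, y))\<bar> * \<bar>f (snd (x, y))\<bar>) \<partial>lborel)"
  proof (rule Bochner_Integration.integrable_bound)
    have "integrable lborel (\<lambda>x::'a. indicator (ball 0 1) x * (B * B * (\<integral>y. ?k y \<partial>lborel)))"
      by (intro integrable_mult_left integrable_real_indicator) (auto simp: emeasure_lborel_ball_finite)
    then show "integrable lborel (\<lambda>x::'a. indicator (ball 0 1) x * (B * B * (\<integral>y. ?k y \<partial>lborel)))" .
    have kn: "(\<integral>y. ?k y \<partial>lborel) \<ge> 0" by (intro Bochner_Integration.integral_nonneg) auto
    show "AE x in lborel. norm (\<integral>y. norm (norm (fst (x, y) - snd (x, y)) powr (- s) * \<bar>f (fst (x, y))\<bar> * \<bar>f (snd (x, y))\<bar>) \<partial>lborel)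
      \<le> norm (indicator (ball 0 1) x * (B * B * (\<integral>y. ?k y \<partial>lborel)))"
    proof (rule AE_I2)
      fix x :: 'a
      have "(\<integral>y. ?F x y \<partial>lborel) \<le> (\<integral>y. B * \<bar>f x\<bar> * ?k (x - y) \<partial>lborel)"
        using kx by (intro integral_mono Fi le integrable_mult_right)
      also have "\<dots> = B * \<bar>f x\<bar> * (\<integral>y. ?k y \<partial>lborel)" by (simp only: integral_mult_right_zero kxi)
      also have "\<dots> \<le> indicator (ball 0 1) x * (B * B * (\<integral>y. ?k y \<partial>lborel))"
        using out[of x] bd[of x] B0 kn by (cases "norm x < 1") (auto simp: indicator_def intro!: mult_right_mono mult_left_mono)
      finally have 1: "(\<integral>y. ?F x y \<partial>lborel) \<le> indicator (ball 0 1) x * (B * B * (\<integral>y. ?k y \<partial>lborel))" .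
      have 2: "0 \<le> (\<integral>y. ?F x y \<partial>lborel)" by (intro Bochner_Integration.integral_nonneg) auto
      have 3: "(\<integral>y. norm (norm (fst (x, y) - snd (x, y)) powr (- s) * \<bar>f (fst (x, y))\<bar> * \<bar>f (snd (x, y))\<bar>) \<partial>lborel) = (\<integral>y. ?F x y \<partial>lborel)"
        by (simp add: abs_mult)
      show "norm (\<integral>y. norm (norm (fst (x, y) - snd (x, y)) powr (- s) * \<bar>f (fst (x, y))\<bar> * \<bar>f (snd (x, y))\<bar>) \<partial>lborel)
        \<le> norm (indicator (ball 0 1) x * (B * B * (\<integral>y. ?k y \<partial>lborel)))"
        unfolding 3
      proof -
        have "norm (\<integral>y. ?F x y \<partial>lborel) = (\<integral>y. ?F x y \<partial>lborel)" using 2 by simp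
        also note 1
        also have "indicator (ball 0 1) x * (B * B * (\<integral>y. ?k y \<partial>lborel)) \<le> norm (indicator (ball 0 1) x * (B * B * (\<integral>y. ?k y \<partial>lborel)))"
          unfolding real_norm_def by (rule abs_ge_self)
        finally show "norm (\<integral>y. ?F x y \<partial>lborel) \<le> norm (indicator (ball 0 1) x * (B * B * (\<integral>y. ?k y \<partial>lborel)))" .
      qed
    qed
  qed measurable
qed

lemma integral_pos_open:
  fixes h :: "'a::euclidean_space \<Rightarrow> real"
  assumes h: "integrable lborel h" and nn: "AE x in lborel. h x \<ge> 0"
    and U: "open U" "U \<noteq> {}" and pos: "\<And>x. x \<in> U \<Longrightarrow> h x > 0"
  shows "(\<integral>x. h x \<partial>lborel) > 0"
proof -
  have "(\<integral>x. h x \<partial>lborel) \<noteq> 0"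
  proof
    assume "(\<integral>x. h x \<partial>lborel) = 0"
    then have "AE x in lborel. h x = 0" using integral_nonneg_eq_0_iff_AE[OF h nn] by simp
    then have "AE x in lborel. x \<notin> U" by eventually_elim (use pos in force)
    then have "U \<in> null_sets lborel" using U by (subst AE_iff_null_sets) auto
    then have "negligible U" by (simp add: negligible_iff_null_sets null_sets_completionI)
    then show False using open_not_negligible[OF U] by blast
  qed
  moreover have "(\<integral>x. h x \<partial>lborel) \<ge> 0" using nn by (rule integral_nonneg_AE)
  ultimately show ?thesis by simp
qed

text \<open>Reflecting one variable turns the form into the integral of a function of one sign.\<close>

lemma reflection_positive_form:
  fixes Q :: "'a::euclidean_space \<Rightarrow> real" and \<sigma> :: real
  assumes b: "b \<in> Basis" "b' \<in> Basis"
    and Qm: "Q \<in> borel_measurable borel"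
    and Qi: "integrable (lborel \<Otimes>\<^sub>M lborel) (\<lambda>p. Q (fst p - snd p) * bump_field b' 1 (fst p) * bump_field b' 1 (snd p))"
    and Qx: "\<And>x. integrable lborel (\<lambda>y. Q (x - y) * bump_field b' 1 x * bump_field b' 1 y)"
    and mono: "\<And>x y. (x \<bullet> b') * (y \<bullet> b') > 0 \<Longrightarrow> x \<noteq> y \<Longrightarrow> \<sigma> * (Q (x - y) - Q (x - reflection b' y)) \<ge> 0"
    and strict: "\<And>x y. (x \<bullet> b') * (y \<bullet> b') > 0 \<Longrightarrow> (x - y) \<bullet> b \<noteq> 0 \<Longrightarrow> \<sigma> * (Q (x - y) - Q (x - reflection b' y)) > 0"
  shows "\<sigma> * (\<integral>p. Q (fst p - snd p) * bump_field b' 1 (fst p) * bump_field b' 1 (snd p) \<partial>(lborel \<Otimes>\<^sub>M lborel)) > 0"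
proof -
  let ?f = "bump_field b' 1"
  let ?R = "reflection b'"
  have [measurable]: "Q \<in> borel_measurable borel" by (rule Qm)
  have [measurable]: "?f \<in> borel_measurable borel" by (rule bump_measurable[OF bump_bump_field]) simp
  have bb: "b' \<bullet> b' = 1" using b by (simp add: inner_Basis)
  have Rb: "?R y \<bullet> b' = - (y \<bullet> b')" for y by (simp add: reflection_def inner_diff_left bb)
  have RR: "?R (?R y) = y" for y
    unfolding reflection_def[of b' "?R y"] Rb by (simp add: reflection_def)
  have nR: "norm (?R y) = norm y" for y
    using norm_reflection_diff[OF b(2), of 0 y] by simp
  have fR: "?f (?R y) = - ?f y" for y by (simp add: bump_field_def Rb nR)
  have fE: "\<exists>c\<ge>0. ?f y = c * (y \<bullet> b')" for y
    unfolding bump_field_def by (intro exI[of _ "exp_recip 0 (1 - (norm y)\<^sup>2 / 1\<^sup>2)"]) (auto simp: exp_recip_nonneg)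
  have fpos: "?f y > 0" if "norm y < 1" "y \<bullet> b' > 0" for y
  proof -
    have "(norm y)\<^sup>2 < 1" using that power_strict_mono[of "norm y" 1 2] by simp
    then show ?thesis using that by (simp add: bump_field_def exp_recip_def)
  qed
  \<comment> \<open>The bump is odd under the reflection, so averaging over y and its mirror image
    replaces Q (x - y) by half the difference with the reflected value.\<close>
  let ?D = "\<lambda>x y. (Q (x - y) - Q (x - ?R y)) * ?f x * ?f y"
  have nonneg: "\<sigma> * ?D x y \<ge> 0" if "y \<noteq> x" "y \<noteq> ?R x" for x y
  proof -
    obtain c c' where c: "c \<ge> 0" "c' \<ge> 0" "?f x = c * (x \<bullet> b')" "?f y = c' * (y \<bullet> b')" using fE by metis
    have eq: "\<sigma> * ?D x y = (c * c') * ((\<sigma> * (Q (x - y) - Q (x - ?R y))) * ((x \<bullet> b') * (y \<bullet> b')))"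
      by (simp add: c mult_ac)
    have "(\<sigma> * (Q (x - y) - Q (x - ?R y))) * ((x \<bullet> b') * (y \<bullet> b')) \<ge> 0"
    proof -
      consider "(x \<bullet> b') * (y \<bullet> b') > 0" | "(x \<bullet> b') * (y \<bullet> b') < 0" | "(x \<bullet> b') * (y \<bullet> b') = 0" by linarith
      then show ?thesis
      proof cases
        case 1 then show ?thesis using mono[OF 1] that by simp
      next
        \<comment> \<open>For points on opposite sides the monotonicity is applied to x and the
          mirror image of y, which reverses the sign of the difference along with that of the
          product.\<close>
        case 2
        have "x \<noteq> ?R y" using that RR[of y] by metis
        moreover have "(x \<bullet> b') * (?R y \<bullet> b') > 0" using 2 by (simp add: Rb)
        ultimately have "\<sigma> * (Q (x - ?R y) - Q (x - ?R (?R y))) \<ge> 0" by (intro mono)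
        then have "\<sigma> * (Q (x - y) - Q (x - ?R y)) \<le> 0" by (simp add: RR algebra_simps)
        then show ?thesis using 2 by (simp add: mult_nonpos_nonpos)
      next
        case 3
        show ?thesis by (simp only: 3 mult_zero_right order_refl)
      qed
    qed
    then show ?thesis unfolding eq using c by simp
  qed
  have Dx: "integrable lborel (\<lambda>y. \<sigma> * ?D x y)"
    and Phi: "2 * (\<sigma> * (\<integral>y. Q (x - y) * ?f x * ?f y \<partial>lborel)) = (\<integral>y. \<sigma> * ?D x y \<partial>lborel)" for x
  proof -
    have m: "(\<lambda>y. Q (x - y) * ?f x * ?f y) \<in> borel_measurable borel" by measurable
    have i2: "integrable lborel (\<lambda>y. - (Q (x - ?R y) * ?f x * ?f y))"
      using integral_reflection(2)[OF b(2) m Qx[of x]] by (simp add: fR)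
    have I: "(\<integral>y. Q (x - y) * ?f x * ?f y \<partial>lborel) = (\<integral>y. - (Q (x - ?R y) * ?f x * ?f y) \<partial>lborel)"
      using integral_reflection(1)[OF b(2) m] by (simp add: fR)
    have eq: "?D x y = Q (x - y) * ?f x * ?f y + - (Q (x - ?R y) * ?f x * ?f y)" for y
      by (simp add: algebra_simps)
    show "integrable lborel (\<lambda>y. \<sigma> * ?D x y)"
      unfolding eq by (intro integrable_mult_right Bochner_Integration.integrable_add Qx i2)
    have "(\<integral>y. \<sigma> * ?D x y \<partial>lborel) = \<sigma> * ((\<integral>y. Q (x - y) * ?f x * ?f y \<partial>lborel) + (\<integral>y. - (Q (x - ?R y) * ?f x * ?f y) \<partial>lborel))"
      unfolding eq by (simp only: integral_mult_right_zero Bochner_Integration.integral_add[OF Qx i2])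
    then show "2 * (\<sigma> * (\<integral>y. Q (x - y) * ?f x * ?f y \<partial>lborel)) = (\<integral>y. \<sigma> * ?D x y \<partial>lborel)"
      by (simp only: I[symmetric] distrib_left mult_2)
  qed
  have ae: "AE y in lborel. \<sigma> * ?D x y \<ge> 0" for x
  proof -
    have "AE y in lborel. y \<noteq> z" for z :: 'a by (rule AE_I[where N="{z}"]) auto
    from this[of x] this[of "?R x"] show ?thesis by eventually_elim (rule nonneg)
  qed
  have "0 < (\<integral>x. 2 * (\<sigma> * (\<integral>y. Q (x - y) * ?f x * ?f y \<partial>lborel)) \<partial>lborel)"
  proof (rule integral_pos_open)
    show "integrable lborel (\<lambda>x. 2 * (\<sigma> * (\<integral>y. Q (x - y) * ?f x * ?f y \<partial>lborel)))"
      using lborel_pair.integrable_fst'[OF Qi] by (intro integrable_mult_right) simp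
    show "AE x in lborel. 0 \<le> 2 * (\<sigma> * (\<integral>y. Q (x - y) * ?f x * ?f y \<partial>lborel))"
      unfolding Phi by (intro AE_I2 integral_nonneg_AE[OF ae])
    let ?U = "{x. norm x < 1} \<inter> {x. x \<bullet> b' > 0}"
    show "open ?U"
      by (intro open_Int open_Collect_less continuous_intros)
    have "(1/2) *\<^sub>R b' \<in> ?U" using b by (simp add: inner_Basis)
    then show "?U \<noteq> {}" by blast
    fix x assume x: "x \<in> ?U"
    show "0 < 2 * (\<sigma> * (\<integral>y. Q (x - y) * ?f x * ?f y \<partial>lborel))"
      unfolding Phi
    proof (rule integral_pos_open[OF Dx ae])
      let ?V = "?U \<inter> {y. (x - y) \<bullet> b \<noteq> 0}"
      have "open {y. (x - y) \<bullet> b \<noteq> 0}" by (intro open_Collect_neq continuous_intros)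
      then show "open ?V" using \<open>open ?U\<close> by blast
      have "\<exists>y. y \<in> ?V"
      proof (cases "(x - (1/2) *\<^sub>R b') \<bullet> b \<noteq> 0")
        case True then show ?thesis using \<open>(1/2) *\<^sub>R b' \<in> ?U\<close> by blast
      next
        case False
        \<comment> \<open>A shift along b makes the b-component differ from that of x; its length
          1/4 keeps the point inside the half ball, also when b = b'.\<close>
        let ?y = "(1/2) *\<^sub>R b' + (1/4) *\<^sub>R b"
        have "norm ?y \<le> norm ((1/2) *\<^sub>R b') + norm ((1/4) *\<^sub>R b)" by (rule norm_triangle_ineq)
        then have "norm ?y < 1" using b by simp
        moreover have "b \<bullet> b' \<ge> 0" using b by (simp add: inner_Basis)
        then have "?y \<bullet> b' > 0" by (simp add: inner_add_left bb)
        moreover have "(x - ?y) \<bullet> b = (x - (1/2) *\<^sub>R b') \<bullet> b - 1/4"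
          using b by (simp add: inner_diff_left inner_add_left inner_Basis)
        then have "(x - ?y) \<bullet> b \<noteq> 0" using False by simp
        ultimately show ?thesis by blast
      qed
      then show "?V \<noteq> {}" by blast
      fix y assume y: "y \<in> ?V"
      have "\<sigma> * (Q (x - y) - Q (x - ?R y)) > 0" using x y by (intro strict) auto
      moreover have "?f x > 0" "?f y > 0" using x y fpos by auto
      ultimately have "(\<sigma> * (Q (x - y) - Q (x - ?R y))) * (?f x * ?f y) > 0" by simp
      then show "0 < \<sigma> * ?D x y" by (simp only: mult.assoc)
    qed
  qed
  also have "(\<integral>x. 2 * (\<sigma> * (\<integral>y. Q (x - y) * ?f x * ?f y \<partial>lborel)) \<partial>lborel)
    = 2 * (\<sigma> * (\<integral>p. Q (fst p - snd p) * ?f (fst p) * ?f (snd p) \<partial>(lborel \<Otimes>\<^sub>M lborel)))"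
    using lborel_pair.integral_fst'[OF Qi] by simp
  finally show ?thesis by simp
qed

lemma exp_recip_isCont: "isCont (exp_recip k) t"
  using exp_recip_has_derivative DERIV_isCont by blast

text \<open>The negative of the integrand for the field \<open>bump_field b l\<close> times b and f
  = g = \<open>bump_field b' 1\<close>; the minus sign of the potential's gradient is
  dropped.\<close>

definition commutator_density :: "real \<Rightarrow> 'a::euclidean_space \<Rightarrow> 'a \<Rightarrow> real \<Rightarrow> 'a \<times> 'a \<Rightarrow> real" where
  "commutator_density s b b' l p = (bump_field b l (fst p) - bump_field b l (snd p)) * ((fst p - snd p) \<bullet> b)
     * norm (fst p - snd p) powr (- s - 2) * bump_field b' 1 (fst p) * bump_field b' 1 (snd p)"

text \<open>The second-order zero of the numerator on the diagonal absorbs two powers of the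
  singularity and leaves the integrable |z|^(-s).\<close>

lemma power2_mult_powr_le:
  fixes z :: "'a::euclidean_space"
  assumes t: "\<bar>t\<bar> \<le> C * norm z" and u: "\<bar>u\<bar> \<le> norm z" and C: "C \<ge> 0"
  shows "\<bar>t * u * norm z powr (- s - 2)\<bar> \<le> C * norm z powr (- s)"
proof (cases "z = 0")
  case False
  have "\<bar>t * u\<bar> \<le> (C * norm z) * norm z" unfolding abs_mult using t u C by (intro mult_mono) auto
  then have "\<bar>t * u\<bar> * norm z powr (- s - 2) \<le> (C * norm z * norm z) * norm z powr (- s - 2)"
    by (intro mult_right_mono) auto
  also have "\<dots> = C * (norm z powr 2 * norm z powr (- s - 2))"
    using False by (simp add: powr_numeral power2_eq_square)
  also have "norm z powr 2 * norm z powr (- s - 2) = norm z powr (- s)"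
    by (subst powr_add[symmetric]) simp
  finally show ?thesis by (simp add: abs_mult)
qed (use t u in simp)

text \<open>As l grows the field tends to exp(-1) times the linear one, and the form tends to
  exp(-1) times the form of Q(z) = (z . b)^2 |z|^(-s-2). If b differs from b', reflection keeps (x -
  y) . b and enlarges the distance, so Q decreases for every s > -2. In dimension 1 one has Q(z) =
  |z|^(-s), strictly monotone in the distance for s nonzero, with a direction that depends on the
  sign of s. Reflection positivity makes the limit nonzero, so half of it is a lower bound for all
  large l.\<close>

lemma commutator_form_lower_bound:
  fixes b b' :: "'a::euclidean_space" and s :: real
  assumes b: "b \<in> Basis" "b' \<in> Basis" and s: "- 2 < s" "s < real DIM('a)"
    and nd: "b \<noteq> b' \<or> (DIM('a) = 1 \<and> s \<noteq> 0)"
  shows "\<exists>\<Lambda>>0. \<exists>c>0. \<exists>\<sigma>. \<bar>\<sigma>\<bar> = 1 \<and> (\<forall>l\<ge>\<Lambda>. integrable (lborel \<Otimes>\<^sub>M lborel) (commutator_density s b b' l)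
     \<and> \<sigma> * (\<integral>p. commutator_density s b b' l p \<partial>(lborel \<Otimes>\<^sub>M lborel)) \<ge> c)"
proof -
  let ?f = "bump_field b' 1"
  let ?K = "commutator_density s b b'"
  have fb: "bump ?f" by (rule bump_bump_field) simp
  have [measurable]: "?f \<in> borel_measurable borel" by (rule bump_measurable[OF fb])
  have [measurable]: "bump_field b l \<in> borel_measurable borel" if "l > 0" for l by (rule bump_measurable[OF bump_bump_field[OF that]])
  obtain B where B: "\<And>x. \<bar>?f x\<bar> \<le> B" using bump_bounded_support[OF fb] by blast
  have B0: "B \<ge> 0" using B[of 0] by linarith
  obtain C where C: "C \<ge> 0" "\<And>l x y. l > 0 \<Longrightarrow> \<bar>bump_field b l x - bump_field b l y\<bar> \<le> C * norm (x - y)"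
    using bump_field_lipschitz[of b] by blast
  define Q where "Q = (\<lambda>z::'a. (z \<bullet> b)\<^sup>2 * norm z powr (- s - 2))"
  have Qm[measurable]: "Q \<in> borel_measurable borel" unfolding Q_def by measurable
  let ?W = "\<lambda>p. norm (fst p - snd p) powr (- s) * \<bar>?f (fst p)\<bar> * \<bar>?f (snd p)\<bar>"
  have Wi: "integrable (lborel \<Otimes>\<^sub>M lborel) ?W"
    by (rule riesz_kernel_integrable[OF s(2) _ bump_field_outside B]) auto
  have zb: "\<bar>z \<bullet> b\<bar> \<le> norm z" for z using b by (simp add: Basis_le_norm)
  have Qle: "\<bar>Q z\<bar> \<le> norm z powr (- s)" for z
    using power2_mult_powr_le[of "z \<bullet> b" 1 z "z \<bullet> b" s] zb[of z] by (simp add: Q_def power2_eq_square)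
  have Qi: "integrable (lborel \<Otimes>\<^sub>M lborel) (\<lambda>p. Q (fst p - snd p) * ?f (fst p) * ?f (snd p))"
  proof (rule Bochner_Integration.integrable_bound[OF Wi])
    show "AE p in lborel \<Otimes>\<^sub>M lborel. norm (Q (fst p - snd p) * ?f (fst p) * ?f (snd p)) \<le> norm (?W p)"
      using Qle by (intro AE_I2) (auto simp: abs_mult intro!: mult_right_mono)
  qed measurable
  have Qx: "integrable lborel (\<lambda>y. Q (x - y) * ?f x * ?f y)" for x
  proof (rule Bochner_Integration.integrable_bound)
    let ?k = "\<lambda>z::'a. indicator (ball 0 2) z * norm z powr (- s)"
    have "integrable lborel ?k" by (rule powr_local_integrable) (use s in simp)
    then show "integrable lborel (\<lambda>y. (B * B) * ?k (x - y))"
      using lborel_integral_affine(2)[of "-1" ?k x] by (intro integrable_mult_right) simp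
    show "AE y in lborel. norm (Q (x - y) * ?f x * ?f y) \<le> norm ((B * B) * ?k (x - y))"
    proof (rule AE_I2)
      fix y
      show "norm (Q (x - y) * ?f x * ?f y) \<le> norm ((B * B) * ?k (x - y))"
      proof (cases "norm x < 1 \<and> norm y < 1")
        case True
        then have "norm (x - y) < 2" using norm_triangle_ineq4[of x y] by simp
        then have k: "?k (x - y) = norm (x - y) powr (- s)" by (simp add: indicator_def)
        have "\<bar>Q (x - y)\<bar> * (\<bar>?f x\<bar> * \<bar>?f y\<bar>) \<le> norm (x - y) powr (- s) * (B * B)"
          using B B0 by (intro mult_mono Qle) auto
        then show ?thesis unfolding k by (simp add: abs_mult mult_ac)
      next
        case False
        then have "?f x = 0 \<or> ?f y = 0" using bump_field_outside[of _ b'] by (metis not_le)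
        then have "Q (x - y) * ?f x * ?f y = 0" by auto
        then show ?thesis by (simp only: norm_zero norm_ge_zero)
      qed
    qed
  qed measurable
  \<comment> \<open>The sign is -1 only in dimension 1 with s < 0, where Q grows with the
    distance.\<close>
  define \<sigma> where "\<sigma> = (if b = b' \<and> s < 0 then -1 else (1::real))"
  have strict0: "\<sigma> * (Q (x - y) - Q (x - reflection b' y)) \<ge> 0 \<and> ((x - y) \<bullet> b \<noteq> 0 \<longrightarrow> \<sigma> * (Q (x - y) - Q (x - reflection b' y)) > 0)"
    if xy: "(x \<bullet> b') * (y \<bullet> b') > 0" "x \<noteq> y" for x y
  proof -
    let ?A = "norm (x - y)" and ?A' = "norm (x - reflection b' y)"
    have A0: "?A > 0" using xy by simp
    have "?A\<^sup>2 < ?A'\<^sup>2" using norm_reflection_diff[OF b(2), of x y] xy by simp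
    then have AA: "?A < ?A'" using power2_less_imp_less by fastforce
    show ?thesis
    proof (cases "b = b'")
      case False
      have "reflection b' y \<bullet> b = y \<bullet> b" using b False by (simp add: reflection_def inner_diff_left inner_Basis)
      then have eq: "Q (x - y) - Q (x - reflection b' y) = ((x - y) \<bullet> b)\<^sup>2 * (?A powr (- s - 2) - ?A' powr (- s - 2))"
        by (simp add: Q_def inner_diff_left algebra_simps)
      have "?A' powr (- s - 2) < ?A powr (- s - 2)" using A0 AA s by (intro powr_less_mono2_neg) auto
      then show ?thesis unfolding eq using False by (simp add: \<sigma>_def)
    next
      case True
      then have d1: "DIM('a) = 1" and s0: "s \<noteq> 0" using nd by auto
      obtain e :: 'a where e: "(Basis :: 'a set) = {e}" using d1 card_1_singletonE by blast
      have "b = e" using b(1) unfolding e by (rule singletonD)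
      then have Bs: "(Basis :: 'a set) = {b}" using e by (simp only:)
      have Qp: "Q z = norm z powr (- s)" if "z \<noteq> 0" for z
      proof -
        have "z = (z \<bullet> b) *\<^sub>R b" using euclidean_representation[of z] by (simp add: Bs)
        then have "norm z = \<bar>z \<bullet> b\<bar> * norm b" by (metis norm_scaleR)
        then have "(z \<bullet> b)\<^sup>2 = (norm z)\<^sup>2" using b by simp
        then have "Q z = norm z powr 2 * norm z powr (- s - 2)" using that by (simp add: Q_def powr_numeral)
        also have "\<dots> = norm z powr (- s)" by (subst powr_add[symmetric]) simp
        finally show ?thesis .
      qed
      have q: "Q (x - y) = ?A powr (- s)" "Q (x - reflection b' y) = ?A' powr (- s)"
        using A0 AA by (auto intro!: Qp)
      have "\<sigma> * (?A powr (- s) - ?A' powr (- s)) > 0"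
      proof (cases "s < 0")
        case neg: True
        then have "?A powr (- s) < ?A' powr (- s)" using A0 AA by (intro powr_less_mono2) auto
        then show ?thesis using neg True by (simp add: \<sigma>_def)
      next
        case False
        then have "?A' powr (- s) < ?A powr (- s)" using A0 AA s0 by (intro powr_less_mono2_neg) auto
        then show ?thesis using False by (simp add: \<sigma>_def)
      qed
      then show ?thesis unfolding q by auto
    qed
  qed
  let ?I = "\<integral>p. Q (fst p - snd p) * ?f (fst p) * ?f (snd p) \<partial>(lborel \<Otimes>\<^sub>M lborel)"
  have I: "\<sigma> * ?I > 0"
  proof (rule reflection_positive_form[OF b Qm Qi Qx])
    fix x y assume xy: "(x \<bullet> b') * (y \<bullet> b') > 0"
    show "x \<noteq> y \<Longrightarrow> \<sigma> * (Q (x - y) - Q (x - reflection b' y)) \<ge> 0" using strict0[OF xy] by blast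
    show "(x - y) \<bullet> b \<noteq> 0 \<Longrightarrow> \<sigma> * (Q (x - y) - Q (x - reflection b' y)) > 0" using strict0[OF xy] by (metis diff_self inner_zero_left)
  qed
  have Km: "?K l \<in> borel_measurable (lborel \<Otimes>\<^sub>M lborel)" if "l > 0" for l
  proof -
    have [measurable]: "bump_field b l \<in> borel_measurable borel" by (rule bump_measurable[OF bump_bump_field[OF that]])
    show ?thesis unfolding commutator_density_def[abs_def] by measurable
  qed
  have Kle: "norm (?K l p) \<le> C * ?W p" if "l > 0" for l p
  proof -
    let ?z = "fst p - snd p"
    have "\<bar>(bump_field b l (fst p) - bump_field b l (snd p)) * (?z \<bullet> b) * norm ?z powr (- s - 2)\<bar> \<le> C * norm ?z powr (- s)"
      by (rule power2_mult_powr_le) (use C zb that in auto)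
    then have "\<bar>(bump_field b l (fst p) - bump_field b l (snd p)) * (?z \<bullet> b) * norm ?z powr (- s - 2)\<bar> * (\<bar>?f (fst p)\<bar> * \<bar>?f (snd p)\<bar>)
       \<le> C * norm ?z powr (- s) * (\<bar>?f (fst p)\<bar> * \<bar>?f (snd p)\<bar>)" by (rule mult_right_mono) auto
    then show ?thesis by (simp add: commutator_density_def abs_mult mult_ac)
  qed
  have Ki: "integrable (lborel \<Otimes>\<^sub>M lborel) (?K l)" if "l > 0" for l
  proof (rule Bochner_Integration.integrable_bound)
    show "integrable (lborel \<Otimes>\<^sub>M lborel) (\<lambda>p. C * ?W p)" using Wi by (rule integrable_mult_right)
    show "AE p in lborel \<Otimes>\<^sub>M lborel. norm (?K l p) \<le> norm (C * ?W p)"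
      using Kle[OF that] by (intro AE_I2) (simp add: order_trans[OF _ abs_ge_self])
  qed (rule Km[OF that])
  \<comment> \<open>The value exp(-1) of the cut-off profile at the origin, to which the profile
    tends pointwise as l grows.\<close>
  define E where "E = exp_recip 0 1"
  have E: "E > 0" by (simp add: E_def exp_recip_def)
  have lim: "((\<lambda>l. \<integral>p. ?K l p \<partial>(lborel \<Otimes>\<^sub>M lborel)) \<longlongrightarrow> (\<integral>p. E * (Q (fst p - snd p) * ?f (fst p) * ?f (snd p)) \<partial>(lborel \<Otimes>\<^sub>M lborel))) at_top"
  proof -
    have "(\<lambda>n. \<integral>p. ?K (X n) p \<partial>(lborel \<Otimes>\<^sub>M lborel)) \<longlonglongrightarrow> (\<integral>p. E * (Q (fst p - snd p) * ?f (fst p) * ?f (snd p)) \<partial>(lborel \<Otimes>\<^sub>M lborel))"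
      if X: "filterlim X at_top sequentially" and Xp: "\<And>n. X n > 0" for X :: "nat \<Rightarrow> real"
    proof (rule integral_dominated_convergence[where w="\<lambda>p. C * ?W p"])
      show "integrable (lborel \<Otimes>\<^sub>M lborel) (\<lambda>p. C * ?W p)" using Wi by (rule integrable_mult_right)
      show "AE p in lborel \<Otimes>\<^sub>M lborel. norm (?K (X n) p) \<le> C * ?W p" for n using Kle[OF Xp] by auto
      show "?K (X n) \<in> borel_measurable (lborel \<Otimes>\<^sub>M lborel)" for n by (rule Km[OF Xp])
      show "AE p in lborel \<Otimes>\<^sub>M lborel. (\<lambda>n. ?K (X n) p) \<longlonglongrightarrow> E * (Q (fst p - snd p) * ?f (fst p) * ?f (snd p))"
      proof (rule AE_I2)
        fix p :: "'a \<times> 'a"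
        have "(\<lambda>n. bump_field b (X n) x) \<longlonglongrightarrow> (x \<bullet> b) * E" for x
        proof -
          have "(\<lambda>n. (norm x)\<^sup>2 / (X n)\<^sup>2) \<longlonglongrightarrow> 0"
            by (rule tendsto_divide_0[OF tendsto_const]) (rule filterlim_at_top_imp_at_infinity, rule filterlim_pow_at_top[OF _ X], simp)
          then have "(\<lambda>n. 1 - (norm x)\<^sup>2 / (X n)\<^sup>2) \<longlonglongrightarrow> 1 - 0" by (intro tendsto_intros)
          then have "(\<lambda>n. exp_recip 0 (1 - (norm x)\<^sup>2 / (X n)\<^sup>2)) \<longlonglongrightarrow> exp_recip 0 (1 - 0)"
            by (rule isCont_tendsto_compose[OF exp_recip_isCont])
          then show ?thesis unfolding bump_field_def E_def by (intro tendsto_intros) simp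
        qed
        then have "(\<lambda>n. ?K (X n) p) \<longlonglongrightarrow> ((fst p \<bullet> b) * E - (snd p \<bullet> b) * E) * ((fst p - snd p) \<bullet> b)
           * norm (fst p - snd p) powr (- s - 2) * ?f (fst p) * ?f (snd p)"
          unfolding commutator_density_def by (intro tendsto_intros)
        also have "((fst p \<bullet> b) * E - (snd p \<bullet> b) * E) * ((fst p - snd p) \<bullet> b)
           * norm (fst p - snd p) powr (- s - 2) * ?f (fst p) * ?f (snd p) = E * (Q (fst p - snd p) * ?f (fst p) * ?f (snd p))"
          by (simp add: Q_def inner_diff_left power2_eq_square algebra_simps)
        finally show "(\<lambda>n. ?K (X n) p) \<longlonglongrightarrow> E * (Q (fst p - snd p) * ?f (fst p) * ?f (snd p))" .
      qed
    qed (measurable)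
    note seq = this
    show ?thesis
    proof (rule tendsto_at_topI_sequentially)
      fix X :: "nat \<Rightarrow> real" assume X: "filterlim X at_top sequentially"
      \<comment> \<open>Keeps the scales positive; eventually it changes nothing.\<close>
      let ?Y = "\<lambda>n. max 1 (X n)"
      have Y: "filterlim ?Y at_top sequentially"
        by (rule filterlim_at_top_mono[OF X]) auto
      have "(\<lambda>n. \<integral>p. ?K (?Y n) p \<partial>(lborel \<Otimes>\<^sub>M lborel)) \<longlonglongrightarrow> (\<integral>p. E * (Q (fst p - snd p) * ?f (fst p) * ?f (snd p)) \<partial>(lborel \<Otimes>\<^sub>M lborel))"
        by (rule seq[OF Y]) auto
      moreover have "\<forall>\<^sub>F n in sequentially. (\<integral>p. ?K (?Y n) p \<partial>(lborel \<Otimes>\<^sub>M lborel)) = (\<integral>p. ?K (X n) p \<partial>(lborel \<Otimes>\<^sub>M lborel))"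
      proof -
        have "\<forall>\<^sub>F n in sequentially. X n \<ge> 1" using X by (simp add: filterlim_at_top)
        then show ?thesis by eventually_elim (simp add: max_def)
      qed
      ultimately show "(\<lambda>n. \<integral>p. ?K (X n) p \<partial>(lborel \<Otimes>\<^sub>M lborel)) \<longlonglongrightarrow> (\<integral>p. E * (Q (fst p - snd p) * ?f (fst p) * ?f (snd p)) \<partial>(lborel \<Otimes>\<^sub>M lborel))"
        by (rule Lim_transform_eventually)
    qed
  qed
  have lim': "((\<lambda>l. \<sigma> * (\<integral>p. ?K l p \<partial>(lborel \<Otimes>\<^sub>M lborel))) \<longlongrightarrow> E * (\<sigma> * ?I)) at_top"
    using tendsto_mult_left[OF lim, of \<sigma>] by (simp only: integral_mult_right_zero mult.left_commute)
  define c where "c = E * (\<sigma> * ?I) / 2"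
  have c: "c > 0" using E I by (simp add: c_def)
  have "c < E * (\<sigma> * ?I)" using c unfolding c_def by linarith
  from order_tendstoD(1)[OF lim' this]
  obtain L where L: "\<And>l. l \<ge> L \<Longrightarrow> c < \<sigma> * (\<integral>p. ?K l p \<partial>(lborel \<Otimes>\<^sub>M lborel))"
    by (auto simp: eventually_at_top_linorder)
  show ?thesis
  proof (rule exI[of _ "max L 1"], rule conjI, simp, rule exI[of _ c], rule conjI[OF c], rule exI[of _ \<sigma>], intro conjI allI impI)
    fix l assume "max L 1 \<le> l"
    then have l: "l > 0" "l \<ge> L" by auto
    show "integrable (lborel \<Otimes>\<^sub>M lborel) (?K l)" by (rule Ki[OF l(1)])
    show "c \<le> \<sigma> * (\<integral>p. ?K l p \<partial>(lborel \<Otimes>\<^sub>M lborel))" using L[OF l(2)] by simp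
  qed (use c in \<open>auto simp: \<sigma>_def\<close>)
qed

section \<open>Vector fields with many scales\<close>

definition multiscale :: "'a::euclidean_space \<Rightarrow> (nat \<Rightarrow> real) \<Rightarrow> nat \<Rightarrow> 'a \<Rightarrow> real" where
  "multiscale b sc K x = (\<Sum>k<K. bump_field b (sc k) x)"

lemma bump_multiscale:
  assumes "\<And>k. k < K \<Longrightarrow> sc k > 0"
  shows "bump (multiscale b sc K :: 'a::euclidean_space \<Rightarrow> real)"
  using assms
proof (induction K)
  case 0
  have "bump (\<lambda>x::'a. 0 * bump_field b 1 x)" by (intro bump.cmult bump_bump_field) simp
  then show ?case by (simp add: multiscale_def[abs_def])
next
  case (Suc K)
  then have "bump (\<lambda>x. multiscale b sc K x + bump_field b (sc K) x)"
    by (intro bump.add bump_bump_field) auto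
  then show ?case by (simp add: multiscale_def[abs_def])
qed

lemma abs_nabla_pow_multiscale:
  assumes "\<And>k. k < K \<Longrightarrow> sc k > 0" and a: "a > 0"
  shows "abs_nabla_pow a (\<lambda>x. of_real (multiscale b sc K x)) x
    = (\<Sum>k<K. of_real (sc k powr (1 - a)) * abs_nabla_pow a (\<lambda>x. of_real (bump_field b 1 x)) ((1 / sc k) *\<^sub>R x))"
  using assms(1)
proof (induction K)
  case 0
  show ?case
    by (simp add: multiscale_def abs_nabla_pow_def fourier_def)
next
  case (Suc K)
  have "abs_nabla_pow a (\<lambda>x. of_real (multiscale b sc K x + bump_field b (sc K) x)) x
    = abs_nabla_pow a (\<lambda>x. of_real (multiscale b sc K x)) x + abs_nabla_pow a (\<lambda>x. of_real (bump_field b (sc K) x)) x"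
    using Suc.prems a by (intro abs_nabla_pow_bump_add bump_multiscale bump_bump_field) auto
  also have "(\<lambda>x. complex_of_real (multiscale b sc K x + bump_field b (sc K) x)) = (\<lambda>x. of_real (multiscale b sc (Suc K) x))"
    by (simp add: multiscale_def)
  finally show ?case
    using Suc abs_nabla_pow_bump_field[of "sc K" a b x] by simp
qed

text \<open>Scales are chosen one after another, each wide enough compared with the partial sum
  already built. Since the dilation l^(1-a) is critical for p, every scale adds the same amount J to
  the p-th power of the norm. The upper bound on a, equivalent to p >= 2, also lets the profile's Lp
  norm be controlled from L2.\<close>

lemma multiscale_Lp_scales:
  fixes b :: "'a::euclidean_space"
  assumes a: "a > 1" "a < real DIM('a) / 2 + 1"
  defines "\<Psi> \<equiv> abs_nabla_pow a (\<lambda>x. complex_of_real (bump_field b 1 x))" and "p \<equiv> real DIM('a) / (a - 1)"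
  shows "\<exists>J\<ge>0. \<forall>K \<Lambda>. \<Lambda> > 0 \<longrightarrow> (\<exists>sc. (\<forall>k<K. sc k \<ge> \<Lambda>) \<and> (\<forall>k. Suc k < K \<longrightarrow> 2 * sc k \<le> sc (Suc k)) \<and>
    integrable lborel (\<lambda>x. norm (\<Sum>k<K. of_real (sc k powr (1 - a)) * \<Psi> ((1 / sc k) *\<^sub>R x)) powr p) \<and>
    (\<integral>x. norm (\<Sum>k<K. of_real (sc k powr (1 - a)) * \<Psi> ((1 / sc k) *\<^sub>R x)) powr p \<partial>lborel) \<le> real K * J)"
proof -
  have bb: "bump (bump_field b 1)" by (rule bump_bump_field) simp
  have p2: "p \<ge> 2" unfolding p_def using a by (simp add: field_simps)
  note ui = schwartz_symbol_integrable(1)[OF schwartz_bump[OF bb], of a]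
  have um: "abs_nabla_symbol a (\<lambda>x. complex_of_real (bump_field b 1 x)) \<in> borel_measurable borel" using ui a by auto
  have Pm[measurable]: "\<Psi> \<in> borel_measurable borel"
    unfolding \<Psi>_def abs_nabla_pow_symbol by (rule measurable_inverse_fourier[OF um])
  obtain M where M: "\<And>x. norm (\<Psi> x) \<le> M"
    unfolding \<Psi>_def abs_nabla_pow_symbol using norm_inverse_fourier_le by blast
  have "(\<integral>\<^sup>+x. ennreal (norm (\<Psi> x) powr p) \<partial>lborel) < \<infinity>"
    using abs_nabla_pow_bump_L2[OF bb, of a] a M p2 unfolding \<Psi>_def[symmetric]
    by (intro Lp_from_L2_bounded) auto
  then have Pi: "integrable lborel (\<lambda>x. norm (\<Psi> x) powr p)"
    by (intro integrableI_bounded) auto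
  have exq: "- real DIM('a) / p = 1 - a" using a by (simp add: p_def field_simps)
  let ?J = "(\<integral>x. norm (\<Psi> x) powr p \<partial>lborel) + 1"
  let ?F = "\<lambda>sc K x. \<Sum>k<K. of_real (sc k powr (1 - a)) * \<Psi> ((1 / sc k) *\<^sub>R x)"
  have "\<exists>sc. (\<forall>k<K. sc k \<ge> \<Lambda>) \<and> (\<forall>k. Suc k < K \<longrightarrow> 2 * sc k \<le> sc (Suc k)) \<and>
    integrable lborel (\<lambda>x. norm (?F sc K x) powr p) \<and> (\<integral>x. norm (?F sc K x) powr p \<partial>lborel) \<le> real K * ?J"
    if L: "\<Lambda> > 0" for K and \<Lambda> :: real
  proof (induction K)
    case 0
    show ?case by simp
  next
    case (Suc K)
    then obtain sc where sc: "\<forall>k<K. sc k \<ge> \<Lambda>" "\<forall>k. Suc k < K \<longrightarrow> 2 * sc k \<le> sc (Suc k)"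
      "integrable lborel (\<lambda>x. norm (?F sc K x) powr p)" "(\<integral>x. norm (?F sc K x) powr p \<partial>lborel) \<le> real K * ?J" by blast
    have Fm: "?F sc K \<in> borel_measurable borel" by measurable
    obtain L where Lp: "L > 0" and LL: "\<And>l. l \<ge> L \<Longrightarrow> integrable lborel (\<lambda>x. norm (?F sc K x + of_real (l powr (1 - a)) * \<Psi> ((1 / l) *\<^sub>R x)) powr p) \<and>
      (\<integral>x. norm (?F sc K x + of_real (l powr (1 - a)) * \<Psi> ((1 / l) *\<^sub>R x)) powr p \<partial>lborel) \<le> (\<integral>x. norm (?F sc K x) powr p \<partial>lborel) + (\<integral>x. norm (\<Psi> x) powr p \<partial>lborel) + 1"
      using Lp_add_wide_scale[OF Fm sc(3) Pm Pi M] p2 unfolding exq by auto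
    \<comment> \<open>Wide enough for the Lp estimate, above the threshold of the form, and at least
      twice the previous scale. For K = 0 the truncated index only adds a harmless term to the
      maximum.\<close>
    define l where "l = max (max L \<Lambda>) (2 * sc (K - 1))"
    define sc' where "sc' = sc(K := l)"
    have F': "?F sc' (Suc K) x = ?F sc K x + of_real (l powr (1 - a)) * \<Psi> ((1 / l) *\<^sub>R x)" for x
    proof -
      have "?F sc' K x = ?F sc K x" by (intro sum.cong) (auto simp: sc'_def)
      then show ?thesis by (simp add: sc'_def)
    qed
    have "l \<ge> L" by (simp add: l_def)
    note LL = LL[OF this]
    show ?case
    proof (intro exI[of _ sc'] conjI allI impI)
      show "\<Lambda> \<le> sc' k" if "k < Suc K" for k using that sc(1) by (auto simp: sc'_def l_def less_Suc_eq)
      show "2 * sc' k \<le> sc' (Suc k)" if "Suc k < Suc K" for k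
        using that sc(2) by (cases "Suc k = K") (auto simp: sc'_def l_def)
      show "integrable lborel (\<lambda>x. norm (?F sc' (Suc K) x) powr p)" unfolding F' using LL by blast
      show "(\<integral>x. norm (?F sc' (Suc K) x) powr p \<partial>lborel) \<le> real (Suc K) * ?J"
        unfolding F' using LL sc(4) by (simp add: algebra_simps)
    qed
  qed
  moreover have "?J \<ge> 0" by (intro add_nonneg_nonneg Bochner_Integration.integral_nonneg) auto
  ultimately show ?thesis by blast
qed

text \<open>The factor l of the dilation cancels the inner 1 / l, so every scale has a gradient of
  the same size, which is what the lacunary BMO estimate needs.\<close>

lemma bump_field_has_derivative_scaled:
  assumes l: "l > 0"
  shows "(bump_field b l has_derivative (\<lambda>h. frechet_derivative (bump_field b 1) (at ((1 / l) *\<^sub>R x)) h)) (at x)"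
proof -
  let ?D = "frechet_derivative (bump_field b 1) (at ((1 / l) *\<^sub>R x))"
  have D: "(bump_field b 1 has_derivative ?D) (at ((1 / l) *\<^sub>R x))"
    by (rule frechet_derivative_works[THEN iffD1, OF bump_differentiable[OF bump_bump_field[OF zero_less_one]]])
  have "((\<lambda>x. (1 / l) *\<^sub>R x) has_derivative (\<lambda>h. (1 / l) *\<^sub>R h)) (at x)"
    by (intro has_derivative_scaleR_right has_derivative_ident)
  from has_derivative_mult_right[OF has_derivative_compose[OF this D], of l]
  have "((\<lambda>x. l * bump_field b 1 ((1 / l) *\<^sub>R x)) has_derivative (\<lambda>h. l * ?D ((1 / l) *\<^sub>R h))) (at x)" .
  moreover have "l * ?D ((1 / l) *\<^sub>R h) = ?D h" for h
  proof -
    have "?D ((1 / l) *\<^sub>R h) = (1 / l) *\<^sub>R ?D h"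
      using linear_cmul[OF has_derivative_linear[OF D]] by blast
    then show ?thesis using l by simp
  qed
  moreover have "(\<lambda>x. l * bump_field b 1 ((1 / l) *\<^sub>R x)) = bump_field b l"
    using bump_field_scale[OF l, of b] by auto
  ultimately show ?thesis by simp
qed

lemma bump_field_derivative_at_0:
  fixes b :: "'a::euclidean_space"
  assumes "b \<in> Basis"
  shows "frechet_derivative (bump_field b 1) (at 0) b = exp (- 1)"
proof -
  let ?e = "\<lambda>x::'a. exp_recip 0 (1 - (norm x)\<^sup>2 / 1\<^sup>2)"
  have "bump ?e" using bump.base[of 1 1 0 0] by simp
  from bump_differentiable[OF this, of 0] obtain D where D: "(?e has_derivative D) (at 0)"
    unfolding differentiable_def by blast
  have "((\<lambda>x. (x \<bullet> b) * ?e x) has_derivative (\<lambda>h. (0 \<bullet> b) * D h + (h \<bullet> b) * ?e 0)) (at 0)"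
    by (intro has_derivative_mult D has_derivative_inner_left has_derivative_ident)
  then have "frechet_derivative (bump_field b 1) (at 0) = (\<lambda>h. (0 \<bullet> b) * D h + (h \<bullet> b) * ?e 0)"
    unfolding bump_field_def[abs_def] by (rule frechet_derivative_at[symmetric])
  then show ?thesis using assms by (simp add: exp_recip_def inner_Basis)
qed

text \<open>The Jacobian matrix of the unit-scale field; at scale l the Jacobian is this matrix
  function evaluated at x / l.\<close>

definition rank_one_jacobian :: "real^'n \<Rightarrow> real^'n \<Rightarrow> real^'n^'n" where
  "rank_one_jacobian b x = matrix (\<lambda>h. frechet_derivative (bump_field b 1) (at x) h *\<^sub>R b)"

lemma norm_matrix_le_sum: "norm (M :: real^'n^'m) \<le> (\<Sum>i\<in>UNIV. \<Sum>j\<in>UNIV. \<bar>M $ i $ j\<bar>)"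
proof -
  have "norm M \<le> (\<Sum>i\<in>UNIV. norm (M $ i))" by (simp add: norm_vec_def L2_set_le_sum)
  also have "\<dots> \<le> (\<Sum>i\<in>UNIV. \<Sum>j\<in>UNIV. \<bar>M $ i $ j\<bar>)" by (intro sum_mono norm_le_l1_cart)
  finally show ?thesis .
qed

text \<open>Every entry is a derivative of a bump times a coordinate of b, so the Lipschitz bound,
  the supremum and the support are obtained entrywise and collected by summing.\<close>

lemma rank_one_jacobian_bounds:
  fixes b :: "real^'n"
  assumes b: "b \<in> Basis"
  shows "\<exists>C\<ge>0. \<exists>R\<ge>0. (\<forall>x y. norm (rank_one_jacobian b x - rank_one_jacobian b y) \<le> C * norm (x - y)) \<and>
    (\<forall>x. norm (rank_one_jacobian b x) \<le> C) \<and> (\<forall>x. norm x \<ge> R \<longrightarrow> rank_one_jacobian b x = 0)"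
proof -
  let ?d = "\<lambda>j x. frechet_derivative (bump_field b 1) (at x) (axis j 1)"
  have bd: "bump (?d j)" for j by (intro bump_frechet_derivative bump_bump_field) simp
  obtain L where L: "\<And>j. L j \<ge> 0" "\<And>j x y. \<bar>?d j x - ?d j y\<bar> \<le> L j * norm (x - y)"
    using bump_lipschitz[OF bd] by metis
  obtain R C where RC: "\<And>j. R j > 0" "\<And>j. C j > 0" "\<And>j x. \<bar>?d j x\<bar> \<le> C j" "\<And>j x. norm x \<ge> R j \<Longrightarrow> ?d j x = 0"
    using bump_bounded_support[OF bd] by metis
  have entry: "rank_one_jacobian b x $ i $ j = ?d j x * b $ i" for x i j
    by (simp add: rank_one_jacobian_def matrix_def)
  have b1: "\<bar>b $ i\<bar> \<le> 1" for i using component_le_norm_cart[of b i] b by simp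
  define A where "A = (\<Sum>i\<in>(UNIV::'n set). \<Sum>j\<in>(UNIV::'n set). L j + C j)"
  have A0: "A \<ge> 0" unfolding A_def using L(1) RC(2) by (intro sum_nonneg) (auto intro: add_nonneg_nonneg less_imp_le)
  have le: "norm M \<le> A * t" if M: "\<And>i j. \<bar>M $ i $ j\<bar> \<le> (L j + C j) * t" for M :: "real^'n^'n" and t
  proof -
    have "norm M \<le> (\<Sum>i\<in>UNIV. \<Sum>j\<in>UNIV. \<bar>M $ i $ j\<bar>)" by (rule norm_matrix_le_sum)
    also have "\<dots> \<le> (\<Sum>i\<in>(UNIV::'n set). \<Sum>j\<in>(UNIV::'n set). (L j + C j) * t)" by (intro sum_mono M)
    finally show ?thesis by (simp only: A_def sum_distrib_right)
  qed
  show ?thesis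
  proof (rule exI[of _ A], rule conjI[OF A0], rule exI[of _ "\<Sum>j\<in>UNIV. R j"], intro conjI allI impI)
    show "0 \<le> (\<Sum>j\<in>UNIV. R j)" using RC(1) by (intro sum_nonneg) (auto intro: less_imp_le)
    fix x y :: "real^'n"
    show "norm (rank_one_jacobian b x - rank_one_jacobian b y) \<le> A * norm (x - y)"
    proof (rule le)
      fix i j
      have "\<bar>(rank_one_jacobian b x - rank_one_jacobian b y) $ i $ j\<bar> = \<bar>?d j x - ?d j y\<bar> * \<bar>b $ i\<bar>"
        by (simp add: entry left_diff_distrib[symmetric] abs_mult)
      also have "\<dots> \<le> (L j * norm (x - y)) * 1" using L b1 by (intro mult_mono) auto
      also have "\<dots> \<le> (L j + C j) * norm (x - y)" using RC(2)[of j] by (simp add: mult_right_mono)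
      finally show "\<bar>(rank_one_jacobian b x - rank_one_jacobian b y) $ i $ j\<bar> \<le> (L j + C j) * norm (x - y)" .
    qed
    have "norm (rank_one_jacobian b x) \<le> A * 1"
    proof (rule le)
      fix i j
      have "\<bar>rank_one_jacobian b x $ i $ j\<bar> = \<bar>?d j x\<bar> * \<bar>b $ i\<bar>" by (simp add: entry abs_mult)
      also have "\<dots> \<le> C j * 1" using RC b1 by (intro mult_mono) (auto intro: less_imp_le)
      finally show "\<bar>rank_one_jacobian b x $ i $ j\<bar> \<le> (L j + C j) * 1" using L(1)[of j] by simp
    qed
    then show "norm (rank_one_jacobian b x) \<le> A" by simp
    assume x: "(\<Sum>j\<in>UNIV. R j) \<le> norm x"
    have "R j \<le> norm x" for j
      using member_le_sum[of j UNIV R] RC(1) x by (auto intro: less_imp_le order_trans)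
    then show "rank_one_jacobian b x = 0" using RC(4) by (simp add: vec_eq_iff entry)
  qed
qed

lemma jacobian_multiscale:
  fixes b :: "real^'n"
  assumes pos: "\<And>k. k < K \<Longrightarrow> sc k > 0"
  shows "jacobian (\<lambda>x. multiscale b sc K x *\<^sub>R b) (at x) = (\<Sum>k<K. rank_one_jacobian b ((1 / sc k) *\<^sub>R x))"
proof -
  let ?D = "\<lambda>k h. frechet_derivative (bump_field b 1) (at ((1 / sc k) *\<^sub>R x)) h"
  have "((\<lambda>x. multiscale b sc K x *\<^sub>R b) has_derivative (\<lambda>h. (\<Sum>k<K. ?D k h) *\<^sub>R b)) (at x)"
    unfolding multiscale_def
    by (intro has_derivative_scaleR_left has_derivative_sum bump_field_has_derivative_scaled pos) simp
  then have "frechet_derivative (\<lambda>x. multiscale b sc K x *\<^sub>R b) (at x) = (\<lambda>h. (\<Sum>k<K. ?D k h) *\<^sub>R b)"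
    by (rule frechet_derivative_at[symmetric])
  then show ?thesis
    by (simp add: jacobian_def rank_one_jacobian_def matrix_def vec_eq_iff sum_component sum_distrib_right)
qed

lemma commutator_integrand_multiscale:
  fixes b b' :: "'a::euclidean_space"
  shows "complex_of_real ((multiscale b sc K x *\<^sub>R b - multiscale b sc K y *\<^sub>R b) \<bullet> grad (riesz_pot s) (x - y))
      * of_real (bump_field b' 1 x) * of_real (bump_field b' 1 y)
    = of_real (- (\<Sum>k<K. commutator_density s b b' (sc k) (x, y)))"
proof (cases "x = y")
  \<comment> \<open>On the diagonal the junk value of \<open>grad\<close> at 0 is paired with the
    zero vector.\<close>
  case True
  then show ?thesis by (simp add: commutator_density_def)
next
  case False
  have "(multiscale b sc K x *\<^sub>R b - multiscale b sc K y *\<^sub>R b) \<bullet> grad (riesz_pot s) (x - y)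
    = - ((\<Sum>k<K. bump_field b (sc k) x - bump_field b (sc k) y) * ((x - y) \<bullet> b) * norm (x - y) powr (- s - 2))"
    using False by (simp add: grad_riesz_pot multiscale_def sum_subtractf scaleR_left_diff_distrib[symmetric] inner_commute)
  then show ?thesis
    by (simp only: commutator_density_def fst_conv snd_conv sum_distrib_right of_real_mult[symmetric] mult_minus_left)
qed

section \<open>Part (i): numerator against denominator\<close>

text \<open>With K scales the form is at least c K, while the bracket in the denominator is at most
  B + sqrt (J K); the Sobolev norms of the fixed f = g do not depend on K. Hence the quotient grows
  at least like sqrt K.\<close>

lemma commutator_unbounded:
  fixes s M :: real
  assumes s: "- 2 < s" "s < real CARD('n::finite)" and ns: "\<not> (CARD('n) = 1 \<and> s = 0)" and M: "M > 0"
  shows "\<exists>(v :: real^'n \<Rightarrow> real^'n) (f :: real^'n \<Rightarrow> complex) (g :: real^'n \<Rightarrow> complex).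
           smooth v \<and> compactly_supported v \<and>
           schwartz f \<and> zero_mean f \<and> schwartz g \<and> zero_mean g \<and>
           (let d = real CARD('n);
                N = cmod (\<integral>(x, y). of_real ((v x - v y) \<bullet> grad (riesz_pot s) (x - y)) * f x * g y
                            \<partial>lebesgue);
                D = (BMO_seminorm (\<lambda>x. jacobian v (at x))
                      + (if s < d - 2
                         then Lp_norm (2 * d / (d - s - 2)) (abs_nabla_pow_vec ((d - s) / 2) v)
                         else 0))
                    * Hdot_norm ((s - d) / 2) f * Hdot_norm ((s - d) / 2) g
            in 0 < D \<and> D < \<infinity> \<and> ennreal N / D \<ge> ennreal M)"
proof -
  define d where "d = real CARD('n)"
  have dd: "real DIM(real^'n) = d" by (simp add: d_def)
  have d1: "d \<ge> 1" by (simp add: d_def Suc_le_eq)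
  obtain i :: 'n where True by blast
  define b :: "real^'n" where "b = axis i 1"
  have b: "b \<in> Basis" by (simp add: b_def)
  \<comment> \<open>In dimension at least 2 the bump f = g oscillates in a direction orthogonal to
    that of v. In dimension 1 the directions coincide, and s is nonzero.\<close>
  obtain b' :: "real^'n" where b': "b' \<in> Basis" and bb: "b \<noteq> b' \<or> (DIM(real^'n) = 1 \<and> s \<noteq> 0)"
  proof (cases "CARD('n) = 1")
    case True then show thesis using that[of b] b ns by auto
  next
    case False
    then have "\<exists>j. j \<noteq> i" by (metis (full_types) UNIV_I card_1_singleton_iff is_singletonI' is_singleton_altdef UNIV_not_empty)
    then obtain j where "j \<noteq> i" by blast
    then have "b \<noteq> axis j 1" by (simp add: b_def axis_eq_axis)
    then show thesis using that[of "axis j 1"] by simp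
  qed
  define f where "f = (\<lambda>x. complex_of_real (bump_field b' 1 x))"
  have fb: "bump (bump_field b' 1)" by (rule bump_bump_field) simp
  have fs: "schwartz f" unfolding f_def by (rule schwartz_bump[OF fb])
  have fz: "zero_mean f" unfolding f_def by (rule bump_field_zero_mean)
  have fnz: "bump_field b' 1 ((1/2) *\<^sub>R b') \<noteq> 0"
    using b' by (simp add: bump_field_def exp_recip_def inner_Basis power_divide)
  define h where "h = Hdot_norm ((s - d) / 2) f"
  have ha: "(s - d) / 2 > - real DIM(real^'n) / 2 - 1" using s by (simp add: d_def)
  have h0: "0 < h" and hi: "h < \<infinity>"
    using Hdot_norm_bump[OF fb fz[unfolded f_def] ha fnz] by (simp_all add: h_def f_def)
  define \<eta> where "\<eta> = enn2real h"
  have h\<eta>: "h = ennreal \<eta>" and \<eta>: "\<eta> > 0" using h0 hi by (auto simp: \<eta>_def enn2real_positive_iff)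
  obtain \<Lambda> c \<sigma> where \<Lambda>: "\<Lambda> > 0" and c: "c > 0" and \<sigma>: "\<bar>\<sigma>\<bar> = 1"
    and low: "\<And>l. l \<ge> \<Lambda> \<Longrightarrow> integrable (lborel \<Otimes>\<^sub>M lborel) (commutator_density s b b' l)"
      "\<And>l. l \<ge> \<Lambda> \<Longrightarrow> \<sigma> * (\<integral>p. commutator_density s b b' l p \<partial>(lborel \<Otimes>\<^sub>M lborel)) \<ge> c"
    using commutator_form_lower_bound[OF b b' s(1) _ bb] s(2) by (auto simp: dd)
  obtain C R where C: "C \<ge> 0" and R: "R \<ge> 0"
    and Clip: "\<And>x y. norm (rank_one_jacobian b x - rank_one_jacobian b y) \<le> C * norm (x - y)"
    and Cbd: "\<And>x. norm (rank_one_jacobian b x) \<le> C" and Rout: "\<And>x. norm x \<ge> R \<Longrightarrow> rank_one_jacobian b x = 0"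
    using rank_one_jacobian_bounds[OF b] by metis
  obtain B where B0: "B \<ge> 0" and B: "\<And>K sc. (\<forall>k<K. sc k > 0) \<Longrightarrow> (\<forall>k. Suc k < K \<longrightarrow> 2 * sc k \<le> sc (Suc k)) \<Longrightarrow>
     BMO_seminorm (\<lambda>x. \<Sum>k<K. rank_one_jacobian b ((1 / sc k) *\<^sub>R x)) \<le> ennreal B"
    using BMO_lacunary[OF Clip Cbd Rout R C] by blast
  define a where "a = (d - s) / 2"
  \<comment> \<open>This is d / (a - 1), the exponent for which the dilations of the profile are
    isometric.\<close>
  define p where "p = 2 * d / (d - s - 2)"
  define \<Psi> where "\<Psi> = abs_nabla_pow a (\<lambda>x. complex_of_real (bump_field b 1 x))"
  let ?F = "\<lambda>sc K x. \<Sum>k<K. of_real (sc k powr (1 - a)) * \<Psi> ((1 / sc k) *\<^sub>R x)"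
  \<comment> \<open>The Lp demand is imposed only when the second term is present; otherwise any
    lacunary sequence above the threshold will do. Having J >= 1 makes K J >= 1, used when the
    exponent 1/p is raised to 1/2.\<close>
  obtain J where J: "J \<ge> 1" and scales: "\<And>K. \<exists>sc. (\<forall>k<K. sc k \<ge> \<Lambda>) \<and> (\<forall>k. Suc k < K \<longrightarrow> 2 * sc k \<le> sc (Suc k)) \<and>
     (s < d - 2 \<longrightarrow> integrable lborel (\<lambda>x. norm (?F sc K x) powr p) \<and> (\<integral>x. norm (?F sc K x) powr p \<partial>lborel) \<le> real K * J)"
  proof (cases "s < d - 2")
    case True
    have a1: "1 < a" "a < real DIM(real^'n) / 2 + 1" using True s by (auto simp: a_def d_def)
    have pp: "real DIM(real^'n) / (a - 1) = p" using True unfolding dd by (simp add: p_def a_def field_simps)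
    obtain J where J: "J \<ge> 0" and *: "\<And>K. \<exists>sc. (\<forall>k<K. sc k \<ge> \<Lambda>) \<and> (\<forall>k. Suc k < K \<longrightarrow> 2 * sc k \<le> sc (Suc k)) \<and>
      integrable lborel (\<lambda>x. norm (?F sc K x) powr p) \<and> (\<integral>x. norm (?F sc K x) powr p \<partial>lborel) \<le> real K * J"
      using multiscale_Lp_scales[OF a1, of b] \<Lambda> unfolding pp \<Psi>_def[symmetric] by blast
    show thesis
    proof (rule that[of "J + 1"])
      fix K
      obtain sc where sc: "\<forall>k<K. sc k \<ge> \<Lambda>" "\<forall>k. Suc k < K \<longrightarrow> 2 * sc k \<le> sc (Suc k)"
        "integrable lborel (\<lambda>x. norm (?F sc K x) powr p)" "(\<integral>x. norm (?F sc K x) powr p \<partial>lborel) \<le> real K * J" using * by blast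
      have "real K * J \<le> real K * (J + 1)" by (intro mult_left_mono) auto
      with sc show "\<exists>sc. (\<forall>k<K. sc k \<ge> \<Lambda>) \<and> (\<forall>k. Suc k < K \<longrightarrow> 2 * sc k \<le> sc (Suc k)) \<and>
     (s < d - 2 \<longrightarrow> integrable lborel (\<lambda>x. norm (?F sc K x) powr p) \<and> (\<integral>x. norm (?F sc K x) powr p \<partial>lborel) \<le> real K * (J + 1))"
        by (intro exI[of _ sc]) auto
    qed (use J in simp)
  next
    case False
    show thesis
    proof (rule that[of 1])
      fix K
      show "\<exists>sc. (\<forall>k<K. sc k \<ge> \<Lambda>) \<and> (\<forall>k. Suc k < K \<longrightarrow> 2 * sc k \<le> sc (Suc k)) \<and>
     (s < d - 2 \<longrightarrow> integrable lborel (\<lambda>x. norm (?F sc K x) powr p) \<and> (\<integral>x. norm (?F sc K x) powr p \<partial>lborel) \<le> real K * 1)"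
        using False \<Lambda> by (intro exI[of _ "\<lambda>k. \<Lambda> * 2 ^ k"]) auto
    qed simp
  qed
  \<comment> \<open>Solves M times the bound for the denominator <= c K after division by n, where K
    = n^2; the summand 1 guarantees n >= 1.\<close>
  define S where "S = M * \<eta>\<^sup>2 * (B + sqrt J) / c + 1"
  obtain n :: nat where n: "S \<le> real n" using real_arch_simple by blast
  have S1: "S \<ge> 1" unfolding S_def using M B0 J c by simp
  then have n1: "n \<ge> 1" using n by linarith
  \<comment> \<open>A perfect square, so that sqrt K = n.\<close>
  define K where "K = n * n"
  have K1: "K \<ge> 1" using n1 by (simp add: K_def Suc_le_eq)
  obtain sc where sc\<Lambda>: "\<And>k. k < K \<Longrightarrow> sc k \<ge> \<Lambda>" and lac: "\<forall>k. Suc k < K \<longrightarrow> 2 * sc k \<le> sc (Suc k)"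
    and scp: "s < d - 2 \<Longrightarrow> integrable lborel (\<lambda>x. norm (?F sc K x) powr p) \<and> (\<integral>x. norm (?F sc K x) powr p \<partial>lborel) \<le> real K * J"
    using scales[of K] by blast
  have sc0: "sc k > 0" if "k < K" for k using sc\<Lambda>[OF that] \<Lambda> by simp
  define v where "v = (\<lambda>x. multiscale b sc K x *\<^sub>R b)"
  have mb: "bump (multiscale b sc K)" by (rule bump_multiscale[OF sc0])
  have vs: "smooth v"
    unfolding v_def by (rule smooth_bump_linear[OF bounded_linear_scaleR_left mb])
  obtain R0 where R0: "\<And>x. norm x \<ge> R0 \<Longrightarrow> multiscale b sc K x = 0" using bump_bounded_support[OF mb] by blast
  have vc: "compactly_supported v"
    by (rule compactly_supportedI[of R0]) (simp add: v_def R0)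
  define N where "N = cmod (\<integral>(x, y). of_real ((v x - v y) \<bullet> grad (riesz_pot s) (x - y)) * f x * f y \<partial>lebesgue)"
  have N: "N \<ge> real K * c"
  proof -
    let ?cd = "\<lambda>k. commutator_density s b b' (sc k)"
    have int: "integrable (lborel \<Otimes>\<^sub>M lborel) (?cd k)" if "k < K" for k using low(1)[OF sc\<Lambda>[OF that]] .
    have eq: "(\<lambda>(x, y). of_real ((v x - v y) \<bullet> grad (riesz_pot s) (x - y)) * f x * f y) = (\<lambda>p. complex_of_real (- (\<Sum>k<K. ?cd k p)))"
      unfolding v_def f_def by (simp only: commutator_integrand_multiscale case_prod_unfold prod.collapse)
    have int': "integrable (lborel \<Otimes>\<^sub>M lborel) (\<lambda>p. complex_of_real (- (\<Sum>k<K. ?cd k p)))"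
      using int by (intro integrable_of_real integrable_minus Bochner_Integration.integrable_sum) auto
    then have m: "(\<lambda>p. complex_of_real (- (\<Sum>k<K. ?cd k p))) \<in> borel_measurable (lborel :: ((real^'n) \<times> (real^'n)) measure)"
      unfolding lborel_prod by (rule borel_measurable_integrable)
    have "N = cmod (\<integral>p. complex_of_real (- (\<Sum>k<K. ?cd k p)) \<partial>(lborel \<Otimes>\<^sub>M lborel))"
      unfolding N_def eq lborel_prod by (subst integral_completion[OF m]) (rule refl)
    also have "(\<integral>p. complex_of_real (- (\<Sum>k<K. ?cd k p)) \<partial>(lborel \<Otimes>\<^sub>M lborel)) = of_real (\<integral>p. - (\<Sum>k<K. ?cd k p) \<partial>(lborel \<Otimes>\<^sub>M lborel))"
      by (rule integral_complex_of_real)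
    also have "(\<integral>p. - (\<Sum>k<K. ?cd k p) \<partial>(lborel \<Otimes>\<^sub>M lborel)) = - (\<Sum>k<K. \<integral>p. ?cd k p \<partial>(lborel \<Otimes>\<^sub>M lborel))"
      using int by (subst integral_minus, subst Bochner_Integration.integral_sum) auto
    finally have "N = \<bar>\<Sum>k<K. \<integral>p. ?cd k p \<partial>(lborel \<Otimes>\<^sub>M lborel)\<bar>" by (simp only: norm_of_real abs_minus_cancel)
    \<comment> \<open>All scales contribute with the common sign \<sigma>, so there is no
      cancellation in the sum.\<close>
    also have "\<dots> = \<bar>\<sigma> * (\<Sum>k<K. \<integral>p. ?cd k p \<partial>(lborel \<Otimes>\<^sub>M lborel))\<bar>" by (simp add: abs_mult \<sigma>)
    finally have N1: "N = \<bar>\<sigma> * (\<Sum>k<K. \<integral>p. ?cd k p \<partial>(lborel \<Otimes>\<^sub>M lborel))\<bar>" .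
    have "real K * c = (\<Sum>k<K. c)" by simp
    also have "\<dots> \<le> (\<Sum>k<K. \<sigma> * (\<integral>p. ?cd k p \<partial>(lborel \<Otimes>\<^sub>M lborel)))"
      by (rule sum_mono) (rule low(2)[OF sc\<Lambda>], simp)
    also have "\<dots> = \<sigma> * (\<Sum>k<K. \<integral>p. ?cd k p \<partial>(lborel \<Otimes>\<^sub>M lborel))"
      by (rule sum_distrib_left[symmetric])
    also have "\<dots> \<le> N" unfolding N1 by (rule abs_ge_self)
    finally show ?thesis .
  qed
  define T where "T = BMO_seminorm (\<lambda>x. jacobian v (at x))
                      + (if s < d - 2 then Lp_norm p (abs_nabla_pow_vec a v) else 0)"
  have jac: "(\<lambda>x. jacobian v (at x)) = (\<lambda>x. \<Sum>k<K. rank_one_jacobian b ((1 / sc k) *\<^sub>R x))"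
    unfolding v_def by (rule ext, rule jacobian_multiscale[OF sc0])
  have bmo: "BMO_seminorm (\<lambda>x. jacobian v (at x)) \<le> ennreal B"
    unfolding jac using sc0 lac by (intro B) auto
  \<comment> \<open>At the origin every scale contributes the same nonzero matrix, so the Jacobian
    does not vanish identically. This gives a positive denominator.\<close>
  have bmo0: "0 < BMO_seminorm (\<lambda>x. jacobian v (at x))"
    unfolding jac
  proof (rule BMO_seminorm_pos)
    have cont: "continuous_on UNIV (rank_one_jacobian b)"
      by (rule lipschitz_on_continuous_on[of C]) (auto simp: lipschitz_on_def dist_norm C Clip)
    show "continuous_on UNIV (\<lambda>x. \<Sum>k<K. rank_one_jacobian b ((1 / sc k) *\<^sub>R x))"
      by (intro continuous_on_sum continuous_on_compose2[OF cont] continuous_on_scaleR continuous_on_const continuous_on_id subset_UNIV)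
    show "(\<Sum>k<K. rank_one_jacobian b ((1 / sc k) *\<^sub>R x)) = 0" if x: "norm x \<ge> R * (\<Sum>k<K. sc k)" for x
    proof (rule sum.neutral, rule ballI)
      fix k assume k: "k \<in> {..<K}"
      then have "sc k \<le> (\<Sum>k<K. sc k)" using sc0 by (intro member_le_sum) (auto intro: less_imp_le)
      then have "R * sc k \<le> norm x" using x R by (meson mult_left_mono order_trans)
      then show "rank_one_jacobian b ((1 / sc k) *\<^sub>R x) = 0" using sc0[of k] k by (intro Rout) (simp add: field_simps)
    qed
    have "rank_one_jacobian b 0 $ i $ i = exp (- 1)"
      using bump_field_derivative_at_0[OF b] by (simp add: rank_one_jacobian_def matrix_def b_def)
    then have "rank_one_jacobian b 0 $ i $ i \<noteq> 0" by simp
    then have "rank_one_jacobian b 0 \<noteq> 0" by (metis zero_index)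
    then show "(\<Sum>k<K. rank_one_jacobian b ((1 / sc k) *\<^sub>R 0)) \<noteq> 0" using K1 by (simp add: sum_constant_scaleR del: sum_constant)
  qed
  have lp: "Lp_norm p (abs_nabla_pow_vec a v) \<le> ennreal (sqrt (real K * J))" if sd: "s < d - 2"
  proof -
    have a0: "a > 0" using sd by (simp add: a_def)
    have p2: "p \<ge> 2" using sd s d1 by (simp add: p_def field_simps)
    have comp: "abs_nabla_pow_vec a v x = axis i (?F sc K x)" for x
    proof -
      have "abs_nabla_pow a (\<lambda>y. complex_of_real (v y $ j)) x = (if j = i then ?F sc K x else 0)" for j
      proof (cases "j = i")
        case True
        then have "(\<lambda>y. complex_of_real (v y $ j)) = (\<lambda>y. complex_of_real (multiscale b sc K y))"
          by (simp add: v_def b_def)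
        then show ?thesis using True abs_nabla_pow_multiscale[where K=K and sc=sc and b=b and x=x and a=a, OF sc0 a0] by (simp only: \<Psi>_def if_True refl)
      next
        case False
        then have "(\<lambda>y. complex_of_real (v y $ j)) = (\<lambda>y. 0)" by (simp add: v_def b_def axis_def)
        then show ?thesis using False by (simp add: abs_nabla_pow_def fourier_def)
      qed
      then show ?thesis by (simp add: abs_nabla_pow_vec_def axis_def vec_eq_iff)
    qed
    have nrm: "norm (abs_nabla_pow_vec a v x) = norm (?F sc K x)" for x
      unfolding comp norm_vec_def L2_set_def axis_def by (simp add: if_distrib[where f=norm] if_distrib[where f="\<lambda>t. t\<^sup>2"] cong: if_cong)
    have I: "(\<integral>\<^sup>+x. ennreal (norm (abs_nabla_pow_vec a v x) powr p) \<partial>lborel) = ennreal (\<integral>x. norm (?F sc K x) powr p \<partial>lborel)"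
      unfolding nrm using scp[OF sd] by (intro nn_integral_eq_integral) auto
    have I0: "0 \<le> (\<integral>x. norm (?F sc K x) powr p \<partial>lborel)" by (intro Bochner_Integration.integral_nonneg) auto
    \<comment> \<open>With a base at least 1 and p >= 2 the exponent 1/p may be replaced by
      1/2.\<close>
    have KJ: "1 \<le> real K * J" using K1 J mult_mono[of 1 "real K" 1 J] by simp
    have "(\<integral>x. norm (?F sc K x) powr p \<partial>lborel) powr (1 / p) \<le> (real K * J) powr (1 / p)"
      using scp[OF sd] I0 p2 by (intro powr_mono2) auto
    also have "\<dots> \<le> (real K * J) powr (1 / 2)" using KJ p2 by (intro powr_mono) (auto simp: field_simps)
    also have "\<dots> = sqrt (real K * J)" using KJ by (simp add: powr_half_sqrt)
    finally show ?thesis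
      unfolding Lp_norm_lborel I Let_def using I0 by (simp add: ennreal_leI)
  qed
  have T0: "0 < T" unfolding T_def using bmo0 by (simp add: add_pos_nonneg)
  have "T \<le> ennreal B + ennreal (sqrt (real K * J))"
    unfolding T_def using bmo lp by (intro add_mono) auto
  also have "\<dots> = ennreal (B + sqrt (real K * J))" using B0 J by (intro ennreal_plus[symmetric]) auto
  finally have T: "T \<le> ennreal (B + sqrt (real K * J))" .
  define t where "t = enn2real T"
  have Ti: "T < \<infinity>" using T by (auto simp: less_top[symmetric] top_unique)
  have Tt: "T = ennreal t" and t0: "t > 0" using T0 Ti by (auto simp: t_def enn2real_positive_iff)
  have tB: "t \<le> B + n * sqrt J"
  proof -
    have "t \<le> B + sqrt (real K * J)" using T B0 J unfolding Tt by (subst (asm) ennreal_le_iff) (auto intro!: add_nonneg_nonneg mult_nonneg_nonneg)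
    then show ?thesis by (simp add: K_def real_sqrt_mult)
  qed
  have main: "M * (t * \<eta> * \<eta>) \<le> N"
  proof -
    have "t \<le> n * (B + sqrt J)"
    proof -
      have "B \<le> n * B" using n1 B0 by (simp add: mult_le_cancel_right1)
      then show ?thesis using tB by (simp add: distrib_left)
    qed
    then have "M * \<eta>\<^sup>2 * t \<le> M * \<eta>\<^sup>2 * (n * (B + sqrt J))" using M by (intro mult_left_mono) auto
    also have "\<dots> = n * (M * \<eta>\<^sup>2 * (B + sqrt J))" by simp
    also have "\<dots> \<le> n * (c * n)"
    proof (rule mult_left_mono)
      have "M * \<eta>\<^sup>2 * (B + sqrt J) / c \<le> n" using n unfolding S_def by simp
      then show "M * \<eta>\<^sup>2 * (B + sqrt J) \<le> c * n" using c by (simp add: field_simps)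
    qed simp
    also have "\<dots> = real K * c" by (simp add: K_def)
    finally show ?thesis using N by (simp add: power2_eq_square mult_ac)
  qed
  define \<delta> where "\<delta> = t * \<eta> * \<eta>"
  have \<delta>: "\<delta> > 0" using t0 \<eta> by (simp add: \<delta>_def)
  have D: "T * h * h = ennreal \<delta>" unfolding Tt h\<eta> \<delta>_def using t0 \<eta> by (simp add: ennreal_mult)
  have "N \<ge> 0" by (simp add: N_def)
  have "ennreal M \<le> ennreal (N / \<delta>)"
    using main \<delta> by (intro ennreal_leI) (simp add: \<delta>_def field_simps)
  also have "\<dots> = ennreal N / ennreal \<delta>" using \<delta> \<open>N \<ge> 0\<close> by (rule divide_ennreal[symmetric, rotated])
  finally have fin: "0 < T * h * h \<and> T * h * h < \<infinity> \<and> ennreal N / (T * h * h) \<ge> ennreal M"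
    using \<delta> by (simp add: D)
  show ?thesis
    unfolding Let_def d_def[symmetric] a_def[symmetric] p_def[symmetric]
  proof (rule exI[of _ v], rule exI[of _ f], rule exI[of _ f], intro conjI vs vc fs fz)
    show "0 < (BMO_seminorm (\<lambda>x. jacobian v (at x)) + (if s < d - 2 then Lp_norm p (abs_nabla_pow_vec a v) else 0))
        * Hdot_norm ((s - d) / 2) f * Hdot_norm ((s - d) / 2) f"
      using fin unfolding T_def h_def by (elim conjE)
    show "(BMO_seminorm (\<lambda>x. jacobian v (at x)) + (if s < d - 2 then Lp_norm p (abs_nabla_pow_vec a v) else 0))
        * Hdot_norm ((s - d) / 2) f * Hdot_norm ((s - d) / 2) f < \<infinity>"
      using fin unfolding T_def h_def by (elim conjE)
    show "ennreal M \<le> ennreal (cmod (\<integral>(x, y). of_real ((v x - v y) \<bullet> grad (riesz_pot s) (x - y)) * f x * f y \<partial>lebesgue))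
        / ((BMO_seminorm (\<lambda>x. jacobian v (at x)) + (if s < d - 2 then Lp_norm p (abs_nabla_pow_vec a v) else 0))
        * Hdot_norm ((s - d) / 2) f * Hdot_norm ((s - d) / 2) f)"
      using fin unfolding T_def h_def N_def by (elim conjE)
  qed
qed

subsection \<open>Lower bound for negative Sobolev norms\<close>

lemma fourier_continuous:
  fixes f :: "'a::euclidean_space \<Rightarrow> complex"
  assumes f: "integrable lborel f"
  shows "continuous_on UNIV (fourier f)"
  unfolding continuous_on_eq_continuous_at[OF open_UNIV] continuous_at_sequentially
proof (intro ballI allI impI)
  fix \<xi> :: 'a and X assume X: "X \<longlonglongrightarrow> \<xi>"
  have [measurable]: "f \<in> borel_measurable borel" using f by auto
  have "(\<lambda>n. \<integral>x. f x * cis (- 2 * pi * (X n \<bullet> x)) \<partial>lborel) \<longlonglongrightarrow> (\<integral>x. f x * cis (- 2 * pi * (\<xi> \<bullet> x)) \<partial>lborel)"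
  proof (rule integral_dominated_convergence[where w="\<lambda>x. norm (f x)"])
    show "AE x in lborel. (\<lambda>n. f x * cis (- 2 * pi * (X n \<bullet> x))) \<longlonglongrightarrow> f x * cis (- 2 * pi * (\<xi> \<bullet> x))"
    proof (rule AE_I2)
      fix x
      have "continuous_on UNIV cis" by (intro continuous_intros)
      then have "isCont cis t" for t by (simp add: continuous_on_eq_continuous_at)
      then have "(\<lambda>n. cis (- 2 * pi * (X n \<bullet> x))) \<longlonglongrightarrow> cis (- 2 * pi * (\<xi> \<bullet> x))"
        by (rule isCont_tendsto_compose) (intro tendsto_intros X)
      then show "(\<lambda>n. f x * cis (- 2 * pi * (X n \<bullet> x))) \<longlonglongrightarrow> f x * cis (- 2 * pi * (\<xi> \<bullet> x))"
        by (rule tendsto_mult[OF tendsto_const])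
    qed
    show "AE x in lborel. norm (f x * cis (- 2 * pi * (X n \<bullet> x))) \<le> norm (f x)" for n
      by (simp add: norm_mult)
    show "(\<lambda>x. f x * cis (- 2 * pi * (X n \<bullet> x))) \<in> borel_measurable lborel" for n by measurable
  qed (use f in auto)
  then show "(fourier f \<circ> X) \<longlonglongrightarrow> fourier f \<xi>" by (simp only: fourier_cis comp_def)
qed

text \<open>For \<open>-1 < a < 0\<close> the zero of the Fourier transform at the origin makes the symbol bounded and
  continuous, so that Plancherel's identity holds with equality.\<close>

lemma Hdot_lower_bound:
  fixes f :: "'a::euclidean_space \<Rightarrow> complex"
  assumes f: "schwartz f" and z: "zero_mean f" and a: "- 1 < a" "a < 0"
  shows "(\<integral>\<^sup>+\<xi>. ennreal ((norm (abs_nabla_symbol a f \<xi>))\<^sup>2) \<partial>lborel)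
    \<le> (\<integral>\<^sup>+x. ennreal ((norm (abs_nabla_pow a f x))\<^sup>2) \<partial>lborel)"
proof -
  have [measurable]: "f \<in> borel_measurable borel" by (rule schwartz_measurable[OF f])
  note fi = schwartz_integrable[OF f]
  define C where "C = 2 * pi * (\<integral>x. norm x * norm (f x) \<partial>lborel)"
  have near: "norm (fourier f \<xi>) \<le> C * norm \<xi> ^ 1" for \<xi>
    using fourier_zero_mean_bound[OF fi z, of \<xi>] by (simp add: C_def mult_ac)
  have u: "integrable lborel (abs_nabla_symbol a f)"
    by (rule schwartz_symbol_integrable_zero_mean[OF f z]) (use a in \<open>simp add: field_simps add_pos_nonneg\<close>)
  let ?u = "abs_nabla_symbol a f"
  have C0: "C \<ge> 0" unfolding C_def by (intro mult_nonneg_nonneg Bochner_Integration.integral_nonneg) auto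
  have u_norm: "norm (?u \<xi>) = (2 * pi) powr a * norm \<xi> powr a * norm (fourier f \<xi>)" for \<xi>
    by (simp add: abs_nabla_symbol_def norm_mult powr_mult)
  have un: "norm (?u \<xi>) \<le> (2 * pi) powr a * C * norm \<xi> powr (a + 1)" for \<xi>
  proof (cases "\<xi> = 0")
    case False
    have "norm (?u \<xi>) \<le> ((2 * pi) powr a * norm \<xi> powr a) * (C * norm \<xi> ^ 1)"
      unfolding u_norm by (intro mult_left_mono near) auto
    then show ?thesis using False by (simp add: powr_add mult_ac)
  qed (simp add: abs_nabla_symbol_def)
  have cont: "continuous_on UNIV ?u"
    unfolding continuous_on_eq_continuous_at[OF open_UNIV]
  proof
    fix \<xi> :: 'a
    show "isCont ?u \<xi>"
    proof (cases "\<xi> = 0")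
      case True
      have "((\<lambda>\<xi>::'a. (2 * pi) powr a * C * norm \<xi> powr (a + 1)) \<longlongrightarrow> (2 * pi) powr a * C * norm (0::'a) powr (a + 1)) (at 0)"
        using a by (intro tendsto_intros tendsto_powr') auto
      then have "((\<lambda>\<xi>::'a. (2 * pi) powr a * C * norm \<xi> powr (a + 1)) \<longlongrightarrow> 0) (at 0)" by simp
      then have "(?u \<longlongrightarrow> 0) (at 0)"
        by (rule Lim_null_comparison[rotated]) (use un in auto)
      then show ?thesis using True by (simp add: isCont_def abs_nabla_symbol_def)
    next
      case False
      have "isCont (fourier f) \<xi>" using fourier_continuous[OF fi(1)] by (simp add: continuous_on_eq_continuous_at)
      then show ?thesis unfolding abs_nabla_symbol_def[abs_def] using False
        by (intro continuous_intros) auto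
    qed
  qed
  obtain C' where C': "\<And>\<xi>. norm (fourier f \<xi>) \<le> C'" using norm_fourier_le by blast
  have "norm (?u \<xi>) \<le> (2 * pi) powr a * max C C'" for \<xi>
  proof (cases "norm \<xi> \<le> 1")
    case True
    have "norm \<xi> powr (a + 1) \<le> 1" using True a powr_mono2[of "a + 1" "norm \<xi>" 1] by simp
    then have "(2 * pi) powr a * C * norm \<xi> powr (a + 1) \<le> (2 * pi) powr a * C * 1"
      using C0 by (intro mult_left_mono) auto
    also have "\<dots> \<le> (2 * pi) powr a * max C C'" by (simp add: mult_left_mono)
    finally show ?thesis using un[of \<xi>] by linarith
  next
    case False
    have "(2 * pi * norm \<xi>) powr a \<le> (2 * pi * 1) powr a" using False a by (intro powr_mono2') auto
    then have "norm (?u \<xi>) \<le> (2 * pi) powr a * C'"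
      unfolding abs_nabla_symbol_def norm_mult using C'[of \<xi>] by (intro mult_mono) auto
    also have "\<dots> \<le> (2 * pi) powr a * max C C'" by (simp add: mult_left_mono)
    finally show ?thesis .
  qed
  then show ?thesis unfolding abs_nabla_pow_symbol by (rule inverse_fourier_L2_ge[OF u cont])
qed

subsection \<open>Cauchy integrals of Schwartz functions\<close>

text \<open>Integrability is assumed separately, so only the limit of F along the integers is
  required.\<close>

lemma integral_FTC_half_line:
  fixes f F :: "real \<Rightarrow> 'a::euclidean_space"
  assumes F: "\<And>x. x \<ge> 0 \<Longrightarrow> (F has_vector_derivative f x) (at x)"
    and c: "continuous_on {0..} f" and i: "integrable lborel (\<lambda>x. indicator {0..} x *\<^sub>R f x)"
    and L: "(\<lambda>n. F (real n)) \<longlonglongrightarrow> L"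
  shows "(\<integral>x. indicator {0..} x *\<^sub>R f x \<partial>lborel) = L - F 0"
proof (rule LIMSEQ_unique)
  have n: "(\<integral>x. indicator {0..real n} x *\<^sub>R f x \<partial>lborel) = F (real n) - F 0" for n
    by (rule integral_FTC_Icc) (auto intro: has_vector_derivative_at_within F continuous_on_subset[OF c])
  show "(\<lambda>n. \<integral>x. indicator {0..real n} x *\<^sub>R f x \<partial>lborel) \<longlonglongrightarrow> L - F 0"
    unfolding n by (intro tendsto_intros L)
  show "(\<lambda>n. \<integral>x. indicator {0..real n} x *\<^sub>R f x \<partial>lborel) \<longlonglongrightarrow> (\<integral>x. indicator {0..} x *\<^sub>R f x \<partial>lborel)"
  proof (rule integral_dominated_convergence[where w="\<lambda>x. norm (indicator {0..} x *\<^sub>R f x)"])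
    show "AE x in lborel. (\<lambda>n. indicator {0..real n} x *\<^sub>R f x) \<longlonglongrightarrow> indicator {0..} x *\<^sub>R f x"
    proof (rule AE_I2)
      fix x :: real
      obtain N where N: "x \<le> real N" using real_arch_simple by blast
      have "\<forall>\<^sub>F n in sequentially. indicator {0..real n} x *\<^sub>R f x = indicator {0..} x *\<^sub>R f x"
        using eventually_ge_at_top[of N] by eventually_elim (use N in \<open>auto simp: indicator_def\<close>)
      then show "(\<lambda>n. indicator {0..real n} x *\<^sub>R f x) \<longlonglongrightarrow> indicator {0..} x *\<^sub>R f x" by (rule tendsto_eventually)
    qed
    show "AE x in lborel. norm (indicator {0..real n} x *\<^sub>R f x) \<le> norm (indicator {0..} x *\<^sub>R f x)" for n
      by (auto simp: indicator_def)
    have m: "(\<lambda>x. indicator {0..} x *\<^sub>R f x) \<in> borel_measurable lborel" using i by (rule borel_measurable_integrable)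
    then show "(\<lambda>x. indicator {0..} x *\<^sub>R f x) \<in> borel_measurable lborel" .
    have "(\<lambda>x. indicator {0..real n} x *\<^sub>R f x) = (\<lambda>x. indicator {0..real n} x *\<^sub>R (indicator {0..} x *\<^sub>R f x))" for n
      by (auto simp: indicator_def)
    then show "(\<lambda>x. indicator {0..real n} x *\<^sub>R f x) \<in> borel_measurable lborel" for n
      by (rule ssubst) (rule borel_measurable_scaleR[OF _ m], simp)
  qed (rule integrable_norm[OF i])
qed

lemma integral_exp_half_line:
  fixes w :: complex
  assumes w: "Re w > 0"
  shows "integrable lborel (\<lambda>x. indicator {0..} x *\<^sub>R exp (- w * of_real x))"
    and "(\<integral>x. indicator {0..} x *\<^sub>R exp (- w * of_real x) \<partial>lborel) = 1 / w"
proof -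
  have w0: "w \<noteq> 0" using w by auto
  have "filterlim (\<lambda>x. - Re w * x) at_bot at_top"
    by (rule filterlim_tendsto_neg_mult_at_bot[OF tendsto_const _ filterlim_ident]) (use w in simp)
  then have e0: "((\<lambda>x. exp (- Re w * x)) \<longlongrightarrow> 0) at_top" by (rule filterlim_compose[OF exp_at_bot])
  have c: "continuous_on UNIV (\<lambda>x. exp (- w * of_real x))" by (intro continuous_intros)
  have m: "(\<lambda>x::real. exp (- w * of_real x)) \<in> borel_measurable borel" by (rule borel_measurable_continuous_onI[OF c])
  have nrm: "norm (exp (- w * of_real x)) = exp (- Re w * x)" for x by simp
  have "(\<integral>\<^sup>+x. ennreal (exp (- Re w * x)) * indicator {0..} x \<partial>lborel) = ennreal (0 - (- (1 / Re w) * exp (- Re w * 0)))"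
  proof (rule nn_integral_FTC_atLeast)
    show "((\<lambda>x. - (1 / Re w) * exp (- Re w * x)) has_real_derivative exp (- Re w * x)) (at x)" for x
      using w by (auto intro!: derivative_eq_intros)
    note e0
    then have "((\<lambda>x. - (1 / Re w) * exp (- Re w * x)) \<longlongrightarrow> - (1 / Re w) * 0) at_top" by (intro tendsto_intros)
    then show "((\<lambda>x. - (1 / Re w) * exp (- Re w * x)) \<longlongrightarrow> 0) at_top" by simp
  qed auto
  then have "(\<integral>\<^sup>+x. ennreal (exp (- Re w * x)) * indicator {0..} x \<partial>lborel) < \<infinity>" by simp
  moreover have "(\<integral>\<^sup>+x. norm (indicator {0..} x *\<^sub>R exp (- w * of_real x)) \<partial>lborel) = (\<integral>\<^sup>+x. ennreal (exp (- Re w * x)) * indicator {0..} x \<partial>lborel)"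
    by (intro nn_integral_cong) (simp add: indicator_def)
  ultimately show i: "integrable lborel (\<lambda>x. indicator {0..} x *\<^sub>R exp (- w * of_real x))"
    using m by (intro integrableI_bounded) auto
  have "(\<lambda>n. exp (- Re w * real n)) \<longlonglongrightarrow> 0" by (rule filterlim_compose[OF e0 filterlim_real_sequentially])
  then have "(\<lambda>n. norm (exp (- w * of_real (real n)))) \<longlonglongrightarrow> 0" by (simp only: nrm)
  then have "(\<lambda>n. exp (- w * of_real (real n))) \<longlonglongrightarrow> 0" by (rule tendsto_norm_zero_cancel)
  then have "(\<lambda>n. - (1 / w) * exp (- w * of_real (real n))) \<longlonglongrightarrow> - (1 / w) * 0" by (intro tendsto_intros)
  then have L: "(\<lambda>n. - (1 / w) * exp (- w * of_real (real n))) \<longlonglongrightarrow> 0" by simp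
  have "(\<integral>x. indicator {0..} x *\<^sub>R exp (- w * of_real x) \<partial>lborel) = 0 - (- (1 / w) * exp (- w * of_real 0))"
  proof (rule integral_FTC_half_line[OF _ _ i L])
    show "((\<lambda>x. - (1 / w) * exp (- w * of_real x)) has_vector_derivative exp (- w * of_real x)) (at x)" for x
    proof -
      have "((\<lambda>z. - (1 / w) * exp (- w * z)) has_field_derivative exp (- w * of_real x)) (at (of_real x))"
        using w0 by (auto intro!: derivative_eq_intros)
      from has_vector_derivative_real_field[OF this] show ?thesis .
    qed
  qed (intro continuous_intros)
  then show "(\<integral>x. indicator {0..} x *\<^sub>R exp (- w * of_real x) \<partial>lborel) = 1 / w" by simp
qed

text \<open>The Cauchy integral at the point x + i y, without the factor 1 / (2 pi i); y may have
  either sign.\<close>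

definition cauchy_integral :: "(real \<Rightarrow> complex) \<Rightarrow> real \<Rightarrow> real \<Rightarrow> complex" where
  "cauchy_integral f x y = (\<integral>a. f a / (of_real (a - x) - \<i> * of_real y) \<partial>lborel)"

lemma cauchy_integral_measurable [measurable]:
  assumes [measurable]: "f \<in> borel_measurable borel" "h \<in> borel_measurable M" "k \<in> borel_measurable M"
  shows "(\<lambda>p. cauchy_integral f (h p) (k p)) \<in> borel_measurable M"
  unfolding cauchy_integral_def by (rule lborel.borel_measurable_lebesgue_integral) measurable

lemma sign_cases:
  fixes \<sigma> :: real assumes "\<bar>\<sigma>\<bar> = 1" obtains "\<sigma> = 1" | "\<sigma> = -1"
  using assms by (auto simp: abs_if split: if_splits)

text \<open>The Cauchy kernel is the integral of an exponential over a half line of frequencies, the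
  positive ones for the upper and the negative ones for the lower half plane. This identifies the
  Cauchy integral with a damped half of the Fourier inversion.\<close>

lemma cauchy_integral_fourier:
  fixes f :: "real \<Rightarrow> complex"
  assumes f: "integrable lborel f" and s: "\<bar>\<sigma>\<bar> = 1" and y: "y > 0"
  shows "integrable lborel (\<lambda>\<xi>. indicator {0..} (\<sigma> * \<xi>) *\<^sub>R (of_real (exp (- 2 * pi * y * (\<sigma> * \<xi>))) * fourier f \<xi>))"
    and "cauchy_integral f x (\<sigma> * y) = 2 * pi * \<i> * \<sigma> *
      inverse_fourier (\<lambda>\<xi>. indicator {0..} (\<sigma> * \<xi>) *\<^sub>R (of_real (exp (- 2 * pi * y * (\<sigma> * \<xi>))) * fourier f \<xi>)) x"
proof -
  have ss: "\<sigma> * \<sigma> = 1" and s0: "\<sigma> \<noteq> 0" using s by (auto elim: sign_cases)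
  have [measurable]: "f \<in> borel_measurable borel" using f by auto
  let ?e = "\<lambda>\<xi>. complex_of_real (indicator {0..} (\<sigma> * \<xi>) * exp (- 2 * pi * y * (\<sigma> * \<xi>)))"
  have ei: "integrable lborel ?e"
  proof -
    have "integrable lborel (\<lambda>x::real. indicator {0..} x *\<^sub>R exp (- of_real (2 * pi * y) * complex_of_real x))"
      using y by (intro integral_exp_half_line(1)) simp
    also have "(\<lambda>x::real. indicator {0..} x *\<^sub>R exp (- of_real (2 * pi * y) * complex_of_real x)) = (\<lambda>x. complex_of_real (indicator {0..} x * exp (- 2 * pi * y * x)))"
      by (simp add: fun_eq_iff scaleR_conv_of_real exp_of_real[symmetric])
    finally have 1: "integrable lborel (\<lambda>x. complex_of_real (indicator {0..} x * exp (- 2 * pi * y * x)))" .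
    show ?thesis using lborel_integrable_real_affine[OF 1 s0, of 0] by simp
  qed
  obtain C where C: "\<And>\<xi>. norm (fourier f \<xi>) \<le> C" using norm_fourier_le by blast
  have "integrable lborel (\<lambda>\<xi>. ?e \<xi> * fourier f \<xi>)"
    by (rule integrable_mult_bounded[OF ei _ C]) measurable
  then show ui: "integrable lborel (\<lambda>\<xi>. indicator {0..} (\<sigma> * \<xi>) *\<^sub>R (of_real (exp (- 2 * pi * y * (\<sigma> * \<xi>))) * fourier f \<xi>))"
    by (simp add: scaleR_conv_of_real mult_ac)
  let ?K = "\<lambda>\<xi> a. ?e \<xi> * f a * cis (2 * pi * (\<xi> * (x - a)))"
  have "integrable (lborel \<Otimes>\<^sub>M lborel) (\<lambda>p. ?e (fst p) * f (snd p) * cis (2 * pi * (fst p * (x - snd p))))"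
    by (intro integrable_mult_cis integrable_pair_mult ei f) measurable
  also have "(\<lambda>p. ?e (fst p) * f (snd p) * cis (2 * pi * (fst p * (x - snd p)))) = case_prod ?K"
    by (simp add: fun_eq_iff)
  finally have Ki: "integrable (lborel \<Otimes>\<^sub>M lborel) (case_prod ?K)" .
  have "inverse_fourier (\<lambda>\<xi>. indicator {0..} (\<sigma> * \<xi>) *\<^sub>R (of_real (exp (- 2 * pi * y * (\<sigma> * \<xi>))) * fourier f \<xi>)) x
    = (\<integral>\<xi>. (\<integral>a. ?K \<xi> a \<partial>lborel) \<partial>lborel)"
    unfolding inverse_fourier_def
  proof (rule Bochner_Integration.integral_cong[OF refl])
    fix \<xi> :: real
    have "(\<integral>a. ?K \<xi> a \<partial>lborel) = (\<integral>a. (?e \<xi> * cis (2 * pi * (\<xi> * x))) * (f a * cis (- 2 * pi * (\<xi> * a))) \<partial>lborel)"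
      by (intro Bochner_Integration.integral_cong refl) (simp add: cis_mult right_diff_distrib mult_ac flip: cis_mult; simp add: cis_mult algebra_simps)
    also have "\<dots> = (?e \<xi> * cis (2 * pi * (\<xi> * x))) * fourier f \<xi>"
      unfolding fourier_cis inner_real_def by (rule integral_mult_right_zero)
    finally show "indicator {0..} (\<sigma> * \<xi>) *\<^sub>R (of_real (exp (- 2 * pi * y * (\<sigma> * \<xi>))) * fourier f \<xi>) * cis (2 * pi * (\<xi> \<bullet> x)) = (\<integral>a. ?K \<xi> a \<partial>lborel)"
      by (simp add: scaleR_conv_of_real mult_ac)
  qed
  also have "\<dots> = (\<integral>a. (\<integral>\<xi>. ?K \<xi> a \<partial>lborel) \<partial>lborel)"
    by (rule lborel_pair.Fubini_integral[OF Ki, symmetric])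
  also have "(\<lambda>a. \<integral>\<xi>. ?K \<xi> a \<partial>lborel) = (\<lambda>a. (1 / (2 * pi * \<i> * \<sigma>)) * (f a / (of_real (a - x) - \<i> * of_real (\<sigma> * y))))"
  proof
    fix a
    \<comment> \<open>The decay rate of the exponential in the frequency; its real part 2 pi y is
      positive in both half planes.\<close>
    define w where "w = complex_of_real (2 * pi * y) - \<i> * of_real (2 * pi * \<sigma> * (x - a))"
    have Rw: "Re w > 0" using y by (simp add: w_def)
    have "(\<integral>\<xi>. ?K \<xi> a \<partial>lborel) = \<bar>\<sigma>\<bar> *\<^sub>R (\<integral>u. ?K (0 + \<sigma> * u) a \<partial>lborel)"
      by (rule lborel_integral_real_affine[OF s0])
    also have "(\<lambda>u. ?K (0 + \<sigma> * u) a) = (\<lambda>u. f a * (indicator {0..} u *\<^sub>R exp (- w * of_real u)))"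
    proof
      fix u
      have "exp (- w * of_real u) = of_real (exp (- 2 * pi * y * u)) * cis (2 * pi * (\<sigma> * u * (x - a)))"
        unfolding w_def by (simp add: cis_conv_exp exp_of_real[symmetric] exp_add[symmetric] algebra_simps)
      moreover have ssu: "\<sigma> * (\<sigma> * t) = t" for t using ss by (simp add: mult.assoc[symmetric])
      ultimately show "?K (0 + \<sigma> * u) a = f a * (indicator {0..} u *\<^sub>R exp (- w * of_real u))"
        by (simp only: add_0 ssu) (simp add: scaleR_conv_of_real mult_ac)
    qed
    also have "(\<integral>u. f a * (indicator {0..} u *\<^sub>R exp (- w * of_real u)) \<partial>lborel) = f a * (1 / w)"
      by (subst integral_mult_right_zero) (simp only: integral_exp_half_line(2)[OF Rw])
    finally have I: "(\<integral>\<xi>. ?K \<xi> a \<partial>lborel) = f a * (1 / w)" using s by simp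
    have "w = (2 * pi * \<i> * \<sigma>) * (of_real (a - x) - \<i> * of_real (\<sigma> * y))"
    proof -
      have "complex_of_real \<sigma> * of_real \<sigma> = 1" using ss by (metis of_real_1 of_real_mult)
      then have "(2 * pi * \<i> * \<sigma>) * (\<i> * of_real (\<sigma> * y)) = - of_real (2 * pi * y)"
        by (simp add: mult_ac)
      then show ?thesis unfolding w_def by (simp add: right_diff_distrib)
    qed
    then show "(\<integral>\<xi>. ?K \<xi> a \<partial>lborel) = (1 / (2 * pi * \<i> * \<sigma>)) * (f a / (of_real (a - x) - \<i> * of_real (\<sigma> * y)))"
      unfolding I by simp
  qed
  finally show "cauchy_integral f x (\<sigma> * y) = 2 * pi * \<i> * \<sigma> *
      inverse_fourier (\<lambda>\<xi>. indicator {0..} (\<sigma> * \<xi>) *\<^sub>R (of_real (exp (- 2 * pi * y * (\<sigma> * \<xi>))) * fourier f \<xi>)) x"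
    unfolding cauchy_integral_def using s0 by (simp only: integral_mult_right_zero) simp
qed

text \<open>The upper Plancherel bound on a horizontal line; 4 pi^2 is the squared modulus of the
  factor 2 pi i.\<close>

lemma cauchy_integral_L2_line:
  fixes f :: "real \<Rightarrow> complex"
  assumes f: "integrable lborel f" and s: "\<bar>\<sigma>\<bar> = 1" and y: "y > 0"
  shows "(\<integral>\<^sup>+x. ennreal ((norm (cauchy_integral f x (\<sigma> * y)))\<^sup>2) \<partial>lborel)
    \<le> ennreal (4 * pi\<^sup>2) * (\<integral>\<^sup>+\<xi>. ennreal ((norm (fourier f \<xi>))\<^sup>2) * (indicator {0..} (\<sigma> * \<xi>) * ennreal (exp (- 4 * pi * \<bar>\<xi>\<bar> * y))) \<partial>lborel)"
proof -
  let ?u = "\<lambda>\<xi>. indicator {0..} (\<sigma> * \<xi>) *\<^sub>R (complex_of_real (exp (- 2 * pi * y * (\<sigma> * \<xi>))) * fourier f \<xi>)"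
  have [measurable]: "f \<in> borel_measurable borel" using f by auto
  have um[measurable]: "?u \<in> borel_measurable borel" by measurable
  have nrm: "(norm (cauchy_integral f x (\<sigma> * y)))\<^sup>2 = 4 * pi\<^sup>2 * (norm (inverse_fourier ?u x))\<^sup>2" for x
    unfolding cauchy_integral_fourier(2)[OF f s y] norm_mult using s
    by (simp add: power_mult_distrib)
  have "(\<integral>\<^sup>+x. ennreal ((norm (cauchy_integral f x (\<sigma> * y)))\<^sup>2) \<partial>lborel)
    = ennreal (4 * pi\<^sup>2) * (\<integral>\<^sup>+x. ennreal ((norm (inverse_fourier ?u x))\<^sup>2) \<partial>lborel)"
    unfolding nrm by (subst nn_integral_cmult[symmetric]) (auto simp: ennreal_mult)
  also have "\<dots> \<le> ennreal (4 * pi\<^sup>2) * (\<integral>\<^sup>+\<xi>. ennreal ((norm (?u \<xi>))\<^sup>2) \<partial>lborel)"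
    by (intro mult_left_mono inverse_fourier_L2_le cauchy_integral_fourier(1) f s y) auto
  also have "(\<lambda>\<xi>. ennreal ((norm (?u \<xi>))\<^sup>2)) = (\<lambda>\<xi>. ennreal ((norm (fourier f \<xi>))\<^sup>2) * (indicator {0..} (\<sigma> * \<xi>) * ennreal (exp (- 4 * pi * \<bar>\<xi>\<bar> * y))))"
  proof
    fix \<xi> :: real
    show "ennreal ((norm (?u \<xi>))\<^sup>2) = ennreal ((norm (fourier f \<xi>))\<^sup>2) * (indicator {0..} (\<sigma> * \<xi>) * ennreal (exp (- 4 * pi * \<bar>\<xi>\<bar> * y)))"
    proof (cases "\<sigma> * \<xi> \<ge> 0")
      case True
      then have "\<sigma> * \<xi> = \<bar>\<xi>\<bar>" using s by (metis abs_mult abs_of_nonneg mult_1)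
      then have "(norm (?u \<xi>))\<^sup>2 = (exp (- 2 * pi * y * \<bar>\<xi>\<bar>))\<^sup>2 * (norm (fourier f \<xi>))\<^sup>2"
        using True by (simp add: norm_mult power_mult_distrib)
      also have "(exp (- 2 * pi * y * \<bar>\<xi>\<bar>))\<^sup>2 = exp (- 4 * pi * \<bar>\<xi>\<bar> * y)"
        by (simp add: power2_eq_square exp_add[symmetric] algebra_simps)
      finally show ?thesis using True by (simp add: ennreal_mult mult.commute)
    qed simp
  qed
  finally show ?thesis .
qed

text \<open>Integrating exp(-4 pi |\<xi>| y) over the height gives 1 / (4 pi |\<xi>|), half of the
  weight of the negative Sobolev norm of order 1/2; this half turns 4 pi^2 into 2 pi^2.\<close>

lemma cauchy_integral_L2_half_plane:
  fixes f :: "real \<Rightarrow> complex"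
  assumes f: "schwartz f" and z: "zero_mean f" and s: "\<bar>\<sigma>\<bar> = 1"
  shows "(\<integral>\<^sup>+y. indicator {0<..} y * (\<integral>\<^sup>+x. ennreal ((norm (cauchy_integral f x (\<sigma> * y)))\<^sup>2) \<partial>lborel) \<partial>lborel)
    \<le> ennreal (2 * pi\<^sup>2) * (\<integral>\<^sup>+x. ennreal ((norm (abs_nabla_pow (- 1 / 2) f x))\<^sup>2) \<partial>lborel)"
proof -
  note fi = schwartz_integrable(1)[OF f]
  have [measurable]: "f \<in> borel_measurable borel" using fi by auto
  let ?g = "\<lambda>y \<xi>. ennreal ((norm (fourier f \<xi>))\<^sup>2) * (indicator {0..} (\<sigma> * \<xi>) * ennreal (exp (- 4 * pi * \<bar>\<xi>\<bar> * y)))"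
  have "(\<integral>\<^sup>+\<xi>. (\<integral>\<^sup>+y. indicator {0<..} y * ?g y \<xi> \<partial>lborel) \<partial>lborel) \<le> (\<integral>\<^sup>+\<xi>. ennreal (1/2) * ennreal ((norm (abs_nabla_symbol (- 1 / 2) f \<xi>))\<^sup>2) \<partial>lborel)"
  proof (rule nn_integral_mono_AE)
    have "AE \<xi> in lborel. \<xi> \<noteq> (0::real)" by (rule AE_I[where N="{0}"]) auto
    then show "AE \<xi> in lborel. (\<integral>\<^sup>+y. indicator {0<..} y * ?g y \<xi> \<partial>lborel) \<le> ennreal (1/2) * ennreal ((norm (abs_nabla_symbol (- 1 / 2) f \<xi>))\<^sup>2)"
    proof eventually_elim
      case (elim \<xi>)
      let ?c = "4 * pi * \<bar>\<xi>\<bar>"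
      have c: "?c > 0" using elim by simp
      have "(\<integral>\<^sup>+y. indicator {0<..} y * ?g y \<xi> \<partial>lborel) \<le> (\<integral>\<^sup>+y. ennreal ((norm (fourier f \<xi>))\<^sup>2) * (ennreal (exp (- ?c * y)) * indicator {0..} y) \<partial>lborel)"
        by (intro nn_integral_mono) (auto simp: indicator_def mult_left_mono)
      also have "\<dots> = ennreal ((norm (fourier f \<xi>))\<^sup>2) * (\<integral>\<^sup>+y. ennreal (exp (- ?c * y)) * indicator {0..} y \<partial>lborel)"
        by (rule nn_integral_cmult) measurable
      also have "(\<integral>\<^sup>+y. ennreal (exp (- ?c * y)) * indicator {0..} y \<partial>lborel) = ennreal (0 - (- (1 / ?c) * exp (- ?c * 0)))"
      proof (rule nn_integral_FTC_atLeast)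
        show "((\<lambda>x. - (1 / ?c) * exp (- ?c * x)) has_real_derivative exp (- ?c * x)) (at x)" for x
          using c by (auto intro!: derivative_eq_intros)
        have "filterlim (\<lambda>x. - ?c * x) at_bot at_top"
          by (rule filterlim_tendsto_neg_mult_at_bot[OF tendsto_const _ filterlim_ident]) (use c in linarith)
        then have "((\<lambda>x. exp (- ?c * x)) \<longlongrightarrow> 0) at_top" by (rule filterlim_compose[OF exp_at_bot])
        then have "((\<lambda>x. - (1 / ?c) * exp (- ?c * x)) \<longlongrightarrow> - (1 / ?c) * 0) at_top" by (intro tendsto_intros)
        then show "((\<lambda>x. - (1 / ?c) * exp (- ?c * x)) \<longlongrightarrow> 0) at_top" by simp
      qed auto
      also have "ennreal ((norm (fourier f \<xi>))\<^sup>2) * ennreal (0 - (- (1 / ?c) * exp (- ?c * 0))) = ennreal ((norm (fourier f \<xi>))\<^sup>2 / ?c)"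
        using c by (simp add: ennreal_mult[symmetric])
      also have "(norm (fourier f \<xi>))\<^sup>2 / ?c = (1/2) * (norm (abs_nabla_symbol (- 1 / 2) f \<xi>))\<^sup>2"
      proof -
        have "((2 * pi * \<bar>\<xi>\<bar>) powr (- 1 / 2))\<^sup>2 = (2 * pi * \<bar>\<xi>\<bar>) powr (- 1)"
          by (simp add: power2_eq_square powr_add[symmetric])
        also have "\<dots> = 1 / (2 * pi * \<bar>\<xi>\<bar>)" using elim by (simp add: powr_minus_divide)
        finally show ?thesis
          by (simp add: abs_nabla_symbol_def norm_mult power_mult_distrib)
      qed
      also have "ennreal ((1/2) * (norm (abs_nabla_symbol (- 1 / 2) f \<xi>))\<^sup>2) = ennreal (1/2) * ennreal ((norm (abs_nabla_symbol (- 1 / 2) f \<xi>))\<^sup>2)"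
        by (rule ennreal_mult) auto
      finally show ?case .
    qed
  qed
  also have "\<dots> = ennreal (1/2) * (\<integral>\<^sup>+\<xi>. ennreal ((norm (abs_nabla_symbol (- 1 / 2) f \<xi>))\<^sup>2) \<partial>lborel)"
    unfolding abs_nabla_symbol_def by (rule nn_integral_cmult) measurable
  \<comment> \<open>The Sobolev norm is the L2 norm of an inverse Fourier integral, so returning to
    it from the frequency side takes the lower Plancherel bound.\<close>
  also have "\<dots> \<le> ennreal (1/2) * (\<integral>\<^sup>+x. ennreal ((norm (abs_nabla_pow (- 1 / 2) f x))\<^sup>2) \<partial>lborel)"
    by (intro mult_left_mono Hdot_lower_bound f z) auto
  finally have le: "(\<integral>\<^sup>+\<xi>. (\<integral>\<^sup>+y. indicator {0<..} y * ?g y \<xi> \<partial>lborel) \<partial>lborel) \<le> ennreal (1/2) * (\<integral>\<^sup>+x. ennreal ((norm (abs_nabla_pow (- 1 / 2) f x))\<^sup>2) \<partial>lborel)" .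
  have "(\<integral>\<^sup>+y. indicator {0<..} y * (\<integral>\<^sup>+x. ennreal ((norm (cauchy_integral f x (\<sigma> * y)))\<^sup>2) \<partial>lborel) \<partial>lborel)
    \<le> (\<integral>\<^sup>+y. ennreal (4 * pi\<^sup>2) * (\<integral>\<^sup>+\<xi>. indicator {0<..} y * ?g y \<xi> \<partial>lborel) \<partial>lborel)"
  proof (rule nn_integral_mono)
    fix y :: real
    show "indicator {0<..} y * (\<integral>\<^sup>+x. ennreal ((norm (cauchy_integral f x (\<sigma> * y)))\<^sup>2) \<partial>lborel)
      \<le> ennreal (4 * pi\<^sup>2) * (\<integral>\<^sup>+\<xi>. indicator {0<..} y * ?g y \<xi> \<partial>lborel)"
      using cauchy_integral_L2_line[OF fi s, of y] by (cases "y > 0") (simp_all add: indicator_def)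
  qed
  also have "\<dots> = ennreal (4 * pi\<^sup>2) * (\<integral>\<^sup>+y. (\<integral>\<^sup>+\<xi>. indicator {0<..} y * ?g y \<xi> \<partial>lborel) \<partial>lborel)"
    by (rule nn_integral_cmult) (rule lborel.borel_measurable_nn_integral, measurable)
  also have "(\<integral>\<^sup>+y. (\<integral>\<^sup>+\<xi>. indicator {0<..} y * ?g y \<xi> \<partial>lborel) \<partial>lborel) = (\<integral>\<^sup>+\<xi>. (\<integral>\<^sup>+y. indicator {0<..} y * ?g y \<xi> \<partial>lborel) \<partial>lborel)"
    by (rule lborel_pair.Fubini') measurable
  finally have "(\<integral>\<^sup>+y. indicator {0<..} y * (\<integral>\<^sup>+x. ennreal ((norm (cauchy_integral f x (\<sigma> * y)))\<^sup>2) \<partial>lborel) \<partial>lborel)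
    \<le> ennreal (4 * pi\<^sup>2) * (ennreal (1/2) * (\<integral>\<^sup>+x. ennreal ((norm (abs_nabla_pow (- 1 / 2) f x))\<^sup>2) \<partial>lborel))"
    using mult_left_mono[OF le, of "ennreal (4 * pi\<^sup>2)"] by (rule order_trans) simp
  also have "\<dots> = (ennreal (4 * pi\<^sup>2) * ennreal (1/2)) * (\<integral>\<^sup>+x. ennreal ((norm (abs_nabla_pow (- 1 / 2) f x))\<^sup>2) \<partial>lborel)"
    by (rule mult.assoc[symmetric])
  also have "ennreal (4 * pi\<^sup>2) * ennreal (1/2) = ennreal (2 * pi\<^sup>2)"
    by (subst ennreal_mult[symmetric]) auto
  finally show ?thesis .
qed

subsection \<open>The Cauchy kernel averaged over cones\<close>

text \<open>Odd, hence of mean zero: averaging against it annihilates constants, which is how a mean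
  oscillation arises.\<close>

definition sgn_window :: "real \<Rightarrow> real" where
  "sgn_window s = indicator {-1<..<1} s * sgn s"

text \<open>What the average of 1 / (s + i) or 1 / (s - i) against the window amounts to; the final
  constant is divided by it, so its positivity matters.\<close>

definition window_const :: real where
  "window_const = (\<integral>s. sgn_window s * (s / (s\<^sup>2 + 1)) \<partial>lborel)"

definition cauchy_denom :: "real \<Rightarrow> real \<Rightarrow> real \<Rightarrow> complex" where
  "cauchy_denom a x y = of_real (a - x) - \<i> * of_real y"

text \<open>An integrable majorant in the height y, singular like y^(-1/2) at 0 and decaying like
  y^(-2).\<close>

definition kernel_weight :: "real \<Rightarrow> real" where
  "kernel_weight y = (if y \<le> 0 then 0 else if y < 1 then y powr (- 1 / 2) else y powr (- 2))"

lemma sgn_window_measurable [measurable]: "sgn_window \<in> borel_measurable borel"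
  unfolding sgn_window_def by measurable

lemma kernel_weight_measurable [measurable]: "kernel_weight \<in> borel_measurable borel"
  unfolding kernel_weight_def by measurable

lemma cauchy_denom_measurable [measurable]:
  assumes [measurable]: "f \<in> borel_measurable M" "g \<in> borel_measurable M" "h \<in> borel_measurable M"
  shows "(\<lambda>p. cauchy_denom (f p) (g p) (h p)) \<in> borel_measurable M"
  unfolding cauchy_denom_def by measurable

lemma abs_sgn_window_le: "\<bar>sgn_window s\<bar> \<le> indicator {-1<..<1} s"
  by (auto simp: sgn_window_def indicator_def sgn_if)

lemma sgn_window_minus: "sgn_window (- s) = - sgn_window s"
  by (auto simp: sgn_window_def indicator_def sgn_if)

lemma integrable_window: "integrable lborel (\<lambda>s::real. indicator {-1<..<1} s :: real)"
  by (intro integrable_real_indicator) auto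

lemma integrable_sgn_window_mult:
  fixes h :: "real \<Rightarrow> 'a::{real_normed_algebra_1,banach,second_countable_topology}"
  assumes [measurable]: "h \<in> borel_measurable borel" and h: "\<And>s. norm (h s) \<le> B"
  shows "integrable lborel (\<lambda>s. of_real (sgn_window s) * h s)"
proof (rule Bochner_Integration.integrable_bound)
  show "integrable lborel (\<lambda>s::real. B * (indicator {-1<..<1} s :: real))"
    using integrable_window by (rule integrable_mult_right)
  show "AE s in lborel. norm (of_real (sgn_window s) * h s) \<le> norm (B * (indicator {-1<..<1} s :: real))"
  proof (rule AE_I2)
    fix s
    have "norm (of_real (sgn_window s) * h s) \<le> norm (of_real (sgn_window s) :: 'a) * norm (h s)"
      by (rule norm_mult_ineq)
    also have "\<dots> \<le> indicator {-1<..<1} s * B"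
      using abs_sgn_window_le[of s] h[of s] by (intro mult_mono) auto
    finally show "norm (of_real (sgn_window s) * h s) \<le> norm (B * (indicator {-1<..<1} s :: real))"
      by (simp add: mult.commute)
  qed
qed measurable

lemma window_const_pos: "window_const > 0"
  unfolding window_const_def
proof (rule integral_pos_open[where U="{0<..<1}"])
  have "\<bar>s / (s\<^sup>2 + 1)\<bar> \<le> 1" for s :: real
  proof -
    have "0 \<le> (1 - \<bar>s\<bar>)\<^sup>2" by simp
    then have "\<bar>s\<bar> \<le> s\<^sup>2 + 1" using abs_ge_zero[of s] unfolding power2_diff by simp
    then show ?thesis by (simp add: add_nonneg_pos)
  qed
  then have "integrable lborel (\<lambda>s. of_real (sgn_window s) * (s / (s\<^sup>2 + 1)))"
    by (intro integrable_sgn_window_mult[where B=1]) auto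
  then show "integrable lborel (\<lambda>s. sgn_window s * (s / (s\<^sup>2 + 1)))" by simp
  show "AE s in lborel. 0 \<le> sgn_window s * (s / (s\<^sup>2 + 1))"
    by (rule AE_I2) (auto simp: sgn_window_def indicator_def sgn_if)
  show "0 < sgn_window s * (s / (s\<^sup>2 + 1))" if "s \<in> {0<..<1}" for s
    using that by (auto simp: sgn_window_def indicator_def sgn_if intro!: divide_pos_pos add_nonneg_pos)
qed auto

text \<open>The imaginary part of 1 / (s + i \<sigma>) is even in s and integrates to 0 against the
  odd window, so both half planes give the same real constant.\<close>

lemma sgn_window_divide:
  assumes s: "\<bar>\<sigma>\<bar> = 1"
  shows "(\<integral>s. complex_of_real (sgn_window s) * (1 / (of_real s + \<i> * of_real \<sigma>)) \<partial>lborel) = of_real window_const"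
proof -
  have n: "\<bar>s / (s\<^sup>2 + 1)\<bar> \<le> 1" "\<bar>1 / (s\<^sup>2 + 1)\<bar> \<le> 1" for s :: real
  proof -
    have "0 \<le> (1 - \<bar>s\<bar>)\<^sup>2" by simp
    then have "\<bar>s\<bar> \<le> s\<^sup>2 + 1" using abs_ge_zero[of s] unfolding power2_diff by simp
    then show "\<bar>s / (s\<^sup>2 + 1)\<bar> \<le> 1" "\<bar>1 / (s\<^sup>2 + 1)\<bar> \<le> 1" by (simp_all add: add_nonneg_pos)
  qed
  have i: "integrable lborel (\<lambda>s. of_real (sgn_window s) * (s / (s\<^sup>2 + 1)))"
    "integrable lborel (\<lambda>s. of_real (sgn_window s) * (1 / (s\<^sup>2 + 1)))"
    by (rule integrable_sgn_window_mult[where B=1], measurable, simp only: real_norm_def n)+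
  have split: "complex_of_real (sgn_window s) * (1 / (of_real s + \<i> * of_real \<sigma>))
    = of_real (sgn_window s * (s / (s\<^sup>2 + 1))) - (\<i> * of_real \<sigma>) * of_real (sgn_window s * (1 / (s\<^sup>2 + 1)))" for s
  proof -
    have "(of_real s + \<i> * of_real \<sigma>) * (of_real s - \<i> * of_real \<sigma>) = complex_of_real (s\<^sup>2 + 1)"
      using s by (auto elim: sign_cases simp: algebra_simps power2_eq_square)
    moreover have "complex_of_real (s\<^sup>2 + 1) \<noteq> 0" by (metis of_real_eq_0_iff sum_power2_eq_zero_iff one_neq_zero power_one)
    ultimately have "1 / (of_real s + \<i> * of_real \<sigma>) = (of_real s - \<i> * of_real \<sigma>) / complex_of_real (s\<^sup>2 + 1)"
      by (metis (no_types, lifting) div_by_0 divide_divide_eq_right mult_eq_0_iff nonzero_mult_divide_mult_cancel_right2 mult.right_neutral mult_1)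
    then show ?thesis by (simp add: diff_divide_distrib right_diff_distrib)
  qed
  have odd: "(\<integral>s. sgn_window s * (1 / (s\<^sup>2 + 1)) \<partial>lborel) = 0"
  proof -
    have "(\<integral>s. sgn_window s * (1 / (s\<^sup>2 + 1)) \<partial>lborel) = (\<integral>s. sgn_window (-s) * (1 / ((-s)\<^sup>2 + 1)) \<partial>lborel)"
      using lborel_integral_real_affine[of "-1" "\<lambda>s. sgn_window s * (1 / (s\<^sup>2 + 1))" 0] by simp
    also have "\<dots> = - (\<integral>s. sgn_window s * (1 / (s\<^sup>2 + 1)) \<partial>lborel)"
      by (simp add: sgn_window_minus)
    finally show ?thesis by simp
  qed
  have i1: "integrable lborel (\<lambda>s. complex_of_real (sgn_window s * (s / (s\<^sup>2 + 1))))"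
    and i2: "integrable lborel (\<lambda>s. complex_of_real (sgn_window s * (1 / (s\<^sup>2 + 1))))"
    using i by (simp_all only: complex_of_real_integrable_eq of_real_eq_id id_apply)
  show ?thesis unfolding split window_const_def
    by (subst Bochner_Integration.integral_diff[OF i1 integrable_mult_right[OF i2]])
      (simp only: integral_mult_right_zero integral_complex_of_real odd; simp)
qed

lemma integrable_kernel_weight: "integrable lborel kernel_weight"
proof (rule integrable_power_bounds[where g="-1/2" and h="-2" and C=1])
  show "norm (kernel_weight x) \<le> 1 * norm x powr (-1/2)" if "norm x < 1" "x \<noteq> 0" for x
    using that by (auto simp: kernel_weight_def)
  show "norm (kernel_weight x) \<le> 1 * norm x powr (-2)" if "norm x \<ge> 1" for x
    using that by (auto simp: kernel_weight_def)
qed (auto simp del: measurable_lborel1)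

text \<open>Each factor is split as (A + y)^(-3/4) (A + y)^(-1/4). The power 3/4 < 1 leaves a
  singularity at A = 0 that is integrable against f, and the two powers 1/4 combine to y^(-1/2). The
  summands 1 take care of y >= 1.\<close>

lemma kernel_weight_bound:
  assumes A: "A > 0" and B: "B > 0" and y: "y > 0"
  shows "1 / ((A + y) * (B + y)) \<le> (1 + A powr (- 3 / 4)) * (1 + B powr (- 3 / 4)) * kernel_weight y"
proof (cases "y < 1")
  case True
  have *: "1 / (A + y) \<le> (1 + A powr (- 3 / 4)) * y powr (- 1 / 4)" if A: "A > 0" for A
  proof -
    have "1 / (A + y) = (A + y) powr (- 1)" using A y by (simp add: powr_minus_divide)
    also have "\<dots> = (A + y) powr (- 3 / 4) * (A + y) powr (- 1 / 4)"
      by (simp add: powr_add[symmetric])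
    also have "\<dots> \<le> A powr (- 3 / 4) * y powr (- 1 / 4)"
      using A y by (intro mult_mono powr_mono2') auto
    also have "\<dots> \<le> (1 + A powr (- 3 / 4)) * y powr (- 1 / 4)"
      by (intro mult_right_mono) auto
    finally show ?thesis .
  qed
  have "1 / ((A + y) * (B + y)) = (1 / (A + y)) * (1 / (B + y))" by simp
  also have "\<dots> \<le> ((1 + A powr (- 3 / 4)) * y powr (- 1 / 4)) * ((1 + B powr (- 3 / 4)) * y powr (- 1 / 4))"
    using A B y by (intro mult_mono *) auto
  also have "\<dots> = (1 + A powr (- 3 / 4)) * (1 + B powr (- 3 / 4)) * (y powr (- 1 / 4) * y powr (- 1 / 4))" by simp
  also have "y powr (- 1 / 4) * y powr (- 1 / 4) = kernel_weight y"
    using True y by (simp add: kernel_weight_def powr_add[symmetric])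
  finally show ?thesis .
next
  case False
  have "1 / ((A + y) * (B + y)) \<le> 1 / (y * y)"
    using A B y by (intro divide_left_mono mult_mono) auto
  also have "\<dots> = 1 * kernel_weight y" using False y
    by (simp add: kernel_weight_def powr_minus_divide power2_eq_square)
  also have "\<dots> \<le> ((1 + A powr (- 3 / 4)) * (1 + B powr (- 3 / 4))) * kernel_weight y"
  proof (rule mult_right_mono)
    have "1 * 1 \<le> (1 + A powr (- 3 / 4)) * (1 + B powr (- 3 / 4))" by (intro mult_mono) auto
    then show "1 \<le> (1 + A powr (- 3 / 4)) * (1 + B powr (- 3 / 4))" by simp
    show "0 \<le> kernel_weight y" by (simp add: kernel_weight_def)
  qed
  finally show ?thesis by simp
qed

text \<open>Points of the cone over t are at horizontal distance at most y from t, so the distance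
  from a to such a point controls both y and |a - t|.\<close>

lemma norm_cauchy_denom_ge:
  assumes s: "\<bar>\<sigma>\<bar> = 1" and r: "\<bar>r\<bar> \<le> 1" and y: "y \<ge> 0"
  shows "(\<bar>a - t\<bar> + y) / 3 \<le> norm (cauchy_denom a (t + r * y) (\<sigma> * y))"
proof -
  let ?w = "cauchy_denom a (t + r * y) (\<sigma> * y)"
  have "\<bar>Im ?w\<bar> = y" using s y by (simp add: cauchy_denom_def abs_mult)
  then have 1: "y \<le> norm ?w" using abs_Im_le_cmod[of ?w] by simp
  have "Re ?w = a - (t + r * y)" by (simp add: cauchy_denom_def)
  then have 2: "\<bar>a - (t + r * y)\<bar> \<le> norm ?w" using abs_Re_le_cmod[of ?w] by simp
  have "\<bar>r * y\<bar> \<le> y" using r y by (simp add: abs_mult mult_left_le_one_le)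
  moreover have "\<bar>a - t\<bar> \<le> \<bar>a - (t + r * y)\<bar> + \<bar>r * y\<bar>" by linarith
  ultimately have "\<bar>a - t\<bar> + y \<le> 3 * norm ?w" using 1 2 by linarith
  then show ?thesis by simp
qed

text \<open>Separates the cone variables from the poles a and c, so that all later exchanges of
  integrals are justified by one product majorant; 9 is the square of the cone constant 3.\<close>

lemma kernel_bound:
  assumes s: "\<bar>\<sigma>\<bar> = 1" and a: "a \<noteq> t" and c: "c \<noteq> t"
  shows "norm (complex_of_real (indicator {0<..} y * sgn_window r) /
      (cauchy_denom a (t + r * y) (\<sigma> * y) * cauchy_denom c (t + r * y) (\<sigma> * y)))
    \<le> 9 * (kernel_weight y * indicator {-1<..<1} r) * ((1 + \<bar>a - t\<bar> powr (- 3 / 4)) * (1 + \<bar>c - t\<bar> powr (- 3 / 4)))"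
    (is "norm ?l \<le> ?r")
proof (cases "y > 0 \<and> \<bar>r\<bar> < 1")
  case True
  then have y: "y > 0" and r: "\<bar>r\<bar> \<le> 1" by auto
  let ?A = "cauchy_denom a (t + r * y) (\<sigma> * y)" and ?C = "cauchy_denom c (t + r * y) (\<sigma> * y)"
  have A: "(\<bar>a - t\<bar> + y) / 3 \<le> norm ?A" and C: "(\<bar>c - t\<bar> + y) / 3 \<le> norm ?C"
    using norm_cauchy_denom_ge[OF s r, of y] y by auto
  have "norm ?l \<le> 1 / (norm ?A * norm ?C)"
    using abs_sgn_window_le[of r] y by (auto simp: norm_divide norm_mult intro!: divide_right_mono split: split_indicator_asm)
  also have "\<dots> \<le> 1 / (((\<bar>a - t\<bar> + y) / 3) * ((\<bar>c - t\<bar> + y) / 3))"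
    using A C y by (intro divide_left_mono mult_mono mult_pos_pos) (auto intro: less_le_trans[OF _ A] less_le_trans[OF _ C] add_nonneg_pos)
  also have "\<dots> = 9 * (1 / ((\<bar>a - t\<bar> + y) * (\<bar>c - t\<bar> + y)))" by simp
  also have "\<dots> \<le> 9 * ((1 + \<bar>a - t\<bar> powr (- 3 / 4)) * (1 + \<bar>c - t\<bar> powr (- 3 / 4)) * kernel_weight y)"
    using a c y by (intro mult_left_mono kernel_weight_bound) auto
  also have "\<dots> = ?r" using True by (auto simp: abs_less_iff)
  finally show ?thesis .
next
  case False
  then have "indicator {0<..} y * sgn_window r = 0" by (auto simp: sgn_window_def indicator_def)
  then have l: "?l = 0" by (simp only: of_real_0 div_0)
  have "0 \<le> ?r" by (intro mult_nonneg_nonneg add_nonneg_nonneg) (auto simp: kernel_weight_def)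
  then show ?thesis unfolding l by (simp only: norm_zero)
qed

lemma integrable_kernel_weight_window:
  "integrable (lborel \<Otimes>\<^sub>M lborel) (\<lambda>p. 9 * (kernel_weight (fst p) * indicator {-1<..<1} (snd p :: real)))"
  by (intro integrable_mult_right integrable_pair_mult integrable_kernel_weight integrable_window)

text \<open>The source of the sign functions: on the imaginary axis the argument is plus or minus pi
  / 2.\<close>

lemma Ln_pm_i_times:
  assumes s: "\<bar>\<sigma>\<bar> = 1" and a: "a \<noteq> 0"
  shows "Ln (\<i> * of_real (\<sigma> * a)) = of_real (ln \<bar>a\<bar>) + \<i> * of_real (\<sigma> * pi / 2 * sgn a)"
proof -
  have "\<i> * of_real (\<sigma> * a) = of_real \<bar>a\<bar> * (\<i> * of_real (\<sigma> * sgn a))"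
    by (simp add: abs_mult_sgn mult_ac flip: of_real_mult)
  also have "Ln \<dots> = of_real (ln \<bar>a\<bar>) + Ln (\<i> * of_real (\<sigma> * sgn a))"
    using a s by (subst Ln_times_of_real) (auto simp: sgn_eq_0_iff Ln_of_real)
  also have "Ln (\<i> * of_real (\<sigma> * sgn a)) = \<i> * of_real (\<sigma> * pi / 2 * sgn a)"
    using s by (rule sign_cases) (use a in \<open>auto simp: sgn_if\<close>)
  finally show ?thesis .
qed

text \<open>Along the ray of slope r the denominators are linear in y, so partial fractions yield a
  difference of logarithms. Multiplying the denominators by i \<sigma> moves them into the right
  half plane, away from the branch cut.\<close>

lemma kernel_integral_inner:
  assumes s: "\<bar>\<sigma>\<bar> = 1" and r: "\<bar>r\<bar> \<le> 1" and a: "a \<noteq> t" and c: "c \<noteq> t" and ac: "a \<noteq> c"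
  shows "(\<integral>y. of_real (indicator {0<..} y) / (cauchy_denom a (t + r * y) (\<sigma> * y) * cauchy_denom c (t + r * y) (\<sigma> * y)) \<partial>lborel)
    = (1 / (of_real r + \<i> * of_real \<sigma>)) * ((Ln (\<i> * of_real (\<sigma> * (c - t))) - Ln (\<i> * of_real (\<sigma> * (a - t)))) / of_real (a - c))"
proof -
  define z where "z = of_real r + \<i> * complex_of_real \<sigma>"
  let ?D = "\<lambda>a y. cauchy_denom a (t + r * y) (\<sigma> * y)"
  \<comment> \<open>This is i \<sigma> times the denominator; its real part is y.\<close>
  let ?w = "\<lambda>a y. of_real y + \<i> * complex_of_real (\<sigma> * (a - (t + r * y)))"
  let ?f = "\<lambda>y. 1 / (?D a y * ?D c y)"
  let ?F = "\<lambda>y. (Ln (?w a y) - Ln (?w c y)) / (z * of_real (a - c))"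
  have ss: "complex_of_real \<sigma> * of_real \<sigma> = 1"
    using s by (auto elim: sign_cases)
  have z0: "z \<noteq> 0" using s by (auto simp: z_def complex_eq_iff)
  have D: "?D a y = of_real (a - t) - z * of_real y" for a y
    by (simp add: cauchy_denom_def z_def algebra_simps)
  have wD: "?w a y = \<i> * of_real \<sigma> * ?D a y" for a y
    using ss by (simp add: cauchy_denom_def algebra_simps)
  have D0: "?D a y \<noteq> 0" if "a \<noteq> t" "y \<ge> 0" for a y
  proof -
    have "0 < (\<bar>a - t\<bar> + y) / 3" using that by auto
    then show ?thesis using norm_cauchy_denom_ge[OF s r that(2), of a t] by auto
  qed
  have wn: "?w a y \<notin> \<real>\<^sub>\<le>\<^sub>0" if "a \<noteq> t" "y \<ge> 0" for a y
  proof (cases "y = 0")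
    case True
    then have "Im (?w a y) \<noteq> 0" using that s by auto
    then show ?thesis by (metis complex_nonpos_Reals_iff)
  next
    case False
    then have "Re (?w a y) > 0" using that by simp
    then show ?thesis by (metis complex_nonpos_Reals_iff not_less)
  qed
  have dL: "((\<lambda>y. Ln (?w a y)) has_vector_derivative (- z / ?D a y)) (at y)" if "a \<noteq> t" "y \<ge> 0" for a y
  proof -
    have "((\<lambda>u. \<i> * of_real \<sigma> * (of_real (a - t) - z * u)) has_field_derivative (\<i> * of_real \<sigma> * (0 - z * 1))) (at (of_real y))"
      by (auto intro!: derivative_eq_intros)
    then have "((\<lambda>u. Ln (\<i> * of_real \<sigma> * (of_real (a - t) - z * u))) has_field_derivative
        inverse (\<i> * of_real \<sigma> * (of_real (a - t) - z * of_real y)) * (\<i> * of_real \<sigma> * (0 - z * 1))) (at (of_real y))"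
      by (rule DERIV_chain2[rotated]) (rule has_field_derivative_Ln, use wn[OF that] in \<open>simp only: wD D not_False_eq_True\<close>)
    moreover have "inverse (\<i> * of_real \<sigma> * (of_real (a - t) - z * of_real y)) * (\<i> * of_real \<sigma> * (0 - z * 1)) = - z / ?D a y"
      unfolding D using s D0[OF that] by (auto simp: D divide_simps)
    ultimately have "((\<lambda>u. Ln (\<i> * of_real \<sigma> * (of_real (a - t) - z * u))) has_field_derivative - z / ?D a y) (at (of_real y))"
      by simp
    then have "((\<lambda>y. Ln (\<i> * of_real \<sigma> * (of_real (a - t) - z * of_real y))) has_vector_derivative - z / ?D a y) (at y)"
      by (rule has_vector_derivative_real_field)
    then show ?thesis by (simp only: wD D)
  qed
  have F': "(?F has_vector_derivative ?f y) (at y)" if "y \<ge> 0" for y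
  proof -
    have "(?F has_vector_derivative (- z / ?D a y - (- z / ?D c y)) / (z * of_real (a - c))) (at y)"
      unfolding divide_inverse[where b="z * of_real (a - c)"]
      by (intro bounded_linear.has_vector_derivative[OF bounded_linear_mult_left] has_vector_derivative_diff dL a c that)
    moreover have "(- z / ?D a y - (- z / ?D c y)) / (z * of_real (a - c)) = ?f y"
    proof -
      have "of_real (a - c) = ?D a y - ?D c y" unfolding D by simp
      moreover have "complex_of_real (a - c) \<noteq> 0" using ac by simp
      ultimately show ?thesis using z0 D0[OF a that] D0[OF c that] by (simp add: divide_simps) (simp add: algebra_simps)
    qed
    ultimately show ?thesis by simp
  qed
  have Lim: "(\<lambda>n. ?F (real n)) \<longlonglongrightarrow> 0"
  proof -
    \<comment> \<open>The argument of the logarithm divided by n. The terms ln n cancel in the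
      difference, and the remaining limit is the same for a and c.\<close>
    let ?v = "\<lambda>a n. 1 - \<i> * of_real (\<sigma> * r) + \<i> * complex_of_real (\<sigma> * ((a - t) / real n))"
    have v: "(\<lambda>n. Ln (?v a n)) \<longlonglongrightarrow> Ln (1 - \<i> * of_real (\<sigma> * r) + \<i> * of_real (\<sigma> * 0))" for a
    proof (rule tendsto_Ln)
      show "(\<lambda>n. ?v a n) \<longlonglongrightarrow> 1 - \<i> * of_real (\<sigma> * r) + \<i> * of_real (\<sigma> * 0)"
        by (intro tendsto_intros lim_const_over_n)
      show "1 - \<i> * of_real (\<sigma> * r) + \<i> * of_real (\<sigma> * 0) \<notin> \<real>\<^sub>\<le>\<^sub>0" by (simp add: complex_nonpos_Reals_iff)
    qed
    have "(\<lambda>n. (Ln (?v a n) - Ln (?v c n)) / (z * of_real (a - c))) \<longlonglongrightarrow>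
      (Ln (1 - \<i> * of_real (\<sigma> * r) + \<i> * of_real (\<sigma> * 0)) - Ln (1 - \<i> * of_real (\<sigma> * r) + \<i> * of_real (\<sigma> * 0))) / (z * of_real (a - c))"
      by (intro tendsto_intros v) (use z0 ac in auto)
    then have "(\<lambda>n. (Ln (?v a n) - Ln (?v c n)) / (z * of_real (a - c))) \<longlonglongrightarrow> 0" by simp
    moreover have "eventually (\<lambda>n. (Ln (?v a n) - Ln (?v c n)) / (z * of_real (a - c)) = ?F (real n)) sequentially"
      using eventually_gt_at_top[of 0]
    proof eventually_elim
      case (elim n)
      have "Ln (?w a (real n)) = of_real (ln (real n)) + Ln (?v a n)" for a
      proof -
        have "?w a (real n) = of_real (real n) * ?v a n" using elim by (simp add: field_simps)
        moreover have "Re (?v a n) = 1" by simp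
        then have "?v a n \<noteq> 0" by (metis one_neq_zero zero_complex.simps(1))
        ultimately show ?thesis using elim Ln_times_of_real[of "real n" "?v a n"] by (simp add: Ln_of_real)
      qed
      then show ?case by simp
    qed
    ultimately show ?thesis by (rule Lim_transform_eventually)
  qed
  have int: "integrable lborel (\<lambda>y. indicator {0..} y *\<^sub>R ?f y)"
  proof (rule Bochner_Integration.integrable_bound)
    let ?k = "(1 + \<bar>a - t\<bar> powr (- 3 / 4)) * (1 + \<bar>c - t\<bar> powr (- 3 / 4))"
    show "integrable lborel (\<lambda>y. 9 * ?k * kernel_weight y)"
      by (intro integrable_mult_right integrable_kernel_weight)
    have "AE y in lborel. y \<noteq> (0::real)" by (rule AE_I[where N="{0}"]) auto
    then show "AE y in lborel. norm (indicator {0..} y *\<^sub>R ?f y) \<le> norm (9 * ?k * kernel_weight y)"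
    proof eventually_elim
      case (elim y)
      show ?case
      proof (cases "y > 0")
        case True
        then have y: "y \<ge> 0" by simp
        have A: "(\<bar>a - t\<bar> + y) / 3 \<le> norm (?D a y)" and C: "(\<bar>c - t\<bar> + y) / 3 \<le> norm (?D c y)"
          using norm_cauchy_denom_ge[OF s r y] by auto
        have "norm (?f y) = 1 / (norm (?D a y) * norm (?D c y))" by (simp add: norm_divide norm_mult)
        also have "\<dots> \<le> 1 / (((\<bar>a - t\<bar> + y) / 3) * ((\<bar>c - t\<bar> + y) / 3))"
          using A C True by (intro divide_left_mono mult_mono mult_pos_pos) (auto intro: less_le_trans[OF _ A] less_le_trans[OF _ C] add_nonneg_pos)
        also have "\<dots> = 9 * (1 / ((\<bar>a - t\<bar> + y) * (\<bar>c - t\<bar> + y)))" by simp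
        also have "\<dots> \<le> 9 * (?k * kernel_weight y)"
          using a c True by (intro mult_left_mono kernel_weight_bound) auto
        also have "\<dots> \<le> norm (9 * ?k * kernel_weight y)" by simp
        finally show ?thesis using y by simp
      qed (use elim in auto)
    qed
  qed measurable
  have cont: "continuous_on {0..} ?f"
  proof -
    have "continuous_on {0..} (\<lambda>y. 1 / ((of_real (a - t) - z * of_real y) * (of_real (c - t) - z * of_real y)))"
      using D0[OF a] D0[OF c] by (intro continuous_intros) (auto simp: D)
    then show ?thesis by (simp only: D)
  qed
  have "(\<integral>y. of_real (indicator {0<..} y) / (?D a y * ?D c y) \<partial>lborel) = (\<integral>y. indicator {0..} y *\<^sub>R ?f y \<partial>lborel)"
  proof (rule Bochner_Integration.integral_cong_AE)
    have "AE y in lborel. y \<noteq> (0::real)" by (rule AE_I[where N="{0}"]) auto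
    then show "AE y in lborel. of_real (indicator {0<..} y) / (?D a y * ?D c y) = indicator {0..} y *\<^sub>R ?f y"
      by eventually_elim (auto simp: indicator_def)
  qed measurable
  also have "\<dots> = 0 - ?F 0" by (rule integral_FTC_half_line[OF F' cont int Lim])
  also have "\<dots> = (1 / z) * ((Ln (\<i> * of_real (\<sigma> * (c - t))) - Ln (\<i> * of_real (\<sigma> * (a - t)))) / of_real (a - c))"
    by (simp add: minus_divide_left)
  finally show ?thesis unfolding z_def .
qed

lemma kernel_integral:
  assumes s: "\<bar>\<sigma>\<bar> = 1" and a: "a \<noteq> t" and c: "c \<noteq> t" and ac: "a \<noteq> c"
  shows "(\<integral>p. of_real (indicator {0<..} (fst p) * sgn_window (snd p)) /
      (cauchy_denom a (t + snd p * fst p) (\<sigma> * fst p) * cauchy_denom c (t + snd p * fst p) (\<sigma> * fst p)) \<partial>(lborel \<Otimes>\<^sub>M lborel))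
    = of_real window_const * ((Ln (\<i> * of_real (\<sigma> * (c - t))) - Ln (\<i> * of_real (\<sigma> * (a - t)))) / of_real (a - c))"
proof -
  let ?h = "\<lambda>y r. complex_of_real (indicator {0<..} y * sgn_window r) /
      (cauchy_denom a (t + r * y) (\<sigma> * y) * cauchy_denom c (t + r * y) (\<sigma> * y))"
  let ?L = "(Ln (\<i> * of_real (\<sigma> * (c - t))) - Ln (\<i> * of_real (\<sigma> * (a - t)))) / complex_of_real (a - c)"
  have i: "integrable (lborel \<Otimes>\<^sub>M lborel) (case_prod ?h)"
  proof (rule Bochner_Integration.integrable_bound[OF integrable_mult_left[OF integrable_kernel_weight_window]])
    show "AE p in lborel \<Otimes>\<^sub>M lborel. norm (case_prod ?h p) \<le> norm (9 * (kernel_weight (fst p) * indicator {-1<..<1} (snd p))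
       * ((1 + \<bar>a - t\<bar> powr (- 3 / 4)) * (1 + \<bar>c - t\<bar> powr (- 3 / 4))))"
      by (rule AE_I2, unfold case_prod_beta, rule order_trans[OF kernel_bound[OF s a c]]) simp
  qed measurable
  have "(\<integral>p. of_real (indicator {0<..} (fst p) * sgn_window (snd p)) /
      (cauchy_denom a (t + snd p * fst p) (\<sigma> * fst p) * cauchy_denom c (t + snd p * fst p) (\<sigma> * fst p)) \<partial>(lborel \<Otimes>\<^sub>M lborel))
    = (\<integral>r. (\<integral>y. ?h y r \<partial>lborel) \<partial>lborel)"
    by (subst lborel_pair.integral_snd[OF i]) (simp add: case_prod_unfold)
  also have "\<dots> = (\<integral>r. (complex_of_real (sgn_window r) * (1 / (of_real r + \<i> * of_real \<sigma>))) * ?L \<partial>lborel)"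
  proof (rule Bochner_Integration.integral_cong[OF refl])
    fix r
    show "(\<integral>y. ?h y r \<partial>lborel) = (complex_of_real (sgn_window r) * (1 / (of_real r + \<i> * of_real \<sigma>))) * ?L"
    proof (cases "\<bar>r\<bar> < 1")
      case True
      have "(\<integral>y. ?h y r \<partial>lborel) = (\<integral>y. complex_of_real (sgn_window r) * (of_real (indicator {0<..} y) / (cauchy_denom a (t + r * y) (\<sigma> * y) * cauchy_denom c (t + r * y) (\<sigma> * y))) \<partial>lborel)"
        by (intro Bochner_Integration.integral_cong refl) simp
      also have "\<dots> = complex_of_real (sgn_window r) * ((1 / (of_real r + \<i> * of_real \<sigma>)) * ?L)"
        using True by (subst integral_mult_right_zero, subst kernel_integral_inner[OF s _ a c ac]) auto
      finally show ?thesis by (simp only: mult.assoc)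
    next
      case False
      then have "sgn_window r = 0" by (auto simp: sgn_window_def indicator_def)
      then show ?thesis by simp
    qed
  qed
  also have "\<dots> = of_real window_const * ?L"
    by (subst integral_mult_left_zero) (simp only: sgn_window_divide[OF s])
  finally show ?thesis .
qed

text \<open>The real parts ln |c - t| - ln |a - t| agree in the two half planes and cancel, while
  the arguments have opposite signs and double.\<close>

lemma kernel_integral_difference:
  assumes a: "a \<noteq> t" and c: "c \<noteq> t" and ac: "a \<noteq> c"
  shows "(\<integral>p. of_real (indicator {0<..} (fst p) * sgn_window (snd p)) /
      (cauchy_denom a (t + snd p * fst p) (1 * fst p) * cauchy_denom c (t + snd p * fst p) (1 * fst p)) \<partial>(lborel \<Otimes>\<^sub>M lborel))
    - (\<integral>p. of_real (indicator {0<..} (fst p) * sgn_window (snd p)) /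
      (cauchy_denom a (t + snd p * fst p) (- 1 * fst p) * cauchy_denom c (t + snd p * fst p) (- 1 * fst p)) \<partial>(lborel \<Otimes>\<^sub>M lborel))
    = \<i> * of_real (pi * window_const) * of_real ((sgn (c - t) - sgn (a - t)) / (a - c))"
proof -
  have n: "\<bar>1::real\<bar> = 1" "\<bar>-1::real\<bar> = 1" by auto
  have "a - t \<noteq> 0" "c - t \<noteq> 0" using a c by auto
  note L = Ln_pm_i_times[OF n(1) this(1)] Ln_pm_i_times[OF n(1) this(2)] Ln_pm_i_times[OF n(2) this(1)] Ln_pm_i_times[OF n(2) this(2)]
  have d: "w * (X / d) - w * (Y / d) = w * ((X - Y) / d)" for w X Y d :: complex
    by (simp add: diff_divide_distrib right_diff_distrib)
  have X: "complex_of_real C + \<i> * of_real (1 * pi / 2 * p) - (of_real A + \<i> * of_real (1 * pi / 2 * q))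
    - (of_real C + \<i> * of_real (- 1 * pi / 2 * p) - (of_real A + \<i> * of_real (- 1 * pi / 2 * q)))
    = \<i> * of_real (pi * (p - q))" for A C p q :: real
    by (simp add: complex_eq_iff algebra_simps)
  show ?thesis
    unfolding kernel_integral[OF n(1) a c ac] kernel_integral[OF n(2) a c ac] L d X
    by simp
qed

section \<open>Cone averages of products of Cauchy integrals\<close>

lemma pair_sigma_finite_lborel_pairs:
  "pair_sigma_finite (lborel \<Otimes>\<^sub>M lborel :: ('a::euclidean_space \<times> 'b::euclidean_space) measure) (lborel :: 'c::euclidean_space measure)"
  "pair_sigma_finite (lborel \<Otimes>\<^sub>M lborel :: ('a::euclidean_space \<times> 'b::euclidean_space) measure) (lborel \<Otimes>\<^sub>M lborel :: ('c::euclidean_space \<times> 'd::euclidean_space) measure)"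
  by (simp_all add: lborel_prod pair_sigma_finite_def lborel.sigma_finite_measure_axioms)

lemma integral_pair_mult:
  fixes f :: "'a::euclidean_space \<Rightarrow> complex" and g :: "'b::euclidean_space \<Rightarrow> complex"
  assumes "integrable lborel f" "integrable lborel g"
  shows "(\<integral>p. f (fst p) * g (snd p) \<partial>(lborel \<Otimes>\<^sub>M lborel)) = (\<integral>x. f x \<partial>lborel) * (\<integral>x. g x \<partial>lborel)"
  using lborel_pair.integral_fst'[OF integrable_pair_mult[OF assms]] by simp

text \<open>At fixed y and s the substitution x = t + s y moves the translation from K to b. The
  s-integral then acts on b alone and is at most B. The bound n on b serves Fubini and does not
  enter the estimate.\<close>

lemma sgn_window_slices:
  fixes K :: "real \<times> real \<Rightarrow> complex" and b :: "real \<Rightarrow> real"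
  assumes K: "integrable (lborel \<Otimes>\<^sub>M lborel) K" and K0: "\<And>y x. y \<le> 0 \<Longrightarrow> K (y, x) = 0"
    and b[measurable]: "b \<in> borel_measurable borel" and bn: "\<And>t. \<bar>b t\<bar> \<le> n"
    and B: "\<And>x y. y > 0 \<Longrightarrow> \<bar>\<integral>s. sgn_window s * b (x - s * y) \<partial>lborel\<bar> \<le> B"
  shows "integrable lborel (\<lambda>t. of_real (b t) * (\<integral>p. of_real (sgn_window (snd p)) * K (fst p, t + snd p * fst p) \<partial>(lborel \<Otimes>\<^sub>M lborel)))"
    and "norm (\<integral>t. of_real (b t) * (\<integral>p. of_real (sgn_window (snd p)) * K (fst p, t + snd p * fst p) \<partial>(lborel \<Otimes>\<^sub>M lborel)) \<partial>lborel)
      \<le> B * (\<integral>p. norm (K p) \<partial>(lborel \<Otimes>\<^sub>M lborel))"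
proof -
  interpret P: pair_sigma_finite "lborel \<Otimes>\<^sub>M lborel :: (real \<times> real) measure" "lborel :: real measure"
    by (rule pair_sigma_finite_lborel_pairs)
  have [measurable]: "K \<in> borel_measurable (borel \<Otimes>\<^sub>M borel)"
    using borel_measurable_integrable[OF K] by (simp only: measurable_cong_sets[OF sets_pair_measure_cong[OF sets_lborel sets_lborel] refl])
  have n0: "n \<ge> 0" using bn[of 0] by linarith
  \<comment> \<open>The integrand in t before, and \<open>?\<Psi>\<close> the integrand in x after,
    the substitution x = t + s y.\<close>
  let ?\<Phi> = "\<lambda>p t. of_real (sgn_window (snd p) * b t) * K (fst p, t + snd p * fst p)"
  let ?\<Psi> = "\<lambda>p x. of_real (sgn_window (snd p) * b (x - snd p * fst p)) * K (fst p, x)"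
  define k where "k y = (\<integral>\<^sup>+x. ennreal (norm (K (y, x))) \<partial>lborel)" for y
  have km[measurable]: "k \<in> borel_measurable borel"
    unfolding k_def by measurable
  have kfin: "(\<integral>\<^sup>+y. k y \<partial>lborel) < \<infinity>"
    using K unfolding integrable_iff_bounded k_def by (subst lborel.nn_integral_fst) auto
  have fin: "(\<integral>\<^sup>+p. ennreal n * (indicator {-1<..<1} (snd p) * k (fst p)) \<partial>(lborel \<Otimes>\<^sub>M lborel :: (real \<times> real) measure)) < \<infinity>"
  proof -
    have m: "(\<lambda>p::real \<times> real. ennreal n * (indicator {-1<..<1} (snd p) * k (fst p))) \<in> borel_measurable (lborel \<Otimes>\<^sub>M lborel)"
      by measurable
    have "(\<integral>\<^sup>+p. ennreal n * (indicator {-1<..<1} (snd p) * k (fst p)) \<partial>(lborel \<Otimes>\<^sub>M lborel :: (real \<times> real) measure))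
      = (\<integral>\<^sup>+y. (\<integral>\<^sup>+s. ennreal n * (indicator {-1<..<1} (s::real) * k y) \<partial>lborel) \<partial>lborel)"
      using lborel.nn_integral_fst[OF m] by simp
    also have "\<dots> = (\<integral>\<^sup>+y. (ennreal n * 2) * k y \<partial>lborel)"
      by (intro nn_integral_cong) (simp add: nn_integral_cmult nn_integral_multc mult_ac)
    also have "\<dots> = (ennreal n * 2) * (\<integral>\<^sup>+y. k y \<partial>lborel)" by (rule nn_integral_cmult) simp
    also have "\<dots> < \<infinity>" using kfin by (simp add: ennreal_mult_less_top)
    finally show ?thesis .
  qed
  have coeff: "norm (complex_of_real (sgn_window s * b t) * w) \<le> n * (indicator {-1<..<1} s * norm w)" for s t w
  proof -
    have "norm (complex_of_real (sgn_window s * b t) * w) = (\<bar>sgn_window s\<bar> * \<bar>b t\<bar>) * norm w"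
      by (simp add: norm_mult abs_mult)
    also have "\<dots> \<le> (indicator {-1<..<1} s * n) * norm w"
      by (intro mult_right_mono mult_mono abs_sgn_window_le bn) auto
    finally show ?thesis by (simp add: mult_ac)
  qed
  have inner: "(\<integral>\<^sup>+x. ennreal (norm (\<Theta> x)) \<partial>lborel) \<le> ennreal n * (indicator {-1<..<1} s * k y)"
    if "\<And>x. norm (\<Theta> x) \<le> n * (indicator {-1<..<1} s * norm (K (y, t + x)))"
    for \<Theta> :: "real \<Rightarrow> complex" and s y t
  proof -
    have "(\<integral>\<^sup>+x. ennreal (norm (\<Theta> x)) \<partial>lborel) \<le> (\<integral>\<^sup>+x. ennreal n * (indicator {-1<..<1} s * ennreal (norm (K (y, t + 1 *\<^sub>R x)))) \<partial>lborel)"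
    proof (rule nn_integral_mono)
      fix x
      have "ennreal (norm (\<Theta> x)) \<le> ennreal (n * (indicator {-1<..<1} s * norm (K (y, t + x))))"
        using that by (rule ennreal_leI)
      also have "\<dots> = ennreal n * (indicator {-1<..<1} s * ennreal (norm (K (y, t + 1 *\<^sub>R x))))"
        using n0 by (auto simp: ennreal_mult indicator_def)
      finally show "ennreal (norm (\<Theta> x)) \<le> ennreal n * (indicator {-1<..<1} s * ennreal (norm (K (y, t + 1 *\<^sub>R x))))" .
    qed
    also have "\<dots> = ennreal n * (indicator {-1<..<1} s * (\<integral>\<^sup>+x. ennreal (norm (K (y, t + 1 *\<^sub>R x))) \<partial>lborel))"
      by (subst nn_integral_cmult, measurable, subst nn_integral_cmult) auto
    also have "(\<integral>\<^sup>+x. ennreal (norm (K (y, t + 1 *\<^sub>R x))) \<partial>lborel) = k y"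
      unfolding k_def by (subst nn_integral_lborel_affine[of 1 "\<lambda>x. ennreal (norm (K (y, x)))" t]) auto
    finally show ?thesis .
  qed
  have int: "integrable ((lborel \<Otimes>\<^sub>M lborel) \<Otimes>\<^sub>M lborel) (\<lambda>q. \<Theta> (fst q) (snd q))"
    if [measurable]: "(\<lambda>q. \<Theta> (fst q) (snd q)) \<in> borel_measurable ((borel \<Otimes>\<^sub>M borel) \<Otimes>\<^sub>M borel)"
      and "\<And>p x. norm (\<Theta> p x) \<le> n * (indicator {-1<..<1} (snd p) * norm (K (fst p, \<tau> p + x)))"
    for \<Theta> :: "real \<times> real \<Rightarrow> real \<Rightarrow> complex" and \<tau>
  proof (rule integrableI_bounded)
    show m: "(\<lambda>q. \<Theta> (fst q) (snd q)) \<in> borel_measurable ((lborel \<Otimes>\<^sub>M lborel) \<Otimes>\<^sub>M lborel)" by measurable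
    have "(\<integral>\<^sup>+q. ennreal (norm (\<Theta> (fst q) (snd q))) \<partial>((lborel \<Otimes>\<^sub>M lborel) \<Otimes>\<^sub>M lborel))
      = (\<integral>\<^sup>+p. (\<integral>\<^sup>+x. ennreal (norm (\<Theta> p x)) \<partial>lborel) \<partial>(lborel \<Otimes>\<^sub>M lborel))"
      using lborel.nn_integral_fst[of "\<lambda>q. ennreal (norm (\<Theta> (fst q) (snd q)))" "lborel \<Otimes>\<^sub>M lborel"] m by simp
    also have "\<dots> \<le> (\<integral>\<^sup>+p. ennreal n * (indicator {-1<..<1} (snd p) * k (fst p)) \<partial>(lborel \<Otimes>\<^sub>M lborel :: (real \<times> real) measure))"
      by (rule nn_integral_mono, rule inner, rule that(2))
    also have "\<dots> < \<infinity>" by (rule fin)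
    finally show "(\<integral>\<^sup>+q. ennreal (norm (\<Theta> (fst q) (snd q))) \<partial>((lborel \<Otimes>\<^sub>M lborel) \<Otimes>\<^sub>M lborel)) < \<infinity>" .
  qed
  have \<Phi>i: "integrable ((lborel \<Otimes>\<^sub>M lborel) \<Otimes>\<^sub>M lborel) (case_prod ?\<Phi>)"
    unfolding case_prod_unfold
  proof (rule int[of ?\<Phi> "\<lambda>p. snd p * fst p"])
    show "norm (?\<Phi> p x) \<le> n * (indicator {-1<..<1} (snd p) * norm (K (fst p, snd p * fst p + x)))" for p x
      using coeff[of "snd p" x "K (fst p, x + snd p * fst p)"] by (simp add: add.commute)
  qed measurable
  have \<Psi>i: "integrable ((lborel \<Otimes>\<^sub>M lborel) \<Otimes>\<^sub>M lborel) (case_prod ?\<Psi>)"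
    unfolding case_prod_unfold
  proof (rule int[of ?\<Psi> "\<lambda>p. 0"])
    show "norm (?\<Psi> p x) \<le> n * (indicator {-1<..<1} (snd p) * norm (K (fst p, 0 + x)))" for p x
      using coeff[of "snd p" "x - snd p * fst p" "K (fst p, x)"] by simp
  qed measurable
  have eq: "of_real (b t) * (\<integral>p. of_real (sgn_window (snd p)) * K (fst p, t + snd p * fst p) \<partial>(lborel \<Otimes>\<^sub>M lborel))
    = (\<integral>p. ?\<Phi> p t \<partial>(lborel \<Otimes>\<^sub>M lborel))" for t
    by (subst integral_mult_right_zero[symmetric]) (simp add: mult_ac)
  show "integrable lborel (\<lambda>t. of_real (b t) * (\<integral>p. of_real (sgn_window (snd p)) * K (fst p, t + snd p * fst p) \<partial>(lborel \<Otimes>\<^sub>M lborel)))"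
    unfolding eq by (rule P.integrable_snd[OF \<Phi>i])
  have "(\<integral>t. of_real (b t) * (\<integral>p. of_real (sgn_window (snd p)) * K (fst p, t + snd p * fst p) \<partial>(lborel \<Otimes>\<^sub>M lborel)) \<partial>lborel)
    = (\<integral>p. (\<integral>t. ?\<Phi> p t \<partial>lborel) \<partial>(lborel \<Otimes>\<^sub>M lborel))"
    unfolding eq by (rule P.Fubini_integral[OF \<Phi>i])
  also have "\<dots> = (\<integral>p. (\<integral>x. ?\<Psi> p x \<partial>lborel) \<partial>(lborel \<Otimes>\<^sub>M lborel))"
  proof (rule Bochner_Integration.integral_cong[OF refl])
    fix p :: "real \<times> real"
    show "(\<integral>t. ?\<Phi> p t \<partial>lborel) = (\<integral>x. ?\<Psi> p x \<partial>lborel)"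
      using lborel_integral_real_affine[of 1 "?\<Psi> p" "snd p * fst p"] by (simp add: add.commute)
  qed
  also have "\<dots> = (\<integral>y. (\<integral>s. (\<integral>x. ?\<Psi> (y, s) x \<partial>lborel) \<partial>lborel) \<partial>lborel)"
    using lborel_pair.integral_fst'[OF P.integrable_fst[OF \<Psi>i]] by simp
  finally have I: "(\<integral>t. of_real (b t) * (\<integral>p. of_real (sgn_window (snd p)) * K (fst p, t + snd p * fst p) \<partial>(lborel \<Otimes>\<^sub>M lborel)) \<partial>lborel)
    = (\<integral>y. (\<integral>s. (\<integral>x. ?\<Psi> (y, s) x \<partial>lborel) \<partial>lborel) \<partial>lborel)" .
  have Ni: "integrable (lborel \<Otimes>\<^sub>M lborel) (\<lambda>p. norm (K p))" using K by (rule integrable_norm)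
  have "norm (\<integral>y. (\<integral>s. (\<integral>x. ?\<Psi> (y, s) x \<partial>lborel) \<partial>lborel) \<partial>lborel) \<le> (\<integral>y. B * (\<integral>x. norm (K (y, x)) \<partial>lborel) \<partial>lborel)"
  proof (rule order_trans[OF Bochner_Integration.integral_norm_bound integral_mono_AE])
    show "integrable lborel (\<lambda>y. norm (\<integral>s. (\<integral>x. ?\<Psi> (y, s) x \<partial>lborel) \<partial>lborel))"
      using lborel_pair.integrable_fst'[OF P.integrable_fst[OF \<Psi>i]] by (intro integrable_norm) simp
    show "integrable lborel (\<lambda>y. B * (\<integral>x. norm (K (y, x)) \<partial>lborel))"
      by (intro integrable_mult_right lborel_pair.integrable_fst'[OF Ni])
    show "AE y in lborel. norm (\<integral>s. (\<integral>x. ?\<Psi> (y, s) x \<partial>lborel) \<partial>lborel) \<le> B * (\<integral>x. norm (K (y, x)) \<partial>lborel)"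
      using lborel_pair.AE_integrable_fst'[OF K]
    proof eventually_elim
      case (elim y)
      show ?case
      proof (cases "y > 0")
        case True
        let ?\<Xi> = "\<lambda>s x. of_real (sgn_window s * b (x - s * y)) * K (y, x)"
        have "integrable (lborel \<Otimes>\<^sub>M lborel) (\<lambda>p::real\<times>real. (complex_of_real (indicator {-1<..<1} (fst p)) * K (y, snd p)) * of_real (sgn_window (fst p) * b (snd p - fst p * y)))"
        proof (rule integrable_mult_bounded[where B=n])
          show "integrable (lborel \<Otimes>\<^sub>M lborel) (\<lambda>p::real\<times>real. complex_of_real (indicator {-1<..<1} (fst p)) * K (y, snd p))"
            by (intro integrable_pair_mult elim integrable_of_real integrable_window)
          show "norm (complex_of_real (sgn_window (fst p) * b (snd p - fst p * y))) \<le> n" for p :: "real \<times> real"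
            using coeff[of "fst p" "snd p - fst p * y" 1] n0 by (auto simp: indicator_def of_bool_def split: if_splits)
        qed measurable
        also have "(\<lambda>p::real\<times>real. (complex_of_real (indicator {-1<..<1} (fst p)) * K (y, snd p)) * of_real (sgn_window (fst p) * b (snd p - fst p * y))) = case_prod ?\<Xi>"
          by (auto simp: fun_eq_iff sgn_window_def indicator_def)
        finally have \<Xi>i: "integrable (lborel \<Otimes>\<^sub>M lborel) (case_prod ?\<Xi>)" .
        have "(\<integral>s. (\<integral>x. ?\<Psi> (y, s) x \<partial>lborel) \<partial>lborel) = (\<integral>x. (\<integral>s. ?\<Xi> s x \<partial>lborel) \<partial>lborel)"
          using lborel_pair.Fubini_integral[OF \<Xi>i] by simp
        also have "(\<lambda>x. \<integral>s. ?\<Xi> s x \<partial>lborel) = (\<lambda>x. of_real (\<integral>s. sgn_window s * b (x - s * y) \<partial>lborel) * K (y, x))"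
          by (subst integral_mult_left_zero) (simp only: integral_complex_of_real)
        finally have e: "(\<integral>s. (\<integral>x. ?\<Psi> (y, s) x \<partial>lborel) \<partial>lborel) = (\<integral>x. of_real (\<integral>s. sgn_window s * b (x - s * y) \<partial>lborel) * K (y, x) \<partial>lborel)" .
        have "norm (\<integral>x. of_real (\<integral>s. sgn_window s * b (x - s * y) \<partial>lborel) * K (y, x) \<partial>lborel) \<le> (\<integral>x. B * norm (K (y, x)) \<partial>lborel)"
        proof (rule Bochner_Integration.integral_norm_bound_integral)
          have [measurable]: "(\<lambda>x. \<integral>s. sgn_window s * b (x - s * y) \<partial>lborel) \<in> borel_measurable borel"
            by (rule lborel.borel_measurable_lebesgue_integral) measurable
          have "integrable lborel (\<lambda>x. K (y, x) * of_real (\<integral>s. sgn_window s * b (x - s * y) \<partial>lborel))"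
            by (rule integrable_mult_bounded[where B=B, OF elim]) (use B[OF True] in auto)
          then show "integrable lborel (\<lambda>x. of_real (\<integral>s. sgn_window s * b (x - s * y) \<partial>lborel) * K (y, x))"
            by (simp only: mult.commute)
          show "integrable lborel (\<lambda>x. B * norm (K (y, x)))" using elim by auto
          show "norm (of_real (\<integral>s. sgn_window s * b (x - s * y) \<partial>lborel) * K (y, x)) \<le> B * norm (K (y, x))" for x
            using B[OF True, of x] by (simp only: norm_mult norm_of_real) (rule mult_right_mono, auto)
        qed
        then show ?thesis unfolding e by simp
      qed (simp add: K0)
    qed
  qed
  also have "\<dots> = B * (\<integral>p. norm (K p) \<partial>(lborel \<Otimes>\<^sub>M lborel))"
    using lborel_pair.integral_fst'[OF Ni] by simp
  finally show "norm (\<integral>t. of_real (b t) * (\<integral>p. of_real (sgn_window (snd p)) * K (fst p, t + snd p * fst p) \<partial>(lborel \<Otimes>\<^sub>M lborel)) \<partial>lborel)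
      \<le> B * (\<integral>p. norm (K p) \<partial>(lborel \<Otimes>\<^sub>M lborel))"
    unfolding I .
qed

text \<open>Uniformity in t is the point: within distance 1 of t the singularity is integrable by
  itself, and elsewhere it is at most 1.\<close>

lemma schwartz_singular_weight:
  fixes f :: "real \<Rightarrow> complex"
  assumes f: "schwartz f" and \<beta>: "0 \<le> \<beta>" "\<beta> < 1"
  shows "\<exists>C. \<forall>t. (\<integral>\<^sup>+a. ennreal (norm (f a) * (1 + \<bar>a\<bar>) ^ 3 * \<bar>a - t\<bar> powr (- \<beta>)) \<partial>lborel) \<le> ennreal C"
proof -
  \<comment> \<open>Decay of order 5 absorbs the cubic weight and leaves the integrable order
    2.\<close>
  obtain C where C: "C \<ge> 0" "\<And>x. norm (f x) \<le> C / (1 + norm x) ^ 5"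
    using schwartz_bound[OF f, of 5] by blast
  let ?h = "\<lambda>x::real. indicator (ball 0 1) x * norm x powr (- \<beta>)"
  have h: "integrable lborel ?h" using \<beta> by (intro powr_local_integrable) simp
  have w: "integrable lborel (\<lambda>a::real. C / (1 + norm a) ^ 2)"
    by (rule integrable_one_plus_norm_power) simp
  show ?thesis
  proof (intro exI[of _ "C * (\<integral>x. ?h x \<partial>lborel) + (\<integral>a. C / (1 + norm (a::real)) ^ 2 \<partial>lborel)"] allI)
    fix t :: real
    have h': "integrable lborel (\<lambda>a. ?h (- t + 1 *\<^sub>R a))"
      using lborel_integral_affine(2)[OF one_neq_zero, of ?h "- t"] h by (simp only:)
    have hI: "(\<integral>a. ?h (- t + 1 *\<^sub>R a) \<partial>lborel) = (\<integral>x. ?h x \<partial>lborel)"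
      using lborel_integral_affine(1)[of 1 ?h "- t"] by simp
    have "norm (f a) * (1 + \<bar>a\<bar>) ^ 3 * \<bar>a - t\<bar> powr (- \<beta>) \<le> C * ?h (- t + 1 *\<^sub>R a) + C / (1 + norm a) ^ 2" for a
    proof -
      have "norm (f a) * (1 + \<bar>a\<bar>) ^ 3 \<le> C / (1 + norm a) ^ 5 * (1 + \<bar>a\<bar>) ^ 3"
        by (intro mult_right_mono C) auto
      also have "\<dots> = C / (1 + norm a) ^ 2"
      proof -
        have "C / u ^ 5 * u ^ 3 = C / u ^ 2" if "u > 0" for u :: real
          using that by (simp add: divide_simps power_add[symmetric])
        from this[of "1 + norm a"] show ?thesis by (simp add: add_pos_nonneg)
      qed
      finally have 1: "norm (f a) * (1 + \<bar>a\<bar>) ^ 3 \<le> C / (1 + norm a) ^ 2" .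
      have 2: "C / (1 + norm a) ^ 2 \<le> C / 1" using C by (intro divide_left_mono) (auto simp: add_pos_nonneg)
      show ?thesis
      proof (cases "\<bar>a - t\<bar> < 1")
        case True
        have "norm (f a) * (1 + \<bar>a\<bar>) ^ 3 * \<bar>a - t\<bar> powr (- \<beta>) \<le> C * \<bar>a - t\<bar> powr (- \<beta>)"
          using 1 2 by (intro mult_right_mono) auto
        also have "\<dots> = C * ?h (- t + 1 *\<^sub>R a)" using True by (simp add: indicator_def)
        finally show ?thesis using C by (smt (verit) divide_nonneg_nonneg norm_ge_zero zero_le_power)
      next
        case False
        then have "\<bar>a - t\<bar> powr (- \<beta>) \<le> 1" using \<beta>(1) powr_mono2'[of "- \<beta>" 1 "\<bar>a - t\<bar>"] by simp
        then have "norm (f a) * (1 + \<bar>a\<bar>) ^ 3 * \<bar>a - t\<bar> powr (- \<beta>) \<le> C / (1 + norm a) ^ 2 * 1"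
          using 1 C by (intro mult_mono) auto
        moreover have "0 \<le> C * ?h (- t + 1 *\<^sub>R a)" using C by simp
        ultimately show ?thesis by simp
      qed
    qed
    then have "(\<integral>\<^sup>+a. ennreal (norm (f a) * (1 + \<bar>a\<bar>) ^ 3 * \<bar>a - t\<bar> powr (- \<beta>)) \<partial>lborel)
      \<le> (\<integral>\<^sup>+a. ennreal (C * ?h (- t + 1 *\<^sub>R a) + C / (1 + norm a) ^ 2) \<partial>lborel)"
      by (intro nn_integral_mono ennreal_leI)
    also have "\<dots> = ennreal (\<integral>a. C * ?h (- t + 1 *\<^sub>R a) + C / (1 + norm a) ^ 2 \<partial>lborel)"
      using C by (intro nn_integral_eq_integral Bochner_Integration.integrable_add integrable_mult_right h' w AE_I2) auto
    also have "(\<integral>a. C * ?h (- t + 1 *\<^sub>R a) + C / (1 + norm a) ^ 2 \<partial>lborel) = C * (\<integral>x. ?h x \<partial>lborel) + (\<integral>a. C / (1 + norm (a::real)) ^ 2 \<partial>lborel)"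
      by (subst Bochner_Integration.integral_add[OF integrable_mult_right[OF h'] w]) (simp only: integral_mult_right_zero hI)
    finally show "(\<integral>\<^sup>+a. ennreal (norm (f a) * (1 + \<bar>a\<bar>) ^ 3 * \<bar>a - t\<bar> powr (- \<beta>)) \<partial>lborel)
      \<le> ennreal (C * (\<integral>x. ?h x \<partial>lborel) + (\<integral>a. C / (1 + norm (a::real)) ^ 2 \<partial>lborel))" .
  qed
qed

lemma Hdot_norm_power2:
  "(Hdot_norm a f)\<^sup>2 = (\<integral>\<^sup>+x. ennreal ((norm (abs_nabla_pow a f x))\<^sup>2) \<partial>lborel)"
proof -
  let ?I = "\<integral>\<^sup>+x. ennreal ((norm (abs_nabla_pow a f x))\<^sup>2) \<partial>lborel"
  show ?thesis
  proof (cases "?I = \<infinity>")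
    case True
    then show ?thesis by (simp add: Hdot_norm_def Lp_norm_lborel norm_powr_2)
  next
    case False
    then have "ennreal (enn2real ?I) = ?I" by (simp add: less_top)
    moreover have "(enn2real ?I powr (1 / 2))\<^sup>2 = enn2real ?I" by (simp add: powr_half_sqrt)
    ultimately show ?thesis using False
      by (simp add: Hdot_norm_def Lp_norm_lborel norm_powr_2 ennreal_power)
  qed
qed

lemma Hdot_norm_finite:
  fixes f :: "'a::euclidean_space \<Rightarrow> complex"
  assumes f: "schwartz f" and z: "zero_mean f" and a: "- 1 < a" "a < 0"
  shows "Hdot_norm a f < \<infinity>"
proof -
  have a': "a > - real DIM('a) / 2 - 1" using a by (simp add: field_simps add_pos_nonneg)
  note i = schwartz_symbol_integrable_zero_mean[OF f z a']
  have "(\<integral>\<^sup>+x. ennreal ((norm (abs_nabla_pow a f x))\<^sup>2) \<partial>lborel) \<le> (\<integral>\<^sup>+\<xi>. ennreal ((norm (abs_nabla_symbol a f \<xi>))\<^sup>2) \<partial>lborel)"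
    unfolding abs_nabla_pow_symbol by (rule inverse_fourier_L2_le[OF i(1)])
  also have "\<dots> < \<infinity>"
    using i(2) by (simp add: integrable_iff_bounded)
  finally have "(Hdot_norm a f)\<^sup>2 < \<infinity>" unfolding Hdot_norm_power2 .
  then show ?thesis by (cases "Hdot_norm a f") auto
qed

lemma ennreal_power2_le_imp_le:
  fixes x y :: ennreal assumes "x\<^sup>2 \<le> y\<^sup>2" shows "x \<le> y"
  using assms by (cases x; cases y) (auto simp: ennreal_power top_unique intro: power2_le_imp_le)

text \<open>The first component is the height, the second the horizontal coordinate; \<sigma>
  selects the half plane. The product of the two Cauchy integrals is taken without conjugation, so
  their kernels combine by partial fractions.\<close>

definition half_plane_product :: "(real \<Rightarrow> complex) \<Rightarrow> (real \<Rightarrow> complex) \<Rightarrow> real \<Rightarrow> real \<times> real \<Rightarrow> complex" where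
  "half_plane_product f g \<sigma> p = indicator {0<..} (fst p) *\<^sub>R
     (cauchy_integral f (snd p) (\<sigma> * fst p) * cauchy_integral g (snd p) (\<sigma> * fst p))"

text \<open>Cauchy-Schwarz on the half plane reduces the product to the two square norms.\<close>

lemma half_plane_product_bound:
  assumes f: "schwartz f" "zero_mean f" and g: "schwartz g" "zero_mean g" and s: "\<bar>\<sigma>\<bar> = 1"
  shows "integrable (lborel \<Otimes>\<^sub>M lborel) (half_plane_product f g \<sigma>)"
    and "ennreal (\<integral>p. norm (half_plane_product f g \<sigma> p) \<partial>(lborel \<Otimes>\<^sub>M lborel))
      \<le> ennreal (2 * pi\<^sup>2) * (Hdot_norm (- 1 / 2) f * Hdot_norm (- 1 / 2) g)"
proof -
  have [measurable]: "f \<in> borel_measurable borel" "g \<in> borel_measurable borel"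
    by (intro schwartz_measurable f g)+
  let ?u = "\<lambda>f p. ennreal (indicator {0<..} (fst p) * norm (cauchy_integral f (snd p) (\<sigma> * fst p)))"
  have u2: "(\<integral>\<^sup>+p. (?u f p)\<^sup>2 \<partial>(lborel \<Otimes>\<^sub>M lborel)) \<le> ennreal (2 * pi\<^sup>2) * (Hdot_norm (- 1 / 2) f)\<^sup>2"
    if f: "schwartz f" "zero_mean f" for f
  proof -
    have [measurable]: "f \<in> borel_measurable borel" by (intro schwartz_measurable f)
    have "(\<lambda>p. (?u f p)\<^sup>2) \<in> borel_measurable (lborel \<Otimes>\<^sub>M lborel)" by measurable
    from lborel.nn_integral_fst[OF this]
    have "(\<integral>\<^sup>+p. (?u f p)\<^sup>2 \<partial>(lborel \<Otimes>\<^sub>M lborel)) = (\<integral>\<^sup>+y. (\<integral>\<^sup>+x. (?u f (y, x))\<^sup>2 \<partial>lborel) \<partial>lborel)" by (rule sym)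
    also have "\<dots> = (\<integral>\<^sup>+y. indicator {0<..} y * (\<integral>\<^sup>+x. ennreal ((norm (cauchy_integral f x (\<sigma> * y)))\<^sup>2) \<partial>lborel) \<partial>lborel)"
      by (intro nn_integral_cong) (auto simp: indicator_def ennreal_power)
    finally show ?thesis using cauchy_integral_L2_half_plane[OF f s] unfolding Hdot_norm_power2 by simp
  qed
  have nK: "ennreal (norm (half_plane_product f g \<sigma> p)) = ?u f p * ?u g p" for p
    by (auto simp: half_plane_product_def indicator_def norm_mult ennreal_mult)
  have "(\<integral>\<^sup>+p. ennreal (norm (half_plane_product f g \<sigma> p)) \<partial>(lborel \<Otimes>\<^sub>M lborel))\<^sup>2
    \<le> (\<integral>\<^sup>+p. (?u f p)\<^sup>2 \<partial>(lborel \<Otimes>\<^sub>M lborel)) * (\<integral>\<^sup>+p. (?u g p)\<^sup>2 \<partial>(lborel \<Otimes>\<^sub>M lborel))"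
    unfolding nK by (rule Cauchy_Schwarz_nn_integral) measurable
  also have "\<dots> \<le> (ennreal (2 * pi\<^sup>2) * (Hdot_norm (- 1 / 2) f)\<^sup>2) * (ennreal (2 * pi\<^sup>2) * (Hdot_norm (- 1 / 2) g)\<^sup>2)"
    by (intro mult_mono u2 f g) auto
  also have "\<dots> = (ennreal (2 * pi\<^sup>2) * (Hdot_norm (- 1 / 2) f * Hdot_norm (- 1 / 2) g))\<^sup>2"
    by (simp only: power2_eq_square mult_ac)
  finally have le: "(\<integral>\<^sup>+p. ennreal (norm (half_plane_product f g \<sigma> p)) \<partial>(lborel \<Otimes>\<^sub>M lborel))
    \<le> ennreal (2 * pi\<^sup>2) * (Hdot_norm (- 1 / 2) f * Hdot_norm (- 1 / 2) g)"
    by (rule ennreal_power2_le_imp_le)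
  have fin: "Hdot_norm (- 1 / 2) f < \<infinity>" "Hdot_norm (- 1 / 2) g < \<infinity>"
    by (intro Hdot_norm_finite f g; simp)+
  show i: "integrable (lborel \<Otimes>\<^sub>M lborel) (half_plane_product f g \<sigma>)"
  proof (rule integrableI_bounded)
    show "half_plane_product f g \<sigma> \<in> borel_measurable (lborel \<Otimes>\<^sub>M lborel)"
      unfolding half_plane_product_def[abs_def] by measurable
    show "(\<integral>\<^sup>+p. ennreal (norm (half_plane_product f g \<sigma> p)) \<partial>(lborel \<Otimes>\<^sub>M lborel)) < \<infinity>"
      by (rule le_less_trans[OF le]) (use fin in \<open>simp add: ennreal_mult_less_top\<close>)
  qed
  show "ennreal (\<integral>p. norm (half_plane_product f g \<sigma> p) \<partial>(lborel \<Otimes>\<^sub>M lborel))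
      \<le> ennreal (2 * pi\<^sup>2) * (Hdot_norm (- 1 / 2) f * Hdot_norm (- 1 / 2) g)"
    using le by (subst nn_integral_eq_integral[symmetric]) (use i in auto)
qed

text \<open>Excludes the null set on which the logarithmic formula for the averaged kernel breaks
  down.\<close>

definition off_diag :: "real \<Rightarrow> (real \<times> real) set" where
  "off_diag t = {q. fst q \<noteq> t \<and> snd q \<noteq> t \<and> fst q \<noteq> snd q}"

lemma off_diag_measurable [measurable]:
  assumes [measurable]: "h \<in> borel_measurable M" "k \<in> M \<rightarrow>\<^sub>M borel \<Otimes>\<^sub>M borel"
  shows "Measurable.pred M (\<lambda>p. k p \<in> off_diag (h p))"
  unfolding off_diag_def mem_Collect_eq by measurable

lemma AE_off_diag: "AE q in lborel \<Otimes>\<^sub>M lborel. q \<in> off_diag t"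
proof (rule lborel_pair.AE_pair_measure)
  have "Measurable.pred (lborel \<Otimes>\<^sub>M lborel) (\<lambda>q. q \<in> off_diag t)" by measurable
  then show "{q \<in> space (lborel \<Otimes>\<^sub>M lborel). q \<in> off_diag t} \<in> sets (lborel \<Otimes>\<^sub>M lborel)"
    by (simp only: pred_def)
  have ne: "AE y in lborel. y \<noteq> (x::real)" for x by (rule AE_I[where N="{x}"]) auto
  show "AE x in lborel. AE y in lborel. (x, y) \<in> off_diag t"
    using ne[of t]
  proof eventually_elim
    case (elim x)
    show ?case using ne[of t] ne[of x] by eventually_elim (use elim in \<open>auto simp: off_diag_def\<close>)
  qed
qed

definition kernel_mean :: "real \<Rightarrow> real \<Rightarrow> real \<times> real \<Rightarrow> complex" where
  "kernel_mean \<sigma> t q = (\<integral>p. of_real (indicator {0<..} (fst p) * sgn_window (snd p)) /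
      (cauchy_denom (fst q) (t + snd p * fst p) (\<sigma> * fst p) * cauchy_denom (snd q) (t + snd p * fst p) (\<sigma> * fst p))
      \<partial>(lborel \<Otimes>\<^sub>M lborel))"

text \<open>Fubini between the cone variables and the poles: the product of Cauchy integrals is
  opened up, and the cone average falls on the explicit kernel.\<close>

lemma half_plane_product_slice:
  assumes f: "schwartz f" and g: "schwartz g" and s: "\<bar>\<sigma>\<bar> = 1"
  shows "integrable (lborel \<Otimes>\<^sub>M lborel) (\<lambda>q. (indicator (off_diag t) q *\<^sub>R (f (fst q) * g (snd q))) * kernel_mean \<sigma> t q)"
    and "(\<integral>p. of_real (sgn_window (snd p)) * half_plane_product f g \<sigma> (fst p, t + snd p * fst p) \<partial>(lborel \<Otimes>\<^sub>M lborel))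
      = (\<integral>q. (indicator (off_diag t) q *\<^sub>R (f (fst q) * g (snd q))) * kernel_mean \<sigma> t q \<partial>(lborel \<Otimes>\<^sub>M lborel))"
proof -
  interpret P: pair_sigma_finite "lborel \<Otimes>\<^sub>M lborel :: (real \<times> real) measure" "lborel \<Otimes>\<^sub>M lborel :: (real \<times> real) measure"
    by (rule pair_sigma_finite_lborel_pairs)
  have [measurable]: "f \<in> borel_measurable borel" "g \<in> borel_measurable borel"
    by (intro schwartz_measurable f g)+
  let ?d = "\<lambda>a p. cauchy_denom a (t + snd p * fst p) (\<sigma> * fst p)"
  let ?\<kappa> = "\<lambda>p::real\<times>real. complex_of_real (indicator {0<..} (fst p) * sgn_window (snd p))"
  let ?\<Theta> = "\<lambda>p q. (indicator (off_diag t) q *\<^sub>R (f (fst q) * g (snd q))) * (?\<kappa> p / (?d (fst q) p * ?d (snd q) p))"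
  \<comment> \<open>The singular weights of \<open>kernel_bound\<close>; their exponent 3/4 keeps
    them integrable against Schwartz functions.\<close>
  let ?w = "\<lambda>f a. norm (f a :: complex) * (1 + \<bar>a - t\<bar> powr (- 3 / 4))"
  have wi: "integrable lborel (?w f)" if f: "schwartz f" for f
  proof -
    have [measurable]: "f \<in> borel_measurable borel" by (intro schwartz_measurable f)
    obtain C where C: "\<And>t. (\<integral>\<^sup>+a. ennreal (norm (f a) * (1 + \<bar>a\<bar>) ^ 3 * \<bar>a - t\<bar> powr (- (3 / 4))) \<partial>lborel) \<le> ennreal C"
      using schwartz_singular_weight[OF f, of "3/4"] by auto
    have "integrable lborel (\<lambda>a. norm (f a) * \<bar>a - t\<bar> powr (- (3 / 4)))"
    proof (rule integrableI_bounded)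
      have "norm (norm (f a) * \<bar>a - t\<bar> powr (- (3 / 4))) \<le> norm (f a) * (1 + \<bar>a\<bar>) ^ 3 * \<bar>a - t\<bar> powr (- (3 / 4))" for a
        using mult_left_mono[of 1 "(1 + \<bar>a\<bar>) ^ 3" "norm (f a)"] by (auto intro: mult_right_mono)
      then have "(\<integral>\<^sup>+a. ennreal (norm (norm (f a) * \<bar>a - t\<bar> powr (- (3 / 4)))) \<partial>lborel) \<le> ennreal C"
        by (intro order_trans[OF _ C[of t]] nn_integral_mono ennreal_leI)
      then show "(\<integral>\<^sup>+a. ennreal (norm (norm (f a) * \<bar>a - t\<bar> powr (- (3 / 4)))) \<partial>lborel) < \<infinity>"
        by (simp add: le_less_trans)
    qed measurable
    from Bochner_Integration.integrable_add[OF integrable_norm[OF schwartz_integrable(1)[OF f]] this]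
    show ?thesis by (simp add: distrib_left)
  qed
  have \<Theta>i: "integrable ((lborel \<Otimes>\<^sub>M lborel) \<Otimes>\<^sub>M (lborel \<Otimes>\<^sub>M lborel)) (case_prod ?\<Theta>)"
  proof (rule Bochner_Integration.integrable_bound)
    let ?A = "\<lambda>p::real\<times>real. 9 * (kernel_weight (fst p) * indicator {-1<..<1} (snd p))"
    let ?B = "\<lambda>q. ?w f (fst q) * ?w g (snd q)"
    have A: "integrable lborel ?A" using integrable_kernel_weight_window by (simp only: lborel_prod)
    have B: "integrable lborel ?B" using integrable_pair_mult[OF wi[OF f] wi[OF g]] by (simp only: lborel_prod)
    show "integrable ((lborel \<Otimes>\<^sub>M lborel) \<Otimes>\<^sub>M (lborel \<Otimes>\<^sub>M lborel)) (\<lambda>r. ?A (fst r) * ?B (snd r))"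
      using integrable_pair_mult[OF A B] by (simp only: lborel_prod[where 'a=real and 'b=real])
    show "AE r in (lborel \<Otimes>\<^sub>M lborel) \<Otimes>\<^sub>M (lborel \<Otimes>\<^sub>M lborel). norm (case_prod ?\<Theta> r) \<le> norm (?A (fst r) * ?B (snd r))"
    proof (rule AE_I2)
      fix r :: "(real \<times> real) \<times> real \<times> real"
      obtain y \<rho> a c where r: "r = ((y, \<rho>), (a, c))" by (metis prod.exhaust)
      show "norm (case_prod ?\<Theta> r) \<le> norm (?A (fst r) * ?B (snd r))"
      proof (cases "(a, c) \<in> off_diag t")
        case True
        then have "a \<noteq> t" "c \<noteq> t" by (auto simp: off_diag_def)
        note k = kernel_bound[OF s this, of y \<rho>]
        have "norm (case_prod ?\<Theta> r) = norm (f a) * norm (g c) * norm (complex_of_real (indicator {0<..} y * sgn_window \<rho>) /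
          (cauchy_denom a (t + \<rho> * y) (\<sigma> * y) * cauchy_denom c (t + \<rho> * y) (\<sigma> * y)))"
          using True by (simp only: r case_prod_conv fst_conv snd_conv norm_mult indicator_simps scaleR_one)
        also have "\<dots> \<le> norm (f a) * norm (g c) * (9 * (kernel_weight y * indicator {-1<..<1} \<rho>) * ((1 + \<bar>a - t\<bar> powr (- 3 / 4)) * (1 + \<bar>c - t\<bar> powr (- 3 / 4))))"
          by (intro mult_left_mono k) auto
        also have "\<dots> = ?A (fst r) * ?B (snd r)" by (simp add: r mult_ac)
        finally show ?thesis by (simp only: real_norm_def)
      qed (simp add: r)
    qed
  qed measurable
  have inner: "(\<integral>p. ?\<Theta> p q \<partial>(lborel \<Otimes>\<^sub>M lborel)) = (indicator (off_diag t) q *\<^sub>R (f (fst q) * g (snd q))) * kernel_mean \<sigma> t q" for q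
    unfolding kernel_mean_def by (rule integral_mult_right_zero)
  have "(\<integral>q. ?\<Theta> p q \<partial>(lborel \<Otimes>\<^sub>M lborel)) = of_real (sgn_window (snd p)) * half_plane_product f g \<sigma> (fst p, t + snd p * fst p)" for p
  proof (cases "fst p > 0")
    case True
    have ci: "integrable lborel (\<lambda>a. f a * (1 / ?d a p))" if "schwartz f" for f
    proof (rule integrable_mult_bounded[OF schwartz_integrable(1)[OF that], where B="1 / fst p"])
      fix a
      have "\<bar>Im (?d a p)\<bar> = fst p" using True s by (simp add: cauchy_denom_def abs_mult)
      then have "fst p \<le> norm (?d a p)" using abs_Im_le_cmod[of "?d a p"] by simp
      then show "norm (1 / ?d a p) \<le> 1 / fst p"
        using True by (simp add: norm_divide frac_le)
    qed measurable
    have "(\<integral>q. ?\<Theta> p q \<partial>(lborel \<Otimes>\<^sub>M lborel)) = (\<integral>q. ?\<kappa> p * ((f (fst q) * (1 / ?d (fst q) p)) * (g (snd q) * (1 / ?d (snd q) p))) \<partial>(lborel \<Otimes>\<^sub>M lborel))"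
    proof (rule Bochner_Integration.integral_cong_AE)
      show "AE q in lborel \<Otimes>\<^sub>M lborel. ?\<Theta> p q = ?\<kappa> p * ((f (fst q) * (1 / ?d (fst q) p)) * (g (snd q) * (1 / ?d (snd q) p)))"
        using AE_off_diag[of t] by eventually_elim simp
    qed measurable
    also have "\<dots> = ?\<kappa> p * ((\<integral>a. f a * (1 / ?d a p) \<partial>lborel) * (\<integral>c. g c * (1 / ?d c p) \<partial>lborel))"
      by (subst integral_mult_right_zero) (simp only: integral_pair_mult[OF ci[OF f] ci[OF g]])
    also have "\<dots> = of_real (sgn_window (snd p)) * half_plane_product f g \<sigma> (fst p, t + snd p * fst p)"
      using True by (simp add: half_plane_product_def cauchy_integral_def cauchy_denom_def)
    finally show ?thesis .
  qed (simp add: half_plane_product_def)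
  then show "(\<integral>p. of_real (sgn_window (snd p)) * half_plane_product f g \<sigma> (fst p, t + snd p * fst p) \<partial>(lborel \<Otimes>\<^sub>M lborel))
      = (\<integral>q. (indicator (off_diag t) q *\<^sub>R (f (fst q) * g (snd q))) * kernel_mean \<sigma> t q \<partial>(lborel \<Otimes>\<^sub>M lborel))"
    using P.Fubini_integral[OF \<Theta>i] unfolding inner by simp
  show "integrable (lborel \<Otimes>\<^sub>M lborel) (\<lambda>q. (indicator (off_diag t) q *\<^sub>R (f (fst q) * g (snd q))) * kernel_mean \<sigma> t q)"
    using P.integrable_snd[OF \<Theta>i] unfolding inner .
qed

subsection \<open>The form as an average of mean oscillations\<close>

text \<open>Equal to -2 / |a - c| when t lies strictly between a and c, and 0 otherwise. Its
  integral against v' is therefore -2 times the difference quotient of v.\<close>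

definition sign_kernel :: "real \<Rightarrow> real \<times> real \<Rightarrow> real" where
  "sign_kernel t q = indicator (off_diag t) q * ((sgn (snd q - t) - sgn (fst q - t)) / (fst q - snd q))"

lemma sign_kernel_measurable [measurable]:
  assumes [measurable]: "h \<in> borel_measurable M" "k \<in> M \<rightarrow>\<^sub>M borel \<Otimes>\<^sub>M borel"
  shows "(\<lambda>p. sign_kernel (h p) (k p)) \<in> borel_measurable M"
  unfolding sign_kernel_def by measurable

text \<open>For t between a and c the lengths p and q of the two pieces satisfy 2 / (p + q) <= 1 /
  sqrt (p q) by the arithmetic-geometric mean inequality, which separates a from c. The cubic weight
  in t is the one against which BMO functions are integrable; it passes to a and c because t lies
  between them.\<close>

lemma abs_sign_kernel_le:
  "\<bar>sign_kernel t (a, c)\<bar> * (1 + \<bar>t\<bar>) ^ 3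
    \<le> ((1 + \<bar>a\<bar>) ^ 3 * \<bar>a - t\<bar> powr (- (1 / 2))) * ((1 + \<bar>c\<bar>) ^ 3 * \<bar>c - t\<bar> powr (- (1 / 2)))"
proof (cases "(a, c) \<in> off_diag t \<and> (a < t \<and> t < c \<or> c < t \<and> t < a)")
  case True
  define p q where "p = \<bar>a - t\<bar>" and "q = \<bar>c - t\<bar>"
  have p: "p > 0" and q: "q > 0" and pq: "\<bar>a - c\<bar> = p + q" using True by (auto simp: p_def q_def)
  have "\<bar>sign_kernel t (a, c)\<bar> = 2 / (p + q)"
    unfolding pq[symmetric] using True
    by (auto simp: sign_kernel_def sgn_if abs_if) (metis minus_diff_eq minus_divide_right)
  also have "\<dots> \<le> p powr (- (1 / 2)) * q powr (- (1 / 2))"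
  proof -
    have "0 \<le> (sqrt p - sqrt q)\<^sup>2" by simp
    then have "2 * (sqrt p * sqrt q) \<le> p + q" using p q by (simp add: power2_diff)
    then have "2 / (p + q) \<le> 1 / (sqrt p * sqrt q)" using p q by (simp add: field_simps)
    then show ?thesis using p q by (simp add: powr_minus_divide powr_half_sqrt)
  qed
  finally have 1: "\<bar>sign_kernel t (a, c)\<bar> \<le> p powr (- (1 / 2)) * q powr (- (1 / 2))" .
  have "\<bar>t\<bar> \<le> max \<bar>a\<bar> \<bar>c\<bar>" using True by auto
  moreover have "(1 + \<bar>a\<bar>) * (1 + \<bar>c\<bar>) = 1 + \<bar>a\<bar> + \<bar>c\<bar> + \<bar>a\<bar> * \<bar>c\<bar>" by (simp add: algebra_simps)
  moreover have "0 \<le> \<bar>a\<bar> * \<bar>c\<bar>" by simp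
  ultimately have "1 + \<bar>t\<bar> \<le> (1 + \<bar>a\<bar>) * (1 + \<bar>c\<bar>)" by linarith
  then have "(1 + \<bar>t\<bar>) ^ 3 \<le> ((1 + \<bar>a\<bar>) * (1 + \<bar>c\<bar>)) ^ 3" by (intro power_mono) auto
  then have "\<bar>sign_kernel t (a, c)\<bar> * (1 + \<bar>t\<bar>) ^ 3 \<le> (p powr (- (1 / 2)) * q powr (- (1 / 2))) * ((1 + \<bar>a\<bar>) * (1 + \<bar>c\<bar>)) ^ 3"
    by (intro mult_mono 1) auto
  then show ?thesis by (simp add: p_def q_def power_mult_distrib mult_ac)
next
  case False
  then have "sign_kernel t (a, c) = 0" by (auto simp: sign_kernel_def off_diag_def sgn_if indicator_def)
  then show ?thesis by simp
qed

lemma sign_kernel_form_integrable: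
  fixes b :: "real \<Rightarrow> real"
  assumes f: "schwartz f" and g: "schwartz g" and [measurable]: "b \<in> borel_measurable borel"
    and b: "integrable lborel (\<lambda>t. b t / (1 + \<bar>t\<bar>) ^ 3)"
  shows "integrable ((lborel \<Otimes>\<^sub>M lborel) \<Otimes>\<^sub>M lborel) (\<lambda>(q, t). of_real (b t * sign_kernel t q) * (f (fst q) * g (snd q)))"
    (is "integrable _ (case_prod ?X)")
proof (rule integrableI_bounded)
  interpret P: pair_sigma_finite "lborel \<Otimes>\<^sub>M lborel :: (real \<times> real) measure" "lborel :: real measure"
    by (rule pair_sigma_finite_lborel_pairs)
  have [measurable]: "f \<in> borel_measurable borel" "g \<in> borel_measurable borel"
    by (intro schwartz_measurable f g)+
  show m: "case_prod ?X \<in> borel_measurable ((lborel \<Otimes>\<^sub>M lborel) \<Otimes>\<^sub>M lborel)" by measurable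
  let ?u = "\<lambda>f t a. ennreal (norm (f a :: complex) * (1 + \<bar>a\<bar>) ^ 3 * \<bar>a - t\<bar> powr (- (1 / 2)))"
  obtain C where C: "\<And>t. (\<integral>\<^sup>+a. ?u f t a \<partial>lborel) \<le> ennreal C"
    using schwartz_singular_weight[OF f, of "1/2"] by auto
  obtain D where D: "\<And>t. (\<integral>\<^sup>+a. ?u g t a \<partial>lborel) \<le> ennreal D"
    using schwartz_singular_weight[OF g, of "1/2"] by auto
  have "(\<integral>\<^sup>+r. ennreal (norm (case_prod ?X r)) \<partial>((lborel \<Otimes>\<^sub>M lborel) \<Otimes>\<^sub>M lborel))
    = (\<integral>\<^sup>+t. (\<integral>\<^sup>+q. ennreal (norm (?X q t)) \<partial>(lborel \<Otimes>\<^sub>M lborel)) \<partial>lborel)"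
    using P.nn_integral_snd[of "\<lambda>r. ennreal (norm (case_prod ?X r))"] m by simp
  also have "\<dots> \<le> (\<integral>\<^sup>+t. ennreal (norm (b t / (1 + \<bar>t\<bar>) ^ 3)) * (ennreal C * ennreal D) \<partial>lborel)"
  proof (rule nn_integral_mono)
    fix t :: real
    have "(\<integral>\<^sup>+q. ennreal (norm (?X q t)) \<partial>(lborel \<Otimes>\<^sub>M lborel))
      \<le> (\<integral>\<^sup>+q. ennreal (norm (b t / (1 + \<bar>t\<bar>) ^ 3)) * (?u f t (fst q) * ?u g t (snd q)) \<partial>(lborel \<Otimes>\<^sub>M lborel))"
    proof (rule nn_integral_mono)
      fix q :: "real \<times> real"
      obtain a c where q: "q = (a, c)" by fastforce
      have t: "(1 + \<bar>t\<bar>) ^ 3 > 0" by (simp add: add_pos_nonneg)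
      have "norm (?X q t) = \<bar>b t / (1 + \<bar>t\<bar>) ^ 3\<bar> * (norm (f a) * norm (g c)) * (\<bar>sign_kernel t (a, c)\<bar> * (1 + \<bar>t\<bar>) ^ 3)"
        using t by (simp add: q norm_mult abs_mult)
      also have "\<dots> \<le> \<bar>b t / (1 + \<bar>t\<bar>) ^ 3\<bar> * (norm (f a) * norm (g c)) *
          (((1 + \<bar>a\<bar>) ^ 3 * \<bar>a - t\<bar> powr (- (1 / 2))) * ((1 + \<bar>c\<bar>) ^ 3 * \<bar>c - t\<bar> powr (- (1 / 2))))"
        by (intro mult_left_mono abs_sign_kernel_le) auto
      also have "\<dots> = \<bar>b t / (1 + \<bar>t\<bar>) ^ 3\<bar> * ((norm (f a) * (1 + \<bar>a\<bar>) ^ 3 * \<bar>a - t\<bar> powr (- (1 / 2))) * (norm (g c) * (1 + \<bar>c\<bar>) ^ 3 * \<bar>c - t\<bar> powr (- (1 / 2))))"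
        by (simp only: mult_ac)
      finally have "ennreal (norm (?X q t)) \<le> ennreal (\<bar>b t / (1 + \<bar>t\<bar>) ^ 3\<bar> * ((norm (f a) * (1 + \<bar>a\<bar>) ^ 3 * \<bar>a - t\<bar> powr (- (1 / 2))) * (norm (g c) * (1 + \<bar>c\<bar>) ^ 3 * \<bar>c - t\<bar> powr (- (1 / 2)))))"
        by (rule ennreal_leI)
      also have "\<dots> = ennreal (norm (b t / (1 + \<bar>t\<bar>) ^ 3)) * (?u f t (fst q) * ?u g t (snd q))"
        by (subst ennreal_mult, simp, simp, subst ennreal_mult, simp, simp) (simp only: q fst_conv snd_conv real_norm_def)
      finally show "ennreal (norm (?X q t)) \<le> ennreal (norm (b t / (1 + \<bar>t\<bar>) ^ 3)) * (?u f t (fst q) * ?u g t (snd q))" .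
    qed
    also have "\<dots> = ennreal (norm (b t / (1 + \<bar>t\<bar>) ^ 3)) * (\<integral>\<^sup>+q. ?u f t (fst q) * ?u g t (snd q) \<partial>(lborel \<Otimes>\<^sub>M lborel))"
      by (rule nn_integral_cmult) measurable
    also have "(\<integral>\<^sup>+q. ?u f t (fst q) * ?u g t (snd q) \<partial>(lborel \<Otimes>\<^sub>M lborel)) = (\<integral>\<^sup>+a. ?u f t a \<partial>lborel) * (\<integral>\<^sup>+c. ?u g t c \<partial>lborel)"
    proof -
      have "(\<lambda>q. ?u f t (fst q) * ?u g t (snd q)) \<in> borel_measurable (lborel \<Otimes>\<^sub>M lborel)" by measurable
      from lborel.nn_integral_fst[OF this]
      have "(\<integral>\<^sup>+q. ?u f t (fst q) * ?u g t (snd q) \<partial>(lborel \<Otimes>\<^sub>M lborel)) = (\<integral>\<^sup>+a. (\<integral>\<^sup>+c. ?u f t a * ?u g t c \<partial>lborel) \<partial>lborel)"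
        by (simp only: fst_conv snd_conv)
      also have "\<dots> = (\<integral>\<^sup>+a. ?u f t a * (\<integral>\<^sup>+c. ?u g t c \<partial>lborel) \<partial>lborel)"
        by (intro nn_integral_cong nn_integral_cmult) measurable
      also have "\<dots> = (\<integral>\<^sup>+a. ?u f t a \<partial>lborel) * (\<integral>\<^sup>+c. ?u g t c \<partial>lborel)"
        by (rule nn_integral_multc) measurable
      finally show ?thesis .
    qed
    finally have le: "(\<integral>\<^sup>+q. ennreal (norm (?X q t)) \<partial>(lborel \<Otimes>\<^sub>M lborel))
      \<le> ennreal (norm (b t / (1 + \<bar>t\<bar>) ^ 3)) * ((\<integral>\<^sup>+a. ?u f t a \<partial>lborel) * (\<integral>\<^sup>+c. ?u g t c \<partial>lborel))" .
    show "(\<integral>\<^sup>+q. ennreal (norm (?X q t)) \<partial>(lborel \<Otimes>\<^sub>M lborel)) \<le> ennreal (norm (b t / (1 + \<bar>t\<bar>) ^ 3)) * (ennreal C * ennreal D)"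
      by (rule order_trans[OF le]) (intro mult_left_mono mult_mono C D, auto)
  qed
  also have "\<dots> = (\<integral>\<^sup>+t. ennreal (norm (b t / (1 + \<bar>t\<bar>) ^ 3)) \<partial>lborel) * (ennreal C * ennreal D)"
    by (rule nn_integral_multc) measurable
  also have "\<dots> < \<infinity>" using b by (simp add: integrable_iff_bounded ennreal_mult_less_top)
  finally show "(\<integral>\<^sup>+r. ennreal (norm (case_prod ?X r)) \<partial>((lborel \<Otimes>\<^sub>M lborel) \<Otimes>\<^sub>M lborel)) < \<infinity>" .
qed

text \<open>For bounded b the form is, up to the factor i pi \<open>window_const\<close>, the
  difference of the two half-plane pairings, each controlled by the window average of b.\<close>

lemma sign_kernel_form_bounded:
  fixes b :: "real \<Rightarrow> real"
  assumes f: "schwartz f" "zero_mean f" and g: "schwartz g" "zero_mean g"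
    and [measurable]: "b \<in> borel_measurable borel" and bn: "\<And>t. \<bar>b t\<bar> \<le> n"
    and B: "\<And>x y. y > 0 \<Longrightarrow> \<bar>\<integral>s. sgn_window s * b (x - s * y) \<partial>lborel\<bar> \<le> B"
  shows "ennreal (norm (\<integral>(q, t). of_real (b t * sign_kernel t q) * (f (fst q) * g (snd q)) \<partial>((lborel \<Otimes>\<^sub>M lborel) \<Otimes>\<^sub>M lborel)))
    \<le> ennreal (4 * pi / window_const * B) * (Hdot_norm (- 1 / 2) f * Hdot_norm (- 1 / 2) g)"
proof -
  interpret P: pair_sigma_finite "lborel \<Otimes>\<^sub>M lborel :: (real \<times> real) measure" "lborel :: real measure"
    by (rule pair_sigma_finite_lborel_pairs)
  have s: "\<bar>1::real\<bar> = 1" "\<bar>-1::real\<bar> = 1" by auto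
  have B0: "B \<ge> 0" using B[of 1 0] by linarith
  note c0 = window_const_pos
  let ?X = "\<lambda>q t. of_real (b t * sign_kernel t q) * (f (fst q) * g (snd q))"
  let ?I = "\<integral>r. case_prod ?X r \<partial>((lborel \<Otimes>\<^sub>M lborel) \<Otimes>\<^sub>M lborel)"
  let ?H = "\<lambda>\<sigma>. half_plane_product f g \<sigma>"
  let ?M = "\<lambda>\<sigma> t. \<integral>p. of_real (sgn_window (snd p)) * ?H \<sigma> (fst p, t + snd p * fst p) \<partial>(lborel \<Otimes>\<^sub>M lborel)"
  let ?Z = "\<lambda>\<sigma>. \<integral>p. norm (?H \<sigma> p) \<partial>(lborel \<Otimes>\<^sub>M lborel)"
  let ?N = "Hdot_norm (- 1 / 2) f * Hdot_norm (- 1 / 2) g"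
  have "integrable lborel (\<lambda>t::real. (1 / (1 + norm t) ^ 3) * b t)"
    by (rule integrable_mult_bounded[OF integrable_one_plus_norm_power, of 3 _ n]) (use bn in auto)
  then have "integrable lborel (\<lambda>t. b t / (1 + \<bar>t\<bar>) ^ 3)" by simp
  then have Xi: "integrable ((lborel \<Otimes>\<^sub>M lborel) \<Otimes>\<^sub>M lborel) (case_prod ?X)"
    by (intro sign_kernel_form_integrable f g) auto
  have H0: "?H \<sigma> (y, x) = 0" if "y \<le> 0" for \<sigma> y x using that by (simp add: half_plane_product_def)
  have M: "integrable lborel (\<lambda>t. of_real (b t) * ?M \<sigma> t)" "norm (\<integral>t. of_real (b t) * ?M \<sigma> t \<partial>lborel) \<le> B * ?Z \<sigma>"
    if "\<bar>\<sigma>\<bar> = 1" for \<sigma>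
    using sgn_window_slices[OF half_plane_product_bound(1)[OF f g that] H0 _ bn B] by auto
  \<comment> \<open>Pointwise in t: subtracting the half planes turns the averaged kernels into the
    sign kernel.\<close>
  have diff: "of_real (b t) * ?M 1 t - of_real (b t) * ?M (-1) t = \<i> * of_real (pi * window_const) * (\<integral>q. ?X q t \<partial>(lborel \<Otimes>\<^sub>M lborel))" for t
  proof -
    let ?k = "\<lambda>\<sigma> q. (indicator (off_diag t) q *\<^sub>R (f (fst q) * g (snd q))) * kernel_mean \<sigma> t q"
    note S1 = half_plane_product_slice[OF f(1) g(1) s(1), of t] and S2 = half_plane_product_slice[OF f(1) g(1) s(2), of t]
    have "?M 1 t - ?M (-1) t = (\<integral>q. ?k 1 q - ?k (-1) q \<partial>(lborel \<Otimes>\<^sub>M lborel))"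
      unfolding S1(2) S2(2) by (rule Bochner_Integration.integral_diff[OF S1(1) S2(1), symmetric])
    then have "of_real (b t) * ?M 1 t - of_real (b t) * ?M (-1) t = (\<integral>q. of_real (b t) * (?k 1 q - ?k (-1) q) \<partial>(lborel \<Otimes>\<^sub>M lborel))"
      by (simp only: right_diff_distrib[symmetric] integral_mult_right_zero)
    also have "(\<lambda>q. of_real (b t) * (?k 1 q - ?k (-1) q)) = (\<lambda>q. \<i> * of_real (pi * window_const) * ?X q t)"
    proof
      fix q
      show "of_real (b t) * (?k 1 q - ?k (-1) q) = \<i> * of_real (pi * window_const) * ?X q t"
      proof (cases "q \<in> off_diag t")
        case True
        then have "kernel_mean 1 t q - kernel_mean (-1) t q = \<i> * of_real (pi * window_const) * of_real ((sgn (snd q - t) - sgn (fst q - t)) / (fst q - snd q))"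
          unfolding kernel_mean_def by (intro kernel_integral_difference) (auto simp: off_diag_def)
        moreover have "?k 1 q - ?k (-1) q = (f (fst q) * g (snd q)) * (kernel_mean 1 t q - kernel_mean (-1) t q)"
          using True by (simp add: right_diff_distrib)
        ultimately show ?thesis using True by (simp add: sign_kernel_def)
      qed (simp add: sign_kernel_def)
    qed
    finally show ?thesis by (simp only: integral_mult_right_zero)
  qed
  have "\<i> * of_real (pi * window_const) * ?I = (\<integral>t. \<i> * of_real (pi * window_const) * (\<integral>q. ?X q t \<partial>(lborel \<Otimes>\<^sub>M lborel)) \<partial>lborel)"
    by (subst integral_mult_right_zero) (simp only: P.integral_snd[OF Xi])
  also have "\<dots> = (\<integral>t. of_real (b t) * ?M 1 t \<partial>lborel) - (\<integral>t. of_real (b t) * ?M (-1) t \<partial>lborel)"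
    unfolding diff[symmetric] by (rule Bochner_Integration.integral_diff[OF M(1)[OF s(1)] M(1)[OF s(2)]])
  finally have eq: "\<i> * of_real (pi * window_const) * ?I = (\<integral>t. of_real (b t) * ?M 1 t \<partial>lborel) - (\<integral>t. of_real (b t) * ?M (-1) t \<partial>lborel)" .
  have "norm (\<i> * of_real (pi * window_const) * ?I) \<le> B * ?Z 1 + B * ?Z (-1)"
    unfolding eq using norm_triangle_ineq4[of "\<integral>t. of_real (b t) * ?M 1 t \<partial>lborel" "\<integral>t. of_real (b t) * ?M (-1) t \<partial>lborel"]
      M(2)[OF s(1)] M(2)[OF s(2)] by linarith
  moreover have "norm (\<i> * of_real (pi * window_const) * ?I) = pi * window_const * norm ?I"
    using c0 by (simp only: norm_mult norm_of_real norm_ii) simp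
  ultimately have "norm ?I \<le> B / (pi * window_const) * (?Z 1 + ?Z (-1))"
    using c0 by (simp add: field_simps)
  then have "ennreal (norm ?I) \<le> ennreal (B / (pi * window_const) * (?Z 1 + ?Z (-1)))" by (rule ennreal_leI)
  also have "\<dots> = ennreal (B / (pi * window_const)) * (ennreal (?Z 1) + ennreal (?Z (-1)))"
    using B0 c0 by (subst ennreal_plus[symmetric], simp, simp, intro ennreal_mult) auto
  also have "\<dots> \<le> ennreal (B / (pi * window_const)) * (ennreal (2 * pi\<^sup>2) * ?N + ennreal (2 * pi\<^sup>2) * ?N)"
    by (intro mult_left_mono add_mono half_plane_product_bound(2) f g s) auto
  also have "\<dots> = (ennreal (B / (pi * window_const)) * ennreal (4 * pi\<^sup>2)) * ?N"
  proof -
    have "ennreal (4 * pi\<^sup>2) = ennreal (2 * pi\<^sup>2) + ennreal (2 * pi\<^sup>2)" by (subst ennreal_plus[symmetric]) auto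
    then show ?thesis by (simp only: distrib_right mult.assoc)
  qed
  \<comment> \<open>Two half planes with 2 pi^2 each, divided by pi
    \<open>window_const\<close>.\<close>
  also have "ennreal (B / (pi * window_const)) * ennreal (4 * pi\<^sup>2) = ennreal (4 * pi / window_const * B)"
    using B0 c0 by (subst ennreal_mult[symmetric]) (auto simp: power2_eq_square)
  finally show ?thesis .
qed

text \<open>The hypothesis is uniform over all truncation levels, so dominated convergence removes
  the truncation; the untruncated integrand is itself the majorant.\<close>

lemma sign_kernel_form_bound:
  fixes b :: "real \<Rightarrow> real"
  assumes f: "schwartz f" "zero_mean f" and g: "schwartz g" "zero_mean g"
    and [measurable]: "b \<in> borel_measurable borel" and b: "integrable lborel (\<lambda>t. b t / (1 + \<bar>t\<bar>) ^ 3)"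
    and B: "\<And>n x y. y > 0 \<Longrightarrow> \<bar>\<integral>s. sgn_window s * max (- real n) (min (real n) (b (x - s * y))) \<partial>lborel\<bar> \<le> B"
  shows "ennreal (norm (\<integral>(q, t). of_real (b t * sign_kernel t q) * (f (fst q) * g (snd q)) \<partial>((lborel \<Otimes>\<^sub>M lborel) \<Otimes>\<^sub>M lborel)))
    \<le> ennreal (4 * pi / window_const * B) * (Hdot_norm (- 1 / 2) f * Hdot_norm (- 1 / 2) g)"
proof -
  have [measurable]: "f \<in> borel_measurable borel" "g \<in> borel_measurable borel"
    by (intro schwartz_measurable f g)+
  let ?b = "\<lambda>n t. max (- real n) (min (real n) (b t))"
  let ?X = "\<lambda>b (q, t). of_real (b t * sign_kernel t q) * (f (fst q) * g (snd q))"
  let ?M = "(lborel \<Otimes>\<^sub>M lborel) \<Otimes>\<^sub>M lborel :: ((real \<times> real) \<times> real) measure"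
  let ?R = "ennreal (4 * pi / window_const * B) * (Hdot_norm (- 1 / 2) f * Hdot_norm (- 1 / 2) g)"
  have bn: "ennreal (norm (\<integral>r. ?X (?b n) r \<partial>?M)) \<le> ?R" for n
    by (rule sign_kernel_form_bounded[OF f g, where n="real n"]) (use B in auto)
  have lim: "(\<lambda>n. \<integral>r. ?X (?b n) r \<partial>?M) \<longlonglongrightarrow> (\<integral>r. ?X b r \<partial>?M)"
  proof (rule integral_dominated_convergence[where w="\<lambda>r. norm (?X b r)"])
    show "integrable ?M (\<lambda>r. norm (?X b r))"
      by (intro integrable_norm sign_kernel_form_integrable f g b) auto
    show "AE r in ?M. (\<lambda>n. ?X (?b n) r) \<longlonglongrightarrow> ?X b r"
    proof (rule AE_I2)
      fix r :: "(real \<times> real) \<times> real"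
      obtain q t where r: "r = (q, t)" by fastforce
      obtain N :: nat where N: "\<bar>b t\<bar> \<le> real N" using real_arch_simple by blast
      have "eventually (\<lambda>n. ?X (?b n) r = ?X b r) sequentially"
        using eventually_ge_at_top[of N]
      proof eventually_elim
        case (elim n)
        then have "\<bar>b t\<bar> \<le> real n" using N by linarith
        then have "?b n t = b t" by auto
        then show ?case by (simp only: r case_prod_conv)
      qed
      then show "(\<lambda>n. ?X (?b n) r) \<longlonglongrightarrow> ?X b r" by (rule tendsto_eventually)
    qed
    show "AE r in ?M. norm (?X (?b n) r) \<le> norm (?X b r)" for n
    proof (rule AE_I2)
      fix r :: "(real \<times> real) \<times> real"
      obtain q t where r: "r = (q, t)" by fastforce
      have "\<bar>?b n t\<bar> \<le> \<bar>b t\<bar>" by auto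
      then show "norm (?X (?b n) r) \<le> norm (?X b r)"
        unfolding r case_prod_conv norm_mult norm_of_real abs_mult by (intro mult_right_mono) auto
    qed
  qed measurable
  have "(\<lambda>n. ennreal (norm (\<integral>r. ?X (?b n) r \<partial>?M))) \<longlonglongrightarrow> ennreal (norm (\<integral>r. ?X b r \<partial>?M))"
    by (intro tendsto_ennrealI tendsto_norm lim)
  then show ?thesis by (rule LIMSEQ_le_const2) (use bn in blast)
qed

subsection \<open>Mean oscillation on the line\<close>

text \<open>BMO and weak derivatives are stated for Lebesgue measurable functions, whereas the
  product-measure arguments use Borel ones; a representative equal almost everywhere bridges the
  two.\<close>

lemma locally_integrable_borel_representative:
  fixes f :: "real \<Rightarrow> real"
  assumes f: "locally_integrable f"
  shows "f \<in> borel_measurable lebesgue"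
    and "\<exists>b. b \<in> borel_measurable borel \<and> (AE x in lborel. f x = b x) \<and>
      (\<forall>R. integrable lborel (\<lambda>x. indicator {-R..R} x * b x))"
proof -
  have fi: "integrable lebesgue (\<lambda>x. indicator {-R..R} x *\<^sub>R f x)" for R
    using f unfolding locally_integrable_def set_integrable_def by simp
  show fm: "f \<in> borel_measurable lebesgue"
  proof (rule borel_measurable_LIMSEQ_real)
    show "(\<lambda>x. indicator {- real n..real n} x *\<^sub>R f x) \<in> borel_measurable lebesgue" for n
      by (rule borel_measurable_integrable[OF fi])
    show "(\<lambda>n. indicator {- real n..real n} x *\<^sub>R f x) \<longlonglongrightarrow> f x" for x
    proof (rule tendsto_eventually)
      obtain N :: nat where N: "\<bar>x\<bar> \<le> real N" using real_arch_simple by blast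
      show "eventually (\<lambda>n. indicator {- real n..real n} x *\<^sub>R f x = f x) sequentially"
        using eventually_ge_at_top[of N]
      proof eventually_elim
        case (elim n)
        then have "\<bar>x\<bar> \<le> real n" using N by linarith
        then show ?case by (auto simp: indicator_def abs_le_iff)
      qed
    qed
  qed
  obtain b where b[measurable]: "b \<in> borel_measurable borel" and fb: "AE x in lborel. f x = b x"
    using completion_ex_borel_measurable_real[OF fm] by auto
  have "integrable lborel (\<lambda>x. indicator {-R..R} x * b x)" for R
  proof -
    have m: "(\<lambda>x. indicator {-R..R} x * b x) \<in> borel_measurable lborel" by measurable
    have "integrable lebesgue (\<lambda>x. indicator {-R..R} x *\<^sub>R f x) \<longleftrightarrow> integrable lebesgue (\<lambda>x. indicator {-R..R} x * b x)"
    proof (rule integrable_cong_AE)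
      show "(\<lambda>x. indicator {-R..R} x *\<^sub>R f x) \<in> borel_measurable lebesgue" by (rule borel_measurable_integrable[OF fi])
      show "(\<lambda>x. indicator {-R..R} x * b x) \<in> borel_measurable lebesgue" by (rule measurable_completion[OF m])
      show "AE x in lebesgue. indicator {-R..R} x *\<^sub>R f x = indicator {-R..R} x * b x"
        using AE_completion[OF fb] by eventually_elim simp
    qed
    then show ?thesis using fi integrable_completion[OF m] by simp
  qed
  then show "\<exists>b. b \<in> borel_measurable borel \<and> (AE x in lborel. f x = b x) \<and>
      (\<forall>R. integrable lborel (\<lambda>x. indicator {-R..R} x * b x))"
    using b fb by blast
qed

lemma emeasure_lborel_ball_real: "r > 0 \<Longrightarrow> emeasure lborel (ball (c::real) r) = ennreal (2 * r)"
  by (simp add: ball_eq_greaterThanLessThan)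

text \<open>The constant m is the ball average of the original function, which the seminorm refers
  to; the length 2 r turns the mean into an integral.\<close>

lemma BMO_oscillation:
  fixes f b :: "real \<Rightarrow> real"
  assumes B: "BMO_seminorm f = ennreal B" and B0: "B \<ge> 0"
    and fb: "AE x in lborel. f x = b x" and r: "r > 0"
  shows "\<exists>m. (\<integral>\<^sup>+x. indicator (ball c r) x * ennreal \<bar>b x - m\<bar> \<partial>lborel) \<le> ennreal (2 * B * r)"
proof (rule exI[of _ "ball_average f c r"])
  let ?I = "\<integral>\<^sup>+x. indicator (ball c r) x * ennreal \<bar>b x - ball_average f c r\<bar> \<partial>lborel"
  have e: "emeasure lebesgue (ball c r) = ennreal (2 * r)"
    using emeasure_lborel_ball_real[OF r, of c] by simp
  have "(\<integral>\<^sup>+x\<in>ball c r. ennreal (norm (f x - ball_average f c r)) \<partial>lebesgue) = ?I"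
    unfolding nn_integral_completion
    by (rule nn_integral_cong_AE) (use fb in eventually_elim, simp add: mult.commute)
  then have "?I / emeasure lebesgue (ball c r) \<le> BMO_seminorm f"
    unfolding BMO_seminorm_def using r by (intro SUP_upper2[of c] SUP_upper2[of r]) auto
  then have "ennreal (2 * r) * (?I / ennreal (2 * r)) \<le> ennreal (2 * r) * ennreal B"
    unfolding e B by (rule mult_left_mono) simp
  moreover have "ennreal (2 * r) * (?I / ennreal (2 * r)) = ?I"
    using r by (simp add: ennreal_times_divide mult.commute[of "ennreal (2 * r)"] ennreal_mult_divide_eq)
  moreover have "ennreal (2 * r) * ennreal B = ennreal (2 * B * r)"
    using r B0 by (simp add: ennreal_mult[symmetric] mult_ac)
  ultimately show "?I \<le> ennreal (2 * B * r)" by simp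
qed

text \<open>The window has mean zero, so the truncation of a constant m may be subtracted, and
  truncation is 1-Lipschitz. The map s to x - s y carries the window onto the interval of radius y
  about x, where the oscillation is at most 2 B y; its Jacobian y cancels.\<close>

lemma sgn_window_BMO:
  fixes b :: "real \<Rightarrow> real"
  assumes [measurable]: "b \<in> borel_measurable borel" and B0: "B \<ge> 0" and y: "y > 0"
    and osc: "\<And>c r. r > 0 \<Longrightarrow> \<exists>m. (\<integral>\<^sup>+x. indicator (ball c r) x * ennreal \<bar>b x - m\<bar> \<partial>lborel) \<le> ennreal (2 * B * r)"
  shows "\<bar>\<integral>s. sgn_window s * max (- real n) (min (real n) (b (x - s * y))) \<partial>lborel\<bar> \<le> 2 * B"
proof -
  let ?T = "\<lambda>u. max (- real n) (min (real n) u)"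
  obtain m where m: "(\<integral>\<^sup>+u. indicator (ball x y) u * ennreal \<bar>b u - m\<bar> \<partial>lborel) \<le> ennreal (2 * B * y)"
    using osc[OF y] by blast
  have odd: "(\<integral>s. sgn_window s \<partial>lborel) = 0"
    using lborel_integral_real_affine[of "-1" sgn_window 0] by (simp add: sgn_window_minus)
  have i: "integrable lborel (\<lambda>s. of_real (sgn_window s) * ?T (u s))" if [measurable]: "u \<in> borel_measurable borel" for u
    by (rule integrable_sgn_window_mult[where B="real n"]) auto
  have i1: "integrable lborel (\<lambda>s. sgn_window s * ?T (b (x - s * y)))" and i2: "integrable lborel (\<lambda>s. sgn_window s * ?T m)"
    using i[of "\<lambda>s. b (x - s * y)"] i[of "\<lambda>s. m"] by auto
  have i3: "integrable lborel (\<lambda>s. sgn_window s * (?T (b (x - s * y)) - ?T m))"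
    using Bochner_Integration.integrable_diff[OF i1 i2] by (simp add: right_diff_distrib)
  have "(\<integral>s. sgn_window s * (?T (b (x - s * y)) - ?T m) \<partial>lborel) = (\<integral>s. sgn_window s * ?T (b (x - s * y)) \<partial>lborel) - (\<integral>s. sgn_window s * ?T m \<partial>lborel)"
    using Bochner_Integration.integral_diff[OF i1 i2] by (simp only: right_diff_distrib)
  also have "(\<integral>s. sgn_window s * ?T m \<partial>lborel) = 0"
    by (subst integral_mult_left_zero) (simp only: odd mult_zero_left)
  finally have eq: "(\<integral>s. sgn_window s * ?T (b (x - s * y)) \<partial>lborel) = (\<integral>s. sgn_window s * (?T (b (x - s * y)) - ?T m) \<partial>lborel)" by simp
  let ?A = "\<integral>\<^sup>+s. indicator (ball x y) (x + (- y) *\<^sub>R s) * ennreal \<bar>b (x + (- y) *\<^sub>R s) - m\<bar> \<partial>lborel"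
  have "ennreal \<bar>\<integral>s. sgn_window s * (?T (b (x - s * y)) - ?T m) \<partial>lborel\<bar> \<le> (\<integral>\<^sup>+s. ennreal \<bar>sgn_window s * (?T (b (x - s * y)) - ?T m)\<bar> \<partial>lborel)"
    using integral_norm_bound_ennreal[OF i3] by simp
  also have "\<dots> \<le> ?A"
  proof (rule nn_integral_mono)
    fix s :: real
    show "ennreal \<bar>sgn_window s * (?T (b (x - s * y)) - ?T m)\<bar> \<le> indicator (ball x y) (x + (- y) *\<^sub>R s) * ennreal \<bar>b (x + (- y) *\<^sub>R s) - m\<bar>"
    proof (cases "\<bar>s\<bar> < 1")
      case True
      have "\<bar>?T (b (x - s * y)) - ?T m\<bar> \<le> \<bar>b (x - s * y) - m\<bar>" by (auto simp: max_def min_def)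
      then have "\<bar>sgn_window s * (?T (b (x - s * y)) - ?T m)\<bar> \<le> 1 * \<bar>b (x - s * y) - m\<bar>"
        unfolding abs_mult using abs_sgn_window_le[of s] by (intro mult_mono) (auto simp: indicator_def of_bool_def split: if_splits)
      moreover have "x + (- y) *\<^sub>R s \<in> ball x y" using True y by (simp add: dist_real_def abs_mult)
      moreover have e: "x + (- y) *\<^sub>R s = x - s * y" by simp
      ultimately show ?thesis unfolding e by (simp add: ennreal_leI)
    next
      case False
      then have "sgn_window s = 0" by (auto simp: sgn_window_def indicator_def)
      then show ?thesis by simp
    qed
  qed
  finally have le: "ennreal \<bar>\<integral>s. sgn_window s * (?T (b (x - s * y)) - ?T m) \<partial>lborel\<bar> \<le> ?A" .
  have "ennreal y * ?A = (\<integral>\<^sup>+u. indicator (ball x y) u * ennreal \<bar>b u - m\<bar> \<partial>lborel)"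
    using y by (subst nn_integral_lborel_affine[of "- y" "\<lambda>u. indicator (ball x y) u * ennreal \<bar>b u - m\<bar>" x]) auto
  also have "\<dots> \<le> ennreal (2 * B * y)" by (rule m)
  also have "ennreal (2 * B * y) = ennreal y * ennreal (2 * B)" using y B0 by (simp add: ennreal_mult[symmetric] mult_ac)
  finally have "?A \<le> ennreal (2 * B)" using y by (subst (asm) ennreal_mult_le_mult_iff) auto
  from order_trans[OF le this] show ?thesis unfolding eq using B0 by (subst (asm) ennreal_le_iff) auto
qed

text \<open>Doubling the radius changes the mean by a bounded amount. The crude consequence that the
  integral of |b| over radius 2^k grows at most like 4^k suffices against a cubic weight, which is
  of size 8^(-k) there.\<close>

lemma BMO_weighted_integrable:
  fixes b :: "real \<Rightarrow> real"
  assumes [measurable]: "b \<in> borel_measurable borel" and li: "\<And>R. integrable lborel (\<lambda>x. indicator {-R..R} x * b x)" and B0: "B \<ge> 0"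
    and osc: "\<And>c r. r > 0 \<Longrightarrow> \<exists>m. (\<integral>\<^sup>+x. indicator (ball c r) x * ennreal \<bar>b x - m\<bar> \<partial>lborel) \<le> ennreal (2 * B * r)"
  shows "integrable lborel (\<lambda>t. b t / (1 + \<bar>t\<bar>) ^ 3)"
proof (rule integrableI_bounded)
  define I where "I k = (\<integral>\<^sup>+x. indicator (ball 0 (2 ^ k)) x * ennreal \<bar>b x\<bar> \<partial>lborel)" for k :: nat
  have I0: "I 0 < \<infinity>"
  proof -
    have "I 0 \<le> (\<integral>\<^sup>+x. ennreal (norm (indicator {-1..1} x * b x)) \<partial>lborel)"
      unfolding I_def by (intro nn_integral_mono) (auto simp: indicator_def dist_real_def)
    also have "\<dots> < \<infinity>" using li[of 1] by (simp add: integrable_iff_bounded)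
    finally show ?thesis .
  qed
  \<comment> \<open>The induction step yields 2 C 4^k + 12 B 2^k, which is at most C 4^(k+1) as soon
    as C >= 6 B.\<close>
  define C where "C = enn2real (I 0) + 6 * B"
  have C0: "C \<ge> 0" "6 * B \<le> C" using B0 by (auto simp: C_def)
  have Ik: "I k \<le> ennreal (C * 4 ^ k)" for k
  proof (induction k)
    case 0
    have "I 0 = ennreal (enn2real (I 0))" using I0 by simp
    also have "\<dots> \<le> ennreal (C * 4 ^ 0)" using B0 by (intro ennreal_leI) (simp add: C_def)
    finally show ?case .
  next
    case (Suc k)
    obtain m where m: "(\<integral>\<^sup>+x. indicator (ball 0 (2 ^ Suc k)) x * ennreal \<bar>b x - m\<bar> \<partial>lborel) \<le> ennreal (2 * B * 2 ^ Suc k)"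
      using osc[of "2 ^ Suc k" 0] by auto
    have const: "(\<integral>\<^sup>+x. indicator (ball (0::real) (2 ^ j)) x * ennreal \<bar>m\<bar> \<partial>lborel) = ennreal (2 * 2 ^ j * \<bar>m\<bar>)" for j
      using emeasure_lborel_ball_real[of "2 ^ j" 0] by (simp add: nn_integral_multc ennreal_mult)
    \<comment> \<open>The constant belonging to the larger ball is estimated on the smaller one,
      where b is controlled by the induction hypothesis.\<close>
    have "ennreal (2 * 2 ^ k * \<bar>m\<bar>) \<le> (\<integral>\<^sup>+x. indicator (ball 0 (2 ^ k)) x * ennreal \<bar>b x\<bar> + indicator (ball 0 (2 ^ Suc k)) x * ennreal \<bar>b x - m\<bar> \<partial>lborel)"
      unfolding const[symmetric]
    proof (rule nn_integral_mono)
      fix x :: real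
      have "ennreal \<bar>m\<bar> \<le> ennreal \<bar>b x\<bar> + ennreal \<bar>b x - m\<bar>"
        by (subst ennreal_plus[symmetric], simp, simp, rule ennreal_leI) linarith
      moreover have "(0::real) < 2 ^ k" by simp
      ultimately show "indicator (ball 0 (2 ^ k)) x * ennreal \<bar>m\<bar> \<le> indicator (ball 0 (2 ^ k)) x * ennreal \<bar>b x\<bar> + indicator (ball 0 (2 ^ Suc k)) x * ennreal \<bar>b x - m\<bar>"
        by (auto simp: indicator_def dist_real_def)
    qed
    also have "\<dots> = I k + (\<integral>\<^sup>+x. indicator (ball 0 (2 ^ Suc k)) x * ennreal \<bar>b x - m\<bar> \<partial>lborel)"
      unfolding I_def by (rule nn_integral_add) measurable
    also have "\<dots> \<le> ennreal (C * 4 ^ k) + ennreal (2 * B * 2 ^ Suc k)" by (rule add_mono[OF Suc m])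
    also have "\<dots> = ennreal (C * 4 ^ k + 4 * B * 2 ^ k)" using C0 B0 by (subst ennreal_plus[symmetric]) auto
    finally have mk: "2 * 2 ^ k * \<bar>m\<bar> \<le> C * 4 ^ k + 4 * B * 2 ^ k" using C0 B0 by (subst (asm) ennreal_le_iff) auto
    have "I (Suc k) \<le> (\<integral>\<^sup>+x. indicator (ball 0 (2 ^ Suc k)) x * ennreal \<bar>b x - m\<bar> + indicator (ball 0 (2 ^ Suc k)) x * ennreal \<bar>m\<bar> \<partial>lborel)"
      unfolding I_def
    proof (rule nn_integral_mono)
      fix x :: real
      have "ennreal \<bar>b x\<bar> \<le> ennreal \<bar>b x - m\<bar> + ennreal \<bar>m\<bar>"
        by (subst ennreal_plus[symmetric], simp, simp, rule ennreal_leI) linarith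
      then show "indicator (ball 0 (2 ^ Suc k)) x * ennreal \<bar>b x\<bar> \<le> indicator (ball 0 (2 ^ Suc k)) x * ennreal \<bar>b x - m\<bar> + indicator (ball 0 (2 ^ Suc k)) x * ennreal \<bar>m\<bar>"
        by (auto simp: indicator_def)
    qed
    also have "\<dots> = (\<integral>\<^sup>+x. indicator (ball 0 (2 ^ Suc k)) x * ennreal \<bar>b x - m\<bar> \<partial>lborel) + ennreal (2 * 2 ^ Suc k * \<bar>m\<bar>)"
      unfolding const[symmetric] by (rule nn_integral_add) measurable
    also have "\<dots> \<le> ennreal (2 * B * 2 ^ Suc k) + ennreal (2 * 2 ^ Suc k * \<bar>m\<bar>)"
      by (rule add_right_mono[OF m])
    also have "\<dots> = ennreal (2 * B * 2 ^ Suc k + 2 * 2 ^ Suc k * \<bar>m\<bar>)" using B0 by (subst ennreal_plus[symmetric]) auto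
    also have "\<dots> \<le> ennreal (C * 4 ^ Suc k)"
    proof (rule ennreal_leI)
      have "6 * B * 2 ^ k \<le> C * 4 ^ k"
        using C0 B0 by (intro mult_mono power_mono) auto
      then show "2 * B * 2 ^ Suc k + 2 * 2 ^ Suc k * \<bar>m\<bar> \<le> C * 4 ^ Suc k" using mk by simp
    qed
    finally show ?case .
  qed
  have "(\<integral>\<^sup>+t. ennreal (norm (b t / (1 + \<bar>t\<bar>) ^ 3)) \<partial>lborel)
    \<le> (\<integral>\<^sup>+t. (\<Sum>k. ennreal (8 / 8 ^ k) * (indicator (ball 0 (2 ^ k)) t * ennreal \<bar>b t\<bar>)) \<partial>lborel)"
  proof (rule nn_integral_mono)
    fix t :: real
    define P where "P k \<longleftrightarrow> \<bar>t\<bar> < 2 ^ k" for k :: nat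
    \<comment> \<open>The first dyadic ball containing t. Minimality gives 2^(k-1) <= |t| for k > 0,
      so the cubic weight costs only the factor 8.\<close>
    define k where "k = (LEAST k. P k)"
    have "\<exists>k. P k" unfolding P_def by (rule real_arch_pow) simp
    then have k: "P k" unfolding k_def by (rule LeastI_ex)
    have "1 / (1 + \<bar>t\<bar>) ^ 3 \<le> 8 / 8 ^ k"
    proof (cases k)
      case 0
      have aux: "1 / u \<le> 8" if "1 \<le> u" for u :: real using that by (simp add: divide_simps)
      have "1 \<le> (1 + \<bar>t\<bar>) ^ 3" by (rule one_le_power) simp
      from aux[OF this] show ?thesis using 0 by simp
    next
      case (Suc j)
      then have "\<not> P j" unfolding k_def using not_less_Least lessI by metis
      then have "(2::real) ^ j \<le> 1 + \<bar>t\<bar>" by (simp add: P_def)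
      then have "((2::real) ^ j) ^ 3 \<le> (1 + \<bar>t\<bar>) ^ 3" by (rule power_mono) simp
      moreover have "((2::real) ^ j) ^ 3 = 8 ^ j" by (simp add: power_mult[symmetric] mult.commute[of j] power_mult)
      ultimately have "1 / (1 + \<bar>t\<bar>) ^ 3 \<le> 1 / 8 ^ j" by (intro divide_left_mono) (auto intro!: mult_pos_pos zero_less_power add_pos_nonneg)
      then show ?thesis using Suc by simp
    qed
    then have "(1 / (1 + \<bar>t\<bar>) ^ 3) * \<bar>b t\<bar> \<le> (8 / 8 ^ k) * \<bar>b t\<bar>" by (rule mult_right_mono) simp
    then have "ennreal (norm (b t / (1 + \<bar>t\<bar>) ^ 3)) \<le> ennreal ((8 / 8 ^ k) * \<bar>b t\<bar>)" by (intro ennreal_leI) simp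
    also have "\<dots> = ennreal (8 / 8 ^ k) * (indicator (ball 0 (2 ^ k)) t * ennreal \<bar>b t\<bar>)"
      using k by (subst ennreal_mult) (auto simp: P_def dist_real_def)
    also have "\<dots> \<le> (\<Sum>k. ennreal (8 / 8 ^ k) * (indicator (ball 0 (2 ^ k)) t * ennreal \<bar>b t\<bar>))"
      by (rule ennreal_le_suminf)
    finally show "ennreal (norm (b t / (1 + \<bar>t\<bar>) ^ 3)) \<le> \<dots>" .
  qed
  also have "\<dots> = (\<Sum>k. ennreal (8 / 8 ^ k) * I k)"
    unfolding I_def by (subst nn_integral_suminf) (auto intro!: suminf_cong nn_integral_cmult)
  also have "\<dots> \<le> (\<Sum>k. ennreal (8 * C * (1 / 2) ^ k))"
  proof (rule suminf_le)
    show "ennreal (8 / 8 ^ k) * I k \<le> ennreal (8 * C * (1 / 2) ^ k)" for k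
    proof -
      have "ennreal (8 / 8 ^ k) * I k \<le> ennreal (8 / 8 ^ k) * ennreal (C * 4 ^ k)" by (rule mult_left_mono[OF Ik]) simp
      also have "\<dots> = ennreal (8 / 8 ^ k * (C * 4 ^ k))" using C0 by (subst ennreal_mult) auto
      also have "8 / 8 ^ k * (C * 4 ^ k) = 8 * C * (4 / 8) ^ k"
        by (simp only: power_divide times_divide_eq_right times_divide_eq_left mult_ac)
      finally show ?thesis by simp
    qed
  qed auto
  also have "\<dots> = ennreal (\<Sum>k. 8 * C * (1 / 2) ^ k)"
    using C0 by (intro suminf_ennreal2 summable_mult summable_geometric) auto
  also have "\<dots> < \<infinity>" by simp
  finally show "(\<integral>\<^sup>+t. ennreal (norm (b t / (1 + \<bar>t\<bar>) ^ 3)) \<partial>lborel) < \<infinity>" .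
qed measurable

section \<open>Primitives and weak derivatives on the line\<close>

text \<open>The oriented integral of b from 0 to x: the half sum of signs is the signed indicator of
  the interval between them, up to endpoints. In this form the difference of two primitives matches
  the sign kernel directly.\<close>

definition primitive :: "(real \<Rightarrow> real) \<Rightarrow> real \<Rightarrow> real" where
  "primitive b x = (\<integral>t. b t * ((sgn (x - t) + sgn t) / 2) \<partial>lborel)"

lemma abs_sgn_add_le: "\<bar>(sgn (x - t) + sgn t) / 2\<bar> \<le> indicator {- R..R} t" if "\<bar>x\<bar> \<le> R" for x t R :: real
  using that by (auto simp: indicator_def sgn_if abs_le_iff)

lemma primitive_integrable:
  fixes b :: "real \<Rightarrow> real"
  assumes [measurable]: "b \<in> borel_measurable borel" and li: "\<And>R. integrable lborel (\<lambda>x. indicator {-R..R} x * b x)"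
  shows "integrable lborel (\<lambda>t. b t * ((sgn (x - t) + sgn t) / 2))"
proof (rule Bochner_Integration.integrable_bound[OF li[of "\<bar>x\<bar>"]])
  show "AE t in lborel. norm (b t * ((sgn (x - t) + sgn t) / 2)) \<le> norm (indicator {- \<bar>x\<bar>..\<bar>x\<bar>} t * b t)"
  proof (rule AE_I2)
    fix t
    have "norm (b t * ((sgn (x - t) + sgn t) / 2)) = \<bar>(sgn (x - t) + sgn t) / 2\<bar> * \<bar>b t\<bar>" by (simp add: abs_mult)
    also have "\<dots> \<le> indicator {- \<bar>x\<bar>..\<bar>x\<bar>} t * \<bar>b t\<bar>" by (intro mult_right_mono abs_sgn_add_le) auto
    finally show "norm (b t * ((sgn (x - t) + sgn t) / 2)) \<le> norm (indicator {- \<bar>x\<bar>..\<bar>x\<bar>} t * b t)" by (simp add: abs_mult)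
  qed
qed measurable

lemma primitive_measurable [measurable]:
  assumes [measurable]: "b \<in> borel_measurable borel"
  shows "primitive b \<in> borel_measurable borel"
  unfolding primitive_def[abs_def] by (rule lborel.borel_measurable_lebesgue_integral) measurable

lemma primitive_locally_bounded:
  fixes b :: "real \<Rightarrow> real"
  assumes [measurable]: "b \<in> borel_measurable borel" and li: "\<And>R. integrable lborel (\<lambda>x. indicator {-R..R} x * b x)"
    and x: "\<bar>x\<bar> \<le> R"
  shows "\<bar>primitive b x\<bar> \<le> (\<integral>t. indicator {-R..R} t * \<bar>b t\<bar> \<partial>lborel)"
proof -
  have i: "integrable lborel (\<lambda>t. indicator {-R..R} t * \<bar>b t\<bar>)"
    using integrable_norm[OF li[of R]] by (simp add: abs_mult)
  have "norm (primitive b x) \<le> (\<integral>t. indicator {-R..R} t * \<bar>b t\<bar> \<partial>lborel)"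
    unfolding primitive_def
  proof (rule Bochner_Integration.integral_norm_bound_integral[OF primitive_integrable[OF assms(1) li] i])
    fix t
    have "norm (b t * ((sgn (x - t) + sgn t) / 2)) = \<bar>(sgn (x - t) + sgn t) / 2\<bar> * \<bar>b t\<bar>" by (simp add: abs_mult)
    also have "\<dots> \<le> indicator {-R..R} t * \<bar>b t\<bar>" by (intro mult_right_mono abs_sgn_add_le x) auto
    finally show "norm (b t * ((sgn (x - t) + sgn t) / 2)) \<le> indicator {-R..R} t * \<bar>b t\<bar>" .
  qed
  then show ?thesis by simp
qed

definition antiderivative :: "(real \<Rightarrow> real) \<Rightarrow> real \<Rightarrow> real" where
  "antiderivative h t = (\<integral>x. indicator {..t} x * h x \<partial>lborel)"

text \<open>Zero mean is what makes the antiderivative vanish to the right of the support, so that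
  it is an admissible test function. Its derivatives of positive order are those of the
  bump.\<close>

lemma bump_antiderivative:
  fixes h :: "real \<Rightarrow> real"
  assumes h: "bump h" and z: "(\<integral>x. h x \<partial>lborel) = 0"
  shows "(antiderivative h has_real_derivative h t) (at t)" (is ?D)
    and "smooth (antiderivative h)"
    and "\<exists>R. \<forall>t. \<bar>t\<bar> \<ge> R \<longrightarrow> antiderivative h t = 0"
proof -
  obtain R where R: "R > 0" "\<And>x. norm x \<ge> R \<Longrightarrow> h x = 0" using bump_bounded_support[OF h] by blast
  have deriv: "(antiderivative h has_real_derivative h t) (at t)" for t
  proof -
    \<comment> \<open>The endpoint a lies to the left of the support of h, and t is interior to the
      interval, so the calculus on a compact interval applies.\<close>
    define a c where "a = - R - \<bar>t\<bar> - 1" and "c = \<bar>t\<bar> + 1"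
    have eq: "antiderivative h x = integral {a..x} h" for x
    proof -
      have si: "set_integrable lborel {a..x} h"
        using borel_integrable_compact[of "{a..x}" h] bump_continuous[OF h] unfolding set_integrable_def by auto
      have "antiderivative h x = (\<integral>u. indicator {a..x} u *\<^sub>R h u \<partial>lborel)"
        unfolding antiderivative_def using R by (intro Bochner_Integration.integral_cong refl) (auto simp: indicator_def a_def)
      then show ?thesis using set_borel_integral_eq_integral(2)[OF si] by (simp add: set_lebesgue_integral_def)
    qed
    have t: "t \<in> {a<..<c}" using R(1) by (auto simp: a_def c_def)
    have "((\<lambda>x. integral {a..x} h) has_real_derivative h t) (at t within {a..c})"
      using t by (intro integral_has_real_derivative bump_continuous[OF h]) auto
    moreover have "at t within {a..c} = at t"
      using t by (intro at_within_interior) auto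
    ultimately show ?thesis unfolding eq[abs_def, symmetric] by simp
  qed
  then show ?D .
  have fd: "frechet_derivative (antiderivative h) (at t) = (\<lambda>y. h t * y)" for t
    using deriv[of t] unfolding has_field_derivative_def by (metis frechet_derivative_at)
  show "smooth (antiderivative h)"
    unfolding smooth_def
  proof (intro allI impI)
    fix bs :: "real list" assume bs: "set bs \<subseteq> Basis"
    show "iter_pderiv bs (antiderivative h) differentiable_on UNIV"
    proof (cases bs rule: rev_cases)
      case Nil
      then show ?thesis using deriv
        by (auto simp: differentiable_on_def has_field_derivative_def differentiable_def)
    next
      case (snoc cs c)
      then have c: "c = 1" and cs: "set cs \<subseteq> Basis" using bs by auto
      have "iter_pderiv bs (antiderivative h) = iter_pderiv cs h"
        unfolding snoc iter_pderiv_append by (simp add: fd c)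
      then show ?thesis using smooth_bump[OF h] cs by (simp add: smooth_def)
    qed
  qed
  have "antiderivative h t = 0" if "\<bar>t\<bar> \<ge> R" for t
  proof (cases "t \<ge> 0")
    case True
    then have "antiderivative h t = (\<integral>x. h x \<partial>lborel)"
      unfolding antiderivative_def using R that by (intro Bochner_Integration.integral_cong refl) (auto simp: indicator_def)
    then show ?thesis using z by simp
  next
    case False
    have "indicator {..t} x * h x = 0" for x using R(2)[of x] False that by (auto simp: indicator_def)
    note n0 = this
    show ?thesis by (simp only: antiderivative_def n0) simp
  qed
  then show "\<exists>R. \<forall>t. \<bar>t\<bar> \<ge> R \<longrightarrow> antiderivative h t = 0" by blast
qed

text \<open>Integration by parts carried out as Fubini, since b is merely locally
  integrable.\<close>

lemma integral_primitive_bump: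
  fixes b :: "real \<Rightarrow> real"
  assumes [measurable]: "b \<in> borel_measurable borel" and li: "\<And>R. integrable lborel (\<lambda>x. indicator {-R..R} x * b x)"
    and h: "bump h" and z: "(\<integral>x. h x \<partial>lborel) = 0"
  shows "(\<integral>x. primitive b x * h x \<partial>lborel) = - (\<integral>t. b t * antiderivative h t \<partial>lborel)"
proof -
  have [measurable]: "h \<in> borel_measurable borel" by (rule bump_measurable[OF h])
  note hi = bump_integrable[OF h]
  obtain R where R: "\<And>x. norm x \<ge> R \<Longrightarrow> h x = 0" using bump_bounded_support[OF h] by blast
  let ?F = "\<lambda>x t. h x * (b t * ((sgn (x - t) + sgn t) / 2))"
  have Fi: "integrable (lborel \<Otimes>\<^sub>M lborel) (case_prod ?F)"
  proof (rule Bochner_Integration.integrable_bound[OF integrable_pair_mult[OF hi li[of R]]])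
    show "AE p in lborel \<Otimes>\<^sub>M lborel. norm (case_prod ?F p) \<le> norm (h (fst p) * (indicator {-R..R} (snd p) * b (snd p)))"
    proof (rule AE_I2)
      fix p :: "real \<times> real"
      obtain x t where p: "p = (x, t)" by fastforce
      show "norm (case_prod ?F p) \<le> norm (h (fst p) * (indicator {-R..R} (snd p) * b (snd p)))"
      proof (cases "\<bar>x\<bar> < R")
        case True
        have "norm (case_prod ?F p) = \<bar>h x\<bar> * (\<bar>(sgn (x - t) + sgn t) / 2\<bar> * \<bar>b t\<bar>)" by (simp add: p abs_mult)
        also have "\<dots> \<le> \<bar>h x\<bar> * (indicator {-R..R} t * \<bar>b t\<bar>)"
          using True by (intro mult_left_mono mult_right_mono abs_sgn_add_le) auto
        also have "\<dots> = norm (h (fst p) * (indicator {-R..R} (snd p) * b (snd p)))" by (simp add: p abs_mult)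
        finally show ?thesis .
      next
        case False
        then have "h x = 0" by (intro R) simp
        then show ?thesis by (simp add: p)
      qed
    qed
  qed measurable
  have inner: "(\<integral>x. ?F x t \<partial>lborel) = - (b t * antiderivative h t)" for t
  proof -
    have i: "integrable lborel (\<lambda>x. indicator {..t} x * h x)"
      using integrable_mult_bounded[OF hi, of "indicator {..t}" 1] by (simp add: mult.commute indicator_def)
    have "(\<integral>x. ?F x t \<partial>lborel) = (\<integral>x. b t * (((1 + sgn t) / 2) * h x - indicator {..t} x * h x) \<partial>lborel)"
    proof (rule Bochner_Integration.integral_cong_AE)
      have "AE x in lborel. x \<noteq> t" by (rule AE_I[where N="{t}"]) auto
      then show "AE x in lborel. ?F x t = b t * (((1 + sgn t) / 2) * h x - indicator {..t} x * h x)"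
        by eventually_elim (auto simp: indicator_def sgn_if algebra_simps)
    qed measurable
    also have "\<dots> = b t * (((1 + sgn t) / 2) * (\<integral>x. h x \<partial>lborel) - antiderivative h t)"
      unfolding antiderivative_def
      by (subst integral_mult_right_zero, subst Bochner_Integration.integral_diff[OF integrable_mult_right[OF hi] i]) (simp only: integral_mult_right_zero)
    finally show ?thesis using z by simp
  qed
  have "(\<integral>x. primitive b x * h x \<partial>lborel) = (\<integral>x. (\<integral>t. ?F x t \<partial>lborel) \<partial>lborel)"
    unfolding primitive_def by (simp add: mult.commute)
  also have "\<dots> = (\<integral>t. (\<integral>x. ?F x t \<partial>lborel) \<partial>lborel)"
    by (rule lborel_pair.Fubini_integral[OF Fi, symmetric])
  finally show ?thesis unfolding inner by simp
qed

text \<open>Bumps approximate indicators of intervals, so z has integral 0 over every bounded open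
  interval. The positive and the negative part of z on a bounded interval are then densities of the
  same measure, hence equal almost everywhere, and their difference is 0.\<close>

lemma AE_zero_if_integral_bump_zero:
  fixes z :: "real \<Rightarrow> real"
  assumes [measurable]: "z \<in> borel_measurable borel" and li: "\<And>R. integrable lborel (\<lambda>x. indicator {-R..R} x * z x)"
    and zh: "\<And>h. bump h \<Longrightarrow> (\<integral>x. z x * h x \<partial>lborel) = 0"
  shows "AE x in lborel. z x = 0"
proof -
  have ball: "(\<integral>x. indicator {p<..<q} x * z x \<partial>lborel) = 0" if pq: "p < q" for p q
  proof -
    define a r where "a = (p + q) / 2" and "r = (q - p) / 2"
    have r: "r > 0" using pq by (simp add: r_def)
    \<comment> \<open>The steepness n + 1 makes the profile tend to 1 at each point of the interval,
      while it stays 0 outside and at most 1.\<close>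
    define h where "h n x = exp_recip 0 (real (Suc n) * (1 - (norm (x - a))\<^sup>2 / r\<^sup>2))" for n x
    have hb: "bump (h n)" for n unfolding h_def[abs_def] using r by (intro bump.base) auto
    have [measurable]: "h n \<in> borel_measurable borel" for n by (rule bump_measurable[OF hb])
    have inside: "norm (x - a) < r \<longleftrightarrow> x \<in> {p<..<q}" for x by (auto simp: a_def r_def abs_less_iff field_simps)
    have h0: "h n x = 0" if "x \<notin> {p<..<q}" for n x
    proof -
      have "r \<le> norm (x - a)" using that inside[of x] by linarith
      then have "r\<^sup>2 \<le> (norm (x - a))\<^sup>2" using r by (intro power_mono) auto
      then have "1 \<le> (norm (x - a))\<^sup>2 / r\<^sup>2" using r by simp
      then have "real (Suc n) * (1 - (norm (x - a))\<^sup>2 / r\<^sup>2) \<le> 0" by (intro mult_nonneg_nonpos) auto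
      then show ?thesis by (simp add: h_def exp_recip_def)
    qed
    have "(\<lambda>n. \<integral>x. z x * h n x \<partial>lborel) \<longlonglongrightarrow> (\<integral>x. indicator {p<..<q} x * z x \<partial>lborel)"
    proof (rule integral_dominated_convergence[where w="\<lambda>x. norm (indicator {- (\<bar>p\<bar> + \<bar>q\<bar>)..\<bar>p\<bar> + \<bar>q\<bar>} x * z x)"])
      show "integrable lborel (\<lambda>x. norm (indicator {- (\<bar>p\<bar> + \<bar>q\<bar>)..\<bar>p\<bar> + \<bar>q\<bar>} x * z x))" by (rule integrable_norm[OF li])
      show "AE x in lborel. (\<lambda>n. z x * h n x) \<longlonglongrightarrow> indicator {p<..<q} x * z x"
      proof (rule AE_I2)
        fix x
        show "(\<lambda>n. z x * h n x) \<longlonglongrightarrow> indicator {p<..<q} x * z x"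
        proof (cases "x \<in> {p<..<q}")
          case True
          define u where "u = 1 - (norm (x - a))\<^sup>2 / r\<^sup>2"
          have "(norm (x - a))\<^sup>2 < r\<^sup>2" using True inside[of x] by (intro power_strict_mono) auto
          then have u: "u > 0" using r by (simp add: u_def)
          have "(\<lambda>n. exp (- ((1 / u) / real (Suc n)))) \<longlonglongrightarrow> exp (- 0)"
            by (intro tendsto_intros LIMSEQ_Suc[OF lim_const_over_n])
          moreover have "h n x = exp (- ((1 / u) / real (Suc n)))" for n
            using u unfolding h_def u_def[symmetric] exp_recip_def by simp
          ultimately have "(\<lambda>n. h n x) \<longlonglongrightarrow> 1" by simp
          then have "(\<lambda>n. z x * h n x) \<longlonglongrightarrow> z x * 1" by (intro tendsto_intros)
          then show ?thesis using True by simp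
        next
          case False
          then show ?thesis by (simp add: h0)
        qed
      qed
      show "AE x in lborel. norm (z x * h n x) \<le> norm (indicator {- (\<bar>p\<bar> + \<bar>q\<bar>)..\<bar>p\<bar> + \<bar>q\<bar>} x * z x)" for n
      proof (rule AE_I2)
        fix x
        show "norm (z x * h n x) \<le> norm (indicator {- (\<bar>p\<bar> + \<bar>q\<bar>)..\<bar>p\<bar> + \<bar>q\<bar>} x * z x)"
        proof (cases "x \<in> {p<..<q}")
          case True
          have "\<bar>h n x\<bar> \<le> 1" using exp_recip_bounded[of 0] by (simp add: h_def)
          then have "\<bar>z x\<bar> * \<bar>h n x\<bar> \<le> \<bar>z x\<bar> * 1" by (intro mult_left_mono) auto
          then show ?thesis using True by (auto simp: abs_mult indicator_def)
        qed (simp add: h0)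
      qed
    qed measurable
    moreover have "(\<integral>x. z x * h n x \<partial>lborel) = 0" for n by (rule zh[OF hb])
    ultimately have "(\<lambda>n::nat. 0::real) \<longlonglongrightarrow> (\<integral>x. indicator {p<..<q} x * z x \<partial>lborel)" by (simp only:)
    then show ?thesis by (simp add: LIMSEQ_const_iff)
  qed
  have "AE x in lborel. indicator {-real R<..<real R} x * z x = 0" for R :: nat
  proof -
    define Z where "Z x = indicator {-real R<..<real R} x * z x" for x
    have [measurable]: "Z \<in> borel_measurable borel" unfolding Z_def[abs_def] by measurable
    have zi: "integrable lborel Z"
      unfolding Z_def[abs_def]
      by (rule Bochner_Integration.integrable_bound[OF li[of "real R"]]) (auto simp: indicator_def)
    have max_le: "\<bar>indicator A x * max 0 u\<bar> \<le> \<bar>u\<bar>" for A :: "real set" and x u :: real by (auto simp: indicator_def)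
    have part: "integrable lborel (\<lambda>x. indicator {x0<..} x * max 0 (s * Z x))" for x0 s :: real
      by (rule Bochner_Integration.integrable_bound[OF integrable_mult_right[OF zi, of s]])
        (measurable, rule AE_I2, simp only: real_norm_def max_le)
    let ?f = "\<lambda>s x. ennreal (max 0 (s * Z x))"
    have em: "emeasure (density lborel (?f s)) {x0<..} = ennreal (\<integral>x. indicator {x0<..} x * max 0 (s * Z x) \<partial>lborel)" for x0 s
    proof -
      have "emeasure (density lborel (?f s)) {x0<..} = (\<integral>\<^sup>+x. ennreal (indicator {x0<..} x * max 0 (s * Z x)) \<partial>lborel)"
        by (subst emeasure_density) (auto intro!: nn_integral_cong simp: indicator_def)
      also have "\<dots> = ennreal (\<integral>x. indicator {x0<..} x * max 0 (s * Z x) \<partial>lborel)"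
        by (rule nn_integral_eq_integral[OF part]) auto
      finally show ?thesis .
    qed
    \<comment> \<open>Half lines suffice to identify the two finite measures; the cut-off in Z turns
      each half line into a bounded interval.\<close>
    have "density lborel (?f 1) = density lborel (?f (-1))"
    proof (rule measure_eqI_lessThan)
      show "emeasure (density lborel (?f 1)) {x0<..} < \<infinity>" for x0 unfolding em by simp
      show "emeasure (density lborel (?f 1)) {x0<..} = emeasure (density lborel (?f (-1))) {x0<..}" for x0
      proof -
        have "(\<integral>x. indicator {x0<..} x * max 0 (1 * Z x) \<partial>lborel) - (\<integral>x. indicator {x0<..} x * max 0 (-1 * Z x) \<partial>lborel)
          = (\<integral>x. indicator {x0<..} x * max 0 (1 * Z x) - indicator {x0<..} x * max 0 (-1 * Z x) \<partial>lborel)"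
          by (rule Bochner_Integration.integral_diff[OF part part, symmetric])
        also have "\<dots> = (\<integral>x. indicator {max x0 (- real R)<..<real R} x * z x \<partial>lborel)"
        proof (intro Bochner_Integration.integral_cong refl)
          fix x
          have "max 0 (1 * u) - max 0 (-1 * u) = u" for u :: real by (auto simp: max_def)
          then show "indicator {x0<..} x * max 0 (1 * Z x) - indicator {x0<..} x * max 0 (-1 * Z x) = indicator {max x0 (- real R)<..<real R} x * z x"
            unfolding right_diff_distrib[symmetric] by (auto simp: Z_def indicator_def)
        qed
        also have "\<dots> = 0"
          using ball[of "max x0 (- real R)" "real R"] by (cases "max x0 (- real R) < real R") auto
        finally show ?thesis unfolding em by simp
      qed
    qed auto
    then have "AE x in lborel. ?f 1 x = ?f (-1) x"
      by (subst (asm) sigma_finite_measure.density_unique_iff[OF lborel.sigma_finite_measure_axioms]) auto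
    then show ?thesis unfolding Z_def[symmetric] by eventually_elim (auto simp: max_def split: if_splits)
  qed
  then have "AE x in lborel. \<forall>R::nat. indicator {-real R<..<real R} x * z x = 0" unfolding AE_all_countable by blast
  then show ?thesis
  proof eventually_elim
    case (elim x)
    obtain R :: nat where "\<bar>x\<bar> < real R" using reals_Archimedean2 by blast
    then show ?case using elim[rule_format, of R] by (auto simp: indicator_def abs_less_iff)
  qed
qed

text \<open>The du Bois-Reymond argument: v minus the primitive is orthogonal to all bumps of zero
  mean, since these are derivatives of test functions, and is therefore constant.\<close>

lemma weak_derivative_primitive:
  fixes v w b :: "real \<Rightarrow> real"
  assumes wd: "has_weak_derivative v w" and [measurable]: "b \<in> borel_measurable borel"
    and wb: "AE x in lborel. w x = b x" and li: "\<And>R. integrable lborel (\<lambda>x. indicator {-R..R} x * b x)"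
  shows "\<exists>\<alpha>. AE x in lborel. v x = \<alpha> + primitive b x"
proof -
  have vl: "locally_integrable v" and wl: "locally_integrable w"
    and test: "\<And>\<phi>::real \<Rightarrow> real. smooth \<phi> \<Longrightarrow> compactly_supported \<phi> \<Longrightarrow>
        (\<integral>x. v x * deriv \<phi> x \<partial>lebesgue) = - (\<integral>x. w x * \<phi> x \<partial>lebesgue)"
    using wd unfolding has_weak_derivative_def by auto
  note vm = locally_integrable_borel_representative(1)[OF vl] and wm = locally_integrable_borel_representative(1)[OF wl]
  obtain u where u[measurable]: "u \<in> borel_measurable borel" and vu: "AE x in lborel. v x = u x"
    and ul: "\<And>R. integrable lborel (\<lambda>x. indicator {-R..R} x * u x)"
    using locally_integrable_borel_representative(2)[OF vl] by blast
  have conv: "(\<integral>x. f x * k x \<partial>lebesgue) = (\<integral>x. f' x * k x \<partial>lborel)"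
    if f: "f \<in> borel_measurable lebesgue" and [measurable]: "f' \<in> borel_measurable borel" "k \<in> borel_measurable borel"
      and ff': "AE x in lborel. f x = f' x" for f f' k :: "real \<Rightarrow> real"
  proof -
    have km: "k \<in> borel_measurable lebesgue" by (rule measurable_completion) simp
    have m: "(\<lambda>x. f' x * k x) \<in> borel_measurable lborel" by measurable
    have "(\<integral>x. f x * k x \<partial>lebesgue) = (\<integral>x. f' x * k x \<partial>lebesgue)"
    proof (rule Bochner_Integration.integral_cong_AE)
      show "(\<lambda>x. f x * k x) \<in> borel_measurable lebesgue" by (rule borel_measurable_times[OF f km])
      show "(\<lambda>x. f' x * k x) \<in> borel_measurable lebesgue" by (rule measurable_completion[OF m])
      show "AE x in lebesgue. f x * k x = f' x * k x" using AE_completion[OF ff'] by eventually_elim simp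
    qed
    then show ?thesis using integral_completion[OF m] by simp
  qed
  let ?z = "\<lambda>x. u x - primitive b x"
  have pl: "integrable lborel (\<lambda>x. indicator {-R..R} x * primitive b x)" for R
  proof (rule Bochner_Integration.integrable_bound)
    let ?C = "\<integral>t. indicator {-R..R} t * \<bar>b t\<bar> \<partial>lborel"
    show "integrable lborel (\<lambda>x::real. indicator {-R..R} x * ?C)"
      by (intro integrable_mult_left integrable_real_indicator) (auto simp: emeasure_lborel_Icc_eq)
    show "AE x in lborel. norm (indicator {-R..R} x * primitive b x) \<le> norm (indicator {-R..R} x * ?C)"
    proof (rule AE_I2)
      fix x
      show "norm (indicator {-R..R} x * primitive b x) \<le> norm (indicator {-R..R} x * ?C)"
        using primitive_locally_bounded[OF assms(2) li, of x R] by (auto simp: indicator_def)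
    qed
  qed measurable
  have zl: "integrable lborel (\<lambda>x. indicator {-R..R} x * ?z x)" for R
    using Bochner_Integration.integrable_diff[OF ul pl] by (simp add: right_diff_distrib)
  have mult: "integrable lborel (\<lambda>x. f x * h x)"
    if fl: "\<And>R. integrable lborel (\<lambda>x. indicator {-R..R} x * f x)" and h: "bump h" for f h :: "real \<Rightarrow> real"
  proof -
    obtain R C where R: "\<And>x. \<bar>h x\<bar> \<le> C" "\<And>x. norm x \<ge> R \<Longrightarrow> h x = 0" using bump_bounded_support[OF h] by blast
    have [measurable]: "h \<in> borel_measurable borel" by (rule bump_measurable[OF h])
    have "integrable lborel (\<lambda>x. (indicator {-R..R} x * f x) * h x)"
      by (rule integrable_mult_bounded[OF fl, where B=C]) (use R in auto)
    also have "(\<lambda>x. (indicator {-R..R} x * f x) * h x) = (\<lambda>x. f x * h x)"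
    proof
      fix x
      show "(indicator {-R..R} x * f x) * h x = f x * h x"
        using R(2)[of x] by (cases "R \<le> norm x") (auto simp: indicator_def)
    qed
    finally show ?thesis .
  qed
  have zero: "(\<integral>x. ?z x * h x \<partial>lborel) = 0" if h: "bump h" and h0: "(\<integral>x. h x \<partial>lborel) = 0" for h
  proof -
    note A = bump_antiderivative[OF h h0]
    have [measurable]: "h \<in> borel_measurable borel" by (rule bump_measurable[OF h])
    have Am: "antiderivative h \<in> borel_measurable borel"
      by (intro borel_measurable_continuous_onI continuous_at_imp_continuous_on) (use A(1) DERIV_isCont in blast)
    have dA: "deriv (antiderivative h) = h" using A(1) DERIV_imp_deriv by blast
    have cA: "compactly_supported (antiderivative h)" using A(3) by (metis compactly_supportedI real_norm_def)
    have "(\<integral>x. u x * h x \<partial>lborel) = - (\<integral>x. b x * antiderivative h x \<partial>lborel)"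
      using test[OF A(2) cA] conv[OF vm u _ vu, of h] conv[OF wm _ Am wb] unfolding dA by simp
    also have "\<dots> = (\<integral>x. primitive b x * h x \<partial>lborel)"
      by (rule integral_primitive_bump[OF assms(2) li h h0, symmetric])
    finally show ?thesis
      using Bochner_Integration.integral_diff[OF mult[OF ul h] mult[OF pl h]] by (simp add: left_diff_distrib)
  qed
  \<comment> \<open>A fixed bump of positive mass, used to correct the mean of an arbitrary
    bump.\<close>
  let ?e = "\<lambda>x::real. exp_recip 0 (1 * (1 - (norm (x - 0))\<^sup>2 / 1\<^sup>2))"
  have e: "bump ?e" by (rule bump.base) auto
  define I where "I = (\<integral>x. ?e x \<partial>lborel)"
  have I: "I > 0"
    unfolding I_def
  proof (rule integral_pos_open[where U="ball 0 1"])
    show "0 < ?e x" if "x \<in> ball 0 1" for x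
    proof -
      have "\<bar>x\<bar>\<^sup>2 < 1\<^sup>2" using that by (intro power_strict_mono) auto
      then show ?thesis by (simp add: exp_recip_def)
    qed
  qed (use bump_integrable[OF e] exp_recip_nonneg in auto)
  \<comment> \<open>The only candidate for the constant, read off by testing against the fixed
    bump.\<close>
  define \<alpha> where "\<alpha> = (\<integral>x. ?z x * ?e x \<partial>lborel) / I"
  have "AE x in lborel. ?z x - \<alpha> = 0"
  proof (rule AE_zero_if_integral_bump_zero)
    show "integrable lborel (\<lambda>x. indicator {-R..R} x * (?z x - \<alpha>))" for R
    proof -
      have "integrable lborel (\<lambda>x::real. indicator {-R..R} x * \<alpha>)"
        by (intro integrable_mult_left integrable_real_indicator) (auto simp: emeasure_lborel_Icc_eq)
      from Bochner_Integration.integrable_diff[OF zl[of R] this] show ?thesis by (simp add: right_diff_distrib)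
    qed
    fix h :: "real \<Rightarrow> real" assume h: "bump h"
    \<comment> \<open>Chosen so that h - c e has mean zero and the orthogonality applies to
      it.\<close>
    let ?c = "(\<integral>x. h x \<partial>lborel) / I"
    have hc: "bump (\<lambda>x. h x - ?c * ?e x)" by (intro bump_diff bump.cmult h e)
    have "(\<integral>x. h x - ?c * ?e x \<partial>lborel) = (\<integral>x. h x \<partial>lborel) - ?c * I"
      unfolding I_def by (subst Bochner_Integration.integral_diff[OF bump_integrable[OF h] integrable_mult_right[OF bump_integrable[OF e]]])
        (simp only: integral_mult_right_zero)
    also have "\<dots> = 0" using I by simp
    finally have "0 = (\<integral>x. ?z x * (h x - ?c * ?e x) \<partial>lborel)" using zero[OF hc] by simp
    also have "\<dots> = (\<integral>x. ?z x * h x - ?c * (?z x * ?e x) \<partial>lborel)"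
    proof (intro Bochner_Integration.integral_cong refl)
      have "z * (p - c * q) = z * p - c * (z * q)" for z p c q :: real by (simp add: algebra_simps)
      then show "?z x * (h x - ?c * ?e x) = ?z x * h x - ?c * (?z x * ?e x)" for x .
    qed
    also have "\<dots> = (\<integral>x. ?z x * h x \<partial>lborel) - ?c * (\<integral>x. ?z x * ?e x \<partial>lborel)"
      by (subst Bochner_Integration.integral_diff[OF mult[OF zl h] integrable_mult_right[OF mult[OF zl e]]]) (simp only: integral_mult_right_zero)
    also have "?c * (\<integral>x. ?z x * ?e x \<partial>lborel) = \<alpha> * (\<integral>x. h x \<partial>lborel)" by (simp add: \<alpha>_def)
    finally have "(\<integral>x. ?z x * h x \<partial>lborel) = \<alpha> * (\<integral>x. h x \<partial>lborel)" by simp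
    moreover have "(\<integral>x. (?z x - \<alpha>) * h x \<partial>lborel) = (\<integral>x. ?z x * h x \<partial>lborel) - \<alpha> * (\<integral>x. h x \<partial>lborel)"
      unfolding left_diff_distrib[of "?z _"]
      by (subst Bochner_Integration.integral_diff[OF mult[OF zl h] integrable_mult_right[OF bump_integrable[OF h]]]) (simp only: integral_mult_right_zero)
    ultimately show "(\<integral>x. (?z x - \<alpha>) * h x \<partial>lborel) = 0" by simp
  qed measurable
  then have "AE x in lborel. v x = \<alpha> + primitive b x" using vu by eventually_elim simp
  then show ?thesis ..
qed

section \<open>Part (ii): the commutator bound\<close>

text \<open>In the difference of the two primitives the terms sgn t cancel, and what remains is the
  sign kernel almost everywhere.\<close>

lemma integral_sign_kernel:
  fixes b :: "real \<Rightarrow> real"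
  assumes [measurable]: "b \<in> borel_measurable borel" and li: "\<And>R. integrable lborel (\<lambda>x. indicator {-R..R} x * b x)"
    and ac: "a \<noteq> c"
  shows "(\<integral>t. b t * sign_kernel t (a, c) \<partial>lborel) = - 2 * ((primitive b a - primitive b c) / (a - c))"
proof -
  let ?p = "\<lambda>x t. b t * ((sgn (x - t) + sgn t) / 2)"
  note i = primitive_integrable[OF assms(1) li]
  have "(\<integral>t. b t * sign_kernel t (a, c) \<partial>lborel) = (\<integral>t. (2 / (a - c)) * (?p c t - ?p a t) \<partial>lborel)"
  proof (rule Bochner_Integration.integral_cong_AE)
    have "AE t in lborel. t \<notin> {a, c}" by (rule AE_I[where N="{a, c}"]) (auto simp: emeasure_lborel_countable)
    then show "AE t in lborel. b t * sign_kernel t (a, c) = (2 / (a - c)) * (?p c t - ?p a t)"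
      by eventually_elim (use ac in \<open>simp add: sign_kernel_def off_diag_def field_simps\<close>)
  qed measurable
  also have "\<dots> = (2 / (a - c)) * (primitive b c - primitive b a)"
    unfolding primitive_def by (subst integral_mult_right_zero) (simp only: Bochner_Integration.integral_diff[OF i i])
  also have "\<dots> = - 2 * ((primitive b a - primitive b c) / (a - c))"
    using ac by (simp add: field_simps)
  finally show ?thesis .
qed

text \<open>Replacing v by \<alpha> plus a primitive of v' makes the constant drop out of v x - v y
  and turns the form into -1/2 times the sign-kernel form. This 1/2 cancels the 2 coming from the
  window estimate, so the constant is 4 pi / \<open>window_const\<close>.\<close>

lemma commutator_BMO_bound:
  assumes wd: "has_weak_derivative v v'" and bmo: "v' \<in> BMO"
    and f: "schwartz f" "zero_mean f" and g: "schwartz g" "zero_mean g"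
  shows "ennreal (cmod (\<integral>(x, y). of_real ((v x - v y) / (x - y)) * f x * g y \<partial>lebesgue))
    \<le> ennreal (4 * pi / window_const) * BMO_seminorm v' * Hdot_norm (- 1 / 2) f * Hdot_norm (- 1 / 2) g"
    (is "ennreal (cmod (integral\<^sup>L lebesgue ?F)) \<le> ?R")
proof (cases "integrable lebesgue ?F")
  \<comment> \<open>The integral is then 0 by convention and the bound is trivial, so joint
    measurability may be taken for granted in the other case.\<close>
  case False
  then show ?thesis by (simp add: not_integrable_integral_eq)
next
  case True
  interpret P: pair_sigma_finite "lborel \<Otimes>\<^sub>M lborel :: (real \<times> real) measure" "lborel :: real measure"
    by (rule pair_sigma_finite_lborel_pairs)
  have [measurable]: "f \<in> borel_measurable borel" "g \<in> borel_measurable borel"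
    by (intro schwartz_measurable f g)+
  define B where "B = enn2real (BMO_seminorm v')"
  have B0: "B \<ge> 0" and B: "BMO_seminorm v' = ennreal B"
    using bmo by (auto simp: B_def BMO_def)
  have "locally_integrable v'" using bmo by (simp add: BMO_def)
  then obtain b where b[measurable]: "b \<in> borel_measurable borel" and vb: "AE x in lborel. v' x = b x"
    and li: "\<And>R. integrable lborel (\<lambda>x. indicator {-R..R} x * b x)"
    using locally_integrable_borel_representative(2) by blast
  note osc = BMO_oscillation[OF B B0 vb]
  obtain \<alpha> where \<alpha>: "AE x in lborel. v x = \<alpha> + primitive b x"
    using weak_derivative_primitive[OF wd b vb li] by blast
  let ?X = "\<lambda>q t. of_real (b t * sign_kernel t q) * (f (fst q) * g (snd q))"
  let ?I = "\<integral>r. case_prod ?X r \<partial>((lborel \<Otimes>\<^sub>M lborel) \<Otimes>\<^sub>M lborel)"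
  let ?G = "\<lambda>q. of_real ((primitive b (fst q) - primitive b (snd q)) / (fst q - snd q)) * f (fst q) * g (snd q)"
  note bw = BMO_weighted_integrable[OF b li B0 osc]
  have Xi: "integrable ((lborel \<Otimes>\<^sub>M lborel) \<Otimes>\<^sub>M lborel) (case_prod ?X)"
    by (rule sign_kernel_form_integrable[OF f(1) g(1) b bw])
  have I: "ennreal (norm ?I) \<le> ennreal (4 * pi / window_const * (2 * B)) * (Hdot_norm (- 1 / 2) f * Hdot_norm (- 1 / 2) g)"
    by (rule sign_kernel_form_bound[OF f g b bw sgn_window_BMO[OF b B0 _ osc]])
  have Gm[measurable]: "?G \<in> borel_measurable (lborel \<Otimes>\<^sub>M lborel)" by measurable
  have "(\<integral>q. ?G q \<partial>(lborel \<Otimes>\<^sub>M lborel)) = (\<integral>q. of_real (- 1 / 2) * (\<integral>t. ?X q t \<partial>lborel) \<partial>(lborel \<Otimes>\<^sub>M lborel))"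
  proof (rule Bochner_Integration.integral_cong_AE)
    show "AE q in lborel \<Otimes>\<^sub>M lborel. ?G q = of_real (- 1 / 2) * (\<integral>t. ?X q t \<partial>lborel)"
      using AE_off_diag[of 0]
    proof eventually_elim
      case (elim q)
      obtain a c where q: "q = (a, c)" by fastforce
      have ac: "a \<noteq> c" using elim by (simp add: q off_diag_def)
      have X: "(\<integral>t. ?X q t \<partial>lborel) = of_real (\<integral>t. b t * sign_kernel t (a, c) \<partial>lborel) * (f a * g c)"
        unfolding q fst_conv snd_conv by (subst integral_mult_left_zero) (simp only: integral_complex_of_real)
      have "of_real D * F * G = complex_of_real (- 1 / 2) * (of_real (- 2 * D) * (F * G))" for D F G by simp
      then show ?case unfolding X integral_sign_kernel[OF b li ac] unfolding q fst_conv snd_conv .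
    qed
  qed measurable
  also have "\<dots> = of_real (- 1 / 2) * ?I"
    by (subst integral_mult_right_zero) (simp only: P.integral_fst[OF Xi])
  finally have GI: "(\<integral>q. ?G q \<partial>(lborel \<Otimes>\<^sub>M lborel)) = of_real (- 1 / 2) * ?I" .
  \<comment> \<open>The exceptional set of v is null on the line; the pairs with a coordinate in it
    form a null set in the plane.\<close>
  obtain N where N: "N \<in> null_sets lborel" and vN: "\<And>x. x \<notin> N \<Longrightarrow> v x = \<alpha> + primitive b x"
    using \<alpha> unfolding eventually_ae_filter by auto
  have [measurable]: "N \<in> sets borel" using N by auto
  have "AE q in lborel \<Otimes>\<^sub>M lborel. fst q \<notin> N \<and> snd q \<notin> N"
  proof (rule lborel_pair.AE_pair_measure)
    have "Measurable.pred (lborel \<Otimes>\<^sub>M lborel) (\<lambda>q. fst q \<notin> N \<and> snd q \<notin> N)" by measurable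
    then show "{q \<in> space (lborel \<Otimes>\<^sub>M lborel). fst q \<notin> N \<and> snd q \<notin> N} \<in> sets (lborel \<Otimes>\<^sub>M lborel)"
      by (simp only: pred_def)
    have n: "AE x in lborel. x \<notin> N" by (rule AE_not_in[OF N])
    show "AE x in lborel. AE y in lborel. fst (x, y) \<notin> N \<and> snd (x, y) \<notin> N"
      using n by eventually_elim (use n in simp)
  qed
  then have "AE q in lborel \<Otimes>\<^sub>M lborel. ?F q = ?G q"
    by eventually_elim (auto simp: vN split: prod.splits)
  then have FG: "AE q in lebesgue. ?F q = ?G q"
    by (intro AE_completion) (simp only: lborel_prod)
  have Gm': "?G \<in> borel_measurable lborel" using Gm by (simp only: lborel_prod)
  have "integral\<^sup>L lebesgue ?F = (\<integral>q. ?G q \<partial>lebesgue)"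
    by (rule Bochner_Integration.integral_cong_AE[OF borel_measurable_integrable[OF True] measurable_completion[OF Gm'] FG])
  also have "\<dots> = (\<integral>q. ?G q \<partial>(lborel \<Otimes>\<^sub>M lborel))"
    unfolding lborel_prod by (rule integral_completion[OF Gm'])
  finally have "norm (integral\<^sup>L lebesgue ?F) = (1 / 2) * norm ?I"
    unfolding GI by (simp add: norm_mult)
  then have "ennreal (cmod (integral\<^sup>L lebesgue ?F)) = ennreal (1 / 2) * ennreal (norm ?I)"
    by (simp only:) (rule ennreal_mult, auto)
  also have "\<dots> \<le> ennreal (1 / 2) * (ennreal (4 * pi / window_const * (2 * B)) * (Hdot_norm (- 1 / 2) f * Hdot_norm (- 1 / 2) g))"
    by (rule mult_left_mono[OF I]) simp
  also have "\<dots> = (ennreal (1 / 2) * ennreal (4 * pi / window_const * (2 * B))) * (Hdot_norm (- 1 / 2) f * Hdot_norm (- 1 / 2) g)"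
    by (simp only: mult.assoc)
  also have "ennreal (1 / 2) * ennreal (4 * pi / window_const * (2 * B)) = ennreal (4 * pi / window_const) * ennreal B"
  proof -
    have K: "0 \<le> 4 * pi / window_const" using window_const_pos by simp
    have "ennreal (1 / 2) * ennreal (K * (2 * B)) = ennreal K * ennreal B" if "0 \<le> K" for K
      using that B0 by (subst (1 2) ennreal_mult[symmetric]) auto
    from this[OF K] show ?thesis .
  qed
  finally show ?thesis unfolding B by (simp only: mult.assoc)
qed

theorem theorem2p1:
  shows
   "(\<forall>s::real. - 2 < s \<and> s < real CARD('n::finite) \<and> \<not> (CARD('n) = 1 \<and> s = 0) \<longrightarrow>
      (\<forall>M::real. M > 0 \<longrightarrow>
        (\<exists>(v :: real^'n \<Rightarrow> real^'n) (f :: real^'n \<Rightarrow> complex) (g :: real^'n \<Rightarrow> complex).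
           smooth v \<and> compactly_supported v \<and>
           schwartz f \<and> zero_mean f \<and> schwartz g \<and> zero_mean g \<and>
           (let d = real CARD('n);
                N = cmod (\<integral>(x, y). of_real ((v x - v y) \<bullet> grad (riesz_pot s) (x - y)) * f x * g y
                            \<partial>lebesgue);
                D = (BMO_seminorm (\<lambda>x. jacobian v (at x))
                      + (if s < d - 2
                         then Lp_norm (2 * d / (d - s - 2)) (abs_nabla_pow_vec ((d - s) / 2) v)
                         else 0))
                    * Hdot_norm ((s - d) / 2) f * Hdot_norm ((s - d) / 2) g
            in 0 < D \<and> D < \<infinity> \<and> ennreal N / D \<ge> ennreal M))))
    \<and>
    (\<exists>C::real. C > 0 \<and>
      (\<forall>(v :: real \<Rightarrow> real) v' (f :: real \<Rightarrow> complex) (g :: real \<Rightarrow> complex).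
         has_weak_derivative v v' \<and> v' \<in> BMO \<and>
         schwartz f \<and> zero_mean f \<and> schwartz g \<and> zero_mean g \<longrightarrow>
         ennreal (cmod (\<integral>(x, y). of_real ((v x - v y) / (x - y)) * f x * g y \<partial>lebesgue))
           \<le> ennreal C * BMO_seminorm v' * Hdot_norm (- 1 / 2) f * Hdot_norm (- 1 / 2) g))"
proof (intro conjI allI impI)
  fix s M :: real
  assume "- 2 < s \<and> s < real CARD('n) \<and> \<not> (CARD('n) = 1 \<and> s = 0)" and "M > 0"
  then show "\<exists>(v :: real^'n \<Rightarrow> real^'n) (f :: real^'n \<Rightarrow> complex) (g :: real^'n \<Rightarrow> complex).
           smooth v \<and> compactly_supported v \<and>
           schwartz f \<and> zero_mean f \<and> schwartz g \<and> zero_mean g \<and>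
           (let d = real CARD('n);
                N = cmod (\<integral>(x, y). of_real ((v x - v y) \<bullet> grad (riesz_pot s) (x - y)) * f x * g y
                            \<partial>lebesgue);
                D = (BMO_seminorm (\<lambda>x. jacobian v (at x))
                      + (if s < d - 2
                         then Lp_norm (2 * d / (d - s - 2)) (abs_nabla_pow_vec ((d - s) / 2) v)
                         else 0))
                    * Hdot_norm ((s - d) / 2) f * Hdot_norm ((s - d) / 2) g
            in 0 < D \<and> D < \<infinity> \<and> ennreal N / D \<ge> ennreal M)"
    by (intro commutator_unbounded) auto
next
  show "\<exists>C::real. C > 0 \<and>
      (\<forall>(v :: real \<Rightarrow> real) v' (f :: real \<Rightarrow> complex) (g :: real \<Rightarrow> complex).
         has_weak_derivative v v' \<and> v' \<in> BMO \<and>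
         schwartz f \<and> zero_mean f \<and> schwartz g \<and> zero_mean g \<longrightarrow>
         ennreal (cmod (\<integral>(x, y). of_real ((v x - v y) / (x - y)) * f x * g y \<partial>lebesgue))
           \<le> ennreal C * BMO_seminorm v' * Hdot_norm (- 1 / 2) f * Hdot_norm (- 1 / 2) g)"
    by (rule exI[of _ "4 * pi / window_const"], intro conjI allI impI, use window_const_pos in simp,
      elim conjE, rule commutator_BMO_bound)
qed

end
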